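(* Let $\Omega\subset\mathbb{C}^m$ be a bounded domain and let $\mathcal{M}$ be a (countably generated) almost compactly supported Hilbert module over $\mathcal{A}(\Omega)$. Then $\mathcal{M}$ has a weak resolution by quasi-free Hilbert modules over $\mathcal{A}(\Omega)$.
   Context: $\mathcal{A}(\Omega)$ is the closure, in the supremum norm on $\Omega$, of the functions holomorphic in some neighborhood of the closure of $\Omega$. A Hilbert module over $\mathcal{A}(\Omega)$ is a complex Hilbert space $\mathcal{M}$ that is a unital $\mathcal{A}(\Omega)$-module with continuous multiplication $\mathcal{A}(\Omega)\times\mathcal{M}\to\mathcal{M}$. A submodule is a closed subspace invariant under multiplication; a module map is a bounded linear map commuting with multiplication. A set $\{f_i\}\subset\mathcal{M}$ is generating if the finite sums $\sum\varphi_i f_i$, $\varphi_i\in\mathcal{A}(\Omega)$, are dense in $\mathcal{M}$; $\mathcal{M}$ is countably generated if it has a finite or countable generating set. For $z$ in the closure of $\Omega$, $\mathbb{C}_z$ is the Hilbert module $\mathbb{C}$ with $\varphi v=\varphi(z)v$; $1_z$ is the element $1\in\mathbb{C}_z$. For Hilbert modules $\mathcal{M},\mathcal{N}$, $\mathcal{M}\otimes_{\mathcal{A}}\mathcal{N}$ is the quotient of the Hilbert space tensor product $\mathcal{M}\otimes\mathcal{N}$ by the closed submodule generated by all $\varphi f\otimes g-f\otimes\varphi g$; $f\otimes_{\mathcal{A}}g$ is the class of $f\otimes g$. For $1\le k\le\infty$ ($k=\infty$ meaning countably infinite), $\ell^2_k$ is the $k$-dimensional Hilbert space with standard orthonormal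 basis $\{e_i\}$. A Hilbert module $\mathcal{R}$ is quasi-free of rank $k$ relative to a generating set $\{f_1,f_2,\dots\}$ of $k$ elements if: (i) for each $z\in\Omega$ the vectors $f_i\otimes_{\mathcal{A}}1_z$ form a basis of $\mathcal{R}\otimes_{\mathcal{A}}\mathbb{C}_z$ (meaning only that they are linearly independent and have dense linear span); (ii) the linear maps $X_z$ given on finite linear combinations by $X_z(f_i\otimes_{\mathcal{A}}1_z)=1_z\otimes e_i\in\mathbb{C}_z\otimes\ell^2_k$ are bounded, with norm locally uniformly bounded in $z\in\Omega$; (iii) for $f\in\mathcal{R}$, $f\otimes_{\mathcal{A}}1_z=0$ for every $z\in\Omega$ if and only if $f=0$. It is quasi-free if it is quasi-free of some rank relative to some generating set. A vector $f\in\mathcal{M}$ is compactly supported if there are a compact set $X\subset\Omega$ and a constant $\beta$ (both possibly depending on $f$) with $\|\varphi f\|_{\mathcal{M}}\le\beta\|\varphi\|_X\|f\|_{\mathcal{M}}$ for all $\varphi\in\mathcal{A}(\Omega)$, where $\|\varphi\|_X=\sup_X|\varphi|$. $\mathcal{M}$ is almost compactly supported if it is the closed linear span of its compactly supported vectors. A weak resolution of $\mathcal{M}$ by quasi-free Hilbert modules is a finite or infinite sequence $0\leftarrow\mathcal{M}\xleftarrow{X_0}\mathcal{R}_1\xleftarrow{X_1}\mathcal{R}_2\xleftarrow{X_2}\cdots$ of module maps, with the $\mathcal{R}_i$ quasi-free (in the finite length case the final $\mathcal{R}_i$ is $0$), such that $X_0$ has dense range and $\ker X_i$ equals the closure of $\operatorname{ran}X_{i+1}$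 for all $i\ge 0$. *)

theory Defs
  imports "HOL-Analysis.Analysis" "HOL-Algebra.Module" "HOL-Algebra.AbelCoset"
begin

section \<open>The algebra $\mathcal{A}(\Omega)$\<close>

definition holomorphic_in :: "(complex^'m \<Rightarrow> complex) \<Rightarrow> (complex^'m) set \<Rightarrow> bool" where
  "holomorphic_in \<psi> U \<longleftrightarrow>
    (\<forall>z\<in>U. \<exists>D. (\<psi> has_derivative D) (at z) \<and> (\<forall>c v. D (c *s v) = c * D v))"

text \<open>
  Uniform limits on \<open>\<Omega>\<close> extend uniquely to continuous functions on \<open>closure \<Omega>\<close>, and
  evaluation at boundary points is needed later. An element of the algebra is therefore
  represented by its continuous extension to \<open>closure \<Omega>\<close>, and by 0 elsewhere, so that
  equality of elements is equality of functions.
\<close>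

definition A_set :: "(complex^'m) set \<Rightarrow> (complex^'m \<Rightarrow> complex) set" where
  "A_set \<Omega> = {\<phi>. continuous_on (closure \<Omega>) \<phi> \<and> (\<forall>z. z \<notin> closure \<Omega> \<longrightarrow> \<phi> z = 0) \<and>
     (\<forall>\<epsilon>>0. \<exists>U \<psi>. open U \<and> closure \<Omega> \<subseteq> U \<and> holomorphic_in \<psi> U \<and>
        (\<forall>z\<in>\<Omega>. cmod (\<phi> z - \<psi> z) \<le> \<epsilon>))}"

definition A_ring :: "(complex^'m) set \<Rightarrow> (complex^'m \<Rightarrow> complex) ring" where
  "A_ring \<Omega> = \<lparr>carrier = A_set \<Omega>, mult = (\<lambda>\<phi> \<psi> z. \<phi> z * \<psi> z), one = indicator (closure \<Omega>),
     zero = (\<lambda>z. 0), add = (\<lambda>\<phi> \<psi> z. \<phi> z + \<psi> z)\<rparr>"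

text \<open>Inserting 0 only matters for \<open>X = {}\<close>, where the supremum norm is 0.\<close>

definition sup_norm :: "'p set \<Rightarrow> ('p \<Rightarrow> complex) \<Rightarrow> real" where
  "sup_norm X \<phi> = Sup (insert 0 ((\<lambda>z. cmod (\<phi> z)) ` X))"

text \<open>
  The locale \<open>Metric_space\<close> requires nonnegativity and symmetry on the whole type, hence
  the value 0 off the carrier, here and in \<open>hdist\<close> below.
\<close>

definition A_dist ::
  "(complex^'m) set \<Rightarrow> (complex^'m \<Rightarrow> complex) \<Rightarrow> (complex^'m \<Rightarrow> complex) \<Rightarrow> real" where
  "A_dist \<Omega> \<phi> \<psi> =
     (if \<phi> \<in> A_set \<Omega> \<and> \<psi> \<in> A_set \<Omega> then sup_norm \<Omega> (\<lambda>z. \<phi> z - \<psi> z) else 0)"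

definition A_top :: "(complex^'m) set \<Rightarrow> (complex^'m \<Rightarrow> complex) topology" where
  "A_top \<Omega> = Metric_space.mtopology (A_set \<Omega>) (A_dist \<Omega>)"


section \<open>Complex Hilbert spaces with explicit carriers\<close>

definition complex_ring :: "complex ring" where
  "complex_ring = \<lparr>carrier = UNIV, mult = (*), one = 1, zero = 0, add = (+)\<rparr>"

text \<open>
  The fields \<open>mult\<close> and \<open>one\<close> inherited from the library's module record are not used
  for Hilbert spaces.
\<close>

record 'a hspace = "(complex, 'a) module" +
  cinner :: "'a \<Rightarrow> 'a \<Rightarrow> complex"

definition hnorm :: "('a, 'x) hspace_scheme \<Rightarrow> 'a \<Rightarrow> real" where
  "hnorm H x = sqrt (Re (cinner H x x))"

definition hdist :: "('a, 'x) hspace_scheme \<Rightarrow> 'a \<Rightarrow> 'a \<Rightarrow> real" where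
  "hdist H x y = (if x \<in> carrier H \<and> y \<in> carrier H then hnorm H (x \<ominus>\<^bsub>H\<^esub> y) else 0)"

definition htop :: "('a, 'x) hspace_scheme \<Rightarrow> 'a topology" where
  "htop H = Metric_space.mtopology (carrier H) (hdist H)"

locale hilbert_space = Module.module complex_ring H for H (structure) +
  assumes cinner_add_left: "\<lbrakk>x \<in> carrier H; y \<in> carrier H; z \<in> carrier H\<rbrakk> \<Longrightarrow>
      cinner H (x \<oplus> y) z = cinner H x z + cinner H y z"
    and cinner_smult_left: "\<lbrakk>x \<in> carrier H; y \<in> carrier H\<rbrakk> \<Longrightarrow>
      cinner H (c \<odot> x) y = c * cinner H x y"
    and cinner_commute: "\<lbrakk>x \<in> carrier H; y \<in> carrier H\<rbrakk> \<Longrightarrow> cinner H y x = cnj (cinner H x y)"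
    and cinner_ge_zero: "x \<in> carrier H \<Longrightarrow> 0 \<le> Re (cinner H x x)"
    and cinner_eq_zero: "\<lbrakk>x \<in> carrier H; cinner H x x = 0\<rbrakk> \<Longrightarrow> x = \<zero>"
    and complete: "Metric_space.mcomplete (carrier H) (hdist H)"

definition cspan :: "('a, 'x) hspace_scheme \<Rightarrow> 'a set \<Rightarrow> 'a set" where
  "cspan H S = {\<Oplus>\<^bsub>H\<^esub>x\<in>I. c x \<odot>\<^bsub>H\<^esub> x | I c. finite I \<and> I \<subseteq> S}"

definition dense_in :: "('a, 'x) hspace_scheme \<Rightarrow> 'a set \<Rightarrow> bool" where
  "dense_in H S \<longleftrightarrow> htop H closure_of S = carrier H"

definition lin_indep_family :: "('a, 'x) hspace_scheme \<Rightarrow> 'i set \<Rightarrow> ('i \<Rightarrow> 'a) \<Rightarrow> bool" where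
  "lin_indep_family H J v \<longleftrightarrow>
    (\<forall>I c. finite I \<and> I \<subseteq> J \<and> (\<Oplus>\<^bsub>H\<^esub>i\<in>I. c i \<odot>\<^bsub>H\<^esub> v i) = \<zero>\<^bsub>H\<^esub> \<longrightarrow> (\<forall>i\<in>I. c i = 0))"

definition linear_map_on ::
  "'a set \<Rightarrow> ('a, 'x) hspace_scheme \<Rightarrow> ('b, 'y) hspace_scheme \<Rightarrow> ('a \<Rightarrow> 'b) \<Rightarrow> bool" where
  "linear_map_on V H K T \<longleftrightarrow> T \<in> V \<rightarrow> carrier K \<and>
    (\<forall>x\<in>V. \<forall>y\<in>V. T (x \<oplus>\<^bsub>H\<^esub> y) = T x \<oplus>\<^bsub>K\<^esub> T y) \<and>
    (\<forall>c. \<forall>x\<in>V. T (c \<odot>\<^bsub>H\<^esub> x) = c \<odot>\<^bsub>K\<^esub> T x)"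

definition is_onb :: "('a, 'x) hspace_scheme \<Rightarrow> 'a set \<Rightarrow> bool" where
  "is_onb H E \<longleftrightarrow> E \<subseteq> carrier H \<and>
    (\<forall>e\<in>E. \<forall>e'\<in>E. cinner H e e' = (if e = e' then 1 else 0)) \<and> dense_in H (cspan H E)"

definition some_onb :: "('a, 'x) hspace_scheme \<Rightarrow> 'a set" where
  "some_onb H = (SOME E. is_onb H E)"

text \<open>\<open>\<ell>\<^sup>2\<^sub>k\<close>, with coordinates indexed from 0.\<close>

definition idx :: "enat \<Rightarrow> nat set" where
  "idx k = {i. enat i < k}"

definition ell2 :: "enat \<Rightarrow> (nat \<Rightarrow> complex) hspace" where
  "ell2 k = \<lparr>carrier = {x. (\<forall>i. i \<notin> idx k \<longrightarrow> x i = 0) \<and> summable (\<lambda>i. (cmod (x i))\<^sup>2)},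
     mult = undefined, one = undefined, zero = (\<lambda>i. 0), add = (\<lambda>x y i. x i + y i),
     smult = (\<lambda>c x i. c * x i), cinner = (\<lambda>x y. \<Sum>i. x i * cnj (y i))\<rparr>"

definition ell2_basis :: "nat \<Rightarrow> nat \<Rightarrow> complex" where
  "ell2_basis i = (\<lambda>j. if j = i then 1 else 0)"


section \<open>Hilbert modules over $\mathcal{A}(\Omega)$\<close>

record ('s, 'a) hmodule = "'a hspace" +
  act :: "'s \<Rightarrow> 'a \<Rightarrow> 'a"

definition A_module_of ::
  "('s, 'a, 'x) hmodule_scheme \<Rightarrow> ('s, 'a) module" where
  "A_module_of M = \<lparr>carrier = carrier M, mult = mult M, one = one M, zero = zero M, add = add M,
     smult = act M\<rparr>"

locale hilbert_module = hilbert_space M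
  for \<Omega> :: "(complex^'m) set" and M :: "(complex^'m \<Rightarrow> complex, 'a, 'x) hmodule_scheme" (structure) +
  assumes A_module: "Module.module (A_ring \<Omega>) (A_module_of M)"
    and act_scale: "\<lbrakk>\<phi> \<in> A_set \<Omega>; x \<in> carrier M\<rbrakk> \<Longrightarrow> act M (\<lambda>z. c * \<phi> z) x = c \<odot> act M \<phi> x"
    and act_continuous:
      "continuous_map (prod_topology (A_top \<Omega>) (htop M)) (htop M) (\<lambda>(\<phi>, x). act M \<phi> x)"

definition closed_submodule ::
  "(complex^'m) set \<Rightarrow> (complex^'m \<Rightarrow> complex, 'a, 'x) hmodule_scheme \<Rightarrow> 'a set \<Rightarrow> bool" where
  "closed_submodule \<Omega> M S \<longleftrightarrow> submodule S complex_ring M \<and> closedin (htop M) S \<and>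
    (\<forall>\<phi>\<in>A_set \<Omega>. \<forall>x\<in>S. act M \<phi> x \<in> S)"

definition closed_submodule_gen ::
  "(complex^'m) set \<Rightarrow> (complex^'m \<Rightarrow> complex, 'a, 'x) hmodule_scheme \<Rightarrow> 'a set \<Rightarrow> 'a set" where
  "closed_submodule_gen \<Omega> M G = \<Inter>{S. closed_submodule \<Omega> M S \<and> G \<subseteq> S}"

definition module_map ::
  "(complex^'m) set \<Rightarrow> (complex^'m \<Rightarrow> complex, 'a, 'x) hmodule_scheme \<Rightarrow>
   (complex^'m \<Rightarrow> complex, 'b, 'y) hmodule_scheme \<Rightarrow> ('a \<Rightarrow> 'b) \<Rightarrow> bool" where
  "module_map \<Omega> M N T \<longleftrightarrow> linear_map_on (carrier M) M N T \<and>
    (\<exists>B. \<forall>x\<in>carrier M. hnorm N (T x) \<le> B * hnorm M x) \<and>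
    (\<forall>\<phi>\<in>A_set \<Omega>. \<forall>x\<in>carrier M. T (act M \<phi> x) = act N \<phi> (T x))"

definition generating ::
  "(complex^'m) set \<Rightarrow> (complex^'m \<Rightarrow> complex, 'a, 'x) hmodule_scheme \<Rightarrow> 'a set \<Rightarrow> bool" where
  "generating \<Omega> M F \<longleftrightarrow> F \<subseteq> carrier M \<and>
    dense_in M {\<Oplus>\<^bsub>M\<^esub>f\<in>I. act M (\<phi> f) f | I \<phi>. finite I \<and> I \<subseteq> F \<and> \<phi> \<in> I \<rightarrow> A_set \<Omega>}"

definition countably_generated ::
  "(complex^'m) set \<Rightarrow> (complex^'m \<Rightarrow> complex, 'a, 'x) hmodule_scheme \<Rightarrow> bool" where
  "countably_generated \<Omega> M \<longleftrightarrow> (\<exists>F. countable F \<and> generating \<Omega> M F)"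

definition point_module :: "'p \<Rightarrow> ('p \<Rightarrow> complex, complex) hmodule" where
  "point_module z = \<lparr>carrier = UNIV, mult = (*), one = 1, zero = 0, add = (+), smult = (*),
     cinner = (\<lambda>v w. v * cnj w), act = (\<lambda>\<phi> v. \<phi> z * v)\<rparr>"


section \<open>Tensor products\<close>

text \<open>
  The Hilbert space tensor product of \<open>M\<close> and \<open>N\<close> is realized as the space of conjugate-linear
  Hilbert-Schmidt operators from \<open>N\<close> to \<open>M\<close>, where \<open>f \<otimes> g\<close> is \<open>n \<mapsto> \<langle>g, n\<rangle> f\<close>. The inner product
  is linear in its first argument, so this is bilinear in \<open>f\<close> and \<open>g\<close>, and by Parseval's identity
  \<open>\<langle>f \<otimes> g, f' \<otimes> g'\<rangle> = \<langle>f, f'\<rangle> \<langle>g, g'\<rangle>\<close>. Neither the space nor its inner product depends on the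
  choice of orthonormal basis of \<open>N\<close>; boundedness has to be required separately, since summability
  over one basis says nothing about the other vectors.

  The algebra acts through the left factor. This suffices even when \<open>N\<close> is also a Hilbert module:
  on the quotient below, the two possible actions agree, and the generated closed submodule is
  the same for both.
\<close>

definition htensor ::
  "('s, 'a, 'x) hmodule_scheme \<Rightarrow> ('b, 'y) hspace_scheme \<Rightarrow> ('s, 'b \<Rightarrow> 'a) hmodule" where
  "htensor M N =
    \<lparr>carrier = {T \<in> carrier N \<rightarrow>\<^sub>E carrier M.
        (\<forall>x\<in>carrier N. \<forall>y\<in>carrier N. T (x \<oplus>\<^bsub>N\<^esub> y) = T x \<oplus>\<^bsub>M\<^esub> T y) \<and>
        (\<forall>c. \<forall>x\<in>carrier N. T (c \<odot>\<^bsub>N\<^esub> x) = cnj c \<odot>\<^bsub>M\<^esub> T x) \<and>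
        (\<exists>B. \<forall>x\<in>carrier N. hnorm M (T x) \<le> B * hnorm N x) \<and>
        (\<lambda>e. (hnorm M (T e))\<^sup>2) summable_on some_onb N},
     mult = undefined, one = undefined,
     zero = (\<lambda>n\<in>carrier N. \<zero>\<^bsub>M\<^esub>),
     add = (\<lambda>T S. \<lambda>n\<in>carrier N. T n \<oplus>\<^bsub>M\<^esub> S n),
     smult = (\<lambda>c T. \<lambda>n\<in>carrier N. c \<odot>\<^bsub>M\<^esub> T n),
     cinner = (\<lambda>T S. \<Sum>\<^sub>\<infinity>e\<in>some_onb N. cinner M (T e) (S e)),
     act = (\<lambda>\<phi> T. \<lambda>n\<in>carrier N. act M \<phi> (T n))\<rparr>"

definition elem_tensor ::
  "('s, 'a, 'x) hmodule_scheme \<Rightarrow> ('b, 'y) hspace_scheme \<Rightarrow> 'a \<Rightarrow> 'b \<Rightarrow> 'b \<Rightarrow> 'a" where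
  "elem_tensor M N f g = (\<lambda>n\<in>carrier N. cinner N g n \<odot>\<^bsub>M\<^esub> f)"

text \<open>
  The quotient by a closed submodule consists of cosets. The inner product is computed on the
  representatives orthogonal to \<open>S\<close>, which are the ones of least norm; this is the inner product
  inducing the quotient norm.
\<close>

definition coset_rep :: "('a, 'x) hspace_scheme \<Rightarrow> 'a set \<Rightarrow> 'a set \<Rightarrow> 'a" where
  "coset_rep H S X = (THE x. x \<in> X \<and> (\<forall>s\<in>S. cinner H x s = 0))"

definition hquotient :: "('s, 'a, 'x) hmodule_scheme \<Rightarrow> 'a set \<Rightarrow> ('s, 'a set) hmodule" where
  "hquotient M S =
    \<lparr>carrier = a_rcosets\<^bsub>M\<^esub> S,
     mult = undefined, one = undefined,
     zero = S,
     add = (\<lambda>X Y. X <+>\<^bsub>M\<^esub> Y),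
     smult = (\<lambda>c X. \<Union>x\<in>X. S +>\<^bsub>M\<^esub> (c \<odot>\<^bsub>M\<^esub> x)),
     cinner = (\<lambda>X Y. cinner M (coset_rep M S X) (coset_rep M S Y)),
     act = (\<lambda>\<phi> X. \<Union>x\<in>X. S +>\<^bsub>M\<^esub> act M \<phi> x)\<rparr>"

definition A_relations ::
  "(complex^'m) set \<Rightarrow> (complex^'m \<Rightarrow> complex, 'a, 'x) hmodule_scheme \<Rightarrow>
   (complex^'m \<Rightarrow> complex, 'b, 'y) hmodule_scheme \<Rightarrow> ('b \<Rightarrow> 'a) set" where
  "A_relations \<Omega> M N = closed_submodule_gen \<Omega> (htensor M N)
    {elem_tensor M N (act M \<phi> f) g \<ominus>\<^bsub>htensor M N\<^esub> elem_tensor M N f (act N \<phi> g) | \<phi> f g.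
       \<phi> \<in> A_set \<Omega> \<and> f \<in> carrier M \<and> g \<in> carrier N}"

definition A_tensor ::
  "(complex^'m) set \<Rightarrow> (complex^'m \<Rightarrow> complex, 'a, 'x) hmodule_scheme \<Rightarrow>
   (complex^'m \<Rightarrow> complex, 'b, 'y) hmodule_scheme \<Rightarrow>
   (complex^'m \<Rightarrow> complex, ('b \<Rightarrow> 'a) set) hmodule" where
  "A_tensor \<Omega> M N = hquotient (htensor M N) (A_relations \<Omega> M N)"

definition A_elem_tensor ::
  "(complex^'m) set \<Rightarrow> (complex^'m \<Rightarrow> complex, 'a, 'x) hmodule_scheme \<Rightarrow>
   (complex^'m \<Rightarrow> complex, 'b, 'y) hmodule_scheme \<Rightarrow> 'a \<Rightarrow> 'b \<Rightarrow> ('b \<Rightarrow> 'a) set" where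
  "A_elem_tensor \<Omega> M N f g = A_relations \<Omega> M N +>\<^bsub>htensor M N\<^esub> elem_tensor M N f g"


section \<open>Quasi-free modules\<close>

abbreviation fibre ::
  "(complex^'m) set \<Rightarrow> (complex^'m \<Rightarrow> complex, 'a, 'x) hmodule_scheme \<Rightarrow> complex^'m \<Rightarrow>
   (complex^'m \<Rightarrow> complex, (complex \<Rightarrow> 'a) set) hmodule" where
  "fibre \<Omega> R z \<equiv> A_tensor \<Omega> R (point_module z)"

abbreviation at_point ::
  "(complex^'m) set \<Rightarrow> (complex^'m \<Rightarrow> complex, 'a, 'x) hmodule_scheme \<Rightarrow> complex^'m \<Rightarrow> 'a \<Rightarrow>
   (complex \<Rightarrow> 'a) set" where
  "at_point \<Omega> R z f \<equiv> A_elem_tensor \<Omega> R (point_module z) f 1"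

definition quasi_free_rel ::
  "(complex^'m) set \<Rightarrow> (complex^'m \<Rightarrow> complex, 'a, 'x) hmodule_scheme \<Rightarrow> enat \<Rightarrow> (nat \<Rightarrow> 'a) \<Rightarrow> bool"
  where
  "quasi_free_rel \<Omega> R k f \<longleftrightarrow>
    hilbert_module \<Omega> R \<and> 1 \<le> k \<and> inj_on f (idx k) \<and> generating \<Omega> R (f ` idx k) \<and>
    (\<forall>z\<in>\<Omega>. lin_indep_family (fibre \<Omega> R z) (idx k) (\<lambda>i. at_point \<Omega> R z (f i)) \<and>
        dense_in (fibre \<Omega> R z) (cspan (fibre \<Omega> R z) ((\<lambda>i. at_point \<Omega> R z (f i)) ` idx k))) \<and>
    (\<exists>X. (\<forall>z\<in>\<Omega>.
            linear_map_on (cspan (fibre \<Omega> R z) ((\<lambda>i. at_point \<Omega> R z (f i)) ` idx k))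
              (fibre \<Omega> R z) (htensor (point_module z) (ell2 k)) (X z) \<and>
            (\<forall>i\<in>idx k. X z (at_point \<Omega> R z (f i)) =
               elem_tensor (point_module z) (ell2 k) 1 (ell2_basis i))) \<and>
         (\<forall>w\<in>\<Omega>. \<exists>U B. open U \<and> w \<in> U \<and>
            (\<forall>z\<in>U \<inter> \<Omega>. \<forall>v\<in>cspan (fibre \<Omega> R z) ((\<lambda>i. at_point \<Omega> R z (f i)) ` idx k).
               hnorm (htensor (point_module z) (ell2 k)) (X z v) \<le> B * hnorm (fibre \<Omega> R z) v))) \<and>
    (\<forall>g\<in>carrier R. (\<forall>z\<in>\<Omega>. at_point \<Omega> R z g = \<zero>\<^bsub>fibre \<Omega> R z\<^esub>) \<longleftrightarrow> g = \<zero>\<^bsub>R\<^esub>)"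

definition quasi_free ::
  "(complex^'m) set \<Rightarrow> (complex^'m \<Rightarrow> complex, 'a, 'x) hmodule_scheme \<Rightarrow> bool" where
  "quasi_free \<Omega> R \<longleftrightarrow> (\<exists>k f. quasi_free_rel \<Omega> R k f)"


section \<open>Compactly supported vectors\<close>

definition compactly_supported ::
  "(complex^'m) set \<Rightarrow> (complex^'m \<Rightarrow> complex, 'a, 'x) hmodule_scheme \<Rightarrow> 'a \<Rightarrow> bool" where
  "compactly_supported \<Omega> M f \<longleftrightarrow> f \<in> carrier M \<and>
    (\<exists>X \<beta>. compact X \<and> X \<subseteq> \<Omega> \<and>
      (\<forall>\<phi>\<in>A_set \<Omega>. hnorm M (act M \<phi> f) \<le> \<beta> * sup_norm X \<phi> * hnorm M f))"

definition almost_compactly_supported ::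
  "(complex^'m) set \<Rightarrow> (complex^'m \<Rightarrow> complex, 'a, 'x) hmodule_scheme \<Rightarrow> bool" where
  "almost_compactly_supported \<Omega> M \<longleftrightarrow> dense_in M (cspan M {f. compactly_supported \<Omega> M f})"


section \<open>Weak resolutions\<close>

text \<open>
  The length \<open>L\<close> is the index of the final module, or \<open>\<infinity>\<close>. The modules are \<open>R 1, R 2, \<dots>\<close>
  up to \<open>L\<close>; \<open>X0\<close> maps \<open>R 1\<close> to \<open>M\<close>, and \<open>X i\<close> maps \<open>R (i + 1)\<close> to \<open>R i\<close> for \<open>i \<ge> 1\<close>. In a finite
  resolution the final module is 0, which is not itself quasi-free (the rank being at least 1).
  All modules of a resolution share one carrier type \<open>'b\<close>. Quasi-free modules are separable
  (for bounded \<open>\<Omega>\<close> the algebra is, as a subspace of the continuous functions on \<open>closure \<Omega>\<close>),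
  so each has an isometric copy with elements of type \<open>nat \<Rightarrow> complex\<close>.
\<close>

definition weak_resolution ::
  "(complex^'m) set \<Rightarrow> (complex^'m \<Rightarrow> complex, 'a, 'x) hmodule_scheme \<Rightarrow> enat \<Rightarrow>
   (nat \<Rightarrow> (complex^'m \<Rightarrow> complex, 'b, 'y) hmodule_scheme) \<Rightarrow> ('b \<Rightarrow> 'a) \<Rightarrow> (nat \<Rightarrow> 'b \<Rightarrow> 'b) \<Rightarrow> bool"
  where
  "weak_resolution \<Omega> M L R X0 X \<longleftrightarrow> 1 \<le> L \<and>
    (\<forall>i\<ge>1. enat i < L \<longrightarrow> quasi_free \<Omega> (R i)) \<and>
    (\<forall>n. L = enat n \<longrightarrow> hilbert_module \<Omega> (R n) \<and> carrier (R n) = {\<zero>\<^bsub>R n\<^esub>}) \<and>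
    module_map \<Omega> (R 1) M X0 \<and>
    (\<forall>i\<ge>1. enat (i + 1) \<le> L \<longrightarrow> module_map \<Omega> (R (i + 1)) (R i) (X i)) \<and>
    dense_in M (X0 ` carrier (R 1)) \<and>
    (2 \<le> L \<longrightarrow> a_kernel (R 1) M X0 = htop (R 1) closure_of (X 1 ` carrier (R 2))) \<and>
    (\<forall>i\<ge>1. enat (i + 2) \<le> L \<longrightarrow>
       a_kernel (R (i + 1)) (R i) (X i) =
       htop (R (i + 1)) closure_of (X (i + 1) ` carrier (R (i + 2))))"

end

theory Submission
  imports Defs "HOL-Complex_Analysis.Complex_Analysis"
begin

text \<open>
  All modules of the resolution are closed subspaces of \<open>\<ell>\<^sup>2\<close> on which \<open>\<phi>\<close> multiplies the \<open>n\<close>-th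
  coordinate by \<open>\<phi> (q n)\<close>, for one fixed sequence of points \<open>q n\<close> of \<open>\<Omega>\<close>. Such a subspace is a Hilbert
  module as soon as it is invariant, and everything else depends on choosing points and generators
  well.

  The analytic input is the theorem \<open>sampling\<close>. There are points \<open>p j\<close> in \<open>\<Omega>\<close> and square-summable
  weights \<open>w j\<close> such that \<open>\<bar>\<phi> z\<bar> \<le> c z * \<parallel>\<phi>\<parallel>\<close> for all \<open>\<phi>\<close> in the algebra and \<open>z\<close> in \<open>\<Omega>\<close>, where \<open>\<parallel>\<phi>\<parallel>\<close> is
  the \<open>\<ell>\<^sup>2\<close> norm of \<open>(w j * \<phi> (p j))\<close> over \<open>j\<close> and \<open>c\<close> is continuous on \<open>\<Omega>\<close>. The points form nets that are
  fine compared with the distance to the boundary. By Cauchy's estimate \<open>\<phi>\<close> changes little between a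
  point and its neighbour in the net, little meaning half of a weighted supremum of \<open>\<phi>\<close>, which can
  then be absorbed.

  The coordinates of \<open>\<ell>\<^sup>2\<close> are divided into a sequence of even rows, each a copy of the points \<open>p j\<close>,
  and the odd rows, which together are again a copy of \<open>\<ell>\<^sup>2\<close>. Given \<open>g l\<close> in \<open>\<ell>\<^sup>2\<close>, the \<open>l\<close>-th generator
  has the weights in the \<open>l\<close>-th even row and \<open>g l\<close> in the odd rows. The even rows of a combination
  \<open>x\<close> of the generators with coefficients \<open>\<phi> l\<close> carry the samples of the \<open>\<phi> l\<close>, so the values \<open>\<phi> l z\<close>
  form a sequence of norm at most \<open>c z * \<parallel>x\<parallel>\<close>. This gives bounded evaluation maps \<open>E z\<close> on the closed module
  generated, which send the generators to the standard basis, and by \<open>quasi_free_relI\<close> the module is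
  quasi-free as soon as these evaluations separate its elements. The projection to the odd rows is a
  module map sending the \<open>l\<close>-th generator to \<open>g l\<close>.

  Separation is the delicate point: if \<open>E z x = 0\<close> for all \<open>z\<close>, then the even rows of \<open>x\<close> vanish, but in
  general the odd rows need not. They do vanish if the \<open>g l\<close> are taken from a module \<open>N\<close> that has bounded
  separating evaluations \<open>E' z\<close> of its own and if \<open>\<parallel>g l\<parallel> \<le> 1 / 2 ^ l\<close>, since then \<open>E' z\<close> of the odd rows
  of \<open>x\<close> has norm at most a constant times \<open>\<parallel>E z x\<parallel>\<close> (\<open>quasi_free_cover\<close>). Evaluations restrict to
  submodules, so the kernel of a map out of a module obtained in this way is such an \<open>N\<close>, and its generators
  can be scaled to be small (\<open>small_generators\<close>). Hence from the second module on the
  construction repeats itself.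

  The module \<open>\<M>\<close> that is to be resolved has no evaluations, and its compactly supported vectors take
  over. Take \<open>g l = 0\<close>, and send the \<open>l\<close>-th generator to a compactly supported vector \<open>m l\<close>. Compact
  support means that \<open>\<parallel>\<phi> (m l)\<parallel>\<close> is at most a multiple of the supremum of \<open>\<bar>\<phi>\<bar>\<close> over a compact set, hence
  at most a multiple of the sampled norm of \<open>\<phi>\<close>. After scaling the \<open>m l\<close>, this map is bounded
  (\<open>map_from_base\<close>), and countably many compactly supported vectors generate \<open>\<M>\<close>
  (\<open>compactly_supported_sequence\<close>), so that its range is dense.
\<close>

section \<open>Complex inner product spaces\<close>

lemma complex_ring_simps [simp]:
  "carrier complex_ring = UNIV" "mult complex_ring = (*)" "one complex_ring = 1"
  "zero complex_ring = 0" "add complex_ring = (+)"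
  by (simp_all add: complex_ring_def)

lemma cring_complex_ring: "cring complex_ring"
proof (rule cringI)
  show "abelian_group complex_ring"
    by (rule abelian_groupI) (auto simp: algebra_simps intro: exI [of _ "- _"])
  show "comm_monoid complex_ring"
    by (rule comm_monoidI) auto
qed (auto simp: algebra_simps)

definition hclosure :: "('a, 'x) hspace_scheme \<Rightarrow> 'a set \<Rightarrow> 'a set" where
  "hclosure H S = Abstract_Topology.closure_of (htop H) S"

text \<open>
  Completeness is left out, because it comes last in the constructions below: an isometric copy or
  a quotient is recognized as an inner product space first.
\<close>

locale inner_product_space = Module.module complex_ring H for H (structure) +
  assumes ip_add_left: "\<lbrakk>x \<in> carrier H; y \<in> carrier H; z \<in> carrier H\<rbrakk> \<Longrightarrow>
      cinner H (x \<oplus> y) z = cinner H x z + cinner H y z"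
    and ip_smult_left: "\<lbrakk>x \<in> carrier H; y \<in> carrier H\<rbrakk> \<Longrightarrow>
      cinner H (c \<odot> x) y = c * cinner H x y"
    and ip_commute: "\<lbrakk>x \<in> carrier H; y \<in> carrier H\<rbrakk> \<Longrightarrow> cinner H y x = cnj (cinner H x y)"
    and ip_ge_zero: "x \<in> carrier H \<Longrightarrow> 0 \<le> Re (cinner H x x)"
    and ip_eq_zero: "\<lbrakk>x \<in> carrier H; cinner H x x = 0\<rbrakk> \<Longrightarrow> x = \<zero>"

sublocale hilbert_space \<subseteq> inner_product_space H
  by unfold_locales (fact cinner_add_left cinner_smult_left cinner_commute cinner_ge_zero
      cinner_eq_zero)+

context inner_product_space
begin

lemma smult_in [simp]: "x \<in> carrier H \<Longrightarrow> c \<odot> x \<in> carrier H"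
  using smult_closed [of c x] by simp

lemma smult_add_left: "x \<in> carrier H \<Longrightarrow> (a + b) \<odot> x = a \<odot> x \<oplus> b \<odot> x"
  using smult_l_distr [of a b x] by simp

lemma smult_add_right: "\<lbrakk>x \<in> carrier H; y \<in> carrier H\<rbrakk> \<Longrightarrow> a \<odot> (x \<oplus> y) = a \<odot> x \<oplus> a \<odot> y"
  using smult_r_distr [of a x y] by simp

lemma smult_smult: "x \<in> carrier H \<Longrightarrow> a \<odot> (b \<odot> x) = (a * b) \<odot> x"
  using smult_assoc1 [of a b x] by simp

lemma smult_1 [simp]: "x \<in> carrier H \<Longrightarrow> 1 \<odot> x = x"
  using smult_one [of x] by simp

lemma smult_0 [simp]: "x \<in> carrier H \<Longrightarrow> 0 \<odot> x = \<zero>"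
  using smult_l_null [of x] by simp

lemma smult_zero [simp]: "c \<odot> \<zero> = \<zero>"
  using smult_r_null [of c] by simp

lemma uminus_eq_smult: "x \<in> carrier H \<Longrightarrow> \<ominus> x = (-1) \<odot> x"
proof -
  assume x: "x \<in> carrier H"
  have "(-1) \<odot> x \<oplus> x = \<zero>"
    using smult_add_left [of x "-1" 1] x by simp
  then show ?thesis
    using x by (metis minus_equality smult_in)
qed

lemma minus_eq_smult: "\<lbrakk>x \<in> carrier H; y \<in> carrier H\<rbrakk> \<Longrightarrow> x \<ominus> y = x \<oplus> (-1) \<odot> y"
  by (simp add: a_minus_def uminus_eq_smult)

lemma cinner_add_right: "\<lbrakk>x \<in> carrier H; y \<in> carrier H; z \<in> carrier H\<rbrakk> \<Longrightarrow>
    cinner H x (y \<oplus> z) = cinner H x y + cinner H x z"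
  using ip_add_left [of y z x] ip_commute [of "y \<oplus> z" x] ip_commute [of y x]
    ip_commute [of z x] by simp

lemma cinner_smult_right: "\<lbrakk>x \<in> carrier H; y \<in> carrier H\<rbrakk> \<Longrightarrow>
    cinner H x (c \<odot> y) = cnj c * cinner H x y"
  using ip_smult_left [of y x c] ip_commute [of "c \<odot> y" x] ip_commute [of y x]
  by simp

lemma cinner_minus_left: "\<lbrakk>x \<in> carrier H; y \<in> carrier H; z \<in> carrier H\<rbrakk> \<Longrightarrow>
    cinner H (x \<ominus> y) z = cinner H x z - cinner H y z"
  by (simp add: minus_eq_smult ip_add_left ip_smult_left)

lemma cinner_minus_right: "\<lbrakk>x \<in> carrier H; y \<in> carrier H; z \<in> carrier H\<rbrakk> \<Longrightarrow>
    cinner H x (y \<ominus> z) = cinner H x y - cinner H x z"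
  by (simp add: minus_eq_smult cinner_add_right cinner_smult_right)

lemma cinner_zero_left [simp]: "x \<in> carrier H \<Longrightarrow> cinner H \<zero> x = 0"
  using ip_smult_left [of \<zero> x 0] by simp

lemma cinner_zero_right [simp]: "x \<in> carrier H \<Longrightarrow> cinner H x \<zero> = 0"
  using cinner_smult_right [of x \<zero> 0] by simp

lemma cinner_self: "x \<in> carrier H \<Longrightarrow> cinner H x x = complex_of_real ((hnorm H x)\<^sup>2)"
proof -
  assume x: "x \<in> carrier H"
  have "Im (cinner H x x) = 0"
    using ip_commute [OF x x] by (metis complex_cnj_cancel_iff Reals_cnj_iff complex_is_Real_iff)
  then show ?thesis
    using ip_ge_zero [OF x] by (simp add: hnorm_def complex_eq_iff)
qed

lemma hnorm_nonneg [simp]: "x \<in> carrier H \<Longrightarrow> 0 \<le> hnorm H x"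
  by (simp add: hnorm_def ip_ge_zero)

lemma hnorm_sq: "x \<in> carrier H \<Longrightarrow> (hnorm H x)\<^sup>2 = Re (cinner H x x)"
  by (simp add: hnorm_def ip_ge_zero)

lemma hnorm_zero [simp]: "hnorm H \<zero> = 0"
  by (simp add: hnorm_def)

lemma hnorm_eq_zero: "\<lbrakk>x \<in> carrier H; hnorm H x = 0\<rbrakk> \<Longrightarrow> x = \<zero>"
  using cinner_self [of x] ip_eq_zero [of x] by simp

lemma hnorm_smult: "x \<in> carrier H \<Longrightarrow> hnorm H (c \<odot> x) = cmod c * hnorm H x"
proof -
  assume x: "x \<in> carrier H"
  have "cinner H (c \<odot> x) (c \<odot> x) = (c * cnj c) * cinner H x x"
    using x by (simp add: ip_smult_left cinner_smult_right)
  also have "\<dots> = complex_of_real ((cmod c * hnorm H x)\<^sup>2)"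
    using x by (simp add: cinner_self complex_mult_cnj cmod_power2 power_mult_distrib)
  finally have "Re (cinner H (c \<odot> x) (c \<odot> x)) = (cmod c * hnorm H x)\<^sup>2"
    by simp
  then show ?thesis
    using x hnorm_nonneg [OF x] by (simp add: hnorm_def [of H "c \<odot> x"])
qed

lemma hnorm_add_sq: "\<lbrakk>x \<in> carrier H; y \<in> carrier H\<rbrakk> \<Longrightarrow>
    (hnorm H (x \<oplus> y))\<^sup>2 = (hnorm H x)\<^sup>2 + 2 * Re (cinner H x y) + (hnorm H y)\<^sup>2"
  by (simp add: hnorm_sq ip_add_left cinner_add_right) (simp add: ip_commute [of x y])

lemma hnorm_minus_sq: "\<lbrakk>x \<in> carrier H; y \<in> carrier H\<rbrakk> \<Longrightarrow>
    (hnorm H (x \<ominus> y))\<^sup>2 = (hnorm H x)\<^sup>2 - 2 * Re (cinner H x y) + (hnorm H y)\<^sup>2"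
  by (simp add: minus_eq_smult hnorm_add_sq hnorm_smult cinner_smult_right)

lemma cauchy_schwarz:
  assumes x: "x \<in> carrier H" and y: "y \<in> carrier H"
  shows "cmod (cinner H x y) \<le> hnorm H x * hnorm H y"
proof (cases "hnorm H y = 0")
  case True
  then have "y = \<zero>" using y hnorm_eq_zero by blast
  then show ?thesis using x by simp
next
  case False
  define c where "c = cinner H x y / complex_of_real ((hnorm H y)\<^sup>2)"
  have n: "hnorm H y > 0" using False hnorm_nonneg [OF y] by linarith
  have c1: "cinner H x (c \<odot> y) = complex_of_real ((cmod (cinner H x y))\<^sup>2 / (hnorm H y)\<^sup>2)"
    using x y
    by (simp add: cinner_smult_right c_def complex_norm_square [symmetric] mult.commute
      flip: of_real_power)
  have c2: "(hnorm H (c \<odot> y))\<^sup>2 = (cmod (cinner H x y))\<^sup>2 / (hnorm H y)\<^sup>2"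
    using y n by (simp add: hnorm_smult c_def norm_divide norm_mult norm_power power2_eq_square field_simps)
  have "0 \<le> (hnorm H (x \<ominus> c \<odot> y))\<^sup>2" by simp
  also have "\<dots> = (hnorm H x)\<^sup>2 - (cmod (cinner H x y))\<^sup>2 / (hnorm H y)\<^sup>2"
    using x y by (simp add: hnorm_minus_sq c1 c2 del: of_real_divide)
  finally have "(cmod (cinner H x y))\<^sup>2 \<le> (hnorm H x * hnorm H y)\<^sup>2"
    using n by (simp add: field_simps power_mult_distrib)
  then show ?thesis
    using x y n hnorm_nonneg by (meson mult_nonneg_nonneg power2_le_imp_le)
qed

lemma hnorm_triangle:
  assumes x: "x \<in> carrier H" and y: "y \<in> carrier H"
  shows "hnorm H (x \<oplus> y) \<le> hnorm H x + hnorm H y"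
proof (rule power2_le_imp_le)
  have "Re (cinner H x y) \<le> hnorm H x * hnorm H y"
    using cauchy_schwarz [OF x y] complex_Re_le_cmod order_trans by blast
  then show "(hnorm H (x \<oplus> y))\<^sup>2 \<le> (hnorm H x + hnorm H y)\<^sup>2"
    using x y by (simp add: hnorm_add_sq power2_sum)
  show "0 \<le> hnorm H x + hnorm H y" using x y hnorm_nonneg by fastforce
qed

lemma minus_split:
  assumes "x \<in> carrier H" "y \<in> carrier H" "z \<in> carrier H"
  shows "x \<ominus> z = (x \<ominus> y) \<oplus> (y \<ominus> z)"
proof -
  have "(x \<oplus> \<ominus> y) \<oplus> (y \<oplus> \<ominus> z) = x \<oplus> ((\<ominus> y \<oplus> y) \<oplus> \<ominus> z)"
    using assms by (simp only: a_assoc a_closed a_inv_closed)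
  then show ?thesis
    using assms by (simp add: a_minus_def l_neg)
qed

lemma hnorm_minus_triangle:
  assumes "x \<in> carrier H" "y \<in> carrier H" "z \<in> carrier H"
  shows "hnorm H (x \<ominus> z) \<le> hnorm H (x \<ominus> y) + hnorm H (y \<ominus> z)"
  using hnorm_triangle [of "x \<ominus> y" "y \<ominus> z"] minus_split [OF assms] assms by simp

lemma hnorm_minus_commute:
  assumes "x \<in> carrier H" "y \<in> carrier H"
  shows "hnorm H (x \<ominus> y) = hnorm H (y \<ominus> x)"
proof (rule power2_eq_imp_eq)
  have "Re (cinner H x y) = Re (cinner H y x)"
    using assms by (simp add: ip_commute [of x y])
  then show "(hnorm H (x \<ominus> y))\<^sup>2 = (hnorm H (y \<ominus> x))\<^sup>2"
    using assms by (simp add: hnorm_minus_sq)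
qed (use assms hnorm_nonneg in simp_all)

lemma minus_self [simp]: "x \<in> carrier H \<Longrightarrow> x \<ominus> x = \<zero>"
  by (simp add: a_minus_def r_neg)

lemma minus_zero [simp]: "x \<in> carrier H \<Longrightarrow> x \<ominus> \<zero> = x"
  by (simp add: minus_eq_smult)

lemma minus_eq_zero: "\<lbrakk>x \<in> carrier H; y \<in> carrier H; x \<ominus> y = \<zero>\<rbrakk> \<Longrightarrow> x = y"
  by (metis a_minus_def a_inv_closed minus_equality minus_minus)

lemma eq_if_hnorm_small:
  assumes "x \<in> carrier H" "y \<in> carrier H" "\<And>e. e > 0 \<Longrightarrow> hnorm H (x \<ominus> y) \<le> e"
  shows "x = y"
proof -
  have "hnorm H (x \<ominus> y) \<le> 0" using assms(3) by (meson field_le_epsilon add_0 order_refl dense_ge)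
  then have "hnorm H (x \<ominus> y) = 0" using assms hnorm_nonneg by (meson antisym minus_closed)
  then have "x \<ominus> y = \<zero>" using assms by (simp add: hnorm_eq_zero)
  then show ?thesis by (rule minus_eq_zero [OF assms(1,2)])
qed

lemma add_add_swap:
  assumes "a \<in> carrier H" "b \<in> carrier H" "c \<in> carrier H" "d \<in> carrier H"
  shows "(a \<oplus> b) \<oplus> (c \<oplus> d) = (a \<oplus> c) \<oplus> (b \<oplus> d)"
  using assms by (simp add: a_ac)

lemma add_minus_add:
  assumes "x \<in> carrier H" "y \<in> carrier H" "x' \<in> carrier H" "y' \<in> carrier H"
  shows "(x \<oplus> y) \<ominus> (x' \<oplus> y') = (x \<ominus> x') \<oplus> (y \<ominus> y')"
  using assms by (simp add: minus_eq_smult smult_add_right add_add_swap)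

lemma smult_minus_right:
  assumes "x \<in> carrier H" "y \<in> carrier H"
  shows "c \<odot> (x \<ominus> y) = c \<odot> x \<ominus> c \<odot> y"
  using assms by (simp add: minus_eq_smult smult_add_right smult_smult mult.commute)

lemma metric: "Metric_space (carrier H) (hdist H)"
proof (rule Metric_space.intro)
  fix x y
  show "0 \<le> hdist H x y"
    by (simp add: hdist_def)
  show "hdist H x y = hdist H y x"
    using hnorm_minus_commute [of x y] by (auto simp: hdist_def)
next
  fix x y assume xy: "x \<in> carrier H" "y \<in> carrier H"
  show "hdist H x y = 0 \<longleftrightarrow> x = y"
  proof
    assume "hdist H x y = 0"
    then have "hnorm H (x \<ominus> y) = 0" using xy by (simp add: hdist_def)
    then have "x \<ominus> y = \<zero>" using xy by (simp add: hnorm_eq_zero)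
    then show "x = y" by (rule minus_eq_zero [OF xy])
  next
    assume "x = y"
    then show "hdist H x y = 0" using xy by (simp add: hdist_def)
  qed
next
  fix x y z assume xyz: "x \<in> carrier H" "y \<in> carrier H" "z \<in> carrier H"
  show "hdist H x z \<le> hdist H x y + hdist H y z"
    using hnorm_minus_triangle [OF xyz] xyz by (simp add: hdist_def)
qed

lemma topspace_htop [simp]: "topspace (htop H) = carrier H"
  by (simp add: htop_def Metric_space.topspace_mtopology [OF metric])

lemma in_closure_iff:
  assumes "S \<subseteq> carrier H"
  shows "x \<in> hclosure H S \<longleftrightarrow> x \<in> carrier H \<and> (\<forall>e>0. \<exists>y\<in>S. hnorm H (x \<ominus> y) < e)"
  using assms by (auto simp: hclosure_def htop_def Metric_space.metric_closure_of [OF metric]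
      Metric_space.in_mball [OF metric] hdist_def subset_iff)

lemma closedin_iff:
  "closedin (htop H) S \<longleftrightarrow>
     S \<subseteq> carrier H \<and> (\<forall>x\<in>carrier H. (\<forall>e>0. \<exists>y\<in>S. hnorm H (x \<ominus> y) < e) \<longrightarrow> x \<in> S)"
proof -
  have "closedin (htop H) S \<longleftrightarrow> S \<subseteq> carrier H \<and> hclosure H S \<subseteq> S"
    using closure_of_subset_eq [of S "htop H"] closedin_subset [of "htop H" S]
    by (auto simp: hclosure_def)
  then show ?thesis
    using in_closure_iff [of S] by blast
qed

lemma dense_in_iff:
  assumes "S \<subseteq> carrier H"
  shows "dense_in H S \<longleftrightarrow> (\<forall>x\<in>carrier H. \<forall>e>0. \<exists>y\<in>S. hnorm H (x \<ominus> y) < e)"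
  unfolding dense_in_def hclosure_def [symmetric] using in_closure_iff [OF assms] by blast

text \<open>
  Completeness expressed by the norm alone, so that it can be carried along an isometry.
\<close>

lemma mcomplete_iff:
  "Metric_space.mcomplete (carrier H) (hdist H) \<longleftrightarrow>
    (\<forall>\<sigma> :: nat \<Rightarrow> _. range \<sigma> \<subseteq> carrier H \<longrightarrow> (\<forall>e>0. \<exists>N. \<forall>m\<ge>N. \<forall>n\<ge>N. hnorm H (\<sigma> m \<ominus> \<sigma> n) < e) \<longrightarrow>
       (\<exists>x\<in>carrier H. \<forall>e>0. \<exists>N. \<forall>n\<ge>N. hnorm H (\<sigma> n \<ominus> x) < e))"
proof -
  have swap: "(\<forall>n n'. N \<le> n \<longrightarrow> N \<le> n' \<longrightarrow> Q n n') \<longleftrightarrow> (\<forall>m\<ge>N. \<forall>n\<ge>N. Q m n)"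
    for N :: nat and Q by blast
  have C: "Metric_space.MCauchy (carrier H) (hdist H) \<sigma> \<longleftrightarrow>
     range \<sigma> \<subseteq> carrier H \<and> (\<forall>e>0. \<exists>N. \<forall>m\<ge>N. \<forall>n\<ge>N. hnorm H (\<sigma> m \<ominus> \<sigma> n) < e)" for \<sigma>
  proof (cases "range \<sigma> \<subseteq> carrier H")
    case True
    then have "hdist H (\<sigma> m) (\<sigma> n) = hnorm H (\<sigma> m \<ominus> \<sigma> n)" for m n
      by (simp add: hdist_def image_subset_iff)
    then show ?thesis
      unfolding Metric_space.MCauchy_def [OF metric] by (simp only: swap)
  next
    case False
    then show ?thesis
      unfolding Metric_space.MCauchy_def [OF metric] by (simp only: simp_thms)
  qed
  have L: "limitin (Metric_space.mtopology (carrier H) (hdist H)) \<sigma> x sequentially \<longleftrightarrow>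
     x \<in> carrier H \<and> (\<forall>e>0. \<exists>N. \<forall>n\<ge>N. hnorm H (\<sigma> n \<ominus> x) < e)"
    if "range \<sigma> \<subseteq> carrier H" for \<sigma> :: "nat \<Rightarrow> _" and x
  proof -
    have "hdist H (\<sigma> n) x = hnorm H (\<sigma> n \<ominus> x)" "\<sigma> n \<in> carrier H" if "x \<in> carrier H" for n
      using that \<open>range \<sigma> \<subseteq> carrier H\<close> by (auto simp add: hdist_def image_subset_iff)
    then show ?thesis
      unfolding Metric_space.limitin_metric [OF metric] eventually_sequentially
      by (simp cong: conj_cong)
  qed
  show ?thesis
  proof
    assume l: "Metric_space.mcomplete (carrier H) (hdist H)"
    show "\<forall>\<sigma> :: nat \<Rightarrow> _. range \<sigma> \<subseteq> carrier H \<longrightarrow> (\<forall>e>0. \<exists>N. \<forall>m\<ge>N. \<forall>n\<ge>N. hnorm H (\<sigma> m \<ominus> \<sigma> n) < e) \<longrightarrow>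
       (\<exists>x\<in>carrier H. \<forall>e>0. \<exists>N. \<forall>n\<ge>N. hnorm H (\<sigma> n \<ominus> x) < e)"
    proof (intro allI impI)
      fix \<sigma> :: "nat \<Rightarrow> _" assume r: "range \<sigma> \<subseteq> carrier H"
        and c: "\<forall>e>0. \<exists>N. \<forall>m\<ge>N. \<forall>n\<ge>N. hnorm H (\<sigma> m \<ominus> \<sigma> n) < e"
      have "\<exists>x. limitin (Metric_space.mtopology (carrier H) (hdist H)) \<sigma> x sequentially"
        using l [unfolded Metric_space.mcomplete_def [OF metric] C, rule_format, OF conjI [OF r c]] .
      then show "\<exists>x\<in>carrier H. \<forall>e>0. \<exists>N. \<forall>n\<ge>N. hnorm H (\<sigma> n \<ominus> x) < e"
        unfolding L [OF r] Bex_def .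
    qed
  next
    assume rhs: "\<forall>\<sigma> :: nat \<Rightarrow> _. range \<sigma> \<subseteq> carrier H \<longrightarrow> (\<forall>e>0. \<exists>N. \<forall>m\<ge>N. \<forall>n\<ge>N. hnorm H (\<sigma> m \<ominus> \<sigma> n) < e) \<longrightarrow>
       (\<exists>x\<in>carrier H. \<forall>e>0. \<exists>N. \<forall>n\<ge>N. hnorm H (\<sigma> n \<ominus> x) < e)"
    show "Metric_space.mcomplete (carrier H) (hdist H)"
      unfolding Metric_space.mcomplete_def [OF metric] C
    proof (intro allI impI, elim conjE)
      fix \<sigma> :: "nat \<Rightarrow> _" assume r: "range \<sigma> \<subseteq> carrier H"
        and c: "\<forall>e>0. \<exists>N. \<forall>m\<ge>N. \<forall>n\<ge>N. hnorm H (\<sigma> m \<ominus> \<sigma> n) < e"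
      show "\<exists>x. limitin (Metric_space.mtopology (carrier H) (hdist H)) \<sigma> x sequentially"
        unfolding L [OF r] Bex_def [symmetric] using rhs r c by blast
    qed
  qed
qed

end

lemma hilbert_spaceI:
  assumes "inner_product_space H" and "Metric_space.mcomplete (carrier H) (hdist H)"
  shows "hilbert_space H"
proof -
  interpret inner_product_space H by fact
  show ?thesis
    by unfold_locales
      (fact ip_add_left ip_smult_left ip_commute ip_ge_zero ip_eq_zero
        assms(2))+
qed

lemma (in hilbert_space) Cauchy_converges:
  fixes \<sigma> :: "nat \<Rightarrow> _"
  assumes "\<And>n. \<sigma> n \<in> carrier H"
    and "\<And>e. e > 0 \<Longrightarrow> \<exists>N. \<forall>m\<ge>N. \<forall>n\<ge>N. hnorm H (\<sigma> m \<ominus> \<sigma> n) < e"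
  shows "\<exists>x\<in>carrier H. \<forall>e>0. \<exists>N. \<forall>n\<ge>N. hnorm H (\<sigma> n \<ominus> x) < e"
proof -
  have "range \<sigma> \<subseteq> carrier H" using assms(1) by blast
  moreover have "\<forall>e>0. \<exists>N. \<forall>m\<ge>N. \<forall>n\<ge>N. hnorm H (\<sigma> m \<ominus> \<sigma> n) < e" using assms(2) by blast
  ultimately show ?thesis
    using complete unfolding mcomplete_iff by blast
qed

section \<open>Closed subspaces and orthogonal projection\<close>

context inner_product_space
begin

lemma submodule_iff:
  "submodule S complex_ring H \<longleftrightarrow> S \<subseteq> carrier H \<and> \<zero> \<in> S \<and>
    (\<forall>x\<in>S. \<forall>y\<in>S. x \<oplus> y \<in> S) \<and> (\<forall>c. \<forall>x\<in>S. c \<odot> x \<in> S)"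
proof
  assume S: "submodule S complex_ring H"
  note E = submoduleE [OF S]
  obtain x where x: "x \<in> S" using E(2) by blast
  then have "0 \<odot> x \<in> S" using E(4) [of 0 x] by simp
  moreover have "0 \<odot> x = \<zero>" using x E(1) by auto
  ultimately have "\<zero> \<in> S" by metis
  then show "S \<subseteq> carrier H \<and> \<zero> \<in> S \<and> (\<forall>x\<in>S. \<forall>y\<in>S. x \<oplus> y \<in> S) \<and> (\<forall>c. \<forall>x\<in>S. c \<odot> x \<in> S)"
    using E by auto
next
  assume a: "S \<subseteq> carrier H \<and> \<zero> \<in> S \<and> (\<forall>x\<in>S. \<forall>y\<in>S. x \<oplus> y \<in> S) \<and> (\<forall>c. \<forall>x\<in>S. c \<odot> x \<in> S)"
  show "submodule S complex_ring H"
  proof (rule submoduleI)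
    fix x assume "x \<in> S"
    then show "\<ominus> x \<in> S" using a by (auto simp: uminus_eq_smult subset_iff)
  qed (use a in auto)
qed

lemma submoduleD:
  assumes "submodule S complex_ring H"
  shows "S \<subseteq> carrier H" "\<zero> \<in> S" "\<And>x y. \<lbrakk>x \<in> S; y \<in> S\<rbrakk> \<Longrightarrow> x \<oplus> y \<in> S"
    "\<And>c x. x \<in> S \<Longrightarrow> c \<odot> x \<in> S" "\<And>x y. \<lbrakk>x \<in> S; y \<in> S\<rbrakk> \<Longrightarrow> x \<ominus> y \<in> S"
proof -
  note a = assms [unfolded submodule_iff]
  show "S \<subseteq> carrier H" "\<zero> \<in> S" "\<And>x y. \<lbrakk>x \<in> S; y \<in> S\<rbrakk> \<Longrightarrow> x \<oplus> y \<in> S"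
    "\<And>c x. x \<in> S \<Longrightarrow> c \<odot> x \<in> S"
    using a by auto
  show "x \<ominus> y \<in> S" if "x \<in> S" "y \<in> S" for x y
  proof -
    have "x \<ominus> y = x \<oplus> (-1) \<odot> y" using that a by (auto intro: minus_eq_smult)
    then show ?thesis using that a by simp
  qed
qed

lemma finsum_in_submodule:
  assumes "submodule S complex_ring H" "finite I" "\<And>i. i \<in> I \<Longrightarrow> v i \<in> S"
  shows "(\<Oplus>i\<in>I. v i) \<in> S"
  using assms(2,3)
proof (induction I)
  case empty
  then show ?case using submoduleD(2) [OF assms(1)] by simp
next
  case (insert i I)
  then have "v \<in> I \<rightarrow> carrier H" "v i \<in> carrier H" using submoduleD(1) [OF assms(1)] by auto
  then show ?case using insert submoduleD(3) [OF assms(1)] by simp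
qed

lemma hclosure_in_carrier: "hclosure H S \<subseteq> carrier H"
  unfolding hclosure_def by (metis closure_of_subset_topspace topspace_htop)

lemma subset_hclosure: "S \<subseteq> carrier H \<Longrightarrow> S \<subseteq> hclosure H S"
  unfolding hclosure_def by (simp add: closure_of_subset)

lemma closedin_hclosure: "closedin (htop H) (hclosure H S)"
  unfolding hclosure_def by simp

lemma hclosure_minimal: "\<lbrakk>S \<subseteq> T; closedin (htop H) T\<rbrakk> \<Longrightarrow> hclosure H S \<subseteq> T"
  unfolding hclosure_def by (rule closure_of_minimal)

lemma hclosure_approx:
  assumes "x \<in> hclosure H S" "S \<subseteq> carrier H" "e > 0"
  obtains y where "y \<in> S" "hnorm H (x \<ominus> y) < e"
  using assms in_closure_iff by blast

lemma submodule_hclosure: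
  assumes S: "submodule S complex_ring H"
  shows "submodule (hclosure H S) complex_ring H"
proof -
  note D = submoduleD [OF S]
  have car: "x \<in> carrier H" if "x \<in> hclosure H S" for x using that hclosure_in_carrier by blast
  have add: "x \<oplus> y \<in> hclosure H S" if x: "x \<in> hclosure H S" and y: "y \<in> hclosure H S" for x y
    unfolding in_closure_iff [OF D(1)]
  proof (intro conjI allI impI)
    show "x \<oplus> y \<in> carrier H" using car x y by simp
    fix e :: real assume "e > 0"
    then have e: "e / 2 > 0" by simp
    obtain x' where x': "x' \<in> S" "hnorm H (x \<ominus> x') < e / 2" by (rule hclosure_approx [OF x D(1) e])
    obtain y' where y': "y' \<in> S" "hnorm H (y \<ominus> y') < e / 2" by (rule hclosure_approx [OF y D(1) e])
    have c: "x \<in> carrier H" "y \<in> carrier H" "x' \<in> carrier H" "y' \<in> carrier H"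
      using car x y x' y' D(1) by auto
    have "hnorm H ((x \<oplus> y) \<ominus> (x' \<oplus> y')) \<le> hnorm H (x \<ominus> x') + hnorm H (y \<ominus> y')"
      using c hnorm_triangle [of "x \<ominus> x'" "y \<ominus> y'"] by (simp add: add_minus_add)
    also have "\<dots> < e" using x' y' by simp
    finally show "\<exists>z\<in>S. hnorm H ((x \<oplus> y) \<ominus> z) < e" using D(3) [OF x'(1) y'(1)] by blast
  qed
  have smult: "c \<odot> x \<in> hclosure H S" if x: "x \<in> hclosure H S" for c x
    unfolding in_closure_iff [OF D(1)]
  proof (intro conjI allI impI)
    show "c \<odot> x \<in> carrier H" using car x by simp
    fix e :: real assume "e > 0"
    then have e: "e / (cmod c + 1) > 0" by (simp add: add_nonneg_pos)
    obtain x' where x': "x' \<in> S" "hnorm H (x \<ominus> x') < e / (cmod c + 1)"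
      by (rule hclosure_approx [OF x D(1) e])
    have c: "x \<in> carrier H" "x' \<in> carrier H" using car x x' D(1) by auto
    have "hnorm H (c \<odot> x \<ominus> c \<odot> x') = cmod c * hnorm H (x \<ominus> x')"
      using c by (simp add: smult_minus_right [symmetric] hnorm_smult)
    also have "\<dots> \<le> (cmod c + 1) * hnorm H (x \<ominus> x')"
      using c by (intro mult_right_mono) simp_all
    also have "\<dots> < e"
      using x'(2) pos_less_divide_eq [of "cmod c + 1" _ e] by (simp add: add_nonneg_pos mult.commute)
    finally show "\<exists>z\<in>S. hnorm H (c \<odot> x \<ominus> z) < e" using D(4) [OF x'(1)] by blast
  qed
  show ?thesis
    unfolding submodule_iff using hclosure_in_carrier subset_hclosure [OF D(1)] D(2) add smult by blast
qed

text \<open>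
  All continuity arguments go through this form: inequalities and equations between bounded
  linear maps, known on the combinations of generators, are extended to the closed
  module by applying it to a difference of norms.
\<close>

lemma Lipschitz_nonpos_hclosure:
  assumes "S \<subseteq> C" "C \<subseteq> carrier H"
    and lip: "\<And>x y. \<lbrakk>x \<in> C; y \<in> C\<rbrakk> \<Longrightarrow> \<bar>h x - h y\<bar> \<le> L * hnorm H (x \<ominus> y)"
    and le: "\<And>x. x \<in> S \<Longrightarrow> h x \<le> 0"
    and x: "x \<in> C" "x \<in> hclosure H S"
  shows "h x \<le> (0::real)"
proof (rule ccontr)
  assume "\<not> h x \<le> 0"
  then have e: "h x / (\<bar>L\<bar> + 1) > 0" by (simp add: add_nonneg_pos)
  obtain y where y: "y \<in> S" "hnorm H (x \<ominus> y) < h x / (\<bar>L\<bar> + 1)"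
    by (rule hclosure_approx [OF x(2) _ e]) (use assms(1,2) in auto)
  have c: "x \<in> carrier H" "y \<in> carrier H" "y \<in> C" using y x assms(1,2) by auto
  have "h x \<le> h y + L * hnorm H (x \<ominus> y)" using lip [OF x(1) c(3)] by simp
  also have "\<dots> \<le> 0 + (\<bar>L\<bar> + 1) * hnorm H (x \<ominus> y)"
    using le [OF y(1)] c by (intro add_mono mult_right_mono) auto
  also have "\<dots> < h x"
    using y(2) pos_less_divide_eq [of "\<bar>L\<bar> + 1" _ "h x"] by (simp add: add_nonneg_pos mult.commute)
  finally show False by simp
qed

text \<open>
  The parallelogram law for \<open>x - a\<close> and \<open>x - b\<close>; it forces minimizing sequences in a subspace to
  be Cauchy.
\<close>

lemma hnorm_midpoint:
  assumes "x \<in> carrier H" "a \<in> carrier H" "b \<in> carrier H"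
  shows "(hnorm H (a \<ominus> b))\<^sup>2 = 2 * (hnorm H (x \<ominus> a))\<^sup>2 + 2 * (hnorm H (x \<ominus> b))\<^sup>2
    - 4 * (hnorm H (x \<ominus> (1/2) \<odot> (a \<oplus> b)))\<^sup>2"
proof -
  have "(hnorm H (x \<ominus> (1/2) \<odot> (a \<oplus> b)))\<^sup>2 = (hnorm H x)\<^sup>2 - Re (cinner H x a) - Re (cinner H x b)
      + (hnorm H (a \<oplus> b))\<^sup>2 / 4"
    using assms by (simp add: hnorm_minus_sq [of x] hnorm_smult cinner_add_right
      cinner_smult_right power_divide add_divide_distrib)
  then show ?thesis
    using assms
    by (simp add: hnorm_minus_sq [of a b] hnorm_minus_sq [of x a] hnorm_minus_sq [of x b]
        hnorm_add_sq [of a b] field_simps)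
qed

lemma hnorm_diff_le:
  assumes "x \<in> carrier H" "y \<in> carrier H"
  shows "\<bar>hnorm H x - hnorm H y\<bar> \<le> hnorm H (x \<ominus> y)"
  using hnorm_minus_triangle [of x y \<zero>] hnorm_minus_triangle [of y x \<zero>]
    hnorm_minus_commute [OF assms] assms by simp

end

lemma (in inner_product_space) hnorm_finsum_le:
  assumes "finite I" "\<And>i. i \<in> I \<Longrightarrow> v i \<in> carrier H"
  shows "hnorm H (\<Oplus>i\<in>I. v i) \<le> (\<Sum>i\<in>I. hnorm H (v i))"
  using assms
proof (induction I)
  case (insert i I)
  have v: "v \<in> I \<rightarrow> carrier H" "v i \<in> carrier H" using insert.prems by auto
  have "hnorm H (\<Oplus>j\<in>insert i I. v j) = hnorm H (v i \<oplus> (\<Oplus>j\<in>I. v j))"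
    using insert.hyps v by simp
  also have "\<dots> \<le> hnorm H (v i) + hnorm H (\<Oplus>j\<in>I. v j)"
    by (rule hnorm_triangle [OF v(2) finsum_closed [OF v(1)]])
  also have "\<dots> \<le> hnorm H (v i) + (\<Sum>j\<in>I. hnorm H (v j))" using insert by simp
  finally show ?case using insert.hyps by simp
qed simp

lemma (in inner_product_space) cspan_in_carrier: "V \<subseteq> carrier H \<Longrightarrow> cspan H V \<subseteq> carrier H"
  unfolding cspan_def by (auto intro!: finsum_closed)

text \<open>
  The minimizing sequence for the distance from \<open>x\<close> to \<open>S\<close> is Cauchy by the parallelogram law, and at
  its limit \<open>s\<close> moving along any direction \<open>t\<close> of \<open>S\<close> cannot shorten \<open>x - s\<close>.
\<close>

theorem (in hilbert_space) orthogonal_projection: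
  assumes S: "submodule S complex_ring H" and cl: "closedin (htop H) S" and x: "x \<in> carrier H"
  obtains s where "s \<in> S" "\<And>t. t \<in> S \<Longrightarrow> cinner H (x \<ominus> s) t = 0"
proof -
  note D = submoduleD [OF S]
  have car: "s \<in> carrier H" if "s \<in> S" for s using that D(1) by blast
  define q where "q s = (hnorm H (x \<ominus> s))\<^sup>2" for s
  define d where "d = Inf (q ` S)"
  have bdd: "bdd_below (q ` S)" by (rule bdd_belowI [of _ 0]) (auto simp: q_def)
  have dle: "d \<le> q s" if "s \<in> S" for s
    unfolding d_def using that bdd by (intro cInf_lower) auto
  have ne: "q ` S \<noteq> {}" using D(2) by blast
  have "\<exists>s\<in>S. q s < d + 1 / real (Suc n)" for n
  proof -
    have "Inf (q ` S) < d + 1 / real (Suc n)" by (simp add: d_def)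
    then show ?thesis using cInf_lessD [OF ne] by blast
  qed
  then obtain \<sigma> where \<sigma>: "\<And>n. \<sigma> n \<in> S" "\<And>n. q (\<sigma> n) < d + 1 / real (Suc n)" by metis
  have dist: "(hnorm H (\<sigma> m \<ominus> \<sigma> n))\<^sup>2 \<le> 2 / real (Suc m) + 2 / real (Suc n)" for m n
  proof -
    have "(1/2) \<odot> (\<sigma> m \<oplus> \<sigma> n) \<in> S" by (intro D(3,4) \<sigma>(1))
    then have "d \<le> q ((1/2) \<odot> (\<sigma> m \<oplus> \<sigma> n))" by (rule dle)
    then show ?thesis
      using hnorm_midpoint [OF x car [OF \<sigma>(1) [of m]] car [OF \<sigma>(1) [of n]]]
        \<sigma>(2) [of m] \<sigma>(2) [of n]
      by (simp add: q_def)
  qed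
  have Cau: "\<exists>N. \<forall>m\<ge>N. \<forall>n\<ge>N. hnorm H (\<sigma> m \<ominus> \<sigma> n) < e" if e: "e > 0" for e
  proof -
    obtain N where N: "N > 0" "inverse (real N) < e\<^sup>2 / 4"
      using ex_inverse_of_nat_less [of "e\<^sup>2 / 4"] e by auto
    have "hnorm H (\<sigma> m \<ominus> \<sigma> n) < e" if "m \<ge> N" "n \<ge> N" for m n
    proof (rule power2_less_imp_less)
      have "1 / real (Suc k) \<le> inverse (real N)" if "k \<ge> N" for k
        using that N(1) by (simp add: field_simps)
      from this [of m] this [of n] show "(hnorm H (\<sigma> m \<ominus> \<sigma> n))\<^sup>2 < e\<^sup>2"
        using dist [of m n] N(2) that by simp
    qed (use e in simp)
    then show ?thesis by blast
  qed
  obtain s where s: "s \<in> carrier H" "\<And>e. e > 0 \<Longrightarrow> \<exists>N. \<forall>n\<ge>N. hnorm H (\<sigma> n \<ominus> s) < e"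
    using Cauchy_converges [of \<sigma>, OF car [OF \<sigma>(1)] Cau] by blast
  have sS: "s \<in> S"
  proof -
    have "\<exists>y\<in>S. hnorm H (s \<ominus> y) < e" if e: "e > 0" for e
    proof -
      obtain N where "hnorm H (\<sigma> N \<ominus> s) < e" using s(2) [OF e] by blast
      then show ?thesis
        using \<sigma>(1) [of N] hnorm_minus_commute [OF s(1) car [OF \<sigma>(1)], of N]
        by (intro bexI [of _ "\<sigma> N"]) simp_all
    qed
    then show ?thesis using cl s(1) unfolding closedin_iff by blast
  qed
  have "hnorm H (x \<ominus> s) \<le> sqrt d + e" if e: "e > 0" for e
  proof -
    obtain N where N: "\<forall>n\<ge>N. hnorm H (\<sigma> n \<ominus> s) < e / 2" using s(2) [of "e/2"] e by auto
    have d0: "d \<ge> 0" unfolding d_def using ne by (intro cInf_greatest) (auto simp: q_def)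
    have e2: "e\<^sup>2 / 4 > 0" using e by simp
    obtain M where M: "M > 0" "inverse (real M) < e\<^sup>2 / 4"
      using ex_inverse_of_nat_less [OF e2] by auto
    define n where "n = max N M"
    have "1 / real (Suc n) \<le> inverse (real M)" using M(1) by (simp add: n_def field_simps)
    then have "q (\<sigma> n) \<le> d + e\<^sup>2 / 4" using \<sigma>(2) [of n] M(2) by simp
    also have "\<dots> \<le> (sqrt d + e / 2)\<^sup>2"
      using d0 e by (simp add: power2_sum power_divide)
    finally have "hnorm H (x \<ominus> \<sigma> n) \<le> sqrt d + e / 2"
      unfolding q_def by (rule power2_le_imp_le) (use d0 e in simp)
    moreover have "hnorm H (\<sigma> n \<ominus> s) < e / 2" using N by (simp add: n_def)
    ultimately show ?thesis
      using hnorm_minus_triangle [OF x car [OF \<sigma>(1)] s(1), of n] by simp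
  qed
  then have "hnorm H (x \<ominus> s) \<le> sqrt d" by (rule field_le_epsilon)
  moreover have "d \<ge> 0" unfolding d_def using ne by (intro cInf_greatest) (auto simp: q_def)
  ultimately have qs: "q s \<le> d"
    unfolding q_def using x s(1) power_mono [of "hnorm H (x \<ominus> s)" "sqrt d" 2] by simp
  have "cinner H (x \<ominus> s) t = 0" if t: "t \<in> S" for t
  proof (rule ccontr)
    define a where "a = cinner H (x \<ominus> s) t"
    assume "cinner H (x \<ominus> s) t \<noteq> 0"
    then have a: "cmod a > 0" by (simp add: a_def)
    have tc: "t \<in> carrier H" using car t .
    \<comment> \<open>Compare \<open>s\<close> with \<open>s + \<epsilon> a t\<close>: the gain is of first order in \<open>\<epsilon>\<close>, the loss of second order.\<close>
    have ineq: "2 * (cmod a)\<^sup>2 \<le> \<epsilon> * ((cmod a)\<^sup>2 * (hnorm H t)\<^sup>2)" if \<epsilon>: "\<epsilon> > 0" for \<epsilon> :: real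
    proof -
      define c where "c = complex_of_real \<epsilon> * a"
      have "s \<oplus> c \<odot> t \<in> S" by (intro D(3,4) sS t)
      then have "q s \<le> q (s \<oplus> c \<odot> t)" using dle qs by force
      also have "\<dots> = (hnorm H ((x \<ominus> s) \<ominus> c \<odot> t))\<^sup>2"
        using x s(1) tc by (simp add: q_def minus_eq_smult smult_add_right a_assoc)
      also have "\<dots> = q s - 2 * Re (cnj c * a) + (cmod c)\<^sup>2 * (hnorm H t)\<^sup>2"
        using x s(1) tc unfolding q_def
        by (simp add: hnorm_minus_sq [of "x \<ominus> s" "c \<odot> t"] cinner_smult_right hnorm_smult a_def
            power_mult_distrib)
      also have "Re (cnj c * a) = \<epsilon> * (cmod a)\<^sup>2"
        unfolding c_def cmod_power2 by (simp add: power2_eq_square algebra_simps)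
      also have "(cmod c)\<^sup>2 = \<epsilon>\<^sup>2 * (cmod a)\<^sup>2"
        by (simp add: c_def norm_mult power_mult_distrib)
      finally have "\<epsilon> * (2 * (cmod a)\<^sup>2) \<le> \<epsilon> * (\<epsilon> * ((cmod a)\<^sup>2 * (hnorm H t)\<^sup>2))"
        by (simp add: power2_eq_square [of \<epsilon>] algebra_simps)
      then show ?thesis using \<epsilon> by (simp only: mult_le_cancel_left_pos)
    qed
    define K where "K = (hnorm H t)\<^sup>2"
    have "2 * (cmod a)\<^sup>2 \<le> (1 / (K + 1)) * ((cmod a)\<^sup>2 * K)"
      using ineq [of "1 / (K + 1)"] by (simp add: K_def add_nonneg_pos)
    also have "\<dots> \<le> (cmod a)\<^sup>2"
    proof -
      have "K \<ge> 0" by (simp add: K_def)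
      then have "K / (K + 1) \<le> 1" by (simp add: divide_le_eq)
      then have "(cmod a)\<^sup>2 * (K / (K + 1)) \<le> (cmod a)\<^sup>2 * 1" by (intro mult_left_mono) auto
      then show ?thesis by simp
    qed
    finally show False using a by simp
  qed
  then show thesis using that sS by blast
qed

text \<open>
  The structures below (quotients, tensor products with a point module, submodules of \<open>\<ell>\<^sup>2\<close>) are
  records with their own operations. Each embeds isometrically into a space that is already known to
  be a Hilbert space, and an injective \<open>J\<close> respecting the operations transports the axioms back.
\<close>

lemma inner_product_space_by_isometry:
  assumes K: "inner_product_space K" and inj: "inj_on J (carrier H)"
    and Jin: "\<And>x. x \<in> carrier H \<Longrightarrow> J x \<in> carrier K"
    and zero: "\<zero>\<^bsub>H\<^esub> \<in> carrier H" "J \<zero>\<^bsub>H\<^esub> = \<zero>\<^bsub>K\<^esub>"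
    and add: "\<And>x y. \<lbrakk>x \<in> carrier H; y \<in> carrier H\<rbrakk> \<Longrightarrow> x \<oplus>\<^bsub>H\<^esub> y \<in> carrier H"
      "\<And>x y. \<lbrakk>x \<in> carrier H; y \<in> carrier H\<rbrakk> \<Longrightarrow> J (x \<oplus>\<^bsub>H\<^esub> y) = J x \<oplus>\<^bsub>K\<^esub> J y"
    and smult: "\<And>c x. x \<in> carrier H \<Longrightarrow> c \<odot>\<^bsub>H\<^esub> x \<in> carrier H"
      "\<And>c x. x \<in> carrier H \<Longrightarrow> J (c \<odot>\<^bsub>H\<^esub> x) = c \<odot>\<^bsub>K\<^esub> J x"
    and cinner: "\<And>x y. \<lbrakk>x \<in> carrier H; y \<in> carrier H\<rbrakk> \<Longrightarrow> cinner H x y = cinner K (J x) (J y)"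
  shows "inner_product_space H"
proof -
  interpret K: inner_product_space K by fact
  have eqI: "x = y" if "J x = J y" "x \<in> carrier H" "y \<in> carrier H" for x y
    using inj_onD [OF inj that] .
  have ab: "abelian_group H"
  proof (rule abelian_groupI)
    fix x assume x: "x \<in> carrier H"
    have "(-1) \<odot>\<^bsub>H\<^esub> x \<oplus>\<^bsub>H\<^esub> x = \<zero>\<^bsub>H\<^esub>"
    proof (rule eqI)
      have "(-1) \<odot>\<^bsub>K\<^esub> J x \<oplus>\<^bsub>K\<^esub> J x = \<zero>\<^bsub>K\<^esub>"
        using Jin [OF x] K.smult_add_left [of "J x" "-1" 1] by simp
      then show "J ((-1) \<odot>\<^bsub>H\<^esub> x \<oplus>\<^bsub>H\<^esub> x) = J \<zero>\<^bsub>H\<^esub>"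
        using x by (simp add: add smult zero)
    qed (use x in \<open>simp_all add: add smult zero\<close>)
    then show "\<exists>y\<in>carrier H. y \<oplus>\<^bsub>H\<^esub> x = \<zero>\<^bsub>H\<^esub>" using smult(1) [OF x] by blast
  next
    fix x y z assume "x \<in> carrier H" "y \<in> carrier H" "z \<in> carrier H"
    then show "x \<oplus>\<^bsub>H\<^esub> y \<oplus>\<^bsub>H\<^esub> z = x \<oplus>\<^bsub>H\<^esub> (y \<oplus>\<^bsub>H\<^esub> z)"
      by (intro eqI) (simp_all add: add Jin K.a_assoc)
  next
    fix x y assume "x \<in> carrier H" "y \<in> carrier H"
    then show "x \<oplus>\<^bsub>H\<^esub> y = y \<oplus>\<^bsub>H\<^esub> x"
      by (intro eqI) (simp_all add: add Jin K.a_comm)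
  next
    fix x assume "x \<in> carrier H"
    then show "\<zero>\<^bsub>H\<^esub> \<oplus>\<^bsub>H\<^esub> x = x"
      by (intro eqI) (simp_all add: add Jin zero)
  qed (use zero add in auto)
  have "Module.module complex_ring H"
    by (rule moduleI [OF cring_complex_ring ab]; (rule eqI)?)
      (simp_all add: add smult Jin K.smult_add_left K.smult_add_right K.smult_smult)
  then show ?thesis
  proof (rule inner_product_space.intro)
    show "inner_product_space_axioms H"
    proof
      fix x y z assume "x \<in> carrier H" "y \<in> carrier H" "z \<in> carrier H"
      then show "cinner H (x \<oplus>\<^bsub>H\<^esub> y) z = cinner H x z + cinner H y z"
        by (simp add: cinner add Jin K.ip_add_left)
    next
      fix x y assume xy: "x \<in> carrier H" "y \<in> carrier H"
      then show "cinner H (c \<odot>\<^bsub>H\<^esub> x) y = c * cinner H x y" for c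
        by (simp add: cinner smult Jin K.ip_smult_left)
      show "cinner H y x = cnj (cinner H x y)"
        using K.ip_commute [OF Jin [OF xy(1)] Jin [OF xy(2)]] xy by (simp add: cinner)
    next
      fix x assume x: "x \<in> carrier H"
      then show "0 \<le> Re (cinner H x x)" by (simp add: cinner Jin K.ip_ge_zero)
      assume "cinner H x x = 0"
      then have "J x = \<zero>\<^bsub>K\<^esub>" using x cinner [OF x x]
        by (intro K.ip_eq_zero Jin) simp_all
      then show "x = \<zero>\<^bsub>H\<^esub>" using x zero by (intro eqI) simp_all
    qed
  qed
qed

lemma hilbert_space_by_isometry:
  assumes K: "hilbert_space K" and inj: "inj_on J (carrier H)"
    and Jin: "\<And>x. x \<in> carrier H \<Longrightarrow> J x \<in> carrier K"
    and zero: "\<zero>\<^bsub>H\<^esub> \<in> carrier H" "J \<zero>\<^bsub>H\<^esub> = \<zero>\<^bsub>K\<^esub>"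
    and add: "\<And>x y. \<lbrakk>x \<in> carrier H; y \<in> carrier H\<rbrakk> \<Longrightarrow> x \<oplus>\<^bsub>H\<^esub> y \<in> carrier H"
      "\<And>x y. \<lbrakk>x \<in> carrier H; y \<in> carrier H\<rbrakk> \<Longrightarrow> J (x \<oplus>\<^bsub>H\<^esub> y) = J x \<oplus>\<^bsub>K\<^esub> J y"
    and smult: "\<And>c x. x \<in> carrier H \<Longrightarrow> c \<odot>\<^bsub>H\<^esub> x \<in> carrier H"
      "\<And>c x. x \<in> carrier H \<Longrightarrow> J (c \<odot>\<^bsub>H\<^esub> x) = c \<odot>\<^bsub>K\<^esub> J x"
    and cinner: "\<And>x y. \<lbrakk>x \<in> carrier H; y \<in> carrier H\<rbrakk> \<Longrightarrow> cinner H x y = cinner K (J x) (J y)"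
    and closed: "closedin (htop K) (J ` carrier H)"
  shows "hilbert_space H"
proof (rule hilbert_spaceI)
  interpret K: hilbert_space K by fact
  show ips: "inner_product_space H"
    by (rule inner_product_space_by_isometry [OF K.inner_product_space_axioms inj Jin zero add smult cinner])
  interpret H: inner_product_space H by fact
  have J_minus: "J (x \<ominus>\<^bsub>H\<^esub> y) = J x \<ominus>\<^bsub>K\<^esub> J y" if "x \<in> carrier H" "y \<in> carrier H" for x y
    using that by (simp add: H.minus_eq_smult K.minus_eq_smult add smult Jin)
  have norm: "hnorm H (x \<ominus>\<^bsub>H\<^esub> y) = hnorm K (J x \<ominus>\<^bsub>K\<^esub> J y)" if "x \<in> carrier H" "y \<in> carrier H" for x y
    using that by (simp add: hnorm_def cinner J_minus)
  show "Metric_space.mcomplete (carrier H) (hdist H)"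
    unfolding H.mcomplete_iff
  proof (intro allI impI)
    fix \<sigma> :: "nat \<Rightarrow> _"
    assume r: "range \<sigma> \<subseteq> carrier H"
      and c: "\<forall>e>0. \<exists>N. \<forall>m\<ge>N. \<forall>n\<ge>N. hnorm H (\<sigma> m \<ominus>\<^bsub>H\<^esub> \<sigma> n) < e"
    have \<sigma>: "\<sigma> n \<in> carrier H" for n using r by blast
    obtain y where y: "y \<in> carrier K" "\<And>e. e > 0 \<Longrightarrow> \<exists>N. \<forall>n\<ge>N. hnorm K (J (\<sigma> n) \<ominus>\<^bsub>K\<^esub> y) < e"
      using K.Cauchy_converges [of "\<lambda>n. J (\<sigma> n)", OF Jin [OF \<sigma>]]
        c [unfolded norm [OF \<sigma> \<sigma>], rule_format] by blast
    have "\<exists>z\<in>J ` carrier H. hnorm K (y \<ominus>\<^bsub>K\<^esub> z) < e" if e: "e > 0" for e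
    proof -
      obtain N where "hnorm K (J (\<sigma> N) \<ominus>\<^bsub>K\<^esub> y) < e" using y(2) [OF e] by blast
      then show ?thesis
        using \<sigma> [of N] K.hnorm_minus_commute [OF y(1) Jin [OF \<sigma>], of N]
        by (intro bexI [of _ "J (\<sigma> N)"]) simp_all
    qed
    then obtain x where x: "x \<in> carrier H" "y = J x"
      using closed y(1) unfolding K.closedin_iff by blast
    have "\<exists>N. \<forall>n\<ge>N. hnorm H (\<sigma> n \<ominus>\<^bsub>H\<^esub> x) < e" if "e > 0" for e
      using y(2) [OF that] norm [OF \<sigma> x(1)] x(2) by simp
    then show "\<exists>x\<in>carrier H. \<forall>e>0. \<exists>N. \<forall>n\<ge>N. hnorm H (\<sigma> n \<ominus>\<^bsub>H\<^esub> x) < e"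
      using x(1) by blast
  qed
qed

section \<open>Bounded linear maps and quotients\<close>

lemma linear_map_onD:
  assumes "linear_map_on C H K T"
  shows "\<And>x. x \<in> C \<Longrightarrow> T x \<in> carrier K"
    "\<And>x y. \<lbrakk>x \<in> C; y \<in> C\<rbrakk> \<Longrightarrow> T (x \<oplus>\<^bsub>H\<^esub> y) = T x \<oplus>\<^bsub>K\<^esub> T y"
    "\<And>c x. x \<in> C \<Longrightarrow> T (c \<odot>\<^bsub>H\<^esub> x) = c \<odot>\<^bsub>K\<^esub> T x"
  using assms unfolding linear_map_on_def by auto

lemma linear_map_onI:
  assumes "\<And>x. x \<in> C \<Longrightarrow> T x \<in> carrier K"
    "\<And>x y. \<lbrakk>x \<in> C; y \<in> C\<rbrakk> \<Longrightarrow> T (x \<oplus>\<^bsub>H\<^esub> y) = T x \<oplus>\<^bsub>K\<^esub> T y"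
    "\<And>c x. x \<in> C \<Longrightarrow> T (c \<odot>\<^bsub>H\<^esub> x) = c \<odot>\<^bsub>K\<^esub> T x"
  shows "linear_map_on C H K T"
  using assms unfolding linear_map_on_def by auto

locale linear_map =
  H: inner_product_space H + K: inner_product_space K
  for H :: "('a, 'x) hspace_scheme" and K :: "('b, 'y) hspace_scheme" +
  fixes C :: "'a set" and T :: "'a \<Rightarrow> 'b"
  assumes sub: "submodule C complex_ring H" and lin: "linear_map_on C H K T"
begin

lemmas T_in [simp] = linear_map_onD(1) [OF lin]
lemmas T_add = linear_map_onD(2) [OF lin]
lemmas T_smult = linear_map_onD(3) [OF lin]

lemma C_in: "x \<in> C \<Longrightarrow> x \<in> carrier H"
  using H.submoduleD(1) [OF sub] by blast

lemma T_minus: "\<lbrakk>x \<in> C; y \<in> C\<rbrakk> \<Longrightarrow> T (x \<ominus>\<^bsub>H\<^esub> y) = T x \<ominus>\<^bsub>K\<^esub> T y"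
  using H.submoduleD(4) [OF sub, of y "-1"] C_in [of x] C_in [of y]
  by (simp add: H.minus_eq_smult K.minus_eq_smult T_add T_smult)

lemma T_zero: "T \<zero>\<^bsub>H\<^esub> = \<zero>\<^bsub>K\<^esub>"
  using T_smult [OF H.submoduleD(2) [OF sub], of 0] H.submoduleD(2) [OF sub] by simp

lemma T_finsum:
  assumes "finite I" "\<And>i. i \<in> I \<Longrightarrow> v i \<in> C"
  shows "T (\<Oplus>\<^bsub>H\<^esub>i\<in>I. v i) = (\<Oplus>\<^bsub>K\<^esub>i\<in>I. T (v i))"
  using assms
proof (induction I)
  case empty
  then show ?case by (simp add: T_zero)
next
  case (insert i I)
  have v: "v \<in> I \<rightarrow> carrier H" "v i \<in> carrier H" "v i \<in> C"
    using insert.prems C_in by auto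
  have Tv: "(\<lambda>i. T (v i)) \<in> I \<rightarrow> carrier K" "T (v i) \<in> carrier K"
    using insert.prems by auto
  have "(\<Oplus>\<^bsub>H\<^esub>i\<in>I. v i) \<in> C"
    by (rule H.finsum_in_submodule [OF sub insert.hyps(1)]) (use insert.prems in simp)
  then show ?case
    using insert v Tv by (simp add: T_add)
qed

lemma Lipschitz:
  assumes "\<And>x. x \<in> C \<Longrightarrow> hnorm K (T x) \<le> B * hnorm H x" "x \<in> C" "y \<in> C"
  shows "hnorm K (T x \<ominus>\<^bsub>K\<^esub> T y) \<le> B * hnorm H (x \<ominus>\<^bsub>H\<^esub> y)"
  using assms(1) [OF H.submoduleD(5) [OF sub assms(2,3)]] assms(2,3) by (simp add: T_minus)

lemma Lipschitz_hnorm: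
  assumes "\<And>x. x \<in> C \<Longrightarrow> hnorm K (T x) \<le> B * hnorm H x" "x \<in> C" "y \<in> C"
  shows "\<bar>hnorm K (T x) - hnorm K (T y)\<bar> \<le> B * hnorm H (x \<ominus>\<^bsub>H\<^esub> y)"
  using K.hnorm_diff_le [OF T_in [OF assms(2)] T_in [OF assms(3)]] Lipschitz [OF assms] by linarith

lemma vanishes_on_hclosure:
  assumes "\<And>x. x \<in> C \<Longrightarrow> hnorm K (T x) \<le> B * hnorm H x"
    and "S \<subseteq> C" "\<And>x. x \<in> S \<Longrightarrow> T x = \<zero>\<^bsub>K\<^esub>" "x \<in> C" "x \<in> hclosure H S"
  shows "T x = \<zero>\<^bsub>K\<^esub>"
proof -
  have "hnorm K (T x) \<le> 0"
    by (rule H.Lipschitz_nonpos_hclosure [OF assms(2) _ Lipschitz_hnorm [OF assms(1)] _ assms(4,5)])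
      (use C_in assms(3) in auto)
  then show ?thesis
    using assms(4) K.hnorm_nonneg [OF T_in [OF assms(4)]] by (intro K.hnorm_eq_zero) simp_all
qed

end

lemma (in linear_map) submodule_kernel: "submodule {x \<in> C. T x = \<zero>\<^bsub>K\<^esub>} complex_ring H"
  unfolding H.submodule_iff
  using H.submoduleD(2-4) [OF sub] C_in by (auto simp: T_zero T_add T_smult)

lemma (in linear_map) closedin_kernel:
  assumes "\<And>x. x \<in> C \<Longrightarrow> hnorm K (T x) \<le> B * hnorm H x" and C: "closedin (htop H) C"
  shows "closedin (htop H) {x \<in> C. T x = \<zero>\<^bsub>K\<^esub>}"
proof -
  let ?N = "{x \<in> C. T x = \<zero>\<^bsub>K\<^esub>}"
  have N: "?N \<subseteq> carrier H" using C_in by blast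
  have "hclosure H ?N \<subseteq> ?N"
  proof
    fix x assume x: "x \<in> hclosure H ?N"
    have "x \<in> C" using H.hclosure_minimal [OF _ C, of ?N] x by blast
    moreover have "T x = \<zero>\<^bsub>K\<^esub>"
      by (rule vanishes_on_hclosure [OF assms(1) _ _ \<open>x \<in> C\<close> x]) auto
    ultimately show "x \<in> ?N" by blast
  qed
  then have "?N = hclosure H ?N" using H.subset_hclosure [OF N] by blast
  then show ?thesis using H.closedin_hclosure by metis
qed

lemma linear_maps_eq_on_hclosure:
  assumes T1: "linear_map H K C T1" and T2: "linear_map H K C T2"
    and B1: "\<And>x. x \<in> C \<Longrightarrow> hnorm K (T1 x) \<le> B1 * hnorm H x"
    and B2: "\<And>x. x \<in> C \<Longrightarrow> hnorm K (T2 x) \<le> B2 * hnorm H x"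
    and S: "S \<subseteq> C" "\<And>x. x \<in> S \<Longrightarrow> T1 x = T2 x" and x: "x \<in> C" "x \<in> hclosure H S"
  shows "T1 x = T2 x"
proof -
  interpret T1: linear_map H K C T1 by fact
  interpret T2: linear_map H K C T2 by fact
  have "hnorm K (T1 x \<ominus>\<^bsub>K\<^esub> T2 x) \<le> 0"
  proof (rule T1.H.Lipschitz_nonpos_hclosure [OF S(1) _ _ _ x, where L = "B1 + B2"])
    show "C \<subseteq> carrier H" using T1.C_in by blast
    show "hnorm K (T1 y \<ominus>\<^bsub>K\<^esub> T2 y) \<le> 0" if "y \<in> S" for y
    proof -
      have "y \<in> C" using S(1) that by blast
      then show ?thesis using S(2) [OF that] by simp
    qed
    fix y y' assume y: "y \<in> C" and y': "y' \<in> C"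
    note a = T1.T_in [OF y] T2.T_in [OF y] T1.T_in [OF y'] T2.T_in [OF y']
    have "\<bar>hnorm K (T1 y \<ominus>\<^bsub>K\<^esub> T2 y) - hnorm K (T1 y' \<ominus>\<^bsub>K\<^esub> T2 y')\<bar>
        \<le> hnorm K (T1 y \<ominus>\<^bsub>K\<^esub> T1 y') + hnorm K (T2 y \<ominus>\<^bsub>K\<^esub> T2 y')"
      using T1.K.hnorm_minus_triangle [OF a(1) a(3) a(2)] T1.K.hnorm_minus_triangle [OF a(3) a(4) a(2)]
        T1.K.hnorm_minus_triangle [OF a(3) a(1) a(4)] T1.K.hnorm_minus_triangle [OF a(1) a(2) a(4)]
        T1.K.hnorm_minus_commute [OF a(1) a(3)] T1.K.hnorm_minus_commute [OF a(2) a(4)]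
      by linarith
    also have "\<dots> \<le> B1 * hnorm H (y \<ominus>\<^bsub>H\<^esub> y') + B2 * hnorm H (y \<ominus>\<^bsub>H\<^esub> y')"
      by (intro add_mono T1.Lipschitz [OF B1 y y'] T2.Lipschitz [OF B2 y y'])
    finally show "\<bar>hnorm K (T1 y \<ominus>\<^bsub>K\<^esub> T2 y) - hnorm K (T1 y' \<ominus>\<^bsub>K\<^esub> T2 y')\<bar>
        \<le> (B1 + B2) * hnorm H (y \<ominus>\<^bsub>H\<^esub> y')" by (simp only: distrib_right)
  qed
  note a = T1.T_in [OF x(1)] T2.T_in [OF x(1)]
  moreover have "0 \<le> hnorm K (T1 x \<ominus>\<^bsub>K\<^esub> T2 x)"
    by (rule T1.K.hnorm_nonneg [OF T1.K.minus_closed [OF a]])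
  ultimately have "hnorm K (T1 x \<ominus>\<^bsub>K\<^esub> T2 x) = 0" using \<open>hnorm K (T1 x \<ominus>\<^bsub>K\<^esub> T2 x) \<le> 0\<close> by linarith
  then have "T1 x \<ominus>\<^bsub>K\<^esub> T2 x = \<zero>\<^bsub>K\<^esub>" by (rule T1.K.hnorm_eq_zero [OF T1.K.minus_closed [OF a]])
  then show ?thesis by (rule T1.K.minus_eq_zero [OF a])
qed

text \<open>
  A bounded map is extended from a subspace to its closure. It is given by its graph \<open>G\<close>, because the
  maps to be extended are defined on combinations of generators by means of the coefficients, which
  a combination need not determine in an evident way. The bound makes \<open>G\<close> single-valued.
\<close>

theorem extend_by_continuity:
  assumes "inner_product_space H" "hilbert_space K"
    and G: "G \<subseteq> carrier H \<times> carrier K" "G \<noteq> {}"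
    and add: "\<And>x y x' y'. \<lbrakk>(x, y) \<in> G; (x', y') \<in> G\<rbrakk> \<Longrightarrow> (x \<oplus>\<^bsub>H\<^esub> x', y \<oplus>\<^bsub>K\<^esub> y') \<in> G"
    and smult: "\<And>c x y. (x, y) \<in> G \<Longrightarrow> (c \<odot>\<^bsub>H\<^esub> x, c \<odot>\<^bsub>K\<^esub> y) \<in> G"
    and bound: "\<And>x y. (x, y) \<in> G \<Longrightarrow> hnorm K y \<le> B * hnorm H x" and B: "0 \<le> B"
  obtains T where "linear_map_on (hclosure H (fst ` G)) H K T"
    "\<And>x. x \<in> hclosure H (fst ` G) \<Longrightarrow> hnorm K (T x) \<le> B * hnorm H x"
    "\<And>x y. (x, y) \<in> G \<Longrightarrow> T x = y"
proof -
  interpret H: inner_product_space H by fact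
  interpret K: hilbert_space K by fact
  let ?D = "hclosure H (fst ` G)"
  have fst_in: "fst ` G \<subseteq> carrier H" using G by auto
  have D_in: "x \<in> carrier H" if "x \<in> ?D" for x using that H.hclosure_in_carrier by blast
  have G_in: "x \<in> carrier H" "y \<in> carrier K" if "(x, y) \<in> G" for x y using that G(1) by auto
  \<comment> \<open>The closure of the graph; the bound makes it the graph of the extension.\<close>
  define near where "near x s \<longleftrightarrow> x \<in> carrier H \<and> s \<in> carrier K \<and>
    (\<forall>e>0. \<exists>t u. (t, u) \<in> G \<and> hnorm H (x \<ominus>\<^bsub>H\<^esub> t) < e \<and> hnorm K (s \<ominus>\<^bsub>K\<^esub> u) < e)" for x s
  have nearI: "near x s" if "x \<in> carrier H" "s \<in> carrier K"
    "\<And>e. e > 0 \<Longrightarrow> \<exists>t u. (t, u) \<in> G \<and> hnorm H (x \<ominus>\<^bsub>H\<^esub> t) < e \<and> hnorm K (s \<ominus>\<^bsub>K\<^esub> u) < e" for x s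
    using that unfolding near_def by blast
  have near_in: "x \<in> carrier H" "s \<in> carrier K" if "near x s" for x s
    using that unfolding near_def by auto
  have nearE: "\<exists>t u. (t, u) \<in> G \<and> hnorm H (x \<ominus>\<^bsub>H\<^esub> t) < e \<and> hnorm K (s \<ominus>\<^bsub>K\<^esub> u) < e"
    if "near x s" "e > 0" for x s e
    using that unfolding near_def by blast
  have near_G: "near x y" if "(x, y) \<in> G" for x y
    using that G_in [OF that] by (intro nearI exI [of _ x] exI [of _ y]) auto
  have near_add: "near (x \<oplus>\<^bsub>H\<^esub> x') (s \<oplus>\<^bsub>K\<^esub> s')" if n: "near x s" and n': "near x' s'" for x s x' s'
  proof (rule nearI)
    show "x \<oplus>\<^bsub>H\<^esub> x' \<in> carrier H" "s \<oplus>\<^bsub>K\<^esub> s' \<in> carrier K"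
      using near_in [OF n] near_in [OF n'] by simp_all
    fix e :: real assume "e > 0"
    then have e: "e / 2 > 0" by simp
    obtain t u where t: "(t, u) \<in> G" "hnorm H (x \<ominus>\<^bsub>H\<^esub> t) < e / 2" "hnorm K (s \<ominus>\<^bsub>K\<^esub> u) < e / 2"
      using nearE [OF n e] by blast
    obtain t' u' where t': "(t', u') \<in> G" "hnorm H (x' \<ominus>\<^bsub>H\<^esub> t') < e / 2" "hnorm K (s' \<ominus>\<^bsub>K\<^esub> u') < e / 2"
      using nearE [OF n' e] by blast
    note c = near_in [OF n] near_in [OF n'] G_in [OF t(1)] G_in [OF t'(1)]
    have "hnorm H ((x \<oplus>\<^bsub>H\<^esub> x') \<ominus>\<^bsub>H\<^esub> (t \<oplus>\<^bsub>H\<^esub> t')) < e"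
      using H.hnorm_triangle [of "x \<ominus>\<^bsub>H\<^esub> t" "x' \<ominus>\<^bsub>H\<^esub> t'"] c t t' by (simp add: H.add_minus_add)
    moreover have "hnorm K ((s \<oplus>\<^bsub>K\<^esub> s') \<ominus>\<^bsub>K\<^esub> (u \<oplus>\<^bsub>K\<^esub> u')) < e"
      using K.hnorm_triangle [of "s \<ominus>\<^bsub>K\<^esub> u" "s' \<ominus>\<^bsub>K\<^esub> u'"] c t t' by (simp add: K.add_minus_add)
    ultimately show "\<exists>t u. (t, u) \<in> G \<and> hnorm H ((x \<oplus>\<^bsub>H\<^esub> x') \<ominus>\<^bsub>H\<^esub> t) < e \<and>
        hnorm K ((s \<oplus>\<^bsub>K\<^esub> s') \<ominus>\<^bsub>K\<^esub> u) < e"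
      using add [OF t(1) t'(1)] by blast
  qed
  have near_smult: "near (c \<odot>\<^bsub>H\<^esub> x) (c \<odot>\<^bsub>K\<^esub> s)" if n: "near x s" for c x s
  proof (rule nearI)
    show "c \<odot>\<^bsub>H\<^esub> x \<in> carrier H" "c \<odot>\<^bsub>K\<^esub> s \<in> carrier K"
      using near_in [OF n] by simp_all
    fix e :: real assume "e > 0"
    then have e: "e / (cmod c + 1) > 0" by (simp add: add_nonneg_pos)
    obtain t u where t: "(t, u) \<in> G" "hnorm H (x \<ominus>\<^bsub>H\<^esub> t) < e / (cmod c + 1)"
      "hnorm K (s \<ominus>\<^bsub>K\<^esub> u) < e / (cmod c + 1)"
      using nearE [OF n e] by blast
    note c = near_in [OF n] G_in [OF t(1)]
    have lt: "cmod c * r < e" if "0 \<le> r" "r < e / (cmod c + 1)" for r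
    proof -
      have "cmod c * r \<le> (cmod c + 1) * r" using that(1) by (intro mult_right_mono) auto
      also have "\<dots> < e"
        using that(2) pos_less_divide_eq [of "cmod c + 1" r e] by (simp add: add_nonneg_pos mult.commute)
      finally show ?thesis .
    qed
    have "hnorm H (c \<odot>\<^bsub>H\<^esub> x \<ominus>\<^bsub>H\<^esub> c \<odot>\<^bsub>H\<^esub> t) < e"
      using lt [OF _ t(2)] c by (simp add: H.smult_minus_right [symmetric] H.hnorm_smult)
    moreover have "hnorm K (c \<odot>\<^bsub>K\<^esub> s \<ominus>\<^bsub>K\<^esub> c \<odot>\<^bsub>K\<^esub> u) < e"
      using lt [OF _ t(3)] c by (simp add: K.smult_minus_right [symmetric] K.hnorm_smult)
    ultimately show "\<exists>t u. (t, u) \<in> G \<and> hnorm H (c \<odot>\<^bsub>H\<^esub> x \<ominus>\<^bsub>H\<^esub> t) < e \<and>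
        hnorm K (c \<odot>\<^bsub>K\<^esub> s \<ominus>\<^bsub>K\<^esub> u) < e"
      using smult [OF t(1)] by blast
  qed
  have near_bound: "hnorm K s \<le> B * hnorm H x" if n: "near x s" for x s
  proof (rule field_le_epsilon)
    fix e :: real assume "e > 0"
    then have e: "e / (B + 1) > 0" using B by simp
    obtain t u where t: "(t, u) \<in> G" "hnorm H (x \<ominus>\<^bsub>H\<^esub> t) < e / (B + 1)" "hnorm K (s \<ominus>\<^bsub>K\<^esub> u) < e / (B + 1)"
      using nearE [OF n e] by blast
    note c = near_in [OF n] G_in [OF t(1)]
    have "hnorm K s \<le> hnorm K u + e / (B + 1)"
      using K.hnorm_diff_le [OF c(2) c(4)] t(3) by linarith
    also have "\<dots> \<le> B * hnorm H t + e / (B + 1)" using bound [OF t(1)] by simp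
    also have "B * hnorm H t \<le> B * (hnorm H x + e / (B + 1))"
      using H.hnorm_diff_le [OF c(1) c(3)] t(2) B by (intro mult_left_mono) auto
    then have "B * hnorm H t + e / (B + 1) \<le> B * (hnorm H x + e / (B + 1)) + e / (B + 1)" by simp
    also have "\<dots> = B * hnorm H x + (B + 1) * (e / (B + 1))"
      by (simp only: distrib_left distrib_right mult_1_left add.assoc)
    also have "\<dots> = B * hnorm H x + e" using B by simp
    finally show "hnorm K s \<le> B * hnorm H x + e" .
  qed
  have near_unique: "s = s'" if n: "near x s" and n': "near x s'" for x s s'
  proof -
    have c: "x \<in> carrier H" "s \<in> carrier K" "s' \<in> carrier K" using near_in [OF n] near_in [OF n'] by auto
    have "near (x \<oplus>\<^bsub>H\<^esub> (-1) \<odot>\<^bsub>H\<^esub> x) (s \<oplus>\<^bsub>K\<^esub> (-1) \<odot>\<^bsub>K\<^esub> s')"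
      by (intro near_add near_smult n n')
    then have "near \<zero>\<^bsub>H\<^esub> (s \<ominus>\<^bsub>K\<^esub> s')"
      using c by (simp add: H.minus_eq_smult [symmetric] K.minus_eq_smult [symmetric])
    from near_bound [OF this] have "hnorm K (s \<ominus>\<^bsub>K\<^esub> s') \<le> 0" by simp
    then have "hnorm K (s \<ominus>\<^bsub>K\<^esub> s') = 0"
      using K.hnorm_nonneg [OF K.minus_closed [OF c(2,3)]] by linarith
    then have "s \<ominus>\<^bsub>K\<^esub> s' = \<zero>\<^bsub>K\<^esub>" by (rule K.hnorm_eq_zero [OF K.minus_closed [OF c(2,3)]])
    then show ?thesis by (rule K.minus_eq_zero [OF c(2,3)])
  qed
  have near_exists: "\<exists>s. near x s" if x: "x \<in> ?D" for x
  proof -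
    note xc = D_in [OF x]
    have "\<exists>t u. (t, u) \<in> G \<and> hnorm H (x \<ominus>\<^bsub>H\<^esub> t) < 1 / real (Suc n)" for n
    proof -
      obtain t where "t \<in> fst ` G" "hnorm H (x \<ominus>\<^bsub>H\<^esub> t) < 1 / real (Suc n)"
        by (rule H.hclosure_approx [OF x fst_in, of "1 / real (Suc n)"]) simp_all
      then show ?thesis by force
    qed
    then obtain t u where t: "\<And>n. (t n, u n) \<in> G" "\<And>n. hnorm H (x \<ominus>\<^bsub>H\<^esub> t n) < 1 / real (Suc n)"
      by metis
    note c = G_in [OF t(1)]
    have u_dist: "hnorm K (u m \<ominus>\<^bsub>K\<^esub> u n) \<le> B * (1 / real (Suc m) + 1 / real (Suc n))" for m n
    proof -
      have "(t m \<oplus>\<^bsub>H\<^esub> (-1) \<odot>\<^bsub>H\<^esub> t n, u m \<oplus>\<^bsub>K\<^esub> (-1) \<odot>\<^bsub>K\<^esub> u n) \<in> G"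
        by (intro add smult t(1))
      then have "hnorm K (u m \<ominus>\<^bsub>K\<^esub> u n) \<le> B * hnorm H (t m \<ominus>\<^bsub>H\<^esub> t n)"
        using bound c by (simp add: H.minus_eq_smult K.minus_eq_smult)
      also have "hnorm H (t m \<ominus>\<^bsub>H\<^esub> t n) \<le> 1 / real (Suc m) + 1 / real (Suc n)"
        using H.hnorm_minus_triangle [OF c(1) xc c(1), of m n]
          H.hnorm_minus_commute [OF xc c(1), of m] t(2) [of m] t(2) [of n] by simp
      then have "B * hnorm H (t m \<ominus>\<^bsub>H\<^esub> t n) \<le> B * (1 / real (Suc m) + 1 / real (Suc n))"
        using B by (intro mult_left_mono) auto
      finally show ?thesis .
    qed
    have small: "\<exists>N. \<forall>n\<ge>N. 1 / real (Suc n) < e" if e: "e > 0" for e :: real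
    proof -
      obtain N where N: "inverse (real (Suc N)) < e" using reals_Archimedean [OF e] by blast
      have "1 / real (Suc n) < e" if "n \<ge> N" for n
      proof -
        have "1 / real (Suc n) \<le> inverse (real (Suc N))" using that by (simp add: field_simps)
        then show ?thesis using N by simp
      qed
      then show ?thesis by blast
    qed
    have "\<exists>N. \<forall>m\<ge>N. \<forall>n\<ge>N. hnorm K (u m \<ominus>\<^bsub>K\<^esub> u n) < e" if "e > 0" for e
    proof -
      have "e / (2 * (B + 1)) > 0" using that B by simp
      then obtain N where N: "\<forall>n\<ge>N. 1 / real (Suc n) < e / (2 * (B + 1))" using small by blast
      have "hnorm K (u m \<ominus>\<^bsub>K\<^esub> u n) < e" if "m \<ge> N" "n \<ge> N" for m n
      proof -
        have "hnorm K (u m \<ominus>\<^bsub>K\<^esub> u n) \<le> B * (1 / real (Suc m) + 1 / real (Suc n))" by (rule u_dist)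
        also have "\<dots> \<le> (B + 1) * (1 / real (Suc m) + 1 / real (Suc n))"
          by (intro mult_right_mono) auto
        also have "\<dots> < (B + 1) * (e / (2 * (B + 1)) + e / (2 * (B + 1)))"
          using N that B by (intro mult_strict_left_mono add_strict_mono) auto
        also have "\<dots> = (2 * (B + 1)) * (e / (2 * (B + 1)))"
          by (simp only: mult_2 distrib_left distrib_right)
        also have "\<dots> = e" using B by simp
        finally show ?thesis .
      qed
      then show ?thesis by blast
    qed
    then obtain s where s: "s \<in> carrier K" "\<And>e. e > 0 \<Longrightarrow> \<exists>N. \<forall>n\<ge>N. hnorm K (u n \<ominus>\<^bsub>K\<^esub> s) < e"
      using K.Cauchy_converges [of u, OF c(2)] by blast
    have "near x s"
    proof (rule nearI [OF xc s(1)])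
      fix e :: real assume e: "e > 0"
      obtain N where N: "\<forall>n\<ge>N. hnorm K (u n \<ominus>\<^bsub>K\<^esub> s) < e" using s(2) [OF e] by blast
      obtain N' where N': "\<forall>n\<ge>N'. 1 / real (Suc n) < e" using small [OF e] by blast
      define n where "n = max N N'"
      have "hnorm K (s \<ominus>\<^bsub>K\<^esub> u n) < e"
        using N K.hnorm_minus_commute [OF s(1) c(2), of n] by (simp add: n_def)
      moreover have "hnorm H (x \<ominus>\<^bsub>H\<^esub> t n) < e"
      proof -
        have "N' \<le> n" by (simp add: n_def)
        then have "1 / real (Suc n) < e" using N' by blast
        then show ?thesis using t(2) [of n] by linarith
      qed
      ultimately show "\<exists>t u. (t, u) \<in> G \<and> hnorm H (x \<ominus>\<^bsub>H\<^esub> t) < e \<and> hnorm K (s \<ominus>\<^bsub>K\<^esub> u) < e"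
        using t(1) by blast
    qed
    then show ?thesis by blast
  qed
  have D_sub: "submodule ?D complex_ring H"
  proof (rule H.submodule_hclosure)
    obtain x y where "(x, y) \<in> G" using G(2) by auto
    from smult [OF this, of 0] have "(\<zero>\<^bsub>H\<^esub>, \<zero>\<^bsub>K\<^esub>) \<in> G" using G_in [OF \<open>(x, y) \<in> G\<close>] by simp
    then have "\<zero>\<^bsub>H\<^esub> \<in> fst ` G" by force
    moreover have "x \<oplus>\<^bsub>H\<^esub> x' \<in> fst ` G" if "x \<in> fst ` G" "x' \<in> fst ` G" for x x'
      using that add by force
    moreover have "c \<odot>\<^bsub>H\<^esub> x \<in> fst ` G" if "x \<in> fst ` G" for c x
      using that smult by force
    ultimately show "submodule (fst ` G) complex_ring H"
      unfolding H.submodule_iff using fst_in by blast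
  qed
  define T where "T x = (SOME s. near x s)" for x
  have T_near: "near x (T x)" if "x \<in> ?D" for x
    unfolding T_def using someI_ex [OF near_exists [OF that]] .
  have T_eq: "T x = s" if "x \<in> ?D" "near x s" for x s
    by (rule near_unique [OF T_near [OF that(1)] that(2)])
  show thesis
  proof (rule that)
    show "linear_map_on ?D H K T"
    proof (rule linear_map_onI)
      show "T x \<in> carrier K" if "x \<in> ?D" for x using near_in(2) [OF T_near [OF that]] .
      show "T (x \<oplus>\<^bsub>H\<^esub> y) = T x \<oplus>\<^bsub>K\<^esub> T y" if "x \<in> ?D" "y \<in> ?D" for x y
        by (rule T_eq [OF H.submoduleD(3) [OF D_sub that] near_add [OF T_near T_near, OF that]])
      show "T (c \<odot>\<^bsub>H\<^esub> x) = c \<odot>\<^bsub>K\<^esub> T x" if "x \<in> ?D" for c x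
        by (rule T_eq [OF H.submoduleD(4) [OF D_sub that] near_smult [OF T_near, OF that]])
    qed
    show "hnorm K (T x) \<le> B * hnorm H x" if "x \<in> ?D" for x
      by (rule near_bound [OF T_near [OF that]])
    show "T x = y" if "(x, y) \<in> G" for x y
    proof (rule T_eq [OF _ near_G [OF that]])
      have "x \<in> fst ` G" using that by force
      then show "x \<in> ?D" using H.subset_hclosure [OF fst_in] by blast
    qed
  qed
qed

text \<open>
  A coset is identified with its unique element orthogonal to \<open>S\<close>, which exists by
  orthogonal projection. This makes the quotient an isometric copy of the orthogonal complement.
\<close>

locale hilbert_quotient = hilbert_space M
  for M :: "('s, 'a, 'x) hmodule_scheme" (structure) +
  fixes S :: "'a set"
  assumes S_sub: "submodule S complex_ring M" and S_closed: "closedin (htop M) S"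
begin

lemmas S_D = submoduleD [OF S_sub]

abbreviation "Q \<equiv> hquotient M S"

lemma S_in: "s \<in> S \<Longrightarrow> s \<in> carrier M"
  using S_D(1) by blast

lemma mem_coset_iff:
  assumes x: "x \<in> carrier M"
  shows "y \<in> S +> x \<longleftrightarrow> y \<in> carrier M \<and> y \<ominus> x \<in> S"
proof
  assume "y \<in> S +> x"
  then obtain s where s: "s \<in> S" "y = s \<oplus> x" by (auto simp: a_r_coset_def')
  have sc: "s \<in> carrier M" using S_in s(1) .
  have "y \<ominus> x = s"
    using x sc by (simp add: s(2) a_minus_def a_assoc r_neg)
  then show "y \<in> carrier M \<and> y \<ominus> x \<in> S" using s x sc by simp
next
  assume y: "y \<in> carrier M \<and> y \<ominus> x \<in> S"
  have "y = (y \<ominus> x) \<oplus> x"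
    using x y by (simp add: a_minus_def a_assoc l_neg)
  then show "y \<in> S +> x" using y unfolding a_r_coset_def' by blast
qed

lemma coset_eq_iff:
  assumes x: "x \<in> carrier M" and y: "y \<in> carrier M"
  shows "S +> x = S +> y \<longleftrightarrow> x \<ominus> y \<in> S"
proof
  assume "S +> x = S +> y"
  moreover have "x \<in> S +> x" using x S_D(2) by (simp add: mem_coset_iff)
  ultimately show "x \<ominus> y \<in> S" using y by (simp add: mem_coset_iff)
next
  assume xy: "x \<ominus> y \<in> S"
  have "z \<ominus> y \<in> S \<longleftrightarrow> z \<ominus> x \<in> S" if z: "z \<in> carrier M" for z
  proof
    assume "z \<ominus> x \<in> S"
    from S_D(3) [OF this xy] show "z \<ominus> y \<in> S" by (subst minus_split [OF z x y])
  next
    assume a: "z \<ominus> y \<in> S"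
    have "y \<ominus> x = (-1) \<odot> (x \<ominus> y)"
      using x y by (simp add: minus_eq_smult smult_add_right smult_smult a_comm)
    then have "y \<ominus> x \<in> S" using S_D(4) [OF xy, of "-1"] by simp
    from S_D(3) [OF a this] show "z \<ominus> x \<in> S" by (subst minus_split [OF z y x])
  qed
  then show "S +> x = S +> y" using x y by (auto simp: mem_coset_iff)
qed

lemma carrier_Q: "carrier Q = {S +> x | x. x \<in> carrier M}"
  by (auto simp: hquotient_def A_RCOSETS_def')

lemma coset_in_Q [simp]: "x \<in> carrier M \<Longrightarrow> S +> x \<in> carrier Q"
  by (auto simp: carrier_Q)

lemma zero_Q: "\<zero>\<^bsub>Q\<^esub> = S +> \<zero>"
proof -
  have "S = S +> \<zero>"
    by (rule Set.set_eqI) (use S_in in \<open>auto simp: mem_coset_iff\<close>)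
  then show ?thesis by (simp add: hquotient_def)
qed

lemma add_Q:
  assumes x: "x \<in> carrier M" and y: "y \<in> carrier M"
  shows "(S +> x) \<oplus>\<^bsub>Q\<^esub> (S +> y) = S +> (x \<oplus> y)"
proof -
  have "(S +> x) <+>\<^bsub>M\<^esub> (S +> y) = S +> (x \<oplus> y)"
  proof (intro Set.set_eqI iffI)
    fix z assume "z \<in> (S +> x) <+>\<^bsub>M\<^esub> (S +> y)"
    then obtain a b where ab: "a \<in> S +> x" "b \<in> S +> y" "z = a \<oplus> b"
      by (auto simp: set_add_def')
    then have "(a \<ominus> x) \<oplus> (b \<ominus> y) \<in> S" "a \<in> carrier M" "b \<in> carrier M"
      using x y S_D(3) by (auto simp: mem_coset_iff)
    then show "z \<in> S +> (x \<oplus> y)"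
      using x y ab(3) by (simp add: mem_coset_iff add_minus_add)
  next
    fix z assume z: "z \<in> S +> (x \<oplus> y)"
    then have zc: "z \<in> carrier M" using x y by (simp add: mem_coset_iff)
    have e: "z \<ominus> (x \<oplus> y) = (z \<ominus> y) \<ominus> x"
      using x y zc by (simp add: minus_eq_smult smult_add_right a_ac)
    have "z \<ominus> y \<in> S +> x" using z x y zc e by (simp add: mem_coset_iff)
    moreover have "y \<in> S +> y" using y S_D(2) by (simp add: mem_coset_iff)
    moreover have "z = (z \<ominus> y) \<oplus> y" using y zc by (simp add: a_minus_def a_assoc l_neg)
    ultimately show "z \<in> (S +> x) <+>\<^bsub>M\<^esub> (S +> y)" unfolding set_add_def' by blast
  qed
  then show ?thesis by (simp add: hquotient_def)
qed

lemma smult_Q: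
  assumes x: "x \<in> carrier M"
  shows "c \<odot>\<^bsub>Q\<^esub> (S +> x) = S +> (c \<odot> x)"
proof -
  have "S +> (c \<odot> t) = S +> (c \<odot> x)" if "t \<in> S +> x" for t
  proof -
    have t: "t \<in> carrier M" "t \<ominus> x \<in> S" using that x by (auto simp: mem_coset_iff)
    have "c \<odot> t \<ominus> c \<odot> x \<in> S"
      using S_D(4) [OF t(2), of c] x t(1) by (simp add: smult_minus_right)
    then show ?thesis using x t by (simp add: coset_eq_iff)
  qed
  moreover have "x \<in> S +> x" using x S_D(2) by (simp add: mem_coset_iff)
  ultimately have "(\<Union>t\<in>S +> x. S +> (c \<odot> t)) = S +> (c \<odot> x)" by blast
  then show ?thesis by (simp add: hquotient_def)
qed

lemma coset_rep_unique:
  assumes x: "x \<in> carrier M" and r: "r \<in> S +> x" "\<And>s. s \<in> S \<Longrightarrow> cinner M r s = 0"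
  shows "coset_rep M S (S +> x) = r"
  unfolding coset_rep_def
proof (rule the_equality)
  show "r \<in> S +> x \<and> (\<forall>s\<in>S. cinner M r s = 0)" using r by blast
  fix r' assume r': "r' \<in> S +> x \<and> (\<forall>s\<in>S. cinner M r' s = 0)"
  have c: "r \<in> carrier M" "r' \<in> carrier M" using r' r(1) x by (auto simp: mem_coset_iff)
  have "r' \<ominus> r \<in> S"
  proof -
    have "r \<ominus> x \<in> S" "r' \<ominus> x \<in> S" using r' r(1) x by (auto simp: mem_coset_iff)
    then have "S +> r = S +> x" "S +> r' = S +> x" using c x by (simp_all add: coset_eq_iff)
    then show ?thesis using coset_eq_iff [OF c(2) c(1)] by simp
  qed
  then have "cinner M (r' \<ominus> r) (r' \<ominus> r) = 0"
    using r(2) r' c by (simp add: cinner_minus_left [of r' r "r' \<ominus> r"])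
  then have "r' \<ominus> r = \<zero>" by (rule ip_eq_zero [OF minus_closed [OF c(2) c(1)]])
  then show "r' = r" by (rule minus_eq_zero [OF c(2) c(1)])
qed

lemma coset_rep:
  assumes x: "x \<in> carrier M"
  shows "coset_rep M S (S +> x) \<in> S +> x" "coset_rep M S (S +> x) \<in> carrier M"
    "\<And>s. s \<in> S \<Longrightarrow> cinner M (coset_rep M S (S +> x)) s = 0"
    "x \<ominus> coset_rep M S (S +> x) \<in> S"
proof -
  obtain s where s: "s \<in> S" "\<And>t. t \<in> S \<Longrightarrow> cinner M (x \<ominus> s) t = 0"
    using orthogonal_projection [OF S_sub S_closed x] by blast
  have sc: "s \<in> carrier M" using S_in s(1) .
  have d: "(x \<ominus> s) \<ominus> x = (-1) \<odot> s" "x \<ominus> (x \<ominus> s) = s"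
    using add_minus_add [OF x smult_in [OF sc, of "-1"] x zero_closed]
      add_minus_add [OF x zero_closed x smult_in [OF sc, of "-1"]] x sc
    by (simp_all add: minus_eq_smult [OF x sc]) (simp add: minus_eq_smult smult_smult)
  have m: "x \<ominus> s \<in> S +> x"
    using x sc d S_D(4) [OF s(1)] by (simp add: mem_coset_iff)
  have r: "coset_rep M S (S +> x) = x \<ominus> s"
    by (rule coset_rep_unique [OF x m s(2)])
  show "coset_rep M S (S +> x) \<in> S +> x" "coset_rep M S (S +> x) \<in> carrier M"
    "\<And>s. s \<in> S \<Longrightarrow> cinner M (coset_rep M S (S +> x)) s = 0"
    "x \<ominus> coset_rep M S (S +> x) \<in> S"
    using r m x sc s d by simp_all
qed

lemma coset_rep_add:
  assumes x: "x \<in> carrier M" and y: "y \<in> carrier M"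
  shows "coset_rep M S (S +> (x \<oplus> y)) = coset_rep M S (S +> x) \<oplus> coset_rep M S (S +> y)"
proof (rule coset_rep_unique)
  have "coset_rep M S (S +> x) \<oplus> coset_rep M S (S +> y) \<in> (S +> x) <+>\<^bsub>M\<^esub> (S +> y)"
    using coset_rep(1) [OF x] coset_rep(1) [OF y] unfolding set_add_def' by blast
  then show "coset_rep M S (S +> x) \<oplus> coset_rep M S (S +> y) \<in> S +> (x \<oplus> y)"
    using add_Q [OF x y] by (simp add: hquotient_def)
  show "cinner M (coset_rep M S (S +> x) \<oplus> coset_rep M S (S +> y)) s = 0" if "s \<in> S" for s
    using that x y S_in coset_rep(2,3) by (simp add: ip_add_left)
qed (use x y in simp)

lemma coset_rep_smult:
  assumes x: "x \<in> carrier M"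
  shows "coset_rep M S (S +> (c \<odot> x)) = c \<odot> coset_rep M S (S +> x)"
proof (rule coset_rep_unique)
  have r: "coset_rep M S (S +> x) \<in> carrier M" "coset_rep M S (S +> x) \<ominus> x \<in> S"
    using coset_rep(1) [OF x] x by (simp_all add: mem_coset_iff)
  show "c \<odot> coset_rep M S (S +> x) \<in> S +> (c \<odot> x)"
    using S_D(4) [OF r(2), of c] r(1) x by (simp add: mem_coset_iff smult_minus_right)
  show "cinner M (c \<odot> coset_rep M S (S +> x)) s = 0" if "s \<in> S" for s
    using that x S_in coset_rep(2,3) by (simp add: ip_smult_left)
qed (use x in simp)

lemma coset_of_rep: "x \<in> carrier M \<Longrightarrow> S +> coset_rep M S (S +> x) = S +> x"
  using coset_rep [of x] coset_eq_iff [of x "coset_rep M S (S +> x)"] by simp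

lemma inner_product_space_Q: "inner_product_space Q"
proof (rule inner_product_space_by_isometry [OF inner_product_space_axioms])
  have z: "coset_rep M S (S +> \<zero>) = \<zero>"
    using coset_rep_smult [of \<zero> 0] coset_rep(2) [of \<zero>] by simp
  show "inj_on (coset_rep M S) (carrier Q)"
  proof (rule inj_onI)
    have rep: "S +> coset_rep M S X = X" if X: "X \<in> carrier Q" for X
    proof -
      obtain x where x: "x \<in> carrier M" "X = S +> x" using X unfolding carrier_Q by blast
      show ?thesis unfolding x(2) by (rule coset_of_rep [OF x(1)])
    qed
    fix X Y assume X: "X \<in> carrier Q" and Y: "Y \<in> carrier Q"
      and "coset_rep M S X = coset_rep M S Y"
    then have "S +> coset_rep M S X = S +> coset_rep M S Y" by (simp only:)
    then show "X = Y" unfolding rep [OF X] rep [OF Y] .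
  qed
  show "coset_rep M S X \<in> carrier M" if "X \<in> carrier Q" for X
    using that coset_rep(2) by (auto simp: carrier_Q)
  show "\<zero>\<^bsub>Q\<^esub> \<in> carrier Q" "coset_rep M S \<zero>\<^bsub>Q\<^esub> = \<zero>"
    using z by (simp_all add: zero_Q)
  show "X \<oplus>\<^bsub>Q\<^esub> Y \<in> carrier Q" "coset_rep M S (X \<oplus>\<^bsub>Q\<^esub> Y) = coset_rep M S X \<oplus> coset_rep M S Y"
    if "X \<in> carrier Q" "Y \<in> carrier Q" for X Y
    using that by (auto simp: carrier_Q add_Q coset_rep_add)
  show "c \<odot>\<^bsub>Q\<^esub> X \<in> carrier Q" "coset_rep M S (c \<odot>\<^bsub>Q\<^esub> X) = c \<odot> coset_rep M S X"
    if "X \<in> carrier Q" for c X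
    using that by (auto simp: carrier_Q smult_Q coset_rep_smult)
  show "cinner Q X Y = cinner M (coset_rep M S X) (coset_rep M S Y)" for X Y
    by (simp add: hquotient_def)
qed

lemma hnorm_Q: "hnorm Q X = hnorm M (coset_rep M S X)"
  by (simp add: hnorm_def hquotient_def)

lemma hnorm_coset_le:
  assumes x: "x \<in> carrier M"
  shows "hnorm Q (S +> x) \<le> hnorm M x"
proof -
  let ?r = "coset_rep M S (S +> x)"
  note r = coset_rep [OF x]
  have "cinner M ?r (x \<ominus> ?r) = 0" using r(3) [OF r(4)] .
  then have "(hnorm M ?r)\<^sup>2 = Re (cinner M ?r x)"
    using x r(2) by (simp add: cinner_minus_right hnorm_sq)
  also have "\<dots> \<le> hnorm M ?r * hnorm M x"
    using cauchy_schwarz [OF r(2) x] complex_Re_le_cmod order_trans by blast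
  finally have "hnorm M ?r * hnorm M ?r \<le> hnorm M ?r * hnorm M x" by (simp add: power2_eq_square)
  then have "hnorm M ?r \<le> hnorm M x"
    using hnorm_nonneg [OF r(2)] hnorm_nonneg [OF x] by (cases "hnorm M ?r = 0") auto
  then show ?thesis by (simp add: hnorm_Q)
qed

text \<open>
  A linear map that vanishes on \<open>S\<close> has the same value at \<open>x\<close> and at the representative of the coset
  of \<open>x\<close>, so evaluating it at representatives defines the induced map.
\<close>

lemma factor_through_Q:
  assumes K: "inner_product_space K" and T: "linear_map_on (carrier M) M K T"
    and van: "\<And>s. s \<in> S \<Longrightarrow> T s = \<zero>\<^bsub>K\<^esub>"
  shows "linear_map_on (carrier Q) Q K (\<lambda>X. T (coset_rep M S X))"
    "\<And>x. x \<in> carrier M \<Longrightarrow> T (coset_rep M S (S +> x)) = T x"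
proof -
  interpret T: linear_map M K "carrier M" T
    by (intro linear_map.intro linear_map_axioms.intro inner_product_space_axioms K T
        carrier_is_submodule)
  show "linear_map_on (carrier Q) Q K (\<lambda>X. T (coset_rep M S X))"
    by (rule linear_map_onI)
      (auto simp: carrier_Q add_Q smult_Q coset_rep_add coset_rep_smult coset_rep(2) T.T_add T.T_smult)
  show "T (coset_rep M S (S +> x)) = T x" if x: "x \<in> carrier M" for x
  proof -
    note r = coset_rep [OF x]
    have "T x \<ominus>\<^bsub>K\<^esub> T (coset_rep M S (S +> x)) = \<zero>\<^bsub>K\<^esub>"
      using van [OF r(4)] x r(2) by (simp add: T.T_minus)
    then show ?thesis
      by (rule T.K.minus_eq_zero [OF T.T_in [OF x] T.T_in [OF r(2)], symmetric])
  qed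
qed

end

section \<open>Square-summable sequences and one-dimensional modules\<close>

lemma (in inner_product_space) bessel_inequality:
  assumes "finite F" "F \<subseteq> carrier H"
    and on: "\<And>e e'. \<lbrakk>e \<in> F; e' \<in> F\<rbrakk> \<Longrightarrow> cinner H e e' = (if e = e' then 1 else 0)"
    and "x \<in> carrier H"
  shows "(\<Sum>e\<in>F. (cmod (cinner H x e))\<^sup>2) \<le> (hnorm H x)\<^sup>2"
  using assms
proof (induction F arbitrary: x)
  case empty
  then show ?case by simp
next
  case (insert e F)
  have c: "e \<in> carrier H" "x \<in> carrier H" using insert.prems by auto
  define y where "y = x \<ominus> cinner H x e \<odot> e"
  have y: "y \<in> carrier H" using c by (simp add: y_def)
  have ee: "cinner H e e = 1" using insert.prems(2) [of e e] by simp
  have "cinner H y f = cinner H x f" if "f \<in> F" for f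
  proof -
    have "f \<in> carrier H" "e \<noteq> f" using that insert by auto
    then show ?thesis
      using insert.prems(2) [of e f] that c
      by (simp add: y_def cinner_minus_left ip_smult_left)
  qed
  then have "(\<Sum>f\<in>F. (cmod (cinner H x f))\<^sup>2) = (\<Sum>f\<in>F. (cmod (cinner H y f))\<^sup>2)" by simp
  also have "\<dots> \<le> (hnorm H y)\<^sup>2"
    by (rule insert.IH) (use insert.prems y in auto)
  also have "\<dots> = (hnorm H x)\<^sup>2 - (cmod (cinner H x e))\<^sup>2"
  proof -
    have "(hnorm H e)\<^sup>2 = 1" using c ee by (simp add: hnorm_sq)
    moreover have "Re (cinner H x (cinner H x e \<odot> e)) = (cmod (cinner H x e))\<^sup>2"
      using c unfolding cmod_power2 by (simp add: cinner_smult_right power2_eq_square)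
    ultimately show ?thesis
      using c by (simp add: y_def hnorm_minus_sq hnorm_smult power_mult_distrib)
  qed
  finally show ?case using insert.hyps by simp
qed

abbreviation l2 :: "(nat \<Rightarrow> complex) hspace" where "l2 \<equiv> ell2 \<infinity>"

lemma idx_infinity [simp]: "idx \<infinity> = UNIV"
  by (auto simp: idx_def)

lemma l2_simps [simp]:
  "zero l2 = (\<lambda>i. 0)" "add l2 = (\<lambda>x y i. x i + y i)" "smult l2 = (\<lambda>c x i. c * x i)"
  "cinner l2 = (\<lambda>x y. \<Sum>i. x i * cnj (y i))"
  by (simp_all add: ell2_def)

lemma in_l2_iff: "x \<in> carrier l2 \<longleftrightarrow> summable (\<lambda>i. (cmod (x i))\<^sup>2)"
  by (simp add: ell2_def)

lemma l2_add: "\<lbrakk>x \<in> carrier l2; y \<in> carrier l2\<rbrakk> \<Longrightarrow> (\<lambda>i. x i + y i) \<in> carrier l2"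
  unfolding in_l2_iff
proof (rule summable_comparison_test')
  assume "summable (\<lambda>i. (cmod (x i))\<^sup>2)" "summable (\<lambda>i. (cmod (y i))\<^sup>2)"
  then show "summable (\<lambda>i. 2 * (cmod (x i))\<^sup>2 + 2 * (cmod (y i))\<^sup>2)"
    by (intro summable_add summable_mult)
  fix i
  have "(cmod (x i + y i))\<^sup>2 \<le> (cmod (x i) + cmod (y i))\<^sup>2"
    by (intro power_mono norm_triangle_ineq) simp
  also have "\<dots> \<le> 2 * (cmod (x i))\<^sup>2 + 2 * (cmod (y i))\<^sup>2"
    using sum_squares_bound [of "cmod (x i)" "cmod (y i)"] by (simp add: power2_sum)
  finally show "norm ((cmod (x i + y i))\<^sup>2) \<le> 2 * (cmod (x i))\<^sup>2 + 2 * (cmod (y i))\<^sup>2" by simp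
qed

lemma l2_smult: "x \<in> carrier l2 \<Longrightarrow> (\<lambda>i. c * x i) \<in> carrier l2"
  unfolding in_l2_iff by (simp add: norm_mult power_mult_distrib summable_mult)

lemma l2_cinner_summable:
  assumes "x \<in> carrier l2" "y \<in> carrier l2"
  shows "summable (\<lambda>i. x i * cnj (y i))"
proof (rule summable_comparison_test')
  show "summable (\<lambda>i. (cmod (x i))\<^sup>2 + (cmod (y i))\<^sup>2)"
    using assms unfolding in_l2_iff by (intro summable_add)
  fix i
  show "norm (x i * cnj (y i)) \<le> (cmod (x i))\<^sup>2 + (cmod (y i))\<^sup>2"
    using sum_squares_bound [of "cmod (x i)" "cmod (y i)"]
      mult_nonneg_nonneg [OF norm_ge_zero norm_ge_zero, of "x i" "y i"]
    unfolding norm_mult complex_mod_cnj by linarith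
qed

lemma l2_cinner_self: "x \<in> carrier l2 \<Longrightarrow> cinner l2 x x = complex_of_real (\<Sum>i. (cmod (x i))\<^sup>2)"
  unfolding in_l2_iff by (simp add: complex_norm_square [symmetric] suminf_of_real del: of_real_power)

lemma inner_product_space_l2: "inner_product_space l2"
proof (rule inner_product_space.intro)
  have ab: "abelian_group l2"
  proof (rule abelian_groupI)
    fix x assume "x \<in> carrier l2"
    then have "(\<lambda>i. - x i) \<in> carrier l2" using l2_smult [of x "-1"] by simp
    then show "\<exists>y\<in>carrier l2. y \<oplus>\<^bsub>l2\<^esub> x = \<zero>\<^bsub>l2\<^esub>"
      by (intro bexI [of _ "\<lambda>i. - x i"]) simp_all
  qed (simp_all add: l2_add in_l2_iff [of "\<lambda>i. 0"] ac_simps)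
  show "Module.module complex_ring l2"
    by (rule moduleI [OF cring_complex_ring ab]) (simp_all add: l2_smult algebra_simps)
  show "inner_product_space_axioms l2"
  proof
    fix x y z assume xyz: "x \<in> carrier l2" "y \<in> carrier l2" "z \<in> carrier l2"
    then show "cinner l2 (x \<oplus>\<^bsub>l2\<^esub> y) z = cinner l2 x z + cinner l2 y z"
      using suminf_add [OF l2_cinner_summable l2_cinner_summable, OF xyz(1,3,2,3)]
      by (simp add: distrib_right)
  next
    fix x y assume xy: "x \<in> carrier l2" "y \<in> carrier l2"
    show "cinner l2 (c \<odot>\<^bsub>l2\<^esub> x) y = c * cinner l2 x y" for c
      using suminf_mult [OF l2_cinner_summable [OF xy], of c] by (simp add: mult.assoc)
    have "(\<lambda>i. cnj (x i * cnj (y i))) sums cnj (\<Sum>i. x i * cnj (y i))"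
      unfolding sums_cnj using l2_cinner_summable [OF xy] by (rule summable_sums)
    then show "cinner l2 y x = cnj (cinner l2 x y)"
      by (simp add: sums_iff mult.commute)
  next
    fix x assume x: "x \<in> carrier l2"
    show "0 \<le> Re (cinner l2 x x)"
      unfolding l2_cinner_self [OF x] using x by (simp add: suminf_nonneg in_l2_iff)
    assume "cinner l2 x x = 0"
    then have "(\<Sum>i. (cmod (x i))\<^sup>2) = 0" unfolding l2_cinner_self [OF x] by (simp only: of_real_eq_0_iff)
    then have "\<forall>i. (cmod (x i))\<^sup>2 = 0"
      by (rule iffD1 [OF suminf_eq_zero_iff [OF x [unfolded in_l2_iff] zero_le_power2]])
    then show "x = \<zero>\<^bsub>l2\<^esub>" by auto
  qed
qed

interpretation l2: inner_product_space l2
  by (rule inner_product_space_l2)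

lemma l2_minus: "\<lbrakk>x \<in> carrier l2; y \<in> carrier l2\<rbrakk> \<Longrightarrow> x \<ominus>\<^bsub>l2\<^esub> y = (\<lambda>i. x i - y i)"
  by (simp add: l2.minus_eq_smult)

lemma l2_finsum:
  assumes "finite I" "\<And>i. i \<in> I \<Longrightarrow> v i \<in> carrier l2"
  shows "(\<Oplus>\<^bsub>l2\<^esub>i\<in>I. v i) = (\<lambda>n. \<Sum>i\<in>I. v i n)"
  using assms
proof (induction I)
  case (insert i I)
  have "v \<in> I \<rightarrow> carrier l2" "v i \<in> carrier l2" using insert.prems by auto
  then show ?case using insert by simp
qed simp

lemma l2_hnorm: "x \<in> carrier l2 \<Longrightarrow> hnorm l2 x = sqrt (\<Sum>i. (cmod (x i))\<^sup>2)"
  unfolding hnorm_def by (simp only: l2_cinner_self Re_complex_of_real)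

lemma l2_hnorm_sq: "x \<in> carrier l2 \<Longrightarrow> (hnorm l2 x)\<^sup>2 = (\<Sum>i. (cmod (x i))\<^sup>2)"
  by (simp add: l2_hnorm in_l2_iff suminf_nonneg)

lemma l2_sum_le: "\<lbrakk>x \<in> carrier l2; finite I\<rbrakk> \<Longrightarrow> (\<Sum>i\<in>I. (cmod (x i))\<^sup>2) \<le> (hnorm l2 x)\<^sup>2"
  unfolding l2_hnorm_sq by (rule sum_le_suminf) (auto simp: in_l2_iff)

lemma l2_coord_le: "x \<in> carrier l2 \<Longrightarrow> cmod (x i) \<le> hnorm l2 x"
  by (rule power2_le_imp_le) (use l2_sum_le [of x "{i}"] in simp_all)

text \<open>
  Membership in \<open>\<ell>\<^sup>2\<close> and a norm bound come together from a bound on the partial sums; most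
  estimates below produce them in this form.
\<close>

lemma l2I:
  assumes "\<And>k. (\<Sum>i<k. (cmod (x i))\<^sup>2) \<le> r\<^sup>2" "0 \<le> r"
  shows "x \<in> carrier l2" "hnorm l2 x \<le> r"
proof -
  show x: "x \<in> carrier l2"
    unfolding in_l2_iff by (rule summableI_nonneg_bounded [OF _ assms(1)]) simp
  show "hnorm l2 x \<le> r"
    unfolding l2_hnorm [OF x] using suminf_le_const [of "\<lambda>i. (cmod (x i))\<^sup>2" "r\<^sup>2"] x assms
    by (simp add: in_l2_iff real_le_lsqrt)
qed

lemma hilbert_space_l2: "hilbert_space l2"
proof (rule hilbert_spaceI [OF inner_product_space_l2], unfold l2.mcomplete_iff, intro allI impI)
  fix \<sigma> :: "nat \<Rightarrow> nat \<Rightarrow> complex"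
  assume "range \<sigma> \<subseteq> carrier l2"
    and c: "\<forall>e>0. \<exists>N. \<forall>m\<ge>N. \<forall>n\<ge>N. hnorm l2 (\<sigma> m \<ominus>\<^bsub>l2\<^esub> \<sigma> n) < e"
  then have \<sigma>: "\<sigma> n \<in> carrier l2" for n by blast
  have "Cauchy (\<lambda>n. \<sigma> n i)" for i
  proof (rule CauchyI)
    fix e :: real assume "e > 0"
    then obtain N where N: "\<forall>m\<ge>N. \<forall>n\<ge>N. hnorm l2 (\<sigma> m \<ominus>\<^bsub>l2\<^esub> \<sigma> n) < e" using c by blast
    have "cmod (\<sigma> m i - \<sigma> n i) < e" if "m \<ge> N" "n \<ge> N" for m n
    proof -
      have "cmod (\<sigma> m i - \<sigma> n i) \<le> hnorm l2 (\<sigma> m \<ominus>\<^bsub>l2\<^esub> \<sigma> n)"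
        using l2_coord_le [OF l2.minus_closed [OF \<sigma> \<sigma>], of m n i] by (simp add: l2_minus \<sigma>)
      then show ?thesis using N that by (meson le_less_trans)
    qed
    then show "\<exists>N. \<forall>m\<ge>N. \<forall>n\<ge>N. norm (\<sigma> m i - \<sigma> n i) < e" by blast
  qed
  then have "\<exists>y. (\<lambda>n. \<sigma> n i) \<longlonglongrightarrow> y" for i using Cauchy_convergent convergent_def by blast
  then obtain y where y: "\<And>i. (\<lambda>n. \<sigma> n i) \<longlonglongrightarrow> y i" by metis
  have close: "(\<lambda>i. \<sigma> m i - y i) \<in> carrier l2 \<and> hnorm l2 (\<lambda>i. \<sigma> m i - y i) \<le> e"
    if e: "e > 0" and N: "\<forall>m\<ge>N. \<forall>n\<ge>N. hnorm l2 (\<sigma> m \<ominus>\<^bsub>l2\<^esub> \<sigma> n) < e" and m: "m \<ge> N" for e m N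
  proof -
    have "(\<Sum>i<k. (cmod (\<sigma> m i - y i))\<^sup>2) \<le> e\<^sup>2" for k
    proof (rule tendsto_upperbound)
      show "(\<lambda>n. \<Sum>i<k. (cmod (\<sigma> m i - \<sigma> n i))\<^sup>2) \<longlonglongrightarrow> (\<Sum>i<k. (cmod (\<sigma> m i - y i))\<^sup>2)"
        by (intro tendsto_intros y)
      have "(\<Sum>i<k. (cmod (\<sigma> m i - \<sigma> n i))\<^sup>2) \<le> e\<^sup>2" if n: "n \<ge> N" for n
      proof -
        have "(\<Sum>i<k. (cmod (\<sigma> m i - \<sigma> n i))\<^sup>2) \<le> (hnorm l2 (\<sigma> m \<ominus>\<^bsub>l2\<^esub> \<sigma> n))\<^sup>2"
          using l2_sum_le [OF l2.minus_closed [OF \<sigma> \<sigma>], of "{..<k}" m n] by (simp add: l2_minus \<sigma>)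
        also have "\<dots> \<le> e\<^sup>2"
          using N m n l2.hnorm_nonneg [OF l2.minus_closed [OF \<sigma> \<sigma>], of m n]
          by (intro power_mono) (auto intro: less_imp_le)
        finally show ?thesis .
      qed
      then show "\<forall>\<^sub>F n in sequentially. (\<Sum>i<k. (cmod (\<sigma> m i - \<sigma> n i))\<^sup>2) \<le> e\<^sup>2"
        using eventually_sequentially by blast
    qed simp
    then show ?thesis using l2I [of "\<lambda>i. \<sigma> m i - y i" e] e by auto
  qed
  have yl: "y \<in> carrier l2"
  proof -
    obtain N where N: "\<forall>m\<ge>N. \<forall>n\<ge>N. hnorm l2 (\<sigma> m \<ominus>\<^bsub>l2\<^esub> \<sigma> n) < 1" using c zero_less_one by blast
    have d: "(\<lambda>i. \<sigma> N i - y i) \<in> carrier l2" using close [OF zero_less_one N order_refl] by blast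
    show ?thesis using l2.minus_closed [OF \<sigma> [of N] d] by (simp add: l2_minus [OF \<sigma> d])
  qed
  have "\<exists>N. \<forall>n\<ge>N. hnorm l2 (\<sigma> n \<ominus>\<^bsub>l2\<^esub> y) < e" if e: "e > 0" for e
  proof -
    have e2: "e / 2 > 0" using e by simp
    then obtain N where N: "\<forall>m\<ge>N. \<forall>n\<ge>N. hnorm l2 (\<sigma> m \<ominus>\<^bsub>l2\<^esub> \<sigma> n) < e / 2" using c by blast
    have "hnorm l2 (\<sigma> n \<ominus>\<^bsub>l2\<^esub> y) < e" if "n \<ge> N" for n
      using close [OF e2 N that] e by (simp add: l2_minus [OF \<sigma> yl])
    then show ?thesis by blast
  qed
  then show "\<exists>x\<in>carrier l2. \<forall>e>0. \<exists>N. \<forall>n\<ge>N. hnorm l2 (\<sigma> n \<ominus>\<^bsub>l2\<^esub> x) < e" using yl by blast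
qed

interpretation l2: hilbert_space l2
  by (rule hilbert_space_l2)

lemma ell2_basis_in [simp]: "ell2_basis i \<in> carrier l2"
proof -
  have "summable (\<lambda>j. (cmod (ell2_basis i j))\<^sup>2)"
    by (rule summable_finite [of "{i}"]) (auto simp: ell2_basis_def)
  then show ?thesis by (simp add: in_l2_iff)
qed

lemma l2_cinner_basis: "cinner l2 x (ell2_basis i) = x i"
proof -
  have "(\<lambda>j. x j * cnj (ell2_basis i j)) sums (\<Sum>j\<in>{i}. x j * cnj (ell2_basis i j))"
    by (rule sums_finite) (auto simp: ell2_basis_def)
  then show ?thesis by (simp add: sums_iff ell2_basis_def)
qed

lemma ell2_basis_inj: "ell2_basis i = ell2_basis j \<longleftrightarrow> i = j"
  by (auto simp: ell2_basis_def fun_eq_iff)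

lemma l2_hnorm_basis: "hnorm l2 (ell2_basis i) = 1"
  using l2_cinner_basis [of "ell2_basis i" i] unfolding hnorm_def by (simp add: ell2_basis_def)

text \<open>
  The inner product of a tensor product is a sum over an unspecified orthonormal basis of the second
  factor. That such a basis exists has to be shown, here and for the point modules.
\<close>

lemma is_onb_l2: "is_onb l2 (range ell2_basis)"
  unfolding is_onb_def
proof (intro conjI ballI)
  fix e e' assume "e \<in> range ell2_basis" "e' \<in> range ell2_basis"
  then show "cinner l2 e e' = (if e = e' then 1 else 0)"
    by (auto simp only: l2_cinner_basis ell2_basis_inj) (auto simp: ell2_basis_def)
next
  have sub: "cspan l2 (range ell2_basis) \<subseteq> carrier l2"
    unfolding cspan_def by (auto intro!: l2.finsum_closed l2.smult_in simp del: l2_simps)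
  show "dense_in l2 (cspan l2 (range ell2_basis))"
    unfolding l2.dense_in_iff [OF sub]
  proof (intro ballI allI impI)
    fix x :: "nat \<Rightarrow> complex" and e :: real assume x: "x \<in> carrier l2" and e: "e > 0"
    have "e\<^sup>2 > 0" using e by simp
    then obtain N where N: "\<forall>n\<ge>N. norm (\<Sum>i. (cmod (x (i + n)))\<^sup>2) < e\<^sup>2"
      using suminf_exist_split [of "e\<^sup>2" "\<lambda>i. (cmod (x i))\<^sup>2"] x by (auto simp: in_l2_iff)
    define y where "y = (\<Oplus>\<^bsub>l2\<^esub>b\<in>ell2_basis ` {..<N}. cinner l2 x b \<odot>\<^bsub>l2\<^esub> b)"
    have "y n = (if n < N then x n else 0)" for n
    proof -
      have "y n = (\<Sum>b\<in>ell2_basis ` {..<N}. (cinner l2 x b \<odot>\<^bsub>l2\<^esub> b) n)"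
        unfolding y_def by (subst l2_finsum) (auto intro: l2.smult_in simp del: l2_simps)
      also have "\<dots> = (\<Sum>i<N. (cinner l2 x (ell2_basis i) \<odot>\<^bsub>l2\<^esub> ell2_basis i) n)"
        by (subst sum.reindex) (auto simp: inj_on_def ell2_basis_inj)
      also have "\<dots> = (\<Sum>i<N. x i * ell2_basis i n)" by (simp only: l2_cinner_basis) simp
      also have "\<dots> = (if n < N then x n else 0)"
        by (simp add: ell2_basis_def if_distrib cong: if_cong)
      finally show ?thesis .
    qed
    then have y: "y = (\<lambda>n. if n < N then x n else 0)" by blast
    have ysp: "y \<in> cspan l2 (range ell2_basis)"
      unfolding cspan_def y_def by blast
    then have yc: "y \<in> carrier l2" using sub by blast
    have d: "x \<ominus>\<^bsub>l2\<^esub> y = (\<lambda>n. if n < N then 0 else x n)"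
      using x yc by (auto simp: l2_minus y)
    have dc: "(\<lambda>n. if n < N then 0 else x n) \<in> carrier l2"
      using l2.minus_closed [OF x yc] by (simp add: d)
    have "(hnorm l2 (x \<ominus>\<^bsub>l2\<^esub> y))\<^sup>2 = (\<Sum>i. (cmod (if i < N then 0 else x i))\<^sup>2)"
      unfolding d by (rule l2_hnorm_sq [OF dc])
    also have "\<dots> = (\<Sum>i. (cmod (x (i + N)))\<^sup>2)"
      using dc by (subst suminf_split_initial_segment [of _ N]) (simp_all add: in_l2_iff)
    also have "\<dots> < e\<^sup>2" using N by force
    finally have "hnorm l2 (x \<ominus>\<^bsub>l2\<^esub> y) < e" by (rule power2_less_imp_less) (use e in simp)
    then show "\<exists>y\<in>cspan l2 (range ell2_basis). hnorm l2 (x \<ominus>\<^bsub>l2\<^esub> y) < e" using ysp by blast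
  qed
qed auto

lemma some_onb_l2: "is_onb l2 (some_onb l2)"
  unfolding some_onb_def by (rule someI [where P = "is_onb l2"], rule is_onb_l2)

lemma point_module_simps [simp]:
  "carrier (point_module z) = UNIV" "zero (point_module z) = 0" "add (point_module z) = (+)"
  "smult (point_module z) = (*)" "cinner (point_module z) = (\<lambda>v w. v * cnj w)"
  "act (point_module z) = (\<lambda>\<phi> v. \<phi> z * v)"
  by (simp_all add: point_module_def)

lemma inner_product_space_point_module: "inner_product_space (point_module z)"
proof (rule inner_product_space.intro)
  have ab: "abelian_group (point_module z)"
    by (rule abelian_groupI) (auto simp: algebra_simps intro: exI [of _ "- _"])
  show "Module.module complex_ring (point_module z)"
    by (rule moduleI [OF cring_complex_ring ab]) (auto simp: algebra_simps)
  show "inner_product_space_axioms (point_module z)"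
  proof
    fix x y w c :: complex
    show "cinner (point_module z) (x \<oplus>\<^bsub>point_module z\<^esub> y) w =
        cinner (point_module z) x w + cinner (point_module z) y w"
      by (simp add: distrib_right)
    show "cinner (point_module z) (c \<odot>\<^bsub>point_module z\<^esub> x) y = c * cinner (point_module z) x y"
      by (simp add: mult.assoc)
    show "cinner (point_module z) y x = cnj (cinner (point_module z) x y)" by simp
    show "0 \<le> Re (cinner (point_module z) x x)" by simp
    show "cinner (point_module z) x x = 0 \<Longrightarrow> x = \<zero>\<^bsub>point_module z\<^esub>" by simp
  qed
qed

lemma hnorm_point_module [simp]: "hnorm (point_module z) v = cmod v"
  by (simp add: hnorm_def cmod_def power2_eq_square)

lemma is_onb_point_module: "is_onb (point_module z) E \<longleftrightarrow> (\<exists>u. cmod u = 1 \<and> E = {u})"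
proof -
  interpret P: inner_product_space "point_module z" by (rule inner_product_space_point_module)
  have minus: "x \<ominus>\<^bsub>point_module z\<^esub> y = x - y" for x y
    by (simp add: P.minus_eq_smult)
  have sub: "cspan (point_module z) E \<subseteq> carrier (point_module z)" by simp
  have unit: "u * cnj u = 1 \<longleftrightarrow> cmod u = 1" for u :: complex
  proof -
    have "u * cnj u = 1 \<longleftrightarrow> (cmod u)\<^sup>2 = 1"
      unfolding complex_norm_square [symmetric] by (simp only: of_real_eq_1_iff)
    also have "\<dots> \<longleftrightarrow> cmod u = 1"
      using norm_ge_zero [of u] by (auto simp only: power2_eq_1_iff)
    finally show ?thesis .
  qed
  show ?thesis
  proof
    assume onb: "is_onb (point_module z) E"
    then have on: "e * cnj e' = (if e = e' then 1 else 0)" if "e \<in> E" "e' \<in> E" for e e'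
      using that unfolding is_onb_def by simp
    have "E \<noteq> {}"
    proof
      assume "E = {}"
      then have "cspan (point_module z) E = {0}" by (auto simp: cspan_def)
      moreover have "\<exists>y\<in>cspan (point_module z) E. cmod (1 - y) < 1/2"
      proof -
        have "\<forall>x\<in>carrier (point_module z). \<forall>e>0. \<exists>y\<in>cspan (point_module z) E. cmod (x - y) < e"
          using onb unfolding is_onb_def P.dense_in_iff [OF sub] minus hnorm_point_module by blast
        then have "\<forall>e>0. \<exists>y\<in>cspan (point_module z) E. cmod (1 - y) < e" by simp
        moreover have "(1/2::real) > 0" by simp
        ultimately show ?thesis by blast
      qed
      ultimately show False by simp
    qed
    then obtain u where u: "u \<in> E" by blast
    have "e = u" if "e \<in> E" for e
    proof (rule ccontr)
      assume "e \<noteq> u"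
      then have "e * cnj u = 0" using on [OF that u] by simp
      then show False using on [OF u u] on [OF that that] by auto
    qed
    then have "E = {u}" using u by blast
    moreover have "cmod u = 1" using on [OF u u] unit by simp
    ultimately show "\<exists>u. cmod u = 1 \<and> E = {u}" by blast
  next
    assume "\<exists>u. cmod u = 1 \<and> E = {u}"
    then obtain u where u: "cmod u = 1" "E = {u}" by blast
    have "x \<in> cspan (point_module z) E" for x
    proof -
      have "(\<Oplus>\<^bsub>point_module z\<^esub>e\<in>{u}. (x * cnj u) \<odot>\<^bsub>point_module z\<^esub> e) = x"
        using u(1) unit [of u] by (simp add: P.finsum_insert mult.assoc mult.commute)
      then show ?thesis unfolding cspan_def u(2)
        by (intro CollectI exI [of _ "{u}"] exI [of _ "\<lambda>_. x * cnj u"]) simp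
    qed
    then have span: "cspan (point_module z) E = UNIV" by blast
    have "\<exists>y\<in>UNIV. cmod (x - y) < e" if "e > 0" for x e
      by (rule bexI [of _ x]) (use that in simp_all)
    then have "dense_in (point_module z) (cspan (point_module z) E)"
      unfolding P.dense_in_iff [OF sub] minus hnorm_point_module by (simp add: span)
    then show "is_onb (point_module z) E"
      unfolding is_onb_def u(2) using u(1) unit by simp
  qed
qed

lemma some_onb_point_module: "\<exists>u. cmod u = 1 \<and> some_onb (point_module z) = {u}"
proof -
  have "is_onb (point_module z) (some_onb (point_module z))"
    unfolding some_onb_def
    by (rule someI [where P = "is_onb (point_module z)" and x = "{1}"]) (auto simp: is_onb_point_module)
  then show ?thesis by (simp add: is_onb_point_module)
qed

section \<open>The algebra and its action\<close>

lemma A_set_continuous: "\<phi> \<in> A_set \<Omega> \<Longrightarrow> continuous_on (closure \<Omega>) \<phi>"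
  and A_set_outside: "\<lbrakk>\<phi> \<in> A_set \<Omega>; z \<notin> closure \<Omega>\<rbrakk> \<Longrightarrow> \<phi> z = 0"
  by (simp_all add: A_set_def)

text \<open>
  The approximating holomorphic functions are scaled along with \<open>\<phi>\<close>.
\<close>

lemma A_set_smult:
  assumes \<phi>: "\<phi> \<in> A_set \<Omega>"
  shows "(\<lambda>z. c * \<phi> z) \<in> A_set \<Omega>"
  unfolding A_set_def
proof (intro CollectI conjI allI impI)
  show "continuous_on (closure \<Omega>) (\<lambda>z. c * \<phi> z)"
    by (intro continuous_intros A_set_continuous [OF \<phi>])
  show "c * \<phi> z = 0" if "z \<notin> closure \<Omega>" for z using A_set_outside [OF \<phi> that] by simp
  fix \<epsilon> :: real assume "\<epsilon> > 0"
  then have e: "\<epsilon> / (cmod c + 1) > 0" by (simp add: add_nonneg_pos)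
  then obtain U \<psi> where U: "open U" "closure \<Omega> \<subseteq> U" "holomorphic_in \<psi> U"
    and le: "\<forall>z\<in>\<Omega>. cmod (\<phi> z - \<psi> z) \<le> \<epsilon> / (cmod c + 1)"
    using \<phi> unfolding A_set_def by blast
  have "holomorphic_in (\<lambda>z. c * \<psi> z) U"
    unfolding holomorphic_in_def
  proof
    fix z assume "z \<in> U"
    then obtain D where D: "(\<psi> has_derivative D) (at z)" "\<forall>a v. D (a *s v) = a * D v"
      using U(3) unfolding holomorphic_in_def by blast
    have "((\<lambda>z. c * \<psi> z) has_derivative (\<lambda>v. c * D v)) (at z)"
      by (intro has_derivative_mult_right D(1))
    then show "\<exists>D. ((\<lambda>z. c * \<psi> z) has_derivative D) (at z) \<and> (\<forall>a v. D (a *s v) = a * D v)"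
      using D(2) by (intro exI [of _ "\<lambda>v. c * D v"]) (simp add: mult.left_commute)
  qed
  moreover have "cmod (c * \<phi> z - c * \<psi> z) \<le> \<epsilon>" if "z \<in> \<Omega>" for z
  proof -
    have "cmod (c * \<phi> z - c * \<psi> z) = cmod c * cmod (\<phi> z - \<psi> z)"
      by (simp add: right_diff_distrib [symmetric] norm_mult)
    also have "\<dots> \<le> (cmod c + 1) * (\<epsilon> / (cmod c + 1))"
      using le that by (intro mult_mono) auto
    also have "\<dots> = \<epsilon>"
      using norm_ge_zero [of c] by (simp add: add_nonneg_eq_0_iff)
    finally show ?thesis .
  qed
  ultimately show "\<exists>U \<psi>. open U \<and> closure \<Omega> \<subseteq> U \<and> holomorphic_in \<psi> U \<and>
      (\<forall>z\<in>\<Omega>. cmod (c * \<phi> z - \<psi> z) \<le> \<epsilon>)"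
    using U(1,2) by blast
qed

lemma sup_norm_least: "\<lbrakk>\<And>z. z \<in> X \<Longrightarrow> cmod (\<phi> z) \<le> B; 0 \<le> B\<rbrakk> \<Longrightarrow> sup_norm X \<phi> \<le> B"
  unfolding sup_norm_def by (rule cSup_least) auto

lemma sup_norm_upper:
  assumes "\<And>z. z \<in> X \<Longrightarrow> cmod (\<phi> z) \<le> B"
  shows "0 \<le> sup_norm X \<phi>" "z \<in> X \<Longrightarrow> cmod (\<phi> z) \<le> sup_norm X \<phi>"
proof -
  have bdd: "bdd_above (insert 0 ((\<lambda>z. cmod (\<phi> z)) ` X))"
    by (rule bdd_aboveI [of _ "\<bar>B\<bar>"]) (use assms in force)
  show "0 \<le> sup_norm X \<phi>" unfolding sup_norm_def by (rule cSup_upper [OF _ bdd]) simp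
  show "cmod (\<phi> z) \<le> sup_norm X \<phi>" if "z \<in> X"
    unfolding sup_norm_def by (rule cSup_upper [OF _ bdd]) (use that in simp)
qed

lemma A_set_bounded:
  fixes \<Omega> :: "(complex^'m) set"
  assumes "bounded \<Omega>" "\<phi> \<in> A_set \<Omega>"
  shows "\<exists>B\<ge>0. \<forall>z\<in>closure \<Omega>. cmod (\<phi> z) \<le> B"
proof -
  have "compact (closure \<Omega>)" using assms(1) by simp
  then have "compact (\<phi> ` closure \<Omega>)" by (intro compact_continuous_image A_set_continuous assms(2))
  then obtain B where "\<forall>w\<in>\<phi> ` closure \<Omega>. cmod w \<le> B" using compact_imp_bounded bounded_iff by metis
  then show ?thesis by (intro exI [of _ "\<bar>B\<bar>"]) force
qed

lemma A_set_sup_norm: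
  fixes \<Omega> :: "(complex^'m) set"
  assumes "bounded \<Omega>" "\<phi> \<in> A_set \<Omega>"
  shows "0 \<le> sup_norm \<Omega> \<phi>" "z \<in> \<Omega> \<Longrightarrow> cmod (\<phi> z) \<le> sup_norm \<Omega> \<phi>"
proof -
  obtain B where B: "\<And>z. z \<in> closure \<Omega> \<Longrightarrow> cmod (\<phi> z) \<le> B" using A_set_bounded [OF assms] by blast
  have "cmod (\<phi> z) \<le> B" if "z \<in> \<Omega>" for z using B that closure_subset by blast
  from sup_norm_upper [of \<Omega> \<phi> B, OF this] show "0 \<le> sup_norm \<Omega> \<phi>"
    "z \<in> \<Omega> \<Longrightarrow> cmod (\<phi> z) \<le> sup_norm \<Omega> \<phi>" by auto
qed

lemma A_dist_props:
  fixes \<Omega> :: "(complex^'m) set"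
  assumes "bounded \<Omega>" "\<phi> \<in> A_set \<Omega>" "\<psi> \<in> A_set \<Omega>"
  shows "0 \<le> A_dist \<Omega> \<phi> \<psi>" "z \<in> \<Omega> \<Longrightarrow> cmod (\<phi> z - \<psi> z) \<le> A_dist \<Omega> \<phi> \<psi>"
    "\<lbrakk>\<And>z. z \<in> \<Omega> \<Longrightarrow> cmod (\<phi> z - \<psi> z) \<le> B; 0 \<le> B\<rbrakk> \<Longrightarrow> A_dist \<Omega> \<phi> \<psi> \<le> B"
proof -
  obtain B1 where B1: "\<And>z. z \<in> closure \<Omega> \<Longrightarrow> cmod (\<phi> z) \<le> B1" using A_set_bounded [OF assms(1,2)] by blast
  obtain B2 where B2: "\<And>z. z \<in> closure \<Omega> \<Longrightarrow> cmod (\<psi> z) \<le> B2" using A_set_bounded [OF assms(1,3)] by blast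
  have "cmod (\<phi> z - \<psi> z) \<le> B1 + B2" if "z \<in> \<Omega>" for z
  proof -
    have "z \<in> closure \<Omega>" using that closure_subset by blast
    then show ?thesis using norm_triangle_ineq4 [of "\<phi> z" "\<psi> z"] B1 [of z] B2 [of z] by linarith
  qed
  from sup_norm_upper [of \<Omega> "\<lambda>z. \<phi> z - \<psi> z", OF this]
  show "0 \<le> A_dist \<Omega> \<phi> \<psi>" "z \<in> \<Omega> \<Longrightarrow> cmod (\<phi> z - \<psi> z) \<le> A_dist \<Omega> \<phi> \<psi>"
    using assms(2,3) by (auto simp: A_dist_def)
  show "\<lbrakk>\<And>z. z \<in> \<Omega> \<Longrightarrow> cmod (\<phi> z - \<psi> z) \<le> B; 0 \<le> B\<rbrakk> \<Longrightarrow> A_dist \<Omega> \<phi> \<psi> \<le> B"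
    using assms(2,3) sup_norm_least [of \<Omega> "\<lambda>z. \<phi> z - \<psi> z" B] by (simp add: A_dist_def)
qed

lemma A_set_eqI:
  fixes \<Omega> :: "(complex^'m) set"
  assumes "\<phi> \<in> A_set \<Omega>" "\<psi> \<in> A_set \<Omega>" "\<And>z. z \<in> \<Omega> \<Longrightarrow> \<phi> z = \<psi> z"
  shows "\<phi> = \<psi>"
proof
  fix z
  show "\<phi> z = \<psi> z"
  proof (cases "z \<in> closure \<Omega>")
    case True
    have "continuous_on (closure \<Omega>) (\<lambda>z. \<phi> z - \<psi> z)"
      by (intro continuous_intros A_set_continuous assms)
    then have "\<phi> z - \<psi> z = 0"
      by (rule continuous_constant_on_closure [where S = \<Omega>]) (use assms True in auto)
    then show ?thesis by simp
  next
    case False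
    then show ?thesis using A_set_outside assms by metis
  qed
qed

lemma A_metric:
  fixes \<Omega> :: "(complex^'m) set"
  assumes b: "bounded \<Omega>"
  shows "Metric_space (A_set \<Omega>) (A_dist \<Omega>)"
proof (rule Metric_space.intro)
  fix \<phi> \<psi> :: "complex^'m \<Rightarrow> complex"
  show "0 \<le> A_dist \<Omega> \<phi> \<psi>"
    using A_dist_props(1) [OF b] by (cases "\<phi> \<in> A_set \<Omega> \<and> \<psi> \<in> A_set \<Omega>") (auto simp: A_dist_def)
  show "A_dist \<Omega> \<phi> \<psi> = A_dist \<Omega> \<psi> \<phi>"
    by (auto simp: A_dist_def sup_norm_def norm_minus_commute)
next
  fix \<phi> \<psi> assume A: "\<phi> \<in> A_set \<Omega>" "\<psi> \<in> A_set \<Omega>"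
  show "A_dist \<Omega> \<phi> \<psi> = 0 \<longleftrightarrow> \<phi> = \<psi>"
  proof
    assume "A_dist \<Omega> \<phi> \<psi> = 0"
    then have "\<phi> z = \<psi> z" if "z \<in> \<Omega>" for z using A_dist_props(2) [OF b A that] by simp
    then show "\<phi> = \<psi>" by (rule A_set_eqI [OF A])
  next
    assume "\<phi> = \<psi>"
    then have "A_dist \<Omega> \<phi> \<psi> \<le> 0" by (intro A_dist_props(3) [OF b A]) auto
    then show "A_dist \<Omega> \<phi> \<psi> = 0" using A_dist_props(1) [OF b A] by simp
  qed
next
  fix \<phi> \<psi> \<theta> assume A: "\<phi> \<in> A_set \<Omega>" "\<psi> \<in> A_set \<Omega>" "\<theta> \<in> A_set \<Omega>"
  show "A_dist \<Omega> \<phi> \<theta> \<le> A_dist \<Omega> \<phi> \<psi> + A_dist \<Omega> \<psi> \<theta>"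
  proof (rule A_dist_props(3) [OF b A(1,3)])
    fix z assume z: "z \<in> \<Omega>"
    have "cmod (\<phi> z - \<theta> z) \<le> cmod (\<phi> z - \<psi> z) + cmod (\<psi> z - \<theta> z)"
      using norm_triangle_ineq [of "\<phi> z - \<psi> z" "\<psi> z - \<theta> z"] by simp
    also have "\<dots> \<le> A_dist \<Omega> \<phi> \<psi> + A_dist \<Omega> \<psi> \<theta>"
      by (intro add_mono A_dist_props(2) [OF b] A z)
    finally show "cmod (\<phi> z - \<theta> z) \<le> A_dist \<Omega> \<phi> \<psi> + A_dist \<Omega> \<psi> \<theta>" .
  qed (use A_dist_props(1) [OF b A(1,2)] A_dist_props(1) [OF b A(2,3)] in simp)
qed

lemma A_ring_simps [simp]:
  "carrier (A_ring \<Omega>) = A_set \<Omega>" "mult (A_ring \<Omega>) = (\<lambda>\<phi> \<psi> z. \<phi> z * \<psi> z)"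
  "one (A_ring \<Omega>) = indicator (closure \<Omega>)" "zero (A_ring \<Omega>) = (\<lambda>z. 0)"
  "add (A_ring \<Omega>) = (\<lambda>\<phi> \<psi> z. \<phi> z + \<psi> z)"
  by (simp_all add: A_ring_def)

lemma A_module_of_simps [simp]:
  "carrier (A_module_of M) = carrier M" "zero (A_module_of M) = zero M"
  "add (A_module_of M) = add M" "smult (A_module_of M) = act M"
  by (simp_all add: A_module_of_def)

context hilbert_module
begin

lemma cring_A: "cring (A_ring \<Omega>)"
  using A_module by (simp add: module_def)

lemma A_closed:
  "indicator (closure \<Omega>) \<in> A_set \<Omega>" "(\<lambda>z. 0) \<in> A_set \<Omega>"
  "\<lbrakk>\<phi> \<in> A_set \<Omega>; \<psi> \<in> A_set \<Omega>\<rbrakk> \<Longrightarrow> (\<lambda>z. \<phi> z + \<psi> z) \<in> A_set \<Omega>"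
  "\<lbrakk>\<phi> \<in> A_set \<Omega>; \<psi> \<in> A_set \<Omega>\<rbrakk> \<Longrightarrow> (\<lambda>z. \<phi> z * \<psi> z) \<in> A_set \<Omega>"
proof -
  interpret A: cring "A_ring \<Omega>" by (rule cring_A)
  show "indicator (closure \<Omega>) \<in> A_set \<Omega>" "(\<lambda>z. 0) \<in> A_set \<Omega>"
    "\<lbrakk>\<phi> \<in> A_set \<Omega>; \<psi> \<in> A_set \<Omega>\<rbrakk> \<Longrightarrow> (\<lambda>z. \<phi> z + \<psi> z) \<in> A_set \<Omega>"
    "\<lbrakk>\<phi> \<in> A_set \<Omega>; \<psi> \<in> A_set \<Omega>\<rbrakk> \<Longrightarrow> (\<lambda>z. \<phi> z * \<psi> z) \<in> A_set \<Omega>"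
    using A.one_closed A.zero_closed A.a_closed [of \<phi> \<psi>] A.m_closed [of \<phi> \<psi>] by auto
qed

lemma act_in [simp]: "\<lbrakk>\<phi> \<in> A_set \<Omega>; x \<in> carrier M\<rbrakk> \<Longrightarrow> act M \<phi> x \<in> carrier M"
  using Module.module.smult_closed [OF A_module, of \<phi> x] by simp

lemma act_add:
  "\<lbrakk>\<phi> \<in> A_set \<Omega>; x \<in> carrier M; y \<in> carrier M\<rbrakk> \<Longrightarrow> act M \<phi> (x \<oplus> y) = act M \<phi> x \<oplus> act M \<phi> y"
  using Module.module.smult_r_distr [OF A_module, of \<phi> x y] by simp

lemma act_add_left: "\<lbrakk>\<phi> \<in> A_set \<Omega>; \<psi> \<in> A_set \<Omega>; x \<in> carrier M\<rbrakk> \<Longrightarrow>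
    act M (\<lambda>z. \<phi> z + \<psi> z) x = act M \<phi> x \<oplus> act M \<psi> x"
  using Module.module.smult_l_distr [OF A_module, of \<phi> \<psi> x] by simp

lemma act_mult: "\<lbrakk>\<phi> \<in> A_set \<Omega>; \<psi> \<in> A_set \<Omega>; x \<in> carrier M\<rbrakk> \<Longrightarrow>
    act M (\<lambda>z. \<phi> z * \<psi> z) x = act M \<phi> (act M \<psi> x)"
  using Module.module.smult_assoc1 [OF A_module, of \<phi> \<psi> x] by simp

lemma act_one: "x \<in> carrier M \<Longrightarrow> act M (indicator (closure \<Omega>)) x = x"
  using Module.module.smult_one [OF A_module, of x] by simp

text \<open>
  Scalars act like the constant functions of the algebra, whose multiplication commutes with that of
  \<open>\<phi>\<close>.
\<close>

lemma act_smult: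
  assumes \<phi>: "\<phi> \<in> A_set \<Omega>" and x: "x \<in> carrier M"
  shows "act M \<phi> (c \<odot> x) = c \<odot> act M \<phi> x"
proof -
  define \<kappa> :: "complex^'m \<Rightarrow> complex" where "\<kappa> = (\<lambda>z. c * indicator (closure \<Omega>) z)"
  have \<kappa>: "\<kappa> \<in> A_set \<Omega>" unfolding \<kappa>_def by (rule A_set_smult [OF A_closed(1)])
  have "act M \<phi> (c \<odot> x) = act M \<phi> (act M \<kappa> x)"
    using act_scale [OF A_closed(1) x, of c] by (simp add: \<kappa>_def act_one [OF x])
  also have "\<dots> = act M (\<lambda>z. \<phi> z * \<kappa> z) x" by (rule act_mult [OF \<phi> \<kappa> x, symmetric])
  also have "(\<lambda>z. \<phi> z * \<kappa> z) = (\<lambda>z. c * \<phi> z)"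
    using A_set_outside [OF \<phi>] by (auto simp: \<kappa>_def fun_eq_iff indicator_def)
  also have "act M (\<lambda>z. c * \<phi> z) x = c \<odot> act M \<phi> x" by (rule act_scale [OF \<phi> x])
  finally show ?thesis .
qed

lemma act_zero: "\<phi> \<in> A_set \<Omega> \<Longrightarrow> act M \<phi> \<zero> = \<zero>"
  using act_smult [of \<phi> \<zero> 0] by simp

lemma linear_map_act: "\<phi> \<in> A_set \<Omega> \<Longrightarrow> linear_map M M (carrier M) (act M \<phi>)"
  by (intro linear_map.intro linear_map_axioms.intro inner_product_space_axioms
      carrier_is_submodule linear_map_onI) (simp_all add: act_add act_smult)

text \<open>
  Joint continuity at \<open>(\<phi>, 0)\<close> provides a ball that is mapped into the unit ball.
\<close>

lemma act_bounded:
  assumes b: "bounded \<Omega>" and \<phi>: "\<phi> \<in> A_set \<Omega>"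
  obtains B where "0 \<le> B" "\<And>x. x \<in> carrier M \<Longrightarrow> hnorm M (act M \<phi> x) \<le> B * hnorm M x"
proof -
  have topA: "topspace (A_top \<Omega>) = A_set \<Omega>"
    unfolding A_top_def by (rule Metric_space.topspace_mtopology [OF A_metric [OF b]])
  have "continuous_map (htop M) (prod_topology (A_top \<Omega>) (htop M)) (\<lambda>x. (\<phi>, x))"
    unfolding continuous_map_pairwise o_def using \<phi> topA by simp
  then have "continuous_map (htop M) (htop M) ((\<lambda>(\<phi>, x). act M \<phi> x) \<circ> (\<lambda>x. (\<phi>, x)))"
    by (rule continuous_map_compose [OF _ act_continuous])
  then have cont: "continuous_map (htop M) (htop M) (act M \<phi>)" by (simp add: o_def)
  define V where "V = {x \<in> carrier M. hnorm M x < 1}"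
  have ball: "Metric_space.mball (carrier M) (hdist M) \<zero> r = {x \<in> carrier M. hnorm M x < r}" for r
    using Metric_space.in_mball [OF metric, of _ \<zero> r] hnorm_minus_commute [of \<zero>]
    by (auto simp: hdist_def)
  have "openin (htop M) V"
    unfolding V_def ball [symmetric] htop_def by (rule Metric_space.openin_mball [OF metric])
  then have "openin (htop M) {x \<in> carrier M. act M \<phi> x \<in> V}"
    using openin_continuous_map_preimage [OF cont] by simp
  moreover have "\<zero> \<in> {x \<in> carrier M. act M \<phi> x \<in> V}" using act_zero [OF \<phi>] by (simp add: V_def)
  ultimately obtain d where d: "d > 0" "{x \<in> carrier M. hnorm M x < d} \<subseteq> {x \<in> carrier M. act M \<phi> x \<in> V}"
    unfolding htop_def Metric_space.openin_mtopology [OF metric] ball [symmetric] by blast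
  have "hnorm M (act M \<phi> x) \<le> (2 / d) * hnorm M x" if x: "x \<in> carrier M" for x
  proof (cases "hnorm M x = 0")
    case True
    then have "x = \<zero>" using x hnorm_eq_zero by blast
    then show ?thesis using act_zero [OF \<phi>] by simp
  next
    case False
    then have n: "hnorm M x > 0" using hnorm_nonneg [OF x] by linarith
    define c where "c = complex_of_real (d / (2 * hnorm M x))"
    have cn: "cmod c = d / (2 * hnorm M x)" using d(1) n by (simp add: c_def norm_divide)
    have "hnorm M (c \<odot> x) = d / 2" using x n by (simp add: hnorm_smult cn)
    then have "c \<odot> x \<in> {x \<in> carrier M. act M \<phi> x \<in> V}" using d x by (intro subsetD [OF d(2)]) simp
    then have "hnorm M (c \<odot> act M \<phi> x) < 1" using x by (simp add: V_def act_smult [OF \<phi> x])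
    then have "d / (2 * hnorm M x) * hnorm M (act M \<phi> x) < 1" using x \<phi> by (simp add: hnorm_smult cn)
    then show ?thesis using n d(1) by (simp add: field_simps)
  qed
  then show thesis using that [of "2 / d"] d(1) by simp
qed

end

text \<open>
  The estimate splits \<open>\<psi> y - \<phi> x\<close> into \<open>(\<psi> - \<phi>) y\<close> and \<open>\<phi> (y - x)\<close>.
\<close>

lemma act_continuousI:
  fixes \<Omega> :: "(complex^'m) set"
  assumes b: "bounded \<Omega>" and M: "inner_product_space M"
    and act_in: "\<And>\<phi> x. \<lbrakk>\<phi> \<in> A_set \<Omega>; x \<in> carrier M\<rbrakk> \<Longrightarrow> act M \<phi> x \<in> carrier M"
    and est: "\<And>\<phi> \<psi> x y. \<lbrakk>\<phi> \<in> A_set \<Omega>; \<psi> \<in> A_set \<Omega>; x \<in> carrier M; y \<in> carrier M\<rbrakk> \<Longrightarrow>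
       hnorm M (act M \<psi> y \<ominus>\<^bsub>M\<^esub> act M \<phi> x) \<le>
         A_dist \<Omega> \<phi> \<psi> * hnorm M y + sup_norm \<Omega> \<phi> * hnorm M (x \<ominus>\<^bsub>M\<^esub> y)"
  shows "continuous_map (prod_topology (A_top \<Omega>) (htop M)) (htop M) (\<lambda>(\<phi>, x). act M \<phi> x)"
proof -
  interpret M: inner_product_space M by fact
  note AM = A_metric [OF b]
  have topA: "topspace (A_top \<Omega>) = A_set \<Omega>"
    unfolding A_top_def by (rule Metric_space.topspace_mtopology [OF AM])
  have "openin (prod_topology (A_top \<Omega>) (htop M)) {p \<in> A_set \<Omega> \<times> carrier M. (\<lambda>(\<phi>, x). act M \<phi> x) p \<in> U}"
    if U: "openin (htop M) U" for U
    unfolding openin_prod_topology_alt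
  proof (intro allI impI)
    fix \<phi> x assume "(\<phi>, x) \<in> {p \<in> A_set \<Omega> \<times> carrier M. (\<lambda>(\<phi>, x). act M \<phi> x) p \<in> U}"
    then have \<phi>: "\<phi> \<in> A_set \<Omega>" and x: "x \<in> carrier M" and xU: "act M \<phi> x \<in> U" by auto
    obtain r where r: "r > 0" "Metric_space.mball (carrier M) (hdist M) (act M \<phi> x) r \<subseteq> U"
      using U xU unfolding htop_def Metric_space.openin_mtopology [OF M.metric] by blast
    define d where "d = min 1 (r / (hnorm M x + 1 + sup_norm \<Omega> \<phi>))"
    have s0: "0 \<le> sup_norm \<Omega> \<phi>" by (rule A_set_sup_norm(1) [OF b \<phi>])
    have pos: "hnorm M x + 1 + sup_norm \<Omega> \<phi> > 0" using s0 M.hnorm_nonneg [OF x] by linarith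
    have d: "d > 0" "d \<le> 1" using r(1) pos by (simp_all add: d_def)
    have d3: "d * (hnorm M x + 1 + sup_norm \<Omega> \<phi>) \<le> r"
    proof -
      have "d \<le> r / (hnorm M x + 1 + sup_norm \<Omega> \<phi>)" by (simp add: d_def)
      then show ?thesis by (simp only: pos_le_divide_eq [OF pos])
    qed
    let ?V = "Metric_space.mball (A_set \<Omega>) (A_dist \<Omega>) \<phi> d"
    let ?W = "Metric_space.mball (carrier M) (hdist M) x d"
    have "openin (A_top \<Omega>) ?V" unfolding A_top_def by (rule Metric_space.openin_mball [OF AM])
    moreover have "openin (htop M) ?W" unfolding htop_def by (rule Metric_space.openin_mball [OF M.metric])
    moreover have "\<phi> \<in> ?V" "x \<in> ?W"
      using d \<phi> x by (simp_all add: Metric_space.centre_in_mball_iff [OF AM] Metric_space.centre_in_mball_iff [OF M.metric])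
    moreover have "?V \<times> ?W \<subseteq> {p \<in> A_set \<Omega> \<times> carrier M. (\<lambda>(\<phi>, x). act M \<phi> x) p \<in> U}"
    proof (clarify)
      fix \<psi> y assume "\<psi> \<in> ?V" "y \<in> ?W"
      then have \<psi>: "\<psi> \<in> A_set \<Omega>" "A_dist \<Omega> \<phi> \<psi> < d" and y: "y \<in> carrier M" "hnorm M (x \<ominus>\<^bsub>M\<^esub> y) < d"
        using x by (auto simp: Metric_space.in_mball [OF AM] Metric_space.in_mball [OF M.metric] hdist_def)
      have ny: "hnorm M y \<le> hnorm M x + 1"
        using M.hnorm_diff_le [OF x y(1)] y(2) d(2) by linarith
      have "hnorm M (act M \<psi> y \<ominus>\<^bsub>M\<^esub> act M \<phi> x) \<le> A_dist \<Omega> \<phi> \<psi> * hnorm M y + sup_norm \<Omega> \<phi> * hnorm M (x \<ominus>\<^bsub>M\<^esub> y)"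
        by (rule est [OF \<phi> \<psi>(1) x y(1)])
      also have "\<dots> \<le> A_dist \<Omega> \<phi> \<psi> * (hnorm M x + 1) + sup_norm \<Omega> \<phi> * d"
        using ny y s0 A_dist_props(1) [OF b \<phi> \<psi>(1)] by (intro add_mono mult_left_mono) auto
      also have "\<dots> < d * (hnorm M x + 1) + sup_norm \<Omega> \<phi> * d"
        using \<psi>(2) M.hnorm_nonneg [OF x] by (intro add_strict_right_mono mult_strict_right_mono) auto
      also have "\<dots> \<le> r" using d3 by (simp add: algebra_simps)
      finally have "hnorm M (act M \<psi> y \<ominus>\<^bsub>M\<^esub> act M \<phi> x) < r" .
      then have "act M \<psi> y \<in> U"
        using r(2) M.hnorm_minus_commute [OF act_in [OF \<psi>(1) y(1)] act_in [OF \<phi> x]] act_in [OF \<psi>(1) y(1)] act_in [OF \<phi> x]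
        by (auto simp: Metric_space.in_mball [OF M.metric] hdist_def subset_iff)
      then show "(\<psi>, y) \<in> A_set \<Omega> \<times> carrier M \<and> act M \<psi> y \<in> U" using \<psi> y by blast
    qed
    ultimately show "\<exists>V W. openin (A_top \<Omega>) V \<and> openin (htop M) W \<and> \<phi> \<in> V \<and> x \<in> W \<and>
        V \<times> W \<subseteq> {p \<in> A_set \<Omega> \<times> carrier M. (\<lambda>(\<phi>, x). act M \<phi> x) p \<in> U}" by blast
  qed
  then show ?thesis
    unfolding continuous_map_def using act_in topA by auto
qed

section \<open>Fibres and a criterion for quasi-freeness\<close>

lemma htensor_simps:
  "add (htensor M N) = (\<lambda>T S. \<lambda>n\<in>carrier N. T n \<oplus>\<^bsub>M\<^esub> S n)"
  "zero (htensor M N) = (\<lambda>n\<in>carrier N. \<zero>\<^bsub>M\<^esub>)"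
  "smult (htensor M N) = (\<lambda>c T. \<lambda>n\<in>carrier N. c \<odot>\<^bsub>M\<^esub> T n)"
  "cinner (htensor M N) = (\<lambda>T S. \<Sum>\<^sub>\<infinity>e\<in>some_onb N. cinner M (T e) (S e))"
  "act (htensor M N) = (\<lambda>\<phi> T. \<lambda>n\<in>carrier N. act M \<phi> (T n))"
  by (simp_all add: htensor_def)

lemma htensor_carrierI:
  assumes "T \<in> carrier N \<rightarrow>\<^sub>E carrier M"
    "\<And>x y. \<lbrakk>x \<in> carrier N; y \<in> carrier N\<rbrakk> \<Longrightarrow> T (x \<oplus>\<^bsub>N\<^esub> y) = T x \<oplus>\<^bsub>M\<^esub> T y"
    "\<And>c x. x \<in> carrier N \<Longrightarrow> T (c \<odot>\<^bsub>N\<^esub> x) = cnj c \<odot>\<^bsub>M\<^esub> T x"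
    "\<And>x. x \<in> carrier N \<Longrightarrow> hnorm M (T x) \<le> B * hnorm N x"
    "(\<lambda>e. (hnorm M (T e))\<^sup>2) summable_on some_onb N"
  shows "T \<in> carrier (htensor M N)"
proof -
  have "\<exists>B. \<forall>x\<in>carrier N. hnorm M (T x) \<le> B * hnorm N x" using assms(4) by blast
  then show ?thesis using assms(1-3,5) by (simp add: htensor_def)
qed

lemma restrict_UNIV_fun [simp]: "restrict f UNIV = f"
  by (simp add: fun_eq_iff)

text \<open>
  A conjugate-linear map on \<open>\<complex>\<close> is determined by its value at 1, so the tensor product of \<open>M\<close> with a
  point module is an isometric copy of \<open>M\<close> via \<open>T \<mapsto> T 1\<close>, with inverse \<open>tens\<close>.
\<close>

locale point_tensor = hilbert_space M
  for M :: "(complex^'m \<Rightarrow> complex, 'a, 'x) hmodule_scheme" (structure) +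
  fixes z :: "complex^'m"
begin

abbreviation "P \<equiv> point_module z"
abbreviation "N \<equiv> htensor M P"

lemma elem_tensor_point: "elem_tensor M P f g = (\<lambda>n. (g * cnj n) \<odot> f)"
  by (simp add: elem_tensor_def)

definition tens :: "'a \<Rightarrow> complex \<Rightarrow> 'a" where "tens f = (\<lambda>n. cnj n \<odot> f)"

lemma tens_eq: "elem_tensor M P f 1 = tens f"
  by (simp add: elem_tensor_point tens_def)

lemma elem_tensor_eq: "f \<in> carrier M \<Longrightarrow> elem_tensor M P f g = tens (g \<odot> f)"
  by (simp add: elem_tensor_point tens_def smult_smult mult.commute)

lemma tens_in: "f \<in> carrier M \<Longrightarrow> tens f \<in> carrier N"
proof (rule htensor_carrierI)
  assume f: "f \<in> carrier M"
  show "tens f \<in> carrier P \<rightarrow>\<^sub>E carrier M"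
    by (rule PiE_I) (use f in \<open>simp_all add: tens_def\<close>)
  show "tens f (x \<oplus>\<^bsub>P\<^esub> y) = tens f x \<oplus> tens f y" for x y
    using f by (simp add: tens_def smult_add_left)
  show "tens f (c \<odot>\<^bsub>P\<^esub> x) = cnj c \<odot> tens f x" for c x
    using f by (simp add: tens_def smult_smult)
  show "hnorm M (tens f x) \<le> hnorm M f * hnorm P x" for x
    using f by (simp add: tens_def hnorm_smult)
  obtain u where u: "some_onb P = {u}" using some_onb_point_module [of z] by blast
  show "(\<lambda>e. (hnorm M (tens f e))\<^sup>2) summable_on some_onb P"
    unfolding u by (rule summable_on_finite) (rule finite.intros finite.emptyI)+
qed

lemma N_E:
  assumes "T \<in> carrier N"
  shows "T 1 \<in> carrier M" "T = tens (T 1)"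
proof -
  show "T 1 \<in> carrier M" using assms by (auto simp: htensor_def)
  have *: "\<forall>c x. T (c * x) = cnj c \<odot> T x" using assms by (simp add: htensor_def)
  have "T n = cnj n \<odot> T 1" for n
    using spec [OF spec [OF *, of n], of 1] unfolding mult_1_right .
  then show "T = tens (T 1)" unfolding tens_def by (rule ext)
qed

lemma tens_1 [simp]: "f \<in> carrier M \<Longrightarrow> tens f 1 = f"
  by (simp add: tens_def)

lemma N_cinner:
  assumes "T \<in> carrier N" "S \<in> carrier N"
  shows "cinner N T S = cinner M (T 1) (S 1)"
proof -
  obtain u where u: "cmod u = 1" "some_onb P = {u}" using some_onb_point_module [of z] by blast
  note T = N_E [OF assms(1)] and S = N_E [OF assms(2)]
  have "u * cnj u = 1"
    using complex_norm_square [of u] u(1) by simp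
  moreover have "T u = cnj u \<odot> T 1" "S u = cnj u \<odot> S 1"
    using fun_cong [OF T(2), of u] fun_cong [OF S(2), of u] by (simp_all only: tens_def)
  ultimately show ?thesis
    using T(1) S(1) u(2)
    by (simp add: htensor_simps cinner_smult_right ip_smult_left mult.assoc [symmetric])
qed

lemma N_ops:
  "\<lbrakk>T \<in> carrier N; S \<in> carrier N\<rbrakk> \<Longrightarrow> T \<oplus>\<^bsub>N\<^esub> S = tens (T 1 \<oplus> S 1)"
  "T \<in> carrier N \<Longrightarrow> c \<odot>\<^bsub>N\<^esub> T = tens (c \<odot> T 1)"
  "\<zero>\<^bsub>N\<^esub> = tens \<zero>"
proof -
  show "T \<oplus>\<^bsub>N\<^esub> S = tens (T 1 \<oplus> S 1)" if "T \<in> carrier N" "S \<in> carrier N"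
  proof -
    note T = N_E [OF that(1)] and S = N_E [OF that(2)]
    have *: "T n \<oplus> S n = cnj n \<odot> (T 1 \<oplus> S 1)" for n
      using smult_add_right [OF T(1) S(1), of "cnj n"] fun_cong [OF T(2), of n] fun_cong [OF S(2), of n]
      by (simp only: tens_def)
    show ?thesis
      unfolding htensor_simps tens_def point_module_simps restrict_UNIV_fun by (rule ext) (rule *)
  qed
  show "c \<odot>\<^bsub>N\<^esub> T = tens (c \<odot> T 1)" if "T \<in> carrier N"
  proof -
    note T = N_E [OF that]
    have *: "c \<odot> T n = cnj n \<odot> (c \<odot> T 1)" for n
      using smult_smult [OF T(1), of c "cnj n"] smult_smult [OF T(1), of "cnj n" c]
        fun_cong [OF T(2), of n] by (simp only: tens_def mult.commute)
    show ?thesis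
      unfolding htensor_simps tens_def point_module_simps restrict_UNIV_fun by (rule ext) (rule *)
  qed
  show "\<zero>\<^bsub>N\<^esub> = tens \<zero>" by (simp add: htensor_simps tens_def)
qed

lemma hilbert_space_N: "hilbert_space N"
proof (rule hilbert_space_by_isometry [where J = "\<lambda>T. T 1", OF hilbert_space_axioms])
  show "inj_on (\<lambda>T. T 1) (carrier N)"
  proof (rule inj_onI)
    fix T S assume T: "T \<in> carrier N" and S: "S \<in> carrier N" and eq: "T 1 = S 1"
    have "T = tens (T 1)" by (rule N_E(2) [OF T])
    also have "\<dots> = tens (S 1)" by (simp only: eq)
    also have "\<dots> = S" by (rule N_E(2) [OF S, symmetric])
    finally show "T = S" .
  qed
  show "T 1 \<in> carrier M" if "T \<in> carrier N" for T by (rule N_E(1) [OF that])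
  show "\<zero>\<^bsub>N\<^esub> \<in> carrier N" "\<zero>\<^bsub>N\<^esub> 1 = \<zero>" by (simp_all add: N_ops tens_in)
  show "T \<oplus>\<^bsub>N\<^esub> S \<in> carrier N" "(T \<oplus>\<^bsub>N\<^esub> S) 1 = T 1 \<oplus> S 1" if "T \<in> carrier N" "S \<in> carrier N" for T S
    using that by (simp_all add: N_ops N_E(1) tens_in)
  show "c \<odot>\<^bsub>N\<^esub> T \<in> carrier N" "(c \<odot>\<^bsub>N\<^esub> T) 1 = c \<odot> T 1" if "T \<in> carrier N" for c T
    using that by (simp_all add: N_ops N_E(1) tens_in)
  show "cinner N T S = cinner M (T 1) (S 1)" if "T \<in> carrier N" "S \<in> carrier N" for T S
    by (rule N_cinner [OF that])
  have "(\<lambda>T. T 1) ` carrier N = carrier M"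
  proof (intro Set.set_eqI iffI)
    fix f assume "f \<in> carrier M"
    then show "f \<in> (\<lambda>T. T 1) ` carrier N" by (intro image_eqI [of _ _ "tens f"]) (simp_all add: tens_in)
  qed (auto simp: N_E(1))
  then show "closedin (htop M) ((\<lambda>T. T 1) ` carrier N)"
    by (simp add: closedin_iff)
qed

lemma N_hnorm: "T \<in> carrier N \<Longrightarrow> hnorm N T = hnorm M (T 1)"
  by (simp add: hnorm_def N_cinner)

end

text \<open>
  The fibre at \<open>z\<close> is the quotient of \<open>M\<close> by the closed span of all \<open>\<phi> f - \<phi> z f\<close>, in the form that
  the tensor product gives to it; \<open>pr\<close> is the quotient map.
\<close>

locale fibre_at = hilbert_module \<Omega> M
  for \<Omega> :: "(complex^'m) set" and M :: "(complex^'m \<Rightarrow> complex, 'a, 'x) hmodule_scheme" (structure) +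
  fixes z :: "complex^'m"
  assumes bounded: "bounded \<Omega>"
begin

sublocale pt: point_tensor M z
  by (rule point_tensor.intro [OF hilbert_space_axioms])

abbreviation "N \<equiv> htensor M (point_module z)"
abbreviation "S \<equiv> A_relations \<Omega> M (point_module z)"

sublocale N: hilbert_space N
  by (rule pt.hilbert_space_N)

lemma act_N: "\<lbrakk>\<phi> \<in> A_set \<Omega>; T \<in> carrier N\<rbrakk> \<Longrightarrow> act N \<phi> T = pt.tens (act M \<phi> (T 1))"
proof -
  assume \<phi>: "\<phi> \<in> A_set \<Omega>" and T: "T \<in> carrier N"
  note E = pt.N_E [OF T]
  have *: "act M \<phi> (T n) = cnj n \<odot> act M \<phi> (T 1)" for n
    using act_smult [OF \<phi> E(1), of "cnj n"] fun_cong [OF E(2), of n] by (simp only: pt.tens_def)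
  show ?thesis
    unfolding htensor_simps pt.tens_def point_module_simps restrict_UNIV_fun by (rule ext) (rule *)
qed

abbreviation "relators \<equiv> {elem_tensor M (point_module z) (act M \<phi> f) g \<ominus>\<^bsub>N\<^esub>
    elem_tensor M (point_module z) f (act (point_module z) \<phi> g) | \<phi> f g.
    \<phi> \<in> A_set \<Omega> \<and> f \<in> carrier M \<and> g \<in> carrier (point_module z)}"

lemma S_eq: "S = \<Inter>{V. closed_submodule \<Omega> N V \<and> relators \<subseteq> V}"
  by (simp add: A_relations_def closed_submodule_gen_def)

lemma closed_submodule_carrier: "closed_submodule \<Omega> N (carrier N)"
  unfolding closed_submodule_def
  using N.carrier_is_submodule by (auto simp: N.closedin_iff act_N pt.tens_in pt.N_E(1))

lemma relators_in: "relators \<subseteq> carrier N"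
  by (auto simp: pt.elem_tensor_eq pt.tens_in intro!: N.minus_closed)

lemma S_nonempty: "{V. closed_submodule \<Omega> N V \<and> relators \<subseteq> V} \<noteq> {}"
  using closed_submodule_carrier relators_in by blast

sublocale fq: hilbert_quotient N S
proof (intro hilbert_quotient.intro hilbert_quotient_axioms.intro N.hilbert_space_axioms)
  let ?\<V> = "{V. closed_submodule \<Omega> N V \<and> relators \<subseteq> V}"
  have sub: "submodule V complex_ring N" if "V \<in> ?\<V>" for V
    using that by (simp add: closed_submodule_def)
  have in_car: "\<Inter>?\<V> \<subseteq> carrier N"
    using closed_submodule_carrier relators_in by blast
  have zero: "\<zero>\<^bsub>N\<^esub> \<in> \<Inter>?\<V>"
    by (rule InterI) (rule N.submoduleD(2) [OF sub])
  have add: "x \<oplus>\<^bsub>N\<^esub> y \<in> \<Inter>?\<V>" if "x \<in> \<Inter>?\<V>" "y \<in> \<Inter>?\<V>" for x y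
    by (rule InterI, rule N.submoduleD(3) [OF sub]) (use that in blast)+
  have smult: "c \<odot>\<^bsub>N\<^esub> x \<in> \<Inter>?\<V>" if "x \<in> \<Inter>?\<V>" for c x
    by (rule InterI, rule N.submoduleD(4) [OF sub]) (use that in blast)+
  show "submodule S complex_ring N"
    unfolding S_eq N.submodule_iff by (intro conjI ballI allI in_car zero add smult)
  show "closedin (htop N) S"
    unfolding S_eq by (rule closedin_Inter [OF S_nonempty]) (auto simp: closed_submodule_def)
qed

lemma relators_subset: "relators \<subseteq> S"
  unfolding S_eq by blast

lemma S_least: "\<lbrakk>closed_submodule \<Omega> N V; relators \<subseteq> V\<rbrakk> \<Longrightarrow> S \<subseteq> V"
  unfolding S_eq by blast

abbreviation "F \<equiv> fibre \<Omega> M z"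
abbreviation "pr \<equiv> at_point \<Omega> M z"

lemma F_eq: "F = hquotient N S"
  by (simp add: A_tensor_def)

lemma pr_eq: "pr f = S +>\<^bsub>N\<^esub> pt.tens f"
  by (simp add: A_elem_tensor_def pt.tens_eq)

lemma inner_product_space_F: "inner_product_space F"
  unfolding F_eq by (rule fq.inner_product_space_Q)

sublocale F: inner_product_space F
  by (rule inner_product_space_F)

lemma linear_map_on_pr: "linear_map_on (carrier M) M F pr"
proof (rule linear_map_onI)
  fix x assume x: "x \<in> carrier M"
  show "pr x \<in> carrier F" using x by (simp add: pr_eq F_eq pt.tens_in)
  show "pr (c \<odot> x) = c \<odot>\<^bsub>F\<^esub> pr x" for c
    using x pt.N_ops(2) [OF pt.tens_in [OF x], of c] by (simp add: pr_eq F_eq fq.smult_Q pt.tens_in)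
  fix y assume y: "y \<in> carrier M"
  show "pr (x \<oplus> y) = pr x \<oplus>\<^bsub>F\<^esub> pr y"
    using x y pt.N_ops(1) [OF pt.tens_in [OF x] pt.tens_in [OF y]]
    by (simp add: pr_eq F_eq fq.add_Q pt.tens_in)
qed

sublocale pr: linear_map M F "carrier M" pr
  by (intro linear_map.intro linear_map_axioms.intro inner_product_space_axioms inner_product_space_F
      carrier_is_submodule linear_map_on_pr)

lemma hnorm_pr_le: "x \<in> carrier M \<Longrightarrow> hnorm F (pr x) \<le> hnorm M x"
  using fq.hnorm_coset_le [OF pt.tens_in, of x] by (simp add: pr_eq F_eq pt.N_hnorm pt.tens_in)

lemma pr_surj: "X \<in> carrier F \<Longrightarrow> \<exists>x\<in>carrier M. X = pr x"
proof -
  assume "X \<in> carrier F"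
  then obtain T where T: "T \<in> carrier N" "X = S +>\<^bsub>N\<^esub> T" unfolding F_eq fq.carrier_Q by blast
  have "X = pr (T 1)" unfolding pr_eq T(2) by (rule arg_cong [OF pt.N_E(2) [OF T(1)]])
  then show ?thesis using pt.N_E(1) [OF T(1)] by blast
qed

lemma pr_act:
  assumes \<phi>: "\<phi> \<in> A_set \<Omega>" and x: "x \<in> carrier M"
  shows "pr (act M \<phi> x) = \<phi> z \<odot>\<^bsub>F\<^esub> pr x"
proof -
  have "elem_tensor M (point_module z) (act M \<phi> x) 1 \<ominus>\<^bsub>N\<^esub>
      elem_tensor M (point_module z) x (act (point_module z) \<phi> 1) \<in> S"
    by (rule subsetD [OF relators_subset])
      (use \<phi> x in \<open>auto intro!: exI [of _ \<phi>] exI [of _ x] exI [of _ 1]\<close>)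
  then have "pt.tens (act M \<phi> x) \<ominus>\<^bsub>N\<^esub> pt.tens (\<phi> z \<odot> x) \<in> S"
    using \<phi> x by (simp add: pt.elem_tensor_eq)
  then have "pr (act M \<phi> x) = pr (\<phi> z \<odot> x)"
    using \<phi> x by (simp add: pr_eq fq.coset_eq_iff pt.tens_in)
  then show ?thesis using x by (simp add: pr.T_smult)
qed

text \<open>
  A bounded map \<open>E\<close> on which \<open>\<phi>\<close> acts by the number \<open>\<phi> z\<close> kills all relators, and the kernel of
  \<open>E\<close> is a closed submodule. So \<open>E\<close> descends to the fibre, with the same bound.
\<close>

lemma functional_on_fibre:
  assumes E: "linear_map_on (carrier M) M l2 E"
    and bd: "\<And>x. x \<in> carrier M \<Longrightarrow> hnorm l2 (E x) \<le> B * hnorm M x"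
    and eq: "\<And>\<phi> x. \<lbrakk>\<phi> \<in> A_set \<Omega>; x \<in> carrier M\<rbrakk> \<Longrightarrow> E (act M \<phi> x) = \<phi> z \<odot>\<^bsub>l2\<^esub> E x"
  obtains G where "linear_map_on (carrier F) F l2 G"
    "\<And>x. x \<in> carrier M \<Longrightarrow> G (pr x) = E x"
    "\<And>X. X \<in> carrier F \<Longrightarrow> hnorm l2 (G X) \<le> B * hnorm F X"
proof -
  interpret E: linear_map M l2 "carrier M" E
    by (intro linear_map.intro linear_map_axioms.intro inner_product_space_axioms
        inner_product_space_l2 carrier_is_submodule E)
  have E1: "linear_map_on (carrier N) N l2 (\<lambda>T. E (T 1))"
    by (rule linear_map_onI)
      (simp_all add: pt.N_ops pt.N_E(1) E.T_add E.T_smult del: l2_simps)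
  interpret E1: linear_map N l2 "carrier N" "\<lambda>T. E (T 1)"
    by (intro linear_map.intro linear_map_axioms.intro N.inner_product_space_axioms
        inner_product_space_l2 N.carrier_is_submodule E1)
  define V where "V = {T \<in> carrier N. E (T 1) = \<zero>\<^bsub>l2\<^esub>}"
  have "closed_submodule \<Omega> N V"
    unfolding closed_submodule_def
  proof (intro conjI ballI)
    show "submodule V complex_ring N" unfolding V_def by (rule E1.submodule_kernel)
    show "closedin (htop N) V"
      unfolding V_def
      by (rule E1.closedin_kernel [where B = B])
        (use bd in \<open>auto simp: pt.N_hnorm pt.N_E(1) N.closedin_iff\<close>)
    fix \<phi> T assume \<phi>: "\<phi> \<in> A_set \<Omega>" and T: "T \<in> V"
    then have "T \<in> carrier N" "E (T 1) = \<zero>\<^bsub>l2\<^esub>" by (simp_all only: V_def mem_Collect_eq)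
    then show "act N \<phi> T \<in> V"
      unfolding V_def using \<phi> by (simp add: act_N pt.tens_in pt.N_E(1) eq)
  qed
  moreover have "relators \<subseteq> V"
  proof
    fix R assume R: "R \<in> relators"
    then obtain \<phi> f g where \<phi>: "\<phi> \<in> A_set \<Omega>" and f: "f \<in> carrier M"
      and Req: "R = pt.tens (g \<odot> act M \<phi> f) \<ominus>\<^bsub>N\<^esub> pt.tens ((\<phi> z * g) \<odot> f)"
      by (auto simp: pt.elem_tensor_eq)
    have "E (R 1) = E (g \<odot> act M \<phi> f) \<ominus>\<^bsub>l2\<^esub> E ((\<phi> z * g) \<odot> f)"
      using E1.T_minus [OF pt.tens_in pt.tens_in, of "g \<odot> act M \<phi> f" "(\<phi> z * g) \<odot> f"] \<phi> f
      by (simp add: Req)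
    also have "\<dots> = (g * \<phi> z) \<odot>\<^bsub>l2\<^esub> E f \<ominus>\<^bsub>l2\<^esub> (\<phi> z * g) \<odot>\<^bsub>l2\<^esub> E f"
      using \<phi> f by (simp add: E.T_smult eq l2.smult_smult del: l2_simps)
    also have "\<dots> = \<zero>\<^bsub>l2\<^esub>"
      using f by (simp add: mult.commute del: l2_simps)
    finally show "R \<in> V" using R relators_in unfolding V_def by blast
  qed
  ultimately have van: "E (T 1) = \<zero>\<^bsub>l2\<^esub>" if "T \<in> S" for T
    using S_least that unfolding V_def by blast
  define G where "G = (\<lambda>X. E (coset_rep N S X 1))"
  show thesis
  proof (rule that [of G])
    show "linear_map_on (carrier F) F l2 G"
      unfolding F_eq G_def by (rule fq.factor_through_Q(1) [where T = "\<lambda>T. E (T 1)", OF inner_product_space_l2 E1])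
        (rule van)
    show "G (pr x) = E x" if x: "x \<in> carrier M" for x
    proof -
      have "E (coset_rep N S (S +>\<^bsub>N\<^esub> pt.tens x) 1) = E (pt.tens x 1)"
        by (rule fq.factor_through_Q(2) [where T = "\<lambda>T. E (T 1)",
              OF inner_product_space_l2 E1 _ pt.tens_in [OF x]]) (rule van)
      then show ?thesis unfolding G_def pr_eq pt.tens_1 [OF x] .
    qed
    show "hnorm l2 (G X) \<le> B * hnorm F X" if X: "X \<in> carrier F" for X
    proof -
      obtain x where x: "x \<in> carrier M" "X = pr x" using pr_surj [OF X] by blast
      have r: "coset_rep N S X \<in> carrier N"
        using fq.coset_rep(2) [OF pt.tens_in [OF x(1)]] x(2) by (simp add: pr_eq)
      show ?thesis
        using bd [OF pt.N_E(1) [OF r]] pt.N_hnorm [OF r] fq.hnorm_Q [of X] by (simp add: G_def F_eq)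
    qed
  qed
qed

end

text \<open>
  The target of the maps \<open>X z\<close> in the definition of quasi-freeness is the tensor product of
  a point module with \<open>\<ell>\<^sup>2\<close>, whose elements are conjugate-linear functionals on \<open>\<ell>\<^sup>2\<close>. A vector of \<open>\<ell>\<^sup>2\<close>
  is turned into a functional by the inner product. Bessel's inequality for the unspecified
  orthonormal basis of \<open>\<ell>\<^sup>2\<close> shows that this does not increase the norm.
\<close>

lemma riesz_functional:
  fixes z :: "complex^'m"
  defines "W \<equiv> htensor (point_module z) l2"
  defines "\<Phi> \<equiv> \<lambda>v. \<lambda>n\<in>carrier l2. cinner l2 v n"
  shows "linear_map_on (carrier l2) l2 W \<Phi>"
    "\<And>v. v \<in> carrier l2 \<Longrightarrow> hnorm W (\<Phi> v) \<le> hnorm l2 v"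
    "\<Phi> (ell2_basis i) = elem_tensor (point_module z) l2 1 (ell2_basis i)"
proof -
  have onb: "some_onb l2 \<subseteq> carrier l2"
    "\<And>e e'. \<lbrakk>e \<in> some_onb l2; e' \<in> some_onb l2\<rbrakk> \<Longrightarrow> cinner l2 e e' = (if e = e' then 1 else 0)"
    using some_onb_l2 unfolding is_onb_def by blast+
  have bessel: "(\<Sum>e\<in>I. (cmod (cinner l2 v e))\<^sup>2) \<le> (hnorm l2 v)\<^sup>2"
    if "v \<in> carrier l2" "finite I" "I \<subseteq> some_onb l2" for v I
    by (rule l2.bessel_inequality) (use that onb in blast)+
  have sm: "(\<lambda>e. (cmod (cinner l2 v e))\<^sup>2) summable_on some_onb l2" if v: "v \<in> carrier l2" for v
    by (rule nonneg_bdd_above_summable_on) (use bessel [OF v] in \<open>auto intro!: bdd_aboveI\<close>)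
  show "linear_map_on (carrier l2) l2 W \<Phi>"
  proof (rule linear_map_onI)
    fix v assume v: "v \<in> carrier l2"
    show "\<Phi> v \<in> carrier W"
      unfolding W_def
    proof (rule htensor_carrierI)
      show "\<Phi> v \<in> carrier l2 \<rightarrow>\<^sub>E carrier (point_module z)" by (simp add: \<Phi>_def)
      show "\<Phi> v (x \<oplus>\<^bsub>l2\<^esub> y) = \<Phi> v x \<oplus>\<^bsub>point_module z\<^esub> \<Phi> v y" if "x \<in> carrier l2" "y \<in> carrier l2" for x y
        using that v by (simp add: \<Phi>_def l2.cinner_add_right del: l2_simps)
      show "\<Phi> v (c \<odot>\<^bsub>l2\<^esub> x) = cnj c \<odot>\<^bsub>point_module z\<^esub> \<Phi> v x" if "x \<in> carrier l2" for c x
        using that v by (simp add: \<Phi>_def l2.cinner_smult_right del: l2_simps)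
      show "hnorm (point_module z) (\<Phi> v x) \<le> hnorm l2 v * hnorm l2 x" if "x \<in> carrier l2" for x
        using that l2.cauchy_schwarz [OF v that] by (simp add: \<Phi>_def del: l2_simps)
      have "(\<lambda>e. (hnorm (point_module z) (\<Phi> v e))\<^sup>2) summable_on some_onb l2 \<longleftrightarrow>
          (\<lambda>e. (cmod (cinner l2 v e))\<^sup>2) summable_on some_onb l2"
        by (rule summable_on_cong) (use onb(1) in \<open>auto simp: \<Phi>_def simp del: l2_simps\<close>)
      then show "(\<lambda>e. (hnorm (point_module z) (\<Phi> v e))\<^sup>2) summable_on some_onb l2" using sm [OF v] by simp
    qed
    show "\<Phi> (c \<odot>\<^bsub>l2\<^esub> v) = c \<odot>\<^bsub>W\<^esub> \<Phi> v" for c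
      unfolding W_def htensor_simps \<Phi>_def
      by (rule restrict_ext) (use v in \<open>simp add: l2.ip_smult_left del: l2_simps\<close>)
    fix w assume w: "w \<in> carrier l2"
    show "\<Phi> (v \<oplus>\<^bsub>l2\<^esub> w) = \<Phi> v \<oplus>\<^bsub>W\<^esub> \<Phi> w"
      unfolding W_def htensor_simps \<Phi>_def
      by (rule restrict_ext) (use v w in \<open>simp add: l2.ip_add_left del: l2_simps\<close>)
  qed
  show "hnorm W (\<Phi> v) \<le> hnorm l2 v" if v: "v \<in> carrier l2" for v
  proof -
    have "cinner W (\<Phi> v) (\<Phi> v) = (\<Sum>\<^sub>\<infinity>e\<in>some_onb l2. complex_of_real ((cmod (cinner l2 v e))\<^sup>2))"
      unfolding W_def htensor_simps
    proof (rule infsum_cong)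
      fix e assume "e \<in> some_onb l2"
      then have "e \<in> carrier l2" using onb(1) by blast
      then show "cinner (point_module z) (\<Phi> v e) (\<Phi> v e) = complex_of_real ((cmod (cinner l2 v e))\<^sup>2)"
        unfolding complex_norm_square by (simp add: \<Phi>_def del: l2_simps)
    qed
    also have "\<dots> = complex_of_real (\<Sum>\<^sub>\<infinity>e\<in>some_onb l2. (cmod (cinner l2 v e))\<^sup>2)"
      by (rule infsumI [OF has_sum_of_real [OF has_sum_infsum [OF sm [OF v]]]])
    finally have "hnorm W (\<Phi> v) = sqrt (\<Sum>\<^sub>\<infinity>e\<in>some_onb l2. (cmod (cinner l2 v e))\<^sup>2)"
      by (simp only: hnorm_def Re_complex_of_real)
    also have "(\<Sum>\<^sub>\<infinity>e\<in>some_onb l2. (cmod (cinner l2 v e))\<^sup>2) \<le> (hnorm l2 v)\<^sup>2"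
      by (rule infsum_le_finite_sums [OF sm [OF v]]) (rule bessel [OF v])
    then have "sqrt (\<Sum>\<^sub>\<infinity>e\<in>some_onb l2. (cmod (cinner l2 v e))\<^sup>2) \<le> hnorm l2 v"
      by (rule real_le_lsqrt [OF l2.hnorm_nonneg [OF v]])
    finally show ?thesis .
  qed
  show "\<Phi> (ell2_basis i) = elem_tensor (point_module z) l2 1 (ell2_basis i)"
    by (simp add: \<Phi>_def elem_tensor_def)
qed

text \<open>
  A module is quasi-free if it has bounded equivariant maps \<open>E z\<close> to \<open>\<ell>\<^sup>2\<close> that send the generators
  to the standard basis and separate the elements of the module. Such an \<open>E z\<close> descends to a map \<open>G z\<close> on
  the fibre at \<open>z\<close>. It yields the linear independence of the generators in the fibre, it
  becomes \<open>X z\<close> on composing with the preceding lemma, and it sees every element of the module that is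
  seen by \<open>E z\<close>.
\<close>

theorem quasi_free_relI:
  fixes \<Omega> :: "(complex^'m) set" and R :: "(complex^'m \<Rightarrow> complex, 'a, 'x) hmodule_scheme"
  assumes b: "bounded \<Omega>" "\<Omega> \<noteq> {}" and R: "hilbert_module \<Omega> R"
    and gen: "generating \<Omega> R (range f)"
    and lin: "\<And>z. z \<in> \<Omega> \<Longrightarrow> linear_map_on (carrier R) R l2 (E z)"
    and bound: "\<And>z x. \<lbrakk>z \<in> \<Omega>; x \<in> carrier R\<rbrakk> \<Longrightarrow> hnorm l2 (E z x) \<le> \<beta> z * hnorm R x"
    and cont: "continuous_on \<Omega> \<beta>"
    and eq: "\<And>z \<phi> x. \<lbrakk>z \<in> \<Omega>; \<phi> \<in> A_set \<Omega>; x \<in> carrier R\<rbrakk> \<Longrightarrow> E z (act R \<phi> x) = \<phi> z \<odot>\<^bsub>l2\<^esub> E z x"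
    and basis: "\<And>z i. z \<in> \<Omega> \<Longrightarrow> E z (f i) = ell2_basis i"
    and sep: "\<And>x. \<lbrakk>x \<in> carrier R; \<And>z. z \<in> \<Omega> \<Longrightarrow> E z x = \<zero>\<^bsub>l2\<^esub>\<rbrakk> \<Longrightarrow> x = \<zero>\<^bsub>R\<^esub>"
  shows "quasi_free_rel \<Omega> R \<infinity> f"
proof -
  interpret R: hilbert_module \<Omega> R by fact
  have fa: "fibre_at \<Omega> R"
    by (intro fibre_at.intro fibre_at_axioms.intro R b)
  have f_in: "f i \<in> carrier R" for i using gen unfolding generating_def by blast
  have inj: "inj f"
  proof (rule injI)
    fix i j assume ij: "f i = f j"
    obtain z where z: "z \<in> \<Omega>" using b by blast
    have "ell2_basis i = ell2_basis j" by (simp only: basis [OF z, symmetric] ij)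
    then show "i = j" by (simp only: ell2_basis_inj)
  qed
  define good where "good z G \<longleftrightarrow> linear_map_on (carrier (fibre \<Omega> R z)) (fibre \<Omega> R z) l2 G \<and>
      (\<forall>x\<in>carrier R. G (at_point \<Omega> R z x) = E z x) \<and>
      (\<forall>X\<in>carrier (fibre \<Omega> R z). hnorm l2 (G X) \<le> \<beta> z * hnorm (fibre \<Omega> R z) X)" for z G
  have "\<exists>G. good z G" if z: "z \<in> \<Omega>" for z
  proof -
    interpret fibre_at \<Omega> R z by (rule fa)
    show ?thesis
    proof (rule functional_on_fibre [OF lin [OF z] bound [OF z] eq [OF z]])
      fix G
      assume a: "linear_map_on (carrier F) F l2 G" "\<And>x. x \<in> carrier R \<Longrightarrow> G (pr x) = E z x"
        "\<And>X. X \<in> carrier F \<Longrightarrow> hnorm l2 (G X) \<le> \<beta> z * hnorm F X"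
      show "\<exists>G. good z G"
        unfolding good_def by (rule exI [of _ G], intro conjI ballI a; assumption)
    qed
  qed
  then have "\<exists>G. \<forall>z\<in>\<Omega>. good z (G z)" by (intro bchoice ballI)
  then obtain G where good: "\<And>z. z \<in> \<Omega> \<Longrightarrow> good z (G z)" by blast
  have G: "\<And>z. z \<in> \<Omega> \<Longrightarrow> linear_map_on (carrier (fibre \<Omega> R z)) (fibre \<Omega> R z) l2 (G z)"
    "\<And>z x. \<lbrakk>z \<in> \<Omega>; x \<in> carrier R\<rbrakk> \<Longrightarrow> G z (at_point \<Omega> R z x) = E z x"
    "\<And>z X. \<lbrakk>z \<in> \<Omega>; X \<in> carrier (fibre \<Omega> R z)\<rbrakk> \<Longrightarrow> hnorm l2 (G z X) \<le> \<beta> z * hnorm (fibre \<Omega> R z) X"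
    using good unfolding good_def by blast+
  have G_lin: "linear_map (fibre \<Omega> R z) l2 (carrier (fibre \<Omega> R z)) (G z)" if z: "z \<in> \<Omega>" for z
  proof -
    interpret fibre_at \<Omega> R z by (rule fa)
    show ?thesis
      by (intro linear_map.intro linear_map_axioms.intro inner_product_space_F
        inner_product_space_l2 F.carrier_is_submodule G(1) [OF z])
  qed
  have pr_in: "at_point \<Omega> R z x \<in> carrier (fibre \<Omega> R z)" if "x \<in> carrier R" for z x
  proof -
    interpret fibre_at \<Omega> R z by (rule fa)
    show ?thesis using that by (rule pr.T_in)
  qed
  have indep: "lin_indep_family (fibre \<Omega> R z) UNIV (\<lambda>i. at_point \<Omega> R z (f i))" if z: "z \<in> \<Omega>" for z
    unfolding lin_indep_family_def
  proof (intro allI impI ballI)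
    fix I c i
    assume "finite I \<and> I \<subseteq> UNIV \<and>
      (\<Oplus>\<^bsub>fibre \<Omega> R z\<^esub>i\<in>I. c i \<odot>\<^bsub>fibre \<Omega> R z\<^esub> at_point \<Omega> R z (f i)) = \<zero>\<^bsub>fibre \<Omega> R z\<^esub>"
    then have I: "finite I" and sum: "(\<Oplus>\<^bsub>fibre \<Omega> R z\<^esub>i\<in>I. c i \<odot>\<^bsub>fibre \<Omega> R z\<^esub> at_point \<Omega> R z (f i)) = \<zero>\<^bsub>fibre \<Omega> R z\<^esub>"
      by auto
    assume i: "i \<in> I"
    interpret fibre_at \<Omega> R z by (rule fa)
    interpret G: linear_map F l2 "carrier F" "G z" by (rule G_lin [OF z])
    have p: "pr (f j) \<in> carrier F" for j by (rule pr_in [OF f_in])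
    have "\<zero>\<^bsub>l2\<^esub> = G z (\<Oplus>\<^bsub>F\<^esub>j\<in>I. c j \<odot>\<^bsub>F\<^esub> pr (f j))" unfolding sum by (rule G.T_zero [symmetric])
    also have "\<dots> = (\<Oplus>\<^bsub>l2\<^esub>j\<in>I. G z (c j \<odot>\<^bsub>F\<^esub> pr (f j)))"
      by (rule G.T_finsum [OF I]) (rule F.smult_in [OF p])
    also have "\<dots> = (\<lambda>n. \<Sum>j\<in>I. G z (c j \<odot>\<^bsub>F\<^esub> pr (f j)) n)"
      by (rule l2_finsum [OF I]) (rule G.T_in [OF F.smult_in [OF p]])
    also have "\<dots> = (\<lambda>n. \<Sum>j\<in>I. c j * ell2_basis j n)"
      using G.T_smult [OF p] G(2) [OF z f_in] basis [OF z] by simp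
    finally have "0 = (\<Sum>j\<in>I. c j * ell2_basis j i)" by (simp add: fun_eq_iff)
    also have "\<dots> = c i" using I i by (simp add: ell2_basis_def if_distrib cong: if_cong)
    finally show "c i = 0" by simp
  qed
  have span_in: "cspan (fibre \<Omega> R z) (range (\<lambda>i. at_point \<Omega> R z (f i))) \<subseteq> carrier (fibre \<Omega> R z)" for z
  proof -
    interpret fibre_at \<Omega> R z by (rule fa)
    show ?thesis by (rule F.cspan_in_carrier) (use pr_in f_in in blast)
  qed
  have dense: "dense_in (fibre \<Omega> R z) (cspan (fibre \<Omega> R z) (range (\<lambda>i. at_point \<Omega> R z (f i))))"
    if z: "z \<in> \<Omega>" for z
  proof -
    interpret fibre_at \<Omega> R z by (rule fa)
    show ?thesis
      unfolding F.dense_in_iff [OF span_in]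
    proof (intro ballI allI impI)
      fix X and e :: real assume X: "X \<in> carrier F" and e: "e > 0"
      obtain x where x: "x \<in> carrier R" "X = pr x" using pr_surj [OF X] by blast
      let ?G = "{\<Oplus>\<^bsub>R\<^esub>f\<in>I. act R (\<phi> f) f | I \<phi>. finite I \<and> I \<subseteq> range f \<and> \<phi> \<in> I \<rightarrow> A_set \<Omega>}"
      have "?G \<subseteq> carrier R"
        using f_in by (auto intro!: R.finsum_closed R.act_in)
      moreover have "dense_in R ?G" using gen by (simp only: generating_def)
      ultimately have "\<exists>y\<in>?G. hnorm R (x \<ominus>\<^bsub>R\<^esub> y) < e"
        using x(1) e R.dense_in_iff by blast
      then obtain I \<phi> where I: "finite I" "I \<subseteq> range f" "\<phi> \<in> I \<rightarrow> A_set \<Omega>"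
        and lt: "hnorm R (x \<ominus>\<^bsub>R\<^esub> (\<Oplus>\<^bsub>R\<^esub>g\<in>I. act R (\<phi> g) g)) < e" by blast
      define y where "y = (\<Oplus>\<^bsub>R\<^esub>g\<in>I. act R (\<phi> g) g)"
      have g_in: "g \<in> carrier R" "\<phi> g \<in> A_set \<Omega>" "act R (\<phi> g) g \<in> carrier R" if g: "g \<in> I" for g
      proof -
        show gc: "g \<in> carrier R" using g I(2) f_in by blast
        show \<phi>g: "\<phi> g \<in> A_set \<Omega>" by (rule funcset_mem [OF I(3) g])
        show "act R (\<phi> g) g \<in> carrier R" by (rule R.act_in [OF \<phi>g gc])
      qed
      have y: "y \<in> carrier R" unfolding y_def using g_in by (intro R.finsum_closed) auto
      have "pr y = (\<Oplus>\<^bsub>F\<^esub>g\<in>I. pr (act R (\<phi> g) g))"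
        unfolding y_def by (rule pr.T_finsum [OF I(1) g_in(3)])
      also have "\<dots> = (\<Oplus>\<^bsub>F\<^esub>g\<in>I. \<phi> g z \<odot>\<^bsub>F\<^esub> pr g)"
        by (rule F.finsum_cong') (auto simp: g_in pr_act pr_in)
      finally have py: "pr y = (\<Oplus>\<^bsub>F\<^esub>g\<in>I. \<phi> g z \<odot>\<^bsub>F\<^esub> pr g)" .
      \<comment> \<open>The span of a set has coefficients indexed by vectors, so the images of the generators have to be distinct.\<close>
      have inj_pr: "inj_on pr I"
      proof (rule inj_onI)
        fix g h assume "g \<in> I" "h \<in> I" "pr g = pr h"
        then obtain i j where ij: "g = f i" "h = f j" using I(2) by blast
        have "E z (f i) = G z (pr g)" unfolding ij(1) by (rule G(2) [OF z f_in, symmetric])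
        also have "\<dots> = G z (pr h)" using \<open>pr g = pr h\<close> by (rule arg_cong)
        also have "\<dots> = E z (f j)" unfolding ij(2) by (rule G(2) [OF z f_in])
        finally have "E z (f i) = E z (f j)" .
        then have "ell2_basis i = ell2_basis j" by (simp only: basis [OF z])
        then show "g = h" unfolding ij by (simp only: ell2_basis_inj)
      qed
      have "(\<Oplus>\<^bsub>F\<^esub>v\<in>pr ` I. \<phi> (the_inv_into I pr v) z \<odot>\<^bsub>F\<^esub> v) =
          (\<Oplus>\<^bsub>F\<^esub>g\<in>I. \<phi> (the_inv_into I pr (pr g)) z \<odot>\<^bsub>F\<^esub> pr g)"
        by (rule F.finsum_reindex [OF _ inj_pr]) (use g_in pr_in in auto)
      also have "\<dots> = pr y"
        unfolding py by (rule F.finsum_cong') (auto simp: the_inv_into_f_f [OF inj_pr] g_in pr_in)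
      finally have "pr y \<in> cspan F (range (\<lambda>i. pr (f i)))"
        unfolding cspan_def using I(1,2)
        by (intro CollectI exI [of _ "pr ` I"] exI [of _ "\<lambda>v. \<phi> (the_inv_into I pr v) z"]) auto
      moreover have "hnorm F (X \<ominus>\<^bsub>F\<^esub> pr y) < e"
        using hnorm_pr_le [of "x \<ominus>\<^bsub>R\<^esub> y"] x y lt by (simp add: pr.T_minus y_def)
      ultimately show "\<exists>Y\<in>cspan F (range (\<lambda>i. pr (f i))). hnorm F (X \<ominus>\<^bsub>F\<^esub> Y) < e" by blast
    qed
  qed
  define X where "X z v = (\<lambda>n\<in>carrier l2. cinner l2 (G z v) n)" for z v
  have X_lin: "linear_map_on (cspan (fibre \<Omega> R z) (range (\<lambda>i. at_point \<Omega> R z (f i))))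
      (fibre \<Omega> R z) (htensor (point_module z) l2) (X z)" if z: "z \<in> \<Omega>" for z
  proof (rule linear_map_onI)
    note \<Phi> = riesz_functional(1) [of z]
    note g = linear_map_onD [OF G(1) [OF z]]
    fix x assume "x \<in> cspan (fibre \<Omega> R z) (range (\<lambda>i. at_point \<Omega> R z (f i)))"
    then have x: "x \<in> carrier (fibre \<Omega> R z)" using span_in by blast
    show "X z x \<in> carrier (htensor (point_module z) l2)"
      unfolding X_def by (rule linear_map_onD(1) [OF \<Phi> g(1) [OF x]])
    show "X z (c \<odot>\<^bsub>fibre \<Omega> R z\<^esub> x) = c \<odot>\<^bsub>htensor (point_module z) l2\<^esub> X z x" for c
      unfolding X_def g(3) [OF x] by (rule linear_map_onD(3) [OF \<Phi> g(1) [OF x]])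
    fix y assume "y \<in> cspan (fibre \<Omega> R z) (range (\<lambda>i. at_point \<Omega> R z (f i)))"
    then have y: "y \<in> carrier (fibre \<Omega> R z)" using span_in by blast
    show "X z (x \<oplus>\<^bsub>fibre \<Omega> R z\<^esub> y) = X z x \<oplus>\<^bsub>htensor (point_module z) l2\<^esub> X z y"
      unfolding X_def g(2) [OF x y] by (rule linear_map_onD(2) [OF \<Phi> g(1) [OF x] g(1) [OF y]])
  qed
  have X_basis: "X z (at_point \<Omega> R z (f i)) = elem_tensor (point_module z) l2 1 (ell2_basis i)"
    if z: "z \<in> \<Omega>" for z i
    unfolding X_def G(2) [OF z f_in] basis [OF z] by (rule riesz_functional(3))
  have X_bound: "\<exists>U B. open U \<and> w \<in> U \<and> (\<forall>z\<in>U \<inter> \<Omega>.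
      \<forall>v\<in>cspan (fibre \<Omega> R z) (range (\<lambda>i. at_point \<Omega> R z (f i))).
        hnorm (htensor (point_module z) l2) (X z v) \<le> B * hnorm (fibre \<Omega> R z) v)" if w: "w \<in> \<Omega>" for w
  proof -
    have "\<exists>d>0. \<forall>z\<in>\<Omega>. dist z w < d \<longrightarrow> dist (\<beta> z) (\<beta> w) < 1"
      using cont w unfolding continuous_on_iff by (metis zero_less_one)
    then obtain d where d: "d > 0" "\<And>z. \<lbrakk>z \<in> \<Omega>; dist z w < d\<rbrakk> \<Longrightarrow> \<beta> z \<le> \<beta> w + 1"
      by (force simp: dist_real_def)
    have "hnorm (htensor (point_module z) l2) (X z v) \<le> (\<beta> w + 1) * hnorm (fibre \<Omega> R z) v"
      if z: "z \<in> ball w d \<inter> \<Omega>" and v: "v \<in> cspan (fibre \<Omega> R z) (range (\<lambda>i. at_point \<Omega> R z (f i)))" for z v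
    proof -
      have z': "z \<in> \<Omega>" using z by blast
      have v': "v \<in> carrier (fibre \<Omega> R z)" using v span_in by blast
      interpret fibre_at \<Omega> R z by (rule fa)
      have "hnorm (htensor (point_module z) l2) (X z v) \<le> hnorm l2 (G z v)"
        unfolding X_def by (rule riesz_functional(2) [OF linear_map_onD(1) [OF G(1) [OF z'] v']])
      also have "\<dots> \<le> \<beta> z * hnorm F v" by (rule G(3) [OF z' v'])
      also have "\<dots> \<le> (\<beta> w + 1) * hnorm F v"
        using d(2) [OF z'] z v' by (intro mult_right_mono) (auto simp: dist_commute)
      finally show ?thesis .
    qed
    then show ?thesis using d(1) by (intro exI [of _ "ball w d"] exI [of _ "\<beta> w + 1"]) auto
  qed
  have sep': "(\<forall>z\<in>\<Omega>. at_point \<Omega> R z g = \<zero>\<^bsub>fibre \<Omega> R z\<^esub>) \<longleftrightarrow> g = \<zero>\<^bsub>R\<^esub>" if g: "g \<in> carrier R" for g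
  proof
    assume a: "\<forall>z\<in>\<Omega>. at_point \<Omega> R z g = \<zero>\<^bsub>fibre \<Omega> R z\<^esub>"
    show "g = \<zero>\<^bsub>R\<^esub>"
    proof (rule sep [OF g])
      fix z assume z: "z \<in> \<Omega>"
      have "E z g = G z \<zero>\<^bsub>fibre \<Omega> R z\<^esub>" using G(2) [OF z g] a z by simp
      then show "E z g = \<zero>\<^bsub>l2\<^esub>" using linear_map.T_zero [OF G_lin [OF z]] by simp
    qed
  next
    assume g0: "g = \<zero>\<^bsub>R\<^esub>"
    show "\<forall>z\<in>\<Omega>. at_point \<Omega> R z g = \<zero>\<^bsub>fibre \<Omega> R z\<^esub>"
    proof
      fix z assume "z \<in> \<Omega>"
      interpret fibre_at \<Omega> R z by (rule fa)
      show "pr g = \<zero>\<^bsub>F\<^esub>" unfolding g0 by (rule pr.T_zero)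
    qed
  qed
  show ?thesis
    unfolding quasi_free_rel_def idx_infinity
    using R inj gen indep dense X_lin X_basis X_bound sep'
    by (intro conjI exI [of _ X]) auto
qed

section \<open>Sampling the algebra along a sequence of points\<close>

lemma norm_vector_smult: "norm (c *s (v :: complex^'m)) = cmod c * norm v"
  by (simp add: norm_vec_def vector_scalar_mult_def norm_mult L2_set_right_distrib)

lemma bounded_linear_smult_line: "bounded_linear (\<lambda>c. c *s (v :: complex^'m))"
proof (rule bounded_linear_intro [where K = "norm v"])
  show "(x + y) *s v = x *s v + y *s v" for x y by (simp add: vec_eq_iff distrib_right)
  show "(r *\<^sub>R x) *s v = r *\<^sub>R (x *s v)" for r x by (simp add: vec_eq_iff)
  show "norm (x *s v) \<le> norm x * norm v" for x by (simp add: norm_vector_smult)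
qed

text \<open>
  Cauchy's inequality on discs of radius \<open>r - 1\<close> around the points of the unit disc bounds the derivative.
\<close>

lemma holomorphic_difference_bound:
  assumes hol: "g holomorphic_on U" and U: "open U" "cball 0 r \<subseteq> U" and r: "r > 1"
    and le: "\<And>\<zeta>. cmod \<zeta> \<le> r \<Longrightarrow> cmod (g \<zeta>) \<le> S"
  shows "cmod (g 1 - g 0) \<le> S / (r - 1)"
proof -
  have der: "(g has_field_derivative deriv g \<zeta>) (at \<zeta>)" if "cmod \<zeta> \<le> 1" for \<zeta>
    by (rule holomorphic_derivI [OF hol U(1)]) (use U(2) that r in auto)
  have bound: "cmod (deriv g \<zeta>) \<le> S / (r - 1)" if \<zeta>: "cmod \<zeta> \<le> 1" for \<zeta>
  proof -
    have sub: "cball \<zeta> (r - 1) \<subseteq> cball 0 r"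
    proof
      fix x assume "x \<in> cball \<zeta> (r - 1)"
      then have "cmod (x - \<zeta>) \<le> r - 1" by (simp add: dist_norm norm_minus_commute)
      then show "x \<in> cball 0 r" using \<zeta> norm_triangle_ineq [of \<zeta> "x - \<zeta>"] by simp
    qed
    have "cmod ((deriv ^^ 1) g \<zeta>) \<le> fact 1 * S / (r - 1) ^ 1"
    proof (rule Cauchy_inequality)
      show "g holomorphic_on ball \<zeta> (r - 1)"
        using hol sub U(2) ball_subset_cball by (meson holomorphic_on_subset subset_trans)
      show "continuous_on (cball \<zeta> (r - 1)) g"
        using hol sub U(2) by (meson holomorphic_on_imp_continuous_on holomorphic_on_subset subset_trans)
      show "0 < r - 1" using r by simp
      fix x assume "cmod (\<zeta> - x) = r - 1"
      then have "x \<in> cball \<zeta> (r - 1)" by (simp add: dist_norm)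
      then have "cmod x \<le> r" using sub by auto
      then show "cmod (g x) \<le> S" by (rule le)
    qed
    then show ?thesis by simp
  qed
  have "cmod (g 1 - g 0) \<le> S / (r - 1) * cmod (1 - 0)"
  proof (rule field_differentiable_bound [of "cball 0 1" g "deriv g"])
    show "(g has_field_derivative deriv g z) (at z within cball 0 1)" if "z \<in> cball 0 1" for z
      using der that by (auto intro: has_field_derivative_at_within)
    show "cmod (deriv g z) \<le> S / (r - 1)" if "z \<in> cball 0 1" for z using bound that by simp
  qed simp_all
  then show ?thesis by simp
qed

text \<open>
  The one-variable estimate is applied on a complex line, to holomorphic functions
  approximating \<open>\<phi>\<close>: elements of the algebra are uniform limits of holomorphic functions on
  neighbourhoods of the closure, and \<open>S / (r - 1)\<close> survives the limit.
\<close>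

lemma A_set_difference_bound:
  fixes \<Omega> :: "(complex^'m) set"
  assumes \<phi>: "\<phi> \<in> A_set \<Omega>" and r: "r > 1"
    and line: "\<And>\<zeta>. cmod \<zeta> \<le> r \<Longrightarrow> z + \<zeta> *s v \<in> \<Omega>"
    and le: "\<And>\<zeta>. cmod \<zeta> \<le> r \<Longrightarrow> cmod (\<phi> (z + \<zeta> *s v)) \<le> S"
  shows "cmod (\<phi> (z + v) - \<phi> z) \<le> S / (r - 1)"
proof (rule field_le_epsilon)
  fix e :: real assume e: "e > 0"
  define \<epsilon> where "\<epsilon> = e / (1 / (r - 1) + 2)"
  have pos: "1 / (r - 1) + 2 > 0" using r by (simp add: add_pos_pos)
  have \<epsilon>: "\<epsilon> > 0" using e pos by (simp add: \<epsilon>_def)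
  obtain U \<psi> where U: "open U" "closure \<Omega> \<subseteq> U" "holomorphic_in \<psi> U"
    and close': "\<forall>z\<in>\<Omega>. cmod (\<phi> z - \<psi> z) \<le> \<epsilon>"
    using \<phi> \<epsilon> unfolding A_set_def by blast
  have close: "cmod (\<phi> z - \<psi> z) \<le> \<epsilon>" if "z \<in> \<Omega>" for z using close' that by blast
  define g where "g \<zeta> = \<psi> (z + \<zeta> *s v)" for \<zeta>
  define V where "V = (\<lambda>\<zeta>. z + \<zeta> *s v) -` U"
  have line_der: "((\<lambda>\<zeta>. z + \<zeta> *s v) has_derivative (\<lambda>\<mu>. \<mu> *s v)) (at \<zeta>)" for \<zeta>
    using has_derivative_add [OF has_derivative_const bounded_linear_imp_has_derivative [OF bounded_linear_smult_line]]
    by fastforce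
  have "continuous_on UNIV (\<lambda>\<zeta>. z + \<zeta> *s v)"
    by (intro continuous_at_imp_continuous_on ballI has_derivative_continuous [OF line_der])
  from open_vimage [OF U(1) this] have V: "open V" unfolding V_def .
  have hol: "g holomorphic_on V"
  proof (rule holomorphic_onI)
    fix \<zeta> assume "\<zeta> \<in> V"
    then obtain D where D: "(\<psi> has_derivative D) (at (z + \<zeta> *s v))" "\<And>a w. D (a *s w) = a * D w"
      using U(3) unfolding holomorphic_in_def V_def by blast
    have "(g has_derivative (\<lambda>\<mu>. D (\<mu> *s v))) (at \<zeta>)"
      unfolding g_def by (rule has_derivative_compose [OF line_der D(1)])
    then have "(g has_field_derivative D v) (at \<zeta>)"
      unfolding has_field_derivative_def D(2) mult.commute [of _ "D v"] .
    then show "g field_differentiable at \<zeta> within V"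
      using field_differentiable_at_within field_differentiable_def by blast
  qed
  have dom: "z + \<zeta> *s v \<in> U" if "cmod \<zeta> \<le> r" for \<zeta>
    using line [OF that] U(2) closure_subset by blast
  have "cmod (g 1 - g 0) \<le> (S + \<epsilon>) / (r - 1)"
  proof (rule holomorphic_difference_bound [OF hol V _ r])
    show "cball 0 r \<subseteq> V" unfolding V_def using dom by auto
    fix \<zeta> assume "cmod \<zeta> \<le> r"
    from le [OF this] close [OF line [OF this]]
    show "cmod (g \<zeta>) \<le> S + \<epsilon>"
      using norm_triangle_ineq4 [of "\<phi> (z + \<zeta> *s v)" "\<phi> (z + \<zeta> *s v) - g \<zeta>"]
      unfolding g_def by simp
  qed
  then have g: "cmod (\<psi> (z + v) - \<psi> z) \<le> (S + \<epsilon>) / (r - 1)" by (simp add: g_def)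
  have "z + v \<in> \<Omega>" "z \<in> \<Omega>" using line [of 1] line [of 0] r by simp_all
  then have c: "cmod (\<phi> (z + v) - \<psi> (z + v)) \<le> \<epsilon>" "cmod (\<phi> z - \<psi> z) \<le> \<epsilon>" using close by auto
  have split: "\<phi> (z + v) - \<phi> z = (\<phi> (z + v) - \<psi> (z + v)) + (\<psi> (z + v) - \<psi> z) - (\<phi> z - \<psi> z)" by simp
  have "cmod (\<phi> (z + v) - \<phi> z) \<le>
      cmod (\<phi> (z + v) - \<psi> (z + v)) + cmod (\<psi> (z + v) - \<psi> z) + cmod (\<phi> z - \<psi> z)"
    unfolding split
    using norm_triangle_ineq4 [of "(\<phi> (z + v) - \<psi> (z + v)) + (\<psi> (z + v) - \<psi> z)" "\<phi> z - \<psi> z"]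
      norm_triangle_ineq [of "\<phi> (z + v) - \<psi> (z + v)" "\<psi> (z + v) - \<psi> z"] by linarith
  also have "\<dots> \<le> \<epsilon> + (S + \<epsilon>) / (r - 1) + \<epsilon>" using c g by linarith
  also have "\<dots> = S / (r - 1) + \<epsilon> * (1 / (r - 1) + 2)"
    by (simp add: add_divide_distrib distrib_left)
  also have "\<dots> = S / (r - 1) + e" using pos by (simp add: \<epsilon>_def)
  finally show "cmod (\<phi> (z + v) - \<phi> z) \<le> S / (r - 1) + e" .
qed

text \<open>
  A grid with spacing \<open>h / d\<close> in dimension \<open>d\<close>, cut off at a bound for \<open>S\<close>.
\<close>

lemma finite_net_card:
  fixes S :: "'a::euclidean_space set"
  assumes "bounded S"
  shows "\<exists>C\<ge>0. \<forall>h. 0 < h \<and> h \<le> 1 \<longrightarrow>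
    (\<exists>F. finite F \<and> real (card F) \<le> C * (1 / h) ^ DIM('a) \<and> (\<forall>z\<in>S. \<exists>q\<in>F. dist z q \<le> h))"
proof -
  define d where "d = DIM('a)"
  have d: "d > 0" by (simp add: d_def)
  obtain L where L: "L > 0" "\<And>z. z \<in> S \<Longrightarrow> norm z \<le> L" using assms bounded_pos by metis
  define K where "K = 2 * L * d + 5"
  have "2 * L * d \<ge> 0" using L(1) by simp
  then have K: "K > 0" by (simp add: K_def)
  have "\<exists>F. finite F \<and> real (card F) \<le> K ^ d * (1 / h) ^ d \<and> (\<forall>z\<in>S. \<exists>q\<in>F. dist z q \<le> h)"
    if h: "0 < h" "h \<le> 1" for h
  proof -
    define s where "s = h / d"
    have s: "s > 0" using h d by (simp add: s_def)
    define N where "N = nat \<lceil>L / s\<rceil> + 1"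
    have N1: "L / s + 1 \<le> real N" unfolding N_def using of_nat_ceiling [of "L / s"] by simp
    have "real (nat \<lceil>L / s\<rceil>) \<le> L / s + 1"
      using L(1) s by (simp add: of_nat_nat ceiling_le_iff)
    then have N2: "real N \<le> L / s + 2" by (simp add: N_def)
    define I where "I = (Basis :: 'a set) \<rightarrow>\<^sub>E {- int N..int N}"
    define pt :: "('a \<Rightarrow> int) \<Rightarrow> 'a" where "pt k = (\<Sum>b\<in>Basis. (s * of_int (k b)) *\<^sub>R b)" for k
    have finI: "finite I" unfolding I_def by (intro finite_PiE) auto
    have "card I = (2 * N + 1) ^ d"
      unfolding I_def d_def by (subst card_PiE) (auto simp: nat_add_distrib nat_mult_distrib)
    then have "real (card (pt ` I)) \<le> real ((2 * N + 1) ^ d)"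
      using card_image_le [OF finI, of pt] by (metis of_nat_le_iff)
    also have "\<dots> = (2 * real N + 1) ^ d" by (simp add: add.commute)
    also have "\<dots> \<le> (K / h) ^ d"
    proof (rule power_mono)
      have "2 * real N + 1 \<le> 2 * (L / s) + 5" using N2 by simp
      also have "2 * (L / s) = 2 * L * d / h" by (simp add: s_def)
      also have "2 * L * d / h + 5 \<le> 2 * L * d / h + 5 / h"
        using h by (simp add: field_simps)
      also have "\<dots> = K / h" by (simp add: K_def add_divide_distrib)
      finally show "2 * real N + 1 \<le> K / h" .
    qed simp
    also have "(K / h) ^ d = K ^ d * (1 / h) ^ d" by (simp add: power_divide)
    finally have card: "real (card (pt ` I)) \<le> K ^ d * (1 / h) ^ d" .
    have "\<exists>q\<in>pt ` I. dist z q \<le> h" if z: "z \<in> S" for z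
    proof -
      define k where "k = (\<lambda>b\<in>(Basis :: 'a set). \<lfloor>(z \<bullet> b) / s\<rfloor>)"
      have "k \<in> I"
        unfolding I_def
      proof (rule PiE_I)
        fix b :: 'a assume b: "b \<in> Basis"
        have "\<bar>z \<bullet> b\<bar> \<le> L" using Basis_le_norm [OF b, of z] L(2) [OF z] by linarith
        then have "\<bar>(z \<bullet> b) / s\<bar> \<le> L / s" using s by (simp add: divide_right_mono)
        then have "- real N \<le> (z \<bullet> b) / s - 1" "(z \<bullet> b) / s \<le> real N" using N1 by linarith+
        then have "- int N \<le> \<lfloor>(z \<bullet> b) / s\<rfloor>" "\<lfloor>(z \<bullet> b) / s\<rfloor> \<le> int N" by linarith+
        then show "k b \<in> {- int N..int N}" using b by (simp add: k_def)
      qed (simp add: k_def)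
      moreover have "dist z (pt k) \<le> h"
      proof -
        have "\<bar>(z - pt k) \<bullet> b\<bar> \<le> s" if b: "b \<in> Basis" for b
        proof -
          have "pt k \<bullet> b = s * of_int (k b)"
            unfolding pt_def using b by (simp add: inner_sum_left inner_Basis if_distrib cong: if_cong)
          then have e: "(z - pt k) \<bullet> b = s * ((z \<bullet> b) / s - of_int \<lfloor>(z \<bullet> b) / s\<rfloor>)"
            using b s by (simp add: inner_diff_left k_def right_diff_distrib)
          have "0 \<le> (z \<bullet> b) / s - of_int \<lfloor>(z \<bullet> b) / s\<rfloor>" "(z \<bullet> b) / s - of_int \<lfloor>(z \<bullet> b) / s\<rfloor> \<le> 1"
            by linarith+
          then have "0 \<le> (z - pt k) \<bullet> b" "(z - pt k) \<bullet> b \<le> s * 1"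
            unfolding e using s by (intro mult_nonneg_nonneg mult_left_mono; simp)+
          then show ?thesis by simp
        qed
        then have "(\<Sum>b\<in>Basis. \<bar>(z - pt k) \<bullet> b\<bar>) \<le> (\<Sum>b\<in>(Basis :: 'a set). s)" by (rule sum_mono)
        also have "\<dots> = h" using d by (simp add: s_def d_def)
        finally show ?thesis using norm_le_l1 [of "z - pt k"] by (simp add: dist_norm)
      qed
      ultimately show ?thesis by blast
    qed
    then show ?thesis using card finI by blast
  qed
  then show ?thesis using K unfolding d_def by (intro exI [of _ "K ^ DIM('a)"]) auto
qed

lemma sum_half_powers_le: "(\<Sum>l<N. (1 / 2 :: real) ^ l) \<le> 2"
proof -
  have "(\<Sum>l<N. (1 / 2 :: real) ^ l) \<le> (\<Sum>l. (1 / 2) ^ l)"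
    by (rule sum_le_suminf) (auto intro: summable_geometric)
  also have "\<dots> = 2" by (simp add: suminf_geometric)
  finally show ?thesis .
qed

text \<open>
  Let \<open>\<rho>\<close> be the distance to the boundary, cut off at 1, and \<open>a\<close> the real dimension. The layer where \<open>\<rho>\<close>
  is about \<open>1 / 2 ^ n\<close> is served by a net of mesh less than \<open>\<delta> * \<rho>\<close>, with a small constant \<open>\<delta>\<close>. Its points carry the
  weight \<open>1 / 2 ^ (n * a)\<close>, comparable to \<open>\<rho> ^ a\<close>. The net has about \<open>2 ^ (n * a)\<close> points, so
  the squares of the weights are summable.

  Let \<open>M\<close> be the supremum of \<open>\<rho> ^ a * \<bar>\<phi>\<bar>\<close>, which is finite because \<open>\<phi>\<close> is bounded. Every \<open>x\<close> in \<open>\<Omega>\<close> has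
  a net point \<open>q\<close> nearby. By Cauchy's estimate on the complex line through \<open>x\<close> and \<open>q\<close>, the weighted
  difference \<open>\<rho> x ^ a * \<bar>\<phi> q - \<phi> x\<bar>\<close> is at most \<open>M / 2\<close>, while \<open>\<rho> x ^ a * \<bar>\<phi> q\<bar>\<close> is at most the
  sampled norm \<open>S\<close>. So \<open>M \<le> S + M / 2\<close>, that is, \<open>M \<le> 2 * S\<close>, which is the claim with \<open>c = 2 / \<rho> ^ a\<close>.
\<close>

theorem sampling:
  fixes \<Omega> :: "(complex^'m) set"
  assumes op: "open \<Omega>" and bd: "bounded \<Omega>" and ne: "\<Omega> \<noteq> {}"
  obtains p :: "nat \<Rightarrow> complex^'m" and w :: "nat \<Rightarrow> real" and c :: "complex^'m \<Rightarrow> real"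
  where "\<And>j. p j \<in> \<Omega>" "\<And>j. 0 \<le> w j" "summable (\<lambda>j. (w j)\<^sup>2)"
    "continuous_on \<Omega> c" "\<And>z. z \<in> \<Omega> \<Longrightarrow> 0 \<le> c z"
    "\<And>\<phi>. \<phi> \<in> A_set \<Omega> \<Longrightarrow> summable (\<lambda>j. (w j * cmod (\<phi> (p j)))\<^sup>2)"
    "\<And>\<phi> z. \<lbrakk>\<phi> \<in> A_set \<Omega>; z \<in> \<Omega>\<rbrakk> \<Longrightarrow> cmod (\<phi> z) \<le> c z * sqrt (\<Sum>j. (w j * cmod (\<phi> (p j)))\<^sup>2)"
proof -
  define \<rho> where "\<rho> z = min 1 (infdist z (- \<Omega>))" for z
  define a where "a = DIM(complex^'m)"
  have a: "a \<ge> 1" unfolding a_def using DIM_positive [where 'a = "complex^'m"] by linarith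
  have nU: "- \<Omega> \<noteq> {}"
  proof
    assume "- \<Omega> = {}"
    then have "\<Omega> = UNIV" by blast
    then show False using bd not_bounded_UNIV by simp
  qed
  have cl: "closed (- \<Omega>)" using op by (simp add: closed_def)
  have \<rho>1: "\<rho> z \<le> 1" for z by (simp add: \<rho>_def)
  have \<rho>pos: "\<rho> z > 0" if "z \<in> \<Omega>" for z
    using infdist_pos_not_in_closed [OF cl nU, of z] that by (simp add: \<rho>_def)
  have \<rho>lip: "\<rho> z - dist z x \<le> \<rho> x" for z x
    using infdist_triangle_abs [of z "- \<Omega>" x] by (auto simp: \<rho>_def min_def)
  have \<rho>in: "x \<in> \<Omega>" if "dist z x < \<rho> z" for z x
  proof (rule ccontr)
    assume "x \<notin> \<Omega>"
    then have "infdist z (- \<Omega>) \<le> dist z x" by (intro infdist_le) simp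
    then show False using that by (simp add: \<rho>_def)
  qed
  have \<rho>cont: "continuous_on \<Omega> \<rho>" unfolding \<rho>_def by (intro continuous_intros)
  \<comment> \<open>On a disc where \<open>\<rho>\<close> is at least half of its value at the centre, \<open>\<bar>\<phi>\<bar>\<close> is bounded by \<open>2 ^ a * M / \<rho> ^ a\<close>.
    Dividing by \<open>r - 1\<close> has to leave \<open>M / (2 * \<rho> ^ a)\<close>.\<close>
  define r :: real where "r = 2 ^ (a + 1) + 1"
  have r: "r > 1" by (simp add: r_def)
  \<comment> \<open>The disc reaches \<open>r\<close> times the mesh, and must not halve \<open>\<rho>\<close>.\<close>
  define \<delta> where "\<delta> = 1 / (2 * r)"
  have \<delta>: "0 < \<delta>" "\<delta> < 1" "r * \<delta> = 1 / 2" using r by (simp_all add: \<delta>_def)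
  obtain C where C: "C \<ge> 0" "\<And>h. \<lbrakk>0 < h; h \<le> 1\<rbrakk> \<Longrightarrow>
    \<exists>F. finite F \<and> real (card F) \<le> C * (1 / h) ^ a \<and> (\<forall>z\<in>\<Omega>. \<exists>q\<in>F. dist z q \<le> h)"
    using finite_net_card [OF bd] unfolding a_def by blast
  define h where "h n = \<delta> / 2 ^ Suc n" for n :: nat
  have h: "0 < h n" "h n \<le> 1" for n
  proof -
    show "0 < h n" using \<delta> by (simp add: h_def)
    have "\<delta> / 2 ^ Suc n \<le> 1 / 1"
      using \<delta> one_le_power [of "2::real" "Suc n"] by (intro frac_le) auto
    then show "h n \<le> 1" by (simp add: h_def)
  qed
  have "\<exists>F. finite F \<and> real (card F) \<le> C * (1 / h n) ^ a \<and> (\<forall>z\<in>\<Omega>. \<exists>q\<in>F. dist z q \<le> h n)" for n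
    by (rule C(2) [OF h])
  then obtain F where F: "\<And>n. finite (F n)" "\<And>n. real (card (F n)) \<le> C * (1 / h n) ^ a"
    "\<And>n z. z \<in> \<Omega> \<Longrightarrow> \<exists>q\<in>F n. dist z q \<le> h n" by metis
  define G where "G n = F n \<inter> \<Omega>" for n
  have G: "finite (G n)" "real (card (G n)) \<le> C * (1 / h n) ^ a" for n
  proof -
    show "finite (G n)" using F(1) by (simp add: G_def)
    have "card (G n) \<le> card (F n)" using F(1) by (intro card_mono) (auto simp: G_def)
    then show "real (card (G n)) \<le> C * (1 / h n) ^ a" using F(2) [of n] by linarith
  qed
  have "\<exists>e. bij_betw e {0..<card (G n)} (G n)" for n
    by (rule ex_bij_betw_nat_finite [OF G(1)])
  then obtain e where e: "\<And>n. bij_betw (e n) {0..<card (G n)} (G n)" by metis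
  obtain z0 where z0: "z0 \<in> \<Omega>" using ne by blast
  \<comment> \<open>All nets are listed in one sequence; the unused positions get the weight 0.\<close>
  define p where "p j = (case prod_decode j of (n, i) \<Rightarrow> if i < card (G n) then e n i else z0)" for j
  define w :: "nat \<Rightarrow> real" where
    "w j = (case prod_decode j of (n, i) \<Rightarrow> if i < card (G n) then (1 / 2 ^ n) ^ a else 0)" for j
  have p: "p j \<in> \<Omega>" for j
  proof -
    obtain n i where ni: "prod_decode j = (n, i)" by fastforce
    have "e n i \<in> \<Omega>" if "i < card (G n)"
      using bij_betwE [OF e, of n] that by (auto simp: G_def)
    then show ?thesis using z0 ni by (simp add: p_def)
  qed
  have w0: "0 \<le> w j" for j by (simp add: w_def split: prod.split)
  define K where "K = C * (2 / \<delta>) ^ a"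
  have K: "K \<ge> 0" using C(1) \<delta> by (simp add: K_def)
  have wsum: "summable (\<lambda>j. (w j)\<^sup>2)"
  proof (rule summableI_nonneg_bounded)
    fix J :: nat
    define W :: "nat \<times> nat \<Rightarrow> real" where "W = (\<lambda>(n, i). if i < card (G n) then ((1 / 2 ^ n) ^ a)\<^sup>2 else 0)"
    have W0: "W x \<ge> 0" for x by (simp add: W_def split: prod.split)
    have "(\<Sum>j<J. (w j)\<^sup>2) = (\<Sum>j<J. W (prod_decode j))"
      by (rule sum.cong) (auto simp: w_def W_def split: prod.split)
    also have "\<dots> = sum W (prod_decode ` {..<J})"
      by (subst sum.reindex) (auto intro: inj_on_subset [OF inj_prod_decode])
    also have "\<dots> = sum W (prod_decode ` {..<J} \<inter> (SIGMA n:{..<J}. {..<card (G n)}))"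
    proof (rule sum.mono_neutral_right)
      show "\<forall>x\<in>prod_decode ` {..<J} - prod_decode ` {..<J} \<inter> (SIGMA n:{..<J}. {..<card (G n)}). W x = 0"
      proof
        fix x assume x: "x \<in> prod_decode ` {..<J} - prod_decode ` {..<J} \<inter> (SIGMA n:{..<J}. {..<card (G n)})"
        then obtain j where j: "j < J" "x = prod_decode j" by blast
        obtain n i where ni: "x = (n, i)" by fastforce
        have "j = prod_encode (n, i)" using j ni by (metis prod_decode_inverse)
        then have "n < J" using j le_prod_encode_1 [of n i] by linarith
        then show "W x = 0" using x ni by (auto simp: W_def)
      qed
    qed auto
    also have "\<dots> \<le> sum W (SIGMA n:{..<J}. {..<card (G n)})"
      by (rule sum_mono2) (auto simp: W0)
    also have "\<dots> = (\<Sum>n<J. \<Sum>i<card (G n). W (n, i))"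
      by (subst sum.Sigma) auto
    also have "\<dots> = (\<Sum>n<J. real (card (G n)) * ((1 / 2 ^ n) ^ a)\<^sup>2)"
      by (simp add: W_def)
    also have "\<dots> \<le> (\<Sum>n<J. K * (1 / 2) ^ n)"
    proof (rule sum_mono)
      fix n
      define t :: real where "t = (2 ^ n) ^ a"
      have t: "t > 0" by (simp add: t_def)
      have "(1 / h n) ^ a = (2 / \<delta>) ^ a * t"
        unfolding t_def power_mult_distrib [symmetric] by (simp add: h_def)
      then have "real (card (G n)) \<le> K * t" using G(2) [of n] by (simp add: K_def mult.assoc)
      then have "real (card (G n)) * ((1 / 2 ^ n) ^ a)\<^sup>2 \<le> (K * t) * (1 / t)\<^sup>2"
        by (intro mult_mono) (simp_all add: t_def power_one_over K)
      also have "\<dots> = K * (1 / t)" using t by (simp add: power2_eq_square)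
      also have "1 / t = ((1 / 2) ^ n) ^ a" by (simp add: t_def power_one_over)
      also have "((1 / 2 :: real) ^ n) ^ a \<le> ((1 / 2) ^ n) ^ 1"
        using a by (intro power_decreasing) (simp_all add: power_le_one)
      then have "K * ((1 / 2) ^ n) ^ a \<le> K * (1 / 2) ^ n"
        using K by (intro mult_left_mono) simp_all
      finally show "real (card (G n)) * ((1 / 2 ^ n) ^ a)\<^sup>2 \<le> K * (1 / 2) ^ n" .
    qed
    also have "\<dots> = K * (\<Sum>n<J. (1 / 2) ^ n)" by (simp add: sum_distrib_left)
    also have "\<dots> \<le> K * 2"
    proof (rule mult_left_mono [OF _ K])
      show "(\<Sum>n<J. (1 / 2 :: real) ^ n) \<le> 2" by (rule sum_half_powers_le)
    qed
    finally show "(\<Sum>j<J. (w j)\<^sup>2) \<le> K * 2" .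
  qed simp
  have \<phi>sum: "summable (\<lambda>j. (w j * cmod (\<phi> (p j)))\<^sup>2)" if \<phi>: "\<phi> \<in> A_set \<Omega>" for \<phi>
  proof (rule summable_comparison_test')
    show "summable (\<lambda>j. (w j)\<^sup>2 * (sup_norm \<Omega> \<phi>)\<^sup>2)" by (rule summable_mult2 [OF wsum])
    fix j
    have "(w j * cmod (\<phi> (p j)))\<^sup>2 \<le> (w j * sup_norm \<Omega> \<phi>)\<^sup>2"
      using A_set_sup_norm(2) [OF bd \<phi> p] w0 [of j] by (intro power_mono mult_left_mono) simp_all
    then show "norm ((w j * cmod (\<phi> (p j)))\<^sup>2) \<le> (w j)\<^sup>2 * (sup_norm \<Omega> \<phi>)\<^sup>2"
      by (simp add: power_mult_distrib)
  qed
  have main: "cmod (\<phi> z) \<le> 2 / \<rho> z ^ a * sqrt (\<Sum>j. (w j * cmod (\<phi> (p j)))\<^sup>2)"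
    if \<phi>: "\<phi> \<in> A_set \<Omega>" and z: "z \<in> \<Omega>" for \<phi> z
  proof -
    define S where "S = sqrt (\<Sum>j. (w j * cmod (\<phi> (p j)))\<^sup>2)"
    define m where "m x = \<rho> x ^ a * cmod (\<phi> x)" for x
    define M where "M = Sup (m ` \<Omega>)"
    have wS: "w j * cmod (\<phi> (p j)) \<le> S" for j
    proof -
      have "(\<Sum>i\<in>{j}. (w i * cmod (\<phi> (p i)))\<^sup>2) \<le> (\<Sum>i. (w i * cmod (\<phi> (p i)))\<^sup>2)"
        by (rule sum_le_suminf [OF \<phi>sum [OF \<phi>]]) auto
      then show ?thesis unfolding S_def by (intro real_le_rsqrt) simp
    qed
    have "m x \<le> sup_norm \<Omega> \<phi>" if x: "x \<in> \<Omega>" for x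
    proof -
      have "m x \<le> 1 * cmod (\<phi> x)"
        unfolding m_def using \<rho>1 \<rho>pos [OF x] by (intro mult_right_mono power_le_one) (auto intro: less_imp_le)
      then show ?thesis using A_set_sup_norm(2) [OF bd \<phi> x] by simp
    qed
    then have bdd: "bdd_above (m ` \<Omega>)" by (auto intro!: bdd_aboveI)
    have mM: "m x \<le> M" if "x \<in> \<Omega>" for x unfolding M_def using bdd that by (simp add: cSUP_upper)
    have "0 \<le> m z" using \<rho>pos [OF z] by (simp add: m_def)
    then have M0: "M \<ge> 0" using mM [OF z] by linarith
    have step: "m x \<le> S + M / 2" if x: "x \<in> \<Omega>" for x
    proof -
      note \<rho>x = \<rho>pos [OF x]
      have ex: "\<exists>n. (1 / 2 :: real) ^ Suc n < \<rho> x"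
      proof -
        obtain n where n: "(1 / 2 :: real) ^ n < \<rho> x" using real_arch_pow_inv [OF \<rho>x, of "1/2"] by auto
        have "(1 / 2 :: real) ^ Suc n \<le> (1 / 2) ^ n" by simp
        then show ?thesis using n by (meson le_less_trans)
      qed
      \<comment> \<open>The layer of \<open>x\<close>: \<open>\<rho> x\<close> lies between \<open>1 / 2 ^ Suc n\<close> and \<open>1 / 2 ^ n\<close>.\<close>
      define n where "n = (LEAST n. (1 / 2 :: real) ^ Suc n < \<rho> x)"
      have n1: "(1 / 2) ^ Suc n < \<rho> x" unfolding n_def by (rule LeastI_ex [OF ex])
      have n2: "\<rho> x \<le> (1 / 2) ^ n"
      proof (cases n)
        case 0
        then show ?thesis using \<rho>1 by simp
      next
        case (Suc k)
        then have "\<not> (1 / 2) ^ Suc k < \<rho> x"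
          using not_less_Least [of k "\<lambda>n. (1 / 2 :: real) ^ Suc n < \<rho> x"] by (simp add: n_def)
        then show ?thesis using Suc by simp
      qed
      obtain q where q: "q \<in> F n" "dist x q \<le> h n" using F(3) [OF x] by blast
      have hn: "h n < \<delta> * \<rho> x"
        using n1 \<delta>(1) mult_strict_left_mono [OF n1 \<delta>(1)] by (simp add: h_def power_one_over)
      have dq: "dist x q \<le> \<delta> * \<rho> x" using q(2) hn by simp
      also have "\<delta> * \<rho> x < \<rho> x" using \<delta>(2) \<rho>x by simp
      finally have "q \<in> \<Omega>" by (rule \<rho>in)
      then have "q \<in> G n" using q(1) by (simp add: G_def)
      then have "q \<in> e n ` {0..<card (G n)}" using bij_betw_imp_surj_on [OF e [of n]] by simp
      then obtain i where i: "i < card (G n)" "q = e n i" by auto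
      define j where "j = prod_encode (n, i)"
      have pj: "p j = q" "w j = (1 / 2 ^ n) ^ a" using i by (simp_all add: p_def w_def j_def)
      define v where "v = q - x"
      have nv: "norm v \<le> \<delta> * \<rho> x" using dq by (simp add: v_def dist_norm norm_minus_commute)
      have line: "x + \<zeta> *s v \<in> \<Omega> \<and> \<rho> x / 2 \<le> \<rho> (x + \<zeta> *s v)" if \<zeta>: "cmod \<zeta> \<le> r" for \<zeta>
      proof -
        have "dist x (x + \<zeta> *s v) = cmod \<zeta> * norm v" by (simp add: dist_norm norm_vector_smult)
        also have "\<dots> \<le> r * (\<delta> * \<rho> x)" using \<zeta> nv r by (intro mult_mono) auto
        also have "\<dots> = (r * \<delta>) * \<rho> x" by simp
        also have "\<dots> = \<rho> x / 2" unfolding \<delta>(3) by simp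
        finally have d: "dist x (x + \<zeta> *s v) \<le> \<rho> x / 2" .
        then have "x + \<zeta> *s v \<in> \<Omega>" using \<rho>x by (intro \<rho>in [of x]) simp
        moreover have "\<rho> x / 2 \<le> \<rho> (x + \<zeta> *s v)" using \<rho>lip [of x "x + \<zeta> *s v"] d by simp
        ultimately show ?thesis by blast
      qed
      have "cmod (\<phi> (x + v) - \<phi> x) \<le> (M / (\<rho> x / 2) ^ a) / (r - 1)"
      proof (rule A_set_difference_bound [OF \<phi> r])
        fix \<zeta> assume \<zeta>: "cmod \<zeta> \<le> r"
        let ?y = "x + \<zeta> *s v"
        show y: "?y \<in> \<Omega>" using line [OF \<zeta>] by blast
        have "(\<rho> x / 2) ^ a * cmod (\<phi> ?y) \<le> \<rho> ?y ^ a * cmod (\<phi> ?y)"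
          using line [OF \<zeta>] \<rho>x by (intro mult_right_mono power_mono) auto
        also have "\<dots> \<le> M" using mM [OF y] by (simp add: m_def)
        finally show "cmod (\<phi> ?y) \<le> M / (\<rho> x / 2) ^ a"
          using \<rho>x by (simp add: pos_le_divide_eq mult.commute)
      qed
      also have "(M / (\<rho> x / 2) ^ a) / (r - 1) = M / 2 / \<rho> x ^ a"
        by (simp add: r_def power_divide)
      finally have diff: "cmod (\<phi> q - \<phi> x) \<le> M / 2 / \<rho> x ^ a" by (simp add: v_def)
      have "cmod (\<phi> x) \<le> cmod (\<phi> q) + M / 2 / \<rho> x ^ a"
        using diff norm_triangle_ineq2 [of "\<phi> x" "\<phi> q"] by (simp add: norm_minus_commute)
      then have "m x \<le> \<rho> x ^ a * (cmod (\<phi> q) + M / 2 / \<rho> x ^ a)"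
        unfolding m_def using \<rho>x by (intro mult_left_mono) auto
      also have "\<dots> = \<rho> x ^ a * cmod (\<phi> q) + M / 2" using \<rho>x by (simp add: distrib_left)
      also have "\<rho> x ^ a * cmod (\<phi> q) \<le> w j * cmod (\<phi> (p j))"
        unfolding pj using n2 \<rho>x by (intro mult_right_mono power_mono) (auto simp: power_one_over)
      then have "\<rho> x ^ a * cmod (\<phi> q) + M / 2 \<le> S + M / 2" using wS [of j] by linarith
      finally show ?thesis .
    qed
    have "M \<le> S + M / 2" proof -
      have "Sup (m ` \<Omega>) \<le> S + M / 2" using ne step by (intro cSUP_least) auto
      then show ?thesis by (simp only: M_def [symmetric])
    qed
    then have "M \<le> 2 * S" by simp
    then have "m z \<le> 2 * S" using mM [OF z] by linarith
    then show ?thesis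
      unfolding S_def [symmetric] using \<rho>pos [OF z] by (simp add: m_def field_simps)
  qed
  have c: "continuous_on \<Omega> (\<lambda>z. 2 / \<rho> z ^ a)"
  proof (intro continuous_on_divide continuous_on_const continuous_on_power \<rho>cont ballI)
    show "\<rho> z ^ a \<noteq> 0" if "z \<in> \<Omega>" for z using \<rho>pos [OF that] by simp
  qed
  show thesis
  proof (rule that [of p w "\<lambda>z. 2 / \<rho> z ^ a"])
    show "0 \<le> 2 / \<rho> z ^ a" if "z \<in> \<Omega>" for z using \<rho>pos [OF that] by simp
  qed (fact p w0 wsum c \<phi>sum main)+
qed

section \<open>Diagonal modules of sequences\<close>

lemma l2_pull:
  assumes x: "x \<in> carrier l2" and "inj \<iota>"
  shows "(\<lambda>n. x (\<iota> n)) \<in> carrier l2" "hnorm l2 (\<lambda>n. x (\<iota> n)) \<le> hnorm l2 x"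
proof -
  have "(\<Sum>n<k. (cmod (x (\<iota> n)))\<^sup>2) \<le> (hnorm l2 x)\<^sup>2" for k
  proof -
    have "(\<Sum>n<k. (cmod (x (\<iota> n)))\<^sup>2) = (\<Sum>m\<in>\<iota> ` {..<k}. (cmod (x m))\<^sup>2)"
      by (subst sum.reindex) (auto intro: inj_on_subset [OF assms(2)])
    also have "\<dots> \<le> (hnorm l2 x)\<^sup>2" by (rule l2_sum_le [OF x]) simp
    finally show ?thesis .
  qed
  then show "(\<lambda>n. x (\<iota> n)) \<in> carrier l2" "hnorm l2 (\<lambda>n. x (\<iota> n)) \<le> hnorm l2 x"
    using l2I [of "\<lambda>n. x (\<iota> n)" "hnorm l2 x"] l2.hnorm_nonneg [OF x] by blast+
qed

text \<open>
  Transport of a sequence to the positions in the range of \<open>\<iota>\<close>, with zeros elsewhere.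
  Reading off these positions undoes it.
\<close>

definition push :: "(nat \<Rightarrow> nat) \<Rightarrow> (nat \<Rightarrow> complex) \<Rightarrow> nat \<Rightarrow> complex" where
  "push \<iota> y n = (if n \<in> range \<iota> then y (inv_into UNIV \<iota> n) else 0)"

lemma push_at: "inj \<iota> \<Longrightarrow> push \<iota> y (\<iota> m) = y m"
  by (simp add: push_def)

lemma push_outside: "n \<notin> range \<iota> \<Longrightarrow> push \<iota> y n = 0"
  by (simp add: push_def)

lemma l2_push:
  assumes y: "y \<in> carrier l2" and inj: "inj \<iota>"
  shows "push \<iota> y \<in> carrier l2"
proof (rule l2I(1))
  fix k
  have fin: "finite (\<iota> -` {..<k})" using inj by (intro finite_vimageI) simp_all
  have "(\<Sum>n<k. (cmod (push \<iota> y n))\<^sup>2) = (\<Sum>n\<in>\<iota> ` (\<iota> -` {..<k}). (cmod (push \<iota> y n))\<^sup>2)"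
    by (rule sum.mono_neutral_right) (auto simp: push_def)
  also have "\<dots> = (\<Sum>m\<in>\<iota> -` {..<k}. (cmod (y m))\<^sup>2)"
    by (subst sum.reindex) (auto intro: inj_on_subset [OF inj] simp: push_at [OF inj])
  also have "\<dots> \<le> (hnorm l2 y)\<^sup>2" by (rule l2_sum_le [OF y fin])
  finally show "(\<Sum>n<k. (cmod (push \<iota> y n))\<^sup>2) \<le> (hnorm l2 y)\<^sup>2" .
qed (rule l2.hnorm_nonneg [OF y])

lemma l2_mult:
  assumes x: "x \<in> carrier l2" and b: "\<And>n. cmod (b n) \<le> B" and B: "0 \<le> B"
  shows "(\<lambda>n. b n * x n) \<in> carrier l2" "hnorm l2 (\<lambda>n. b n * x n) \<le> B * hnorm l2 x"
proof -
  have "(\<Sum>n<k. (cmod (b n * x n))\<^sup>2) \<le> (B * hnorm l2 x)\<^sup>2" for k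
  proof -
    have "(\<Sum>n<k. (cmod (b n * x n))\<^sup>2) \<le> (\<Sum>n<k. B\<^sup>2 * (cmod (x n))\<^sup>2)"
    proof (rule sum_mono)
      fix n
      have "(cmod (b n))\<^sup>2 \<le> B\<^sup>2" using b by (intro power_mono) auto
      then show "(cmod (b n * x n))\<^sup>2 \<le> B\<^sup>2 * (cmod (x n))\<^sup>2"
        by (simp add: norm_mult power_mult_distrib mult_right_mono)
    qed
    also have "\<dots> = B\<^sup>2 * (\<Sum>n<k. (cmod (x n))\<^sup>2)" by (simp add: sum_distrib_left)
    also have "\<dots> \<le> B\<^sup>2 * (hnorm l2 x)\<^sup>2" by (intro mult_left_mono l2_sum_le [OF x]) simp_all
    finally show ?thesis by (simp add: power_mult_distrib)
  qed
  moreover have "0 \<le> B * hnorm l2 x" using B l2.hnorm_nonneg [OF x] by simp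
  ultimately show "(\<lambda>n. b n * x n) \<in> carrier l2" "hnorm l2 (\<lambda>n. b n * x n) \<le> B * hnorm l2 x"
    using l2I [of "\<lambda>n. b n * x n" "B * hnorm l2 x"] by blast+
qed

definition diag_act :: "(nat \<Rightarrow> 'p) \<Rightarrow> ('p \<Rightarrow> complex) \<Rightarrow> (nat \<Rightarrow> complex) \<Rightarrow> nat \<Rightarrow> complex" where
  "diag_act q \<phi> x = (\<lambda>n. \<phi> (q n) * x n)"

definition diag_module ::
  "(nat \<Rightarrow> 'p) \<Rightarrow> (nat \<Rightarrow> complex) set \<Rightarrow> ('p \<Rightarrow> complex, nat \<Rightarrow> complex) hmodule" where
  "diag_module q C = \<lparr>carrier = C, mult = undefined, one = undefined, zero = zero l2, add = add l2,
     smult = smult l2, cinner = cinner l2, act = diag_act q\<rparr>"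

lemma diag_module_simps:
  "carrier (diag_module q C) = C" "zero (diag_module q C) = zero l2" "add (diag_module q C) = add l2"
  "smult (diag_module q C) = smult l2" "cinner (diag_module q C) = cinner l2"
  "act (diag_module q C) = diag_act q"
  by (simp_all add: diag_module_def)

lemma diag_hnorm: "hnorm (diag_module q C) = hnorm l2"
  by (rule ext) (simp add: hnorm_def diag_module_simps del: l2_simps)

locale diagonal =
  fixes \<Omega> :: "(complex^'m) set" and q :: "nat \<Rightarrow> complex^'m"
  assumes bounded: "bounded \<Omega>" and q_in: "\<And>n. q n \<in> \<Omega>" and cring_A: "cring (A_ring \<Omega>)"
begin

lemma A_one: "indicator (closure \<Omega>) \<in> A_set \<Omega>"
  and A_zero: "(\<lambda>z. 0) \<in> A_set \<Omega>"
  and A_add: "\<lbrakk>\<phi> \<in> A_set \<Omega>; \<psi> \<in> A_set \<Omega>\<rbrakk> \<Longrightarrow> (\<lambda>z. \<phi> z + \<psi> z) \<in> A_set \<Omega>"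
  and A_mult: "\<lbrakk>\<phi> \<in> A_set \<Omega>; \<psi> \<in> A_set \<Omega>\<rbrakk> \<Longrightarrow> (\<lambda>z. \<phi> z * \<psi> z) \<in> A_set \<Omega>"
proof -
  interpret A: cring "A_ring \<Omega>" by (rule cring_A)
  show "indicator (closure \<Omega>) \<in> A_set \<Omega>" "(\<lambda>z. 0) \<in> A_set \<Omega>"
    "\<lbrakk>\<phi> \<in> A_set \<Omega>; \<psi> \<in> A_set \<Omega>\<rbrakk> \<Longrightarrow> (\<lambda>z. \<phi> z + \<psi> z) \<in> A_set \<Omega>"
    "\<lbrakk>\<phi> \<in> A_set \<Omega>; \<psi> \<in> A_set \<Omega>\<rbrakk> \<Longrightarrow> (\<lambda>z. \<phi> z * \<psi> z) \<in> A_set \<Omega>"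
    using A.one_closed A.zero_closed A.a_closed [of \<phi> \<psi>] A.m_closed [of \<phi> \<psi>] by auto
qed

lemma one_at: "z \<in> \<Omega> \<Longrightarrow> indicator (closure \<Omega>) z = (1 :: complex)"
  using closure_subset [of \<Omega>] by (simp add: indicator_def subset_iff)

text \<open>
  The closed submodules, described inside \<open>\<ell>\<^sup>2\<close>: all of them share its operations, so maps between
  them need no bookkeeping of records.
\<close>

definition invariant :: "(nat \<Rightarrow> complex) set \<Rightarrow> bool" where
  "invariant C \<longleftrightarrow> submodule C complex_ring l2 \<and> closedin (htop l2) C \<and>
    (\<forall>\<phi>\<in>A_set \<Omega>. \<forall>x\<in>C. diag_act q \<phi> x \<in> C)"

lemma diag_act_in: "\<lbrakk>\<phi> \<in> A_set \<Omega>; x \<in> carrier l2\<rbrakk> \<Longrightarrow> diag_act q \<phi> x \<in> carrier l2"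
  and diag_act_bound: "\<lbrakk>\<phi> \<in> A_set \<Omega>; x \<in> carrier l2\<rbrakk> \<Longrightarrow>
    hnorm l2 (diag_act q \<phi> x) \<le> sup_norm \<Omega> \<phi> * hnorm l2 x"
  unfolding diag_act_def
  using l2_mult [of x "\<lambda>n. \<phi> (q n)" "sup_norm \<Omega> \<phi>"] A_set_sup_norm [OF bounded _, of \<phi>] q_in
  by blast+

lemma diag_act_add: "diag_act q \<phi> (x \<oplus>\<^bsub>l2\<^esub> y) = diag_act q \<phi> x \<oplus>\<^bsub>l2\<^esub> diag_act q \<phi> y"
  by (simp add: diag_act_def distrib_left)

lemma diag_act_smult: "diag_act q \<phi> (c \<odot>\<^bsub>l2\<^esub> x) = c \<odot>\<^bsub>l2\<^esub> diag_act q \<phi> x"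
  by (simp add: diag_act_def mult.left_commute)

lemma linear_map_diag_act: "\<phi> \<in> A_set \<Omega> \<Longrightarrow> linear_map l2 l2 (carrier l2) (diag_act q \<phi>)"
  by (intro linear_map.intro linear_map_axioms.intro inner_product_space_l2 l2.carrier_is_submodule
      linear_map_onI diag_act_add diag_act_smult diag_act_in)

lemma invariant_hclosure:
  assumes V: "submodule V complex_ring l2"
    and inv: "\<And>\<phi> x. \<lbrakk>\<phi> \<in> A_set \<Omega>; x \<in> V\<rbrakk> \<Longrightarrow> diag_act q \<phi> x \<in> V"
  shows "invariant (hclosure l2 V)"
  unfolding invariant_def
proof (intro conjI ballI l2.submodule_hclosure [OF V] l2.closedin_hclosure)
  note Vc = l2.submoduleD(1) [OF V]
  fix \<phi> x assume \<phi>: "\<phi> \<in> A_set \<Omega>" and x: "x \<in> hclosure l2 V"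
  have xc: "x \<in> carrier l2" using x l2.hclosure_in_carrier by blast
  interpret D: linear_map l2 l2 "carrier l2" "diag_act q \<phi>" by (rule linear_map_diag_act [OF \<phi>])
  show "diag_act q \<phi> x \<in> hclosure l2 V"
    unfolding l2.in_closure_iff [OF Vc]
  proof (intro conjI allI impI diag_act_in [OF \<phi> xc])
    fix e :: real assume e: "e > 0"
    have s: "0 \<le> sup_norm \<Omega> \<phi>" by (rule A_set_sup_norm(1) [OF bounded \<phi>])
    then have e': "e / (sup_norm \<Omega> \<phi> + 1) > 0" using e by simp
    obtain y where y: "y \<in> V" "hnorm l2 (x \<ominus>\<^bsub>l2\<^esub> y) < e / (sup_norm \<Omega> \<phi> + 1)"
      by (rule l2.hclosure_approx [OF x Vc e'])
    have yc: "y \<in> carrier l2" using y Vc by blast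
    have "hnorm l2 (diag_act q \<phi> x \<ominus>\<^bsub>l2\<^esub> diag_act q \<phi> y) \<le> sup_norm \<Omega> \<phi> * hnorm l2 (x \<ominus>\<^bsub>l2\<^esub> y)"
      by (rule D.Lipschitz [OF diag_act_bound [OF \<phi>] xc yc])
    also have "\<dots> \<le> (sup_norm \<Omega> \<phi> + 1) * hnorm l2 (x \<ominus>\<^bsub>l2\<^esub> y)"
      using l2.hnorm_nonneg [OF l2.minus_closed [OF xc yc]] by (intro mult_right_mono) simp_all
    also have "\<dots> < e"
      using y(2) s by (simp only: pos_less_divide_eq [of "sup_norm \<Omega> \<phi> + 1"] mult.commute)
    finally show "\<exists>y\<in>V. hnorm l2 (diag_act q \<phi> x \<ominus>\<^bsub>l2\<^esub> y) < e" using inv [OF \<phi> y(1)] by blast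
  qed
qed

context
  fixes C
  assumes inv: "invariant C"
begin

abbreviation (input) "D \<equiv> diag_module q C"

lemma C_sub: "submodule C complex_ring l2" and C_closed: "closedin (htop l2) C"
  and C_act: "\<lbrakk>\<phi> \<in> A_set \<Omega>; x \<in> C\<rbrakk> \<Longrightarrow> diag_act q \<phi> x \<in> C"
  using inv unfolding invariant_def by blast+

lemma C_in: "x \<in> C \<Longrightarrow> x \<in> carrier l2"
  using l2.submoduleD(1) [OF C_sub] by blast

lemma hilbert_space_D: "hilbert_space D"
proof (rule hilbert_space_by_isometry [where J = "\<lambda>x. x", OF hilbert_space_l2], unfold diag_module_simps)
  show "inj_on (\<lambda>x. x) C" by simp
  show "closedin (htop l2) ((\<lambda>x. x) ` C)" using C_closed by simp
qed (auto intro: C_in l2.submoduleD(2-4) [OF C_sub] simp del: l2_simps)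

lemma D_minus: "\<lbrakk>x \<in> C; y \<in> C\<rbrakk> \<Longrightarrow> x \<ominus>\<^bsub>D\<^esub> y = x \<ominus>\<^bsub>l2\<^esub> y"
proof -
  assume xy: "x \<in> C" "y \<in> C"
  interpret D: hilbert_space D by (rule hilbert_space_D)
  have "x \<ominus>\<^bsub>D\<^esub> y = x \<oplus>\<^bsub>D\<^esub> (-1) \<odot>\<^bsub>D\<^esub> y"
    by (rule D.minus_eq_smult) (use xy in \<open>simp_all only: diag_module_simps\<close>)
  also have "\<dots> = x \<oplus>\<^bsub>l2\<^esub> (-1) \<odot>\<^bsub>l2\<^esub> y" by (simp only: diag_module_simps)
  also have "\<dots> = x \<ominus>\<^bsub>l2\<^esub> y" by (rule l2.minus_eq_smult [OF C_in C_in, OF xy, symmetric])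
  finally show ?thesis .
qed

lemma D_finsum:
  assumes "finite I" "\<And>i. i \<in> I \<Longrightarrow> v i \<in> C"
  shows "(\<Oplus>\<^bsub>D\<^esub>i\<in>I. v i) = (\<lambda>n. \<Sum>i\<in>I. v i n)"
proof -
  interpret D: hilbert_space D by (rule hilbert_space_D)
  show ?thesis
    using assms
  proof (induction I)
    case empty
    show ?case unfolding D.finsum_empty by (simp add: diag_module_simps)
  next
    case (insert i I)
    have v: "v \<in> I \<rightarrow> carrier D" "v i \<in> carrier D" using insert.prems by (auto simp: diag_module_simps)
    have "(\<Oplus>\<^bsub>D\<^esub>i\<in>insert i I. v i) = v i \<oplus>\<^bsub>D\<^esub> (\<Oplus>\<^bsub>D\<^esub>i\<in>I. v i)"
      by (rule D.finsum_insert [OF insert.hyps v])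
    also have "(\<Oplus>\<^bsub>D\<^esub>i\<in>I. v i) = (\<lambda>n. \<Sum>i\<in>I. v i n)" using insert by simp
    finally show ?case using insert.hyps by (simp add: diag_module_simps)
  qed
qed

lemma D_hclosure: "S \<subseteq> C \<Longrightarrow> hclosure D S = hclosure l2 S"
proof -
  assume S: "S \<subseteq> C"
  interpret D: hilbert_space D by (rule hilbert_space_D)
  have sub: "S \<subseteq> carrier D" "S \<subseteq> carrier l2" using S C_in by (auto simp only: diag_module_simps)
  have "hclosure l2 S \<subseteq> C" by (rule l2.hclosure_minimal [OF S C_closed])
  moreover have "x \<in> hclosure D S \<longleftrightarrow> x \<in> hclosure l2 S" if x: "x \<in> C" for x
  proof -
    have "hnorm D (x \<ominus>\<^bsub>D\<^esub> y) = hnorm l2 (x \<ominus>\<^bsub>l2\<^esub> y)" if "y \<in> S" for y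
      using D_minus [OF x] S that by (simp only: diag_hnorm subset_iff)
    then show ?thesis
      unfolding D.in_closure_iff [OF sub(1)] l2.in_closure_iff [OF sub(2)]
      using x C_in [OF x] by (simp only: diag_module_simps cong: bex_cong)
  qed
  moreover have "hclosure D S \<subseteq> C" using D.hclosure_in_carrier by (simp only: diag_module_simps)
  ultimately show ?thesis by blast
qed

text \<open>
  The module laws hold coordinate by coordinate, and the points lie in \<open>\<Omega>\<close>, where functions
  are bounded by the supremum norm; this gives the estimate for joint continuity.
\<close>

lemma hilbert_module_D: "hilbert_module \<Omega> D"
proof -
  interpret D: hilbert_space D by (rule hilbert_space_D)
  have ab: "abelian_group (A_module_of D)"
  proof (rule abelian_groupI, unfold A_module_of_simps)
    fix x assume x: "x \<in> carrier D"
    show "\<exists>y\<in>carrier D. y \<oplus>\<^bsub>D\<^esub> x = \<zero>\<^bsub>D\<^esub>" using D.l_neg [OF x] D.a_inv_closed [OF x] by blast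
  qed (auto intro: D.a_assoc D.a_comm)
  have mod: "Module.module (A_ring \<Omega>) (A_module_of D)"
    by (rule moduleI [OF cring_A ab], unfold A_module_of_simps A_ring_simps diag_module_simps)
      (simp_all add: C_act, simp_all add: diag_act_def algebra_simps one_at [OF q_in])
  have cont: "continuous_map (prod_topology (A_top \<Omega>) (htop D)) (htop D) (\<lambda>(\<phi>, x). act D \<phi> x)"
  proof (rule act_continuousI [OF bounded D.inner_product_space_axioms])
    show "act D \<phi> x \<in> carrier D" if "\<phi> \<in> A_set \<Omega>" "x \<in> carrier D" for \<phi> x
      using C_act that by (simp only: diag_module_simps)
    fix \<phi> \<psi> x y
    assume \<phi>: "\<phi> \<in> A_set \<Omega>" and \<psi>: "\<psi> \<in> A_set \<Omega>" and "x \<in> carrier D" "y \<in> carrier D"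
    then have x: "x \<in> C" and y: "y \<in> C" by (simp_all only: diag_module_simps)
    note xl = C_in [OF x] and yl = C_in [OF y]
    have yx: "y \<ominus>\<^bsub>l2\<^esub> x \<in> carrier l2" by (rule l2.minus_closed [OF yl xl])
    define u where "u = (\<lambda>n. (\<psi> (q n) - \<phi> (q n)) * y n)"
    define v where "v = diag_act q \<phi> (y \<ominus>\<^bsub>l2\<^esub> x)"
    have "cmod (\<psi> (q n) - \<phi> (q n)) \<le> A_dist \<Omega> \<phi> \<psi>" for n
      using A_dist_props(2) [OF bounded \<phi> \<psi> q_in [of n]] by (simp only: norm_minus_commute)
    note u = l2_mult [where b = "\<lambda>n. \<psi> (q n) - \<phi> (q n)", OF yl this A_dist_props(1) [OF bounded \<phi> \<psi>], folded u_def]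
    have v: "v \<in> carrier l2" "hnorm l2 v \<le> sup_norm \<Omega> \<phi> * hnorm l2 (y \<ominus>\<^bsub>l2\<^esub> x)"
      unfolding v_def by (rule diag_act_in [OF \<phi> yx], rule diag_act_bound [OF \<phi> yx])
    have "act D \<psi> y \<ominus>\<^bsub>D\<^esub> act D \<phi> x = diag_act q \<psi> y \<ominus>\<^bsub>l2\<^esub> diag_act q \<phi> x"
      using D_minus [OF C_act [OF \<psi> y] C_act [OF \<phi> x]] by (simp only: diag_module_simps)
    also have "\<dots> = u \<oplus>\<^bsub>l2\<^esub> v"
      unfolding l2_minus [OF diag_act_in [OF \<psi> yl] diag_act_in [OF \<phi> xl]] u_def v_def l2_minus [OF yl xl]
      by (simp add: diag_act_def algebra_simps)
    finally have "hnorm D (act D \<psi> y \<ominus>\<^bsub>D\<^esub> act D \<phi> x) \<le> hnorm l2 u + hnorm l2 v"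
      using l2.hnorm_triangle [OF u(1) v(1)] by (simp only: diag_hnorm)
    also have "\<dots> \<le> A_dist \<Omega> \<phi> \<psi> * hnorm l2 y + sup_norm \<Omega> \<phi> * hnorm l2 (x \<ominus>\<^bsub>l2\<^esub> y)"
      using u(2) v(2) l2.hnorm_minus_commute [OF xl yl] by simp
    finally show "hnorm D (act D \<psi> y \<ominus>\<^bsub>D\<^esub> act D \<phi> x) \<le>
        A_dist \<Omega> \<phi> \<psi> * hnorm D y + sup_norm \<Omega> \<phi> * hnorm D (x \<ominus>\<^bsub>D\<^esub> y)"
      unfolding D_minus [OF x y] diag_hnorm .
  qed
  show ?thesis
  proof (intro hilbert_module.intro hilbert_module_axioms.intro hilbert_space_D mod cont)
    show "act D (\<lambda>z. c * \<phi> z) x = c \<odot>\<^bsub>D\<^esub> act D \<phi> x" for c \<phi> x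
      by (simp add: diag_module_simps diag_act_def mult.assoc)
  qed
qed

end

end

section \<open>Modules generated by sequences\<close>

text \<open>
  Pairs are encoded by natural numbers, which turns a sequence into a matrix. The even rows are
  addressed one at a time; the odd rows together form a second copy of the whole matrix. The
  column index is kept, so that the algebra acts on this copy in the same way as on the
  original.
\<close>

definition even_row :: "nat \<Rightarrow> nat \<Rightarrow> nat" where "even_row i j = prod_encode (2 * i, j)"

definition odd_rows :: "nat \<Rightarrow> nat" where
  "odd_rows n = (case prod_decode n of (i, j) \<Rightarrow> prod_encode (2 * i + 1, j))"

lemma inj_even_row: "inj (even_row i)"
  by (rule injI) (simp add: even_row_def)

lemma inj_odd_rows: "inj odd_rows"
proof (rule injI)
  fix m n assume eq: "odd_rows m = odd_rows n"
  obtain i j where m: "m = prod_encode (i, j)" by (metis prod_decode_inverse surj_pair)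
  obtain k l where n: "n = prod_encode (k, l)" by (metis prod_decode_inverse surj_pair)
  show "m = n" using eq unfolding m n by (simp add: odd_rows_def)
qed

lemma even_row_eq_iff: "even_row i j = even_row i' j' \<longleftrightarrow> i = i' \<and> j = j'"
  by (simp add: even_row_def)

lemma even_row_neq_odd_rows: "even_row i j \<noteq> odd_rows n"
proof
  assume "even_row i j = odd_rows n"
  then have "2 * i = 2 * fst (prod_decode n) + 1"
    by (simp add: even_row_def odd_rows_def split: prod.splits)
  then show False by presburger
qed

lemma row_cases:
  obtains i j where "n = even_row i j" | m where "n = odd_rows m"
proof -
  obtain k j where kj: "prod_decode n = (k, j)" by fastforce
  then have n: "n = prod_encode (k, j)" by (metis prod_decode_inverse)
  show thesis
  proof (cases "even k")
    case True
    then obtain i where "k = 2 * i" by blast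
    then show thesis using n that(1) by (simp add: even_row_def)
  next
    case False
    then obtain i where "k = 2 * i + 1" by (rule oddE)
    then have "n = odd_rows (prod_encode (i, j))" using n by (simp add: odd_rows_def)
    then show thesis by (rule that(2))
  qed
qed

definition odd_part :: "(nat \<Rightarrow> complex) \<Rightarrow> nat \<Rightarrow> complex" where
  "odd_part x = (\<lambda>n. x (odd_rows n))"

lemma odd_part_in: "x \<in> carrier l2 \<Longrightarrow> odd_part x \<in> carrier l2"
  and hnorm_odd_part: "x \<in> carrier l2 \<Longrightarrow> hnorm l2 (odd_part x) \<le> hnorm l2 x"
  unfolding odd_part_def by (rule l2_pull [OF _ inj_odd_rows]; assumption)+

lemma odd_part_add: "odd_part (x \<oplus>\<^bsub>l2\<^esub> y) = odd_part x \<oplus>\<^bsub>l2\<^esub> odd_part y"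
  and odd_part_smult: "odd_part (c \<odot>\<^bsub>l2\<^esub> x) = c \<odot>\<^bsub>l2\<^esub> odd_part x"
  by (simp_all add: odd_part_def)

lemma linear_map_odd_part: "submodule C complex_ring l2 \<Longrightarrow> linear_map l2 l2 C odd_part"
  by (intro linear_map.intro linear_map_axioms.intro inner_product_space_l2
      linear_map_onI odd_part_add odd_part_smult odd_part_in) (auto dest: l2.submoduleD(1))

lemma even_rows_sum_le:
  assumes x: "x \<in> carrier l2"
  shows "summable (\<lambda>j. (cmod (x (even_row i j)))\<^sup>2)"
    "(\<Sum>i<k. \<Sum>j. (cmod (x (even_row i j)))\<^sup>2) \<le> (hnorm l2 x)\<^sup>2"
proof -
  show s: "summable (\<lambda>j. (cmod (x (even_row i j)))\<^sup>2)" for i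
    using l2_pull(1) [OF x inj_even_row] by (simp only: in_l2_iff)
  have "(\<Sum>i<k. \<Sum>j. (cmod (x (even_row i j)))\<^sup>2) = (\<Sum>j. \<Sum>i<k. (cmod (x (even_row i j)))\<^sup>2)"
    by (rule suminf_sum [symmetric]) (rule s)
  also have "\<dots> \<le> (hnorm l2 x)\<^sup>2"
  proof (rule suminf_le_const)
    show "summable (\<lambda>j. \<Sum>i<k. (cmod (x (even_row i j)))\<^sup>2)" by (intro summable_sum s)
    fix J
    have "(\<Sum>j<J. \<Sum>i<k. (cmod (x (even_row i j)))\<^sup>2) =
        (\<Sum>(j, i)\<in>{..<J} \<times> {..<k}. (cmod (x (even_row i j)))\<^sup>2)"
      by (simp add: sum.cartesian_product)
    also have "\<dots> = (\<Sum>n\<in>(\<lambda>(j, i). even_row i j) ` ({..<J} \<times> {..<k}). (cmod (x n))\<^sup>2)"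
      by (subst sum.reindex) (auto simp: inj_on_def even_row_eq_iff intro!: sum.cong)
    also have "\<dots> \<le> (hnorm l2 x)\<^sup>2" by (rule l2_sum_le [OF x]) simp
    finally show "(\<Sum>j<J. \<Sum>i<k. (cmod (x (even_row i j)))\<^sup>2) \<le> (hnorm l2 x)\<^sup>2" .
  qed
  finally show "(\<Sum>i<k. \<Sum>j. (cmod (x (even_row i j)))\<^sup>2) \<le> (hnorm l2 x)\<^sup>2" .
qed

text \<open>
  The data provided by the sampling theorem.
\<close>

locale sampled =
  fixes \<Omega> :: "(complex^'m) set" and p :: "nat \<Rightarrow> complex^'m" and w :: "nat \<Rightarrow> real"
    and c :: "complex^'m \<Rightarrow> real"
  assumes bounded': "bounded \<Omega>" and nonempty: "\<Omega> \<noteq> {}" and cring_A': "cring (A_ring \<Omega>)"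
    and p_in: "\<And>j. p j \<in> \<Omega>" and w_nonneg: "\<And>j. 0 \<le> w j" and w_summable: "summable (\<lambda>j. (w j)\<^sup>2)"
    and c_cont: "continuous_on \<Omega> c" and c_nonneg: "\<And>z. z \<in> \<Omega> \<Longrightarrow> 0 \<le> c z"
    and sample_summable: "\<And>\<phi>. \<phi> \<in> A_set \<Omega> \<Longrightarrow> summable (\<lambda>j. (w j * cmod (\<phi> (p j)))\<^sup>2)"
    and sample_bound: "\<And>\<phi> z. \<lbrakk>\<phi> \<in> A_set \<Omega>; z \<in> \<Omega>\<rbrakk> \<Longrightarrow>
      cmod (\<phi> z) \<le> c z * sqrt (\<Sum>j. (w j * cmod (\<phi> (p j)))\<^sup>2)"
begin

definition q :: "nat \<Rightarrow> complex^'m" where "q n = p (snd (prod_decode n))"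

sublocale diagonal \<Omega> q
  by (intro diagonal.intro bounded' cring_A') (simp add: q_def p_in)

lemma q_even_row: "q (even_row i j) = p j"
  by (simp add: q_def even_row_def)

lemma q_odd_rows: "q (odd_rows n) = q n"
  by (simp add: q_def odd_rows_def split: prod.split)

lemma odd_part_diag_act: "odd_part (diag_act q \<phi> x) = diag_act q \<phi> (odd_part x)"
  by (simp add: odd_part_def diag_act_def q_odd_rows)

definition weights :: "nat \<Rightarrow> complex" where "weights j = complex_of_real (w j)"

lemma weights_in: "weights \<in> carrier l2"
  using w_summable by (simp add: in_l2_iff weights_def)

definition sample_norm :: "(complex^'m \<Rightarrow> complex) \<Rightarrow> real" where
  "sample_norm \<phi> = sqrt (\<Sum>j. (w j * cmod (\<phi> (p j)))\<^sup>2)"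

text \<open>
  Finite families of coefficients are sequences that are eventually 0, so that combinations of generators
  can be added without comparing index sets.
\<close>

definition coeffs :: "(nat \<Rightarrow> complex^'m \<Rightarrow> complex) set" where
  "coeffs = {\<phi>. (\<forall>l. \<phi> l \<in> A_set \<Omega>) \<and> (\<exists>N. \<forall>l\<ge>N. \<phi> l = (\<lambda>z. 0))}"

definition comb :: "(nat \<Rightarrow> nat \<Rightarrow> complex) \<Rightarrow> (nat \<Rightarrow> complex^'m \<Rightarrow> complex) \<Rightarrow> nat \<Rightarrow> complex" where
  "comb h \<phi> = (\<lambda>n. \<Sum>l. \<phi> l (q n) * h l n)"

lemma coeffsD: "\<phi> \<in> coeffs \<Longrightarrow> \<phi> l \<in> A_set \<Omega>" "\<phi> \<in> coeffs \<Longrightarrow> \<exists>N. \<forall>l\<ge>N. \<phi> l = (\<lambda>z. 0)"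
  unfolding coeffs_def by blast+

lemma coeffsI: "\<lbrakk>\<And>l. \<phi> l \<in> A_set \<Omega>; \<And>l. l \<ge> N \<Longrightarrow> \<phi> l = (\<lambda>z. 0)\<rbrakk> \<Longrightarrow> \<phi> \<in> coeffs"
  unfolding coeffs_def by blast

lemma comb_eq: "\<forall>l\<ge>N. \<phi> l = (\<lambda>z. 0) \<Longrightarrow> comb h \<phi> = (\<lambda>n. \<Sum>l<N. \<phi> l (q n) * h l n)"
  unfolding comb_def by (rule ext, rule suminf_finite) (auto simp: not_less)

lemma coeffs_add:
  assumes \<phi>: "\<phi> \<in> coeffs" and \<psi>: "\<psi> \<in> coeffs"
  shows "(\<lambda>l z. \<phi> l z + \<psi> l z) \<in> coeffs"
    "comb h (\<lambda>l z. \<phi> l z + \<psi> l z) = comb h \<phi> \<oplus>\<^bsub>l2\<^esub> comb h \<psi>"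
proof -
  obtain N where N: "\<forall>l\<ge>N. \<phi> l = (\<lambda>z. 0)" using coeffsD(2) [OF \<phi>] by blast
  obtain N' where N': "\<forall>l\<ge>N'. \<psi> l = (\<lambda>z. 0)" using coeffsD(2) [OF \<psi>] by blast
  have a: "\<forall>l\<ge>max N N'. \<phi> l = (\<lambda>z. 0)" "\<forall>l\<ge>max N N'. \<psi> l = (\<lambda>z. 0)" using N N' by auto
  then have b: "\<forall>l\<ge>max N N'. (\<lambda>z. \<phi> l z + \<psi> l z) = (\<lambda>z. 0)" by simp
  show "(\<lambda>l z. \<phi> l z + \<psi> l z) \<in> coeffs"
    by (rule coeffsI [of _ "max N N'"]) (use b in \<open>auto intro: A_add coeffsD(1) [OF \<phi>] coeffsD(1) [OF \<psi>]\<close>)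
  show "comb h (\<lambda>l z. \<phi> l z + \<psi> l z) = comb h \<phi> \<oplus>\<^bsub>l2\<^esub> comb h \<psi>"
    unfolding comb_eq [OF a(1)] comb_eq [OF a(2)] comb_eq [OF b] by (simp add: distrib_right sum.distrib)
qed

lemma coeffs_mult:
  assumes \<phi>: "\<phi> \<in> coeffs" and \<psi>: "\<psi> \<in> A_set \<Omega>"
  shows "(\<lambda>l z. \<psi> z * \<phi> l z) \<in> coeffs"
    "comb h (\<lambda>l z. \<psi> z * \<phi> l z) = diag_act q \<psi> (comb h \<phi>)"
proof -
  obtain N where N: "\<forall>l\<ge>N. \<phi> l = (\<lambda>z. 0)" using coeffsD(2) [OF \<phi>] by blast
  then have b: "\<forall>l\<ge>N. (\<lambda>z. \<psi> z * \<phi> l z) = (\<lambda>z. 0)" by simp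
  show "(\<lambda>l z. \<psi> z * \<phi> l z) \<in> coeffs"
    by (rule coeffsI [of _ N]) (use b in \<open>auto intro: A_mult \<psi> coeffsD(1) [OF \<phi>]\<close>)
  show "comb h (\<lambda>l z. \<psi> z * \<phi> l z) = diag_act q \<psi> (comb h \<phi>)"
    unfolding comb_eq [OF N] comb_eq [OF b] by (simp add: diag_act_def sum_distrib_left mult.assoc)
qed

lemma coeffs_smult:
  assumes \<phi>: "\<phi> \<in> coeffs"
  shows "(\<lambda>l z. a * \<phi> l z) \<in> coeffs" "comb h (\<lambda>l z. a * \<phi> l z) = a \<odot>\<^bsub>l2\<^esub> comb h \<phi>"
proof -
  obtain N where N: "\<forall>l\<ge>N. \<phi> l = (\<lambda>z. 0)" using coeffsD(2) [OF \<phi>] by blast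
  then have b: "\<forall>l\<ge>N. (\<lambda>z. a * \<phi> l z) = (\<lambda>z. 0)" by simp
  show "(\<lambda>l z. a * \<phi> l z) \<in> coeffs"
    by (rule coeffsI [of _ N]) (use b in \<open>auto intro: A_set_smult coeffsD(1) [OF \<phi>]\<close>)
  show "comb h (\<lambda>l z. a * \<phi> l z) = a \<odot>\<^bsub>l2\<^esub> comb h \<phi>"
    unfolding comb_eq [OF N] comb_eq [OF b] by (simp add: sum_distrib_left mult.assoc)
qed

definition unit_coeff :: "nat \<Rightarrow> nat \<Rightarrow> complex^'m \<Rightarrow> complex" where
  "unit_coeff i l = (if l = i then indicator (closure \<Omega>) else (\<lambda>z. 0))"

lemma unit_coeff_in: "unit_coeff i \<in> coeffs"
  by (rule coeffsI [of _ "Suc i"]) (auto simp: unit_coeff_def A_one A_zero)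

lemma comb_unit_coeff: "comb h (unit_coeff i) = h i"
proof -
  have "\<forall>l\<ge>Suc i. unit_coeff i l = (\<lambda>z. 0)" by (simp add: unit_coeff_def)
  from comb_eq [OF this] show ?thesis
    by (rule trans) (simp add: unit_coeff_def one_at [OF q_in] if_distrib [of "\<lambda>f. f _"] cong: if_cong)
qed

lemma comb_finsum:
  assumes \<phi>: "\<phi> \<in> coeffs" "\<forall>l\<ge>N. \<phi> l = (\<lambda>z. 0)" and h: "\<And>l. h l \<in> carrier l2"
  shows "comb h \<phi> = (\<Oplus>\<^bsub>l2\<^esub>l\<in>{..<N}. diag_act q (\<phi> l) (h l))"
proof -
  have "(\<Oplus>\<^bsub>l2\<^esub>l\<in>{..<N}. diag_act q (\<phi> l) (h l)) = (\<lambda>n. \<Sum>l<N. diag_act q (\<phi> l) (h l) n)"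
    by (rule l2_finsum) (auto intro: diag_act_in coeffsD(1) [OF \<phi>(1)] h)
  then show ?thesis unfolding comb_eq [OF \<phi>(2)] by (simp add: diag_act_def)
qed

lemma comb_in_invariant:
  assumes \<phi>: "\<phi> \<in> coeffs" and V: "invariant V" and h: "\<And>l. h l \<in> V"
  shows "comb h \<phi> \<in> V"
proof -
  obtain N where N: "\<forall>l\<ge>N. \<phi> l = (\<lambda>z. 0)" using coeffsD(2) [OF \<phi>] by blast
  have "(\<Oplus>\<^bsub>l2\<^esub>l\<in>{..<N}. diag_act q (\<phi> l) (h l)) \<in> V"
    by (rule l2.finsum_in_submodule [OF C_sub [OF V]])
      (auto intro: C_act [OF V] coeffsD(1) [OF \<phi>] h)
  then show ?thesis unfolding comb_finsum [OF \<phi> N C_in [OF V h]] .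
qed

lemma invariant_l2: "invariant (carrier l2)"
  unfolding invariant_def using diag_act_in l2.carrier_is_submodule l2.closedin_iff by blast

definition span_of :: "(nat \<Rightarrow> nat \<Rightarrow> complex) \<Rightarrow> (nat \<Rightarrow> complex) set" where
  "span_of h = comb h ` coeffs"

lemma submodule_span_of:
  assumes h: "\<And>l. h l \<in> carrier l2"
  shows "submodule (span_of h) complex_ring l2"
  unfolding l2.submodule_iff span_of_def
proof (intro conjI ballI allI subsetI)
  show "x \<in> carrier l2" if "x \<in> comb h ` coeffs" for x
    using that comb_in_invariant [where h = h, OF _ invariant_l2 h] by blast
  show smult: "a \<odot>\<^bsub>l2\<^esub> x \<in> comb h ` coeffs" if x: "x \<in> comb h ` coeffs" for a x
  proof -
    obtain \<phi> where \<phi>: "\<phi> \<in> coeffs" "x = comb h \<phi>" using x by blast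
    show ?thesis
      unfolding \<phi>(2) coeffs_smult(2) [OF \<phi>(1), symmetric] by (rule imageI [OF coeffs_smult(1) [OF \<phi>(1)]])
  qed
  show "x \<oplus>\<^bsub>l2\<^esub> y \<in> comb h ` coeffs" if x: "x \<in> comb h ` coeffs" and y: "y \<in> comb h ` coeffs" for x y
  proof -
    obtain \<phi> where \<phi>: "\<phi> \<in> coeffs" "x = comb h \<phi>" using x by blast
    obtain \<psi> where \<psi>: "\<psi> \<in> coeffs" "y = comb h \<psi>" using y by blast
    show ?thesis
      unfolding \<phi>(2) \<psi>(2) coeffs_add(2) [OF \<phi>(1) \<psi>(1), symmetric]
      by (rule imageI [OF coeffs_add(1) [OF \<phi>(1) \<psi>(1)]])
  qed
  have "0 \<odot>\<^bsub>l2\<^esub> h 0 \<in> comb h ` coeffs"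
    by (rule smult) (use imageI [OF unit_coeff_in [of 0], of "comb h"] in \<open>unfold comb_unit_coeff\<close>)
  then show "\<zero>\<^bsub>l2\<^esub> \<in> comb h ` coeffs" by simp
qed

definition generated :: "(nat \<Rightarrow> nat \<Rightarrow> complex) \<Rightarrow> (nat \<Rightarrow> complex) set" where
  "generated h = hclosure l2 (span_of h)"

lemma invariant_generated:
  assumes h: "\<And>l. h l \<in> carrier l2"
  shows "invariant (generated h)"
  unfolding generated_def
proof (rule invariant_hclosure [OF submodule_span_of [OF h]])
  fix \<psi> x assume \<psi>: "\<psi> \<in> A_set \<Omega>" and "x \<in> span_of h"
  then obtain \<phi> where \<phi>: "\<phi> \<in> coeffs" "x = comb h \<phi>" unfolding span_of_def by blast
  show "diag_act q \<psi> x \<in> span_of h"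
    unfolding \<phi>(2) coeffs_mult(2) [OF \<phi>(1) \<psi>, symmetric] span_of_def
    by (rule imageI [OF coeffs_mult(1) [OF \<phi>(1) \<psi>]])
qed

lemma span_of_subset: "(\<And>l. h l \<in> carrier l2) \<Longrightarrow> span_of h \<subseteq> generated h"
  unfolding generated_def by (rule l2.subset_hclosure [OF l2.submoduleD(1) [OF submodule_span_of]])

lemma generator_in:
  assumes "\<And>l. h l \<in> carrier l2"
  shows "h i \<in> generated h"
proof -
  have "comb h (unit_coeff i) \<in> span_of h" unfolding span_of_def by (rule imageI [OF unit_coeff_in])
  then show ?thesis unfolding comb_unit_coeff using span_of_subset [of h, OF assms] by blast
qed

text \<open>
  The weights record the coefficient, and the odd rows its effect: the module generated
  is the closure of the graph of \<open>\<phi> \<mapsto> comb g \<phi>\<close>, with \<open>\<phi>\<close> measured by its samples.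
\<close>

definition gen :: "(nat \<Rightarrow> nat \<Rightarrow> complex) \<Rightarrow> nat \<Rightarrow> nat \<Rightarrow> complex" where
  "gen g l = push (even_row l) weights \<oplus>\<^bsub>l2\<^esub> push odd_rows (g l)"

lemma gen_in: "(\<And>l. g l \<in> carrier l2) \<Longrightarrow> gen g l \<in> carrier l2"
  unfolding gen_def
  by (intro l2.a_closed l2_push [OF weights_in inj_even_row] l2_push [OF _ inj_odd_rows])

lemma gen_even_row: "gen g l (even_row i j) = (if i = l then weights j else 0)"
proof -
  have o: "even_row i j \<notin> range odd_rows" using even_row_neq_odd_rows by blast
  have e: "even_row i j \<notin> range (even_row l)" if "i \<noteq> l" using that even_row_eq_iff by blast
  show ?thesis
    using push_outside [OF o] push_outside [OF e] push_at [OF inj_even_row, of l weights j]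
    by (auto simp: gen_def)
qed

lemma gen_odd_rows: "gen g l (odd_rows n) = g l n"
proof -
  have "odd_rows n \<notin> range (even_row l)" using even_row_neq_odd_rows by (metis imageE)
  then show ?thesis
    using push_outside push_at [OF inj_odd_rows, of "g l" n] by (simp add: gen_def)
qed

lemma comb_gen_even_row:
  assumes \<phi>: "\<phi> \<in> coeffs"
  shows "comb (gen g) \<phi> (even_row i j) = \<phi> i (p j) * weights j"
proof -
  have "comb (gen g) \<phi> (even_row i j) = (\<Sum>l. \<phi> l (p j) * (if i = l then weights j else 0))"
    by (simp add: comb_def gen_even_row q_even_row)
  also have "\<dots> = (\<Sum>l\<in>{i}. \<phi> l (p j) * (if i = l then weights j else 0))"
    by (rule suminf_finite) auto
  finally show ?thesis by simp
qed

lemma odd_part_comb_gen: "odd_part (comb (gen g) \<phi>) = comb g \<phi>"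
  by (simp add: odd_part_def comb_def gen_odd_rows q_odd_rows)

lemma sample_norms_le:
  assumes \<phi>: "\<phi> \<in> coeffs" and g: "\<And>l. g l \<in> carrier l2"
  shows "(\<Sum>l<k. (sample_norm (\<phi> l))\<^sup>2) \<le> (hnorm l2 (comb (gen g) \<phi>))\<^sup>2"
proof -
  have x: "comb (gen g) \<phi> \<in> carrier l2"
    by (rule comb_in_invariant [OF \<phi> invariant_l2 gen_in [OF g]])
  have "(sample_norm (\<phi> l))\<^sup>2 = (\<Sum>j. (cmod (comb (gen g) \<phi> (even_row l j)))\<^sup>2)" for l
  proof -
    have "(\<Sum>j. (w j * cmod (\<phi> l (p j)))\<^sup>2) \<ge> 0"
      by (rule suminf_nonneg [OF sample_summable [OF coeffsD(1) [OF \<phi>]]]) simp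
    then have "(sample_norm (\<phi> l))\<^sup>2 = (\<Sum>j. (w j * cmod (\<phi> l (p j)))\<^sup>2)"
      by (simp add: sample_norm_def)
    also have "\<dots> = (\<Sum>j. (cmod (comb (gen g) \<phi> (even_row l j)))\<^sup>2)"
      by (simp add: comb_gen_even_row [OF \<phi>] weights_def norm_mult w_nonneg mult.commute)
    finally show ?thesis .
  qed
  then show ?thesis using even_rows_sum_le(2) [OF x, of k] by simp
qed

text \<open>
  Bounded point evaluations that separate the elements, in the sense of reproducing kernel spaces, but
  with values in \<open>\<ell>\<^sup>2\<close>. This is the property that kernels inherit.
\<close>

definition evaluation ::
  "(nat \<Rightarrow> complex) set \<Rightarrow> (complex^'m \<Rightarrow> (nat \<Rightarrow> complex) \<Rightarrow> nat \<Rightarrow> complex) \<Rightarrow> bool" where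
  "evaluation C E \<longleftrightarrow>
    (\<forall>z\<in>\<Omega>. linear_map_on C l2 l2 (E z) \<and> (\<exists>B\<ge>0. \<forall>x\<in>C. hnorm l2 (E z x) \<le> B * hnorm l2 x) \<and>
      (\<forall>\<phi>\<in>A_set \<Omega>. \<forall>x\<in>C. E z (diag_act q \<phi> x) = \<phi> z \<odot>\<^bsub>l2\<^esub> E z x)) \<and>
    (\<forall>x\<in>C. (\<forall>z\<in>\<Omega>. E z x = \<zero>\<^bsub>l2\<^esub>) \<longrightarrow> x = \<zero>\<^bsub>l2\<^esub>)"

text \<open>
  The sampling bound is applied to each coefficient; the even rows add up the squares.
\<close>

lemma value_bound:
  assumes \<phi>: "\<phi> \<in> coeffs" and g: "\<And>l. g l \<in> carrier l2" and z: "z \<in> \<Omega>"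
  shows "(\<lambda>l. \<phi> l z) \<in> carrier l2"
    "hnorm l2 (\<lambda>l. \<phi> l z) \<le> c z * hnorm l2 (comb (gen g) \<phi>)"
proof -
  have x: "comb (gen g) \<phi> \<in> carrier l2"
    by (rule comb_in_invariant [OF \<phi> invariant_l2 gen_in [OF g]])
  have "(\<Sum>l<k. (cmod (\<phi> l z))\<^sup>2) \<le> (c z * hnorm l2 (comb (gen g) \<phi>))\<^sup>2" for k
  proof -
    have "(\<Sum>l<k. (cmod (\<phi> l z))\<^sup>2) \<le> (\<Sum>l<k. (c z)\<^sup>2 * (sample_norm (\<phi> l))\<^sup>2)"
    proof (rule sum_mono)
      fix l
      have "cmod (\<phi> l z) \<le> c z * sample_norm (\<phi> l)"
        unfolding sample_norm_def by (rule sample_bound [OF coeffsD(1) [OF \<phi>] z])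
      then have "(cmod (\<phi> l z))\<^sup>2 \<le> (c z * sample_norm (\<phi> l))\<^sup>2" by (rule power_mono) simp
      then show "(cmod (\<phi> l z))\<^sup>2 \<le> (c z)\<^sup>2 * (sample_norm (\<phi> l))\<^sup>2" by (simp only: power_mult_distrib)
    qed
    also have "\<dots> = (c z)\<^sup>2 * (\<Sum>l<k. (sample_norm (\<phi> l))\<^sup>2)" by (simp only: sum_distrib_left)
    also have "\<dots> \<le> (c z)\<^sup>2 * (hnorm l2 (comb (gen g) \<phi>))\<^sup>2"
      by (rule mult_left_mono [OF sample_norms_le [OF \<phi> g]]) simp
    finally show ?thesis by (simp only: power_mult_distrib)
  qed
  moreover have "0 \<le> c z * hnorm l2 (comb (gen g) \<phi>)"
    by (rule mult_nonneg_nonneg [OF c_nonneg [OF z] l2.hnorm_nonneg [OF x]])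
  ultimately show "(\<lambda>l. \<phi> l z) \<in> carrier l2"
    "hnorm l2 (\<lambda>l. \<phi> l z) \<le> c z * hnorm l2 (comb (gen g) \<phi>)"
    using l2I [of "\<lambda>l. \<phi> l z" "c z * hnorm l2 (comb (gen g) \<phi>)"] by blast+
qed

lemma evaluation_extends:
  assumes g: "\<And>l. g l \<in> carrier l2" and z: "z \<in> \<Omega>"
  shows "\<exists>E. linear_map_on (generated (gen g)) l2 l2 E \<and>
    (\<forall>x\<in>generated (gen g). hnorm l2 (E x) \<le> c z * hnorm l2 x) \<and>
    (\<forall>\<phi>\<in>coeffs. E (comb (gen g) \<phi>) = (\<lambda>l. \<phi> l z))"
proof -
  define G where "G = (\<lambda>\<phi>. (comb (gen g) \<phi>, \<lambda>l. \<phi> l z)) ` coeffs"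
  have fstG: "fst ` G = span_of (gen g)" by (auto simp: G_def span_of_def image_image)
  show ?thesis
  proof (rule extend_by_continuity [of l2 l2 G "c z"])
    show "G \<subseteq> carrier l2 \<times> carrier l2"
      using comb_in_invariant [where h = "gen g", OF _ invariant_l2 gen_in [OF g]]
        value_bound(1) [where g = g, OF _ g z]
      by (auto simp only: G_def)
    show "G \<noteq> {}" using unit_coeff_in by (auto simp: G_def)
    show "hnorm l2 y \<le> c z * hnorm l2 x" if "(x, y) \<in> G" for x y
      using that value_bound(2) [where g = g, OF _ g z] by (auto simp only: G_def prod.inject)
    show "(x \<oplus>\<^bsub>l2\<^esub> x', y \<oplus>\<^bsub>l2\<^esub> y') \<in> G" if "(x, y) \<in> G" "(x', y') \<in> G" for x y x' y'
    proof -
      obtain \<phi> where \<phi>: "\<phi> \<in> coeffs" "x = comb (gen g) \<phi>" "y = (\<lambda>l. \<phi> l z)"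
        using \<open>(x, y) \<in> G\<close> unfolding G_def by blast
      obtain \<psi> where \<psi>: "\<psi> \<in> coeffs" "x' = comb (gen g) \<psi>" "y' = (\<lambda>l. \<psi> l z)"
        using \<open>(x', y') \<in> G\<close> unfolding G_def by blast
      show ?thesis
        unfolding G_def
        by (rule image_eqI [OF _ coeffs_add(1) [OF \<phi>(1) \<psi>(1)]])
          (simp only: \<phi>(2,3) \<psi>(2,3) coeffs_add(2) [OF \<phi>(1) \<psi>(1)] l2_simps)
    qed
    show "(a \<odot>\<^bsub>l2\<^esub> x, a \<odot>\<^bsub>l2\<^esub> y) \<in> G" if "(x, y) \<in> G" for a x y
    proof -
      obtain \<phi> where \<phi>: "\<phi> \<in> coeffs" "x = comb (gen g) \<phi>" "y = (\<lambda>l. \<phi> l z)"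
        using \<open>(x, y) \<in> G\<close> unfolding G_def by blast
      show ?thesis
        unfolding G_def
        by (rule image_eqI [OF _ coeffs_smult(1) [OF \<phi>(1), of a]])
          (simp only: \<phi>(2,3) coeffs_smult(2) [OF \<phi>(1)] l2_simps)
    qed
    fix T
    assume T: "linear_map_on (hclosure l2 (fst ` G)) l2 l2 T"
      "\<And>x. x \<in> hclosure l2 (fst ` G) \<Longrightarrow> hnorm l2 (T x) \<le> c z * hnorm l2 x"
      "\<And>x y. (x, y) \<in> G \<Longrightarrow> T x = y"
    have "T (comb (gen g) \<phi>) = (\<lambda>l. \<phi> l z)" if "\<phi> \<in> coeffs" for \<phi>
      by (rule T(3)) (unfold G_def, rule imageI [OF that])
    then show ?thesis
      using T(1,2) unfolding generated_def fstG by blast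
  qed (use inner_product_space_l2 hilbert_space_l2 c_nonneg [OF z] in auto)
qed

end

section \<open>Covering a module by a free one\<close>

context sampled
begin

lemma invariant_linear_map:
  "\<lbrakk>invariant C; linear_map_on C l2 l2 T\<rbrakk> \<Longrightarrow> linear_map l2 l2 C T"
  by (intro linear_map.intro linear_map_axioms.intro inner_product_space_l2 C_sub)

text \<open>
  The evaluations of the generated module separate its elements because \<open>E z x = 0\<close> implies
  \<open>E' z (odd_part x) = 0\<close>. On a combination \<open>y\<close> with coefficients \<open>\<phi> l\<close>, \<open>E' z (odd_part y)\<close> is the sum
  of the \<open>\<phi> l z\<close> times \<open>E' z (g l)\<close>, where \<open>\<bar>\<phi> l z\<bar> \<le> \<parallel>E z y\<parallel>\<close>, and the norms of \<open>E' z (g l)\<close> decay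
  geometrically. The resulting inequality between the two norms passes to the closure.
\<close>

theorem quasi_free_cover:
  assumes N: "invariant N" and E': "evaluation N E'"
    and gN: "\<And>l. g l \<in> N" and small: "\<And>l. hnorm l2 (g l) \<le> (1 / 2) ^ l"
  defines "C \<equiv> generated (gen g)"
  shows "\<And>x. x \<in> C \<Longrightarrow> odd_part x \<in> N"
    and "quasi_free \<Omega> (diag_module q C)"
    and "\<exists>E. evaluation C E"
proof -
  have g: "g l \<in> carrier l2" for l by (rule C_in [OF N gN])
  note gen_l2 = gen_in [OF g]
  have C: "invariant C" unfolding C_def by (rule invariant_generated [OF gen_l2])
  note Cin = C_in [OF C]
  have CS: "x \<in> hclosure l2 (span_of (gen g))" if "x \<in> C" for x using that by (simp add: C_def generated_def)
  have SC: "span_of (gen g) \<subseteq> C" unfolding C_def by (rule span_of_subset [OF gen_l2])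
  interpret O: linear_map l2 l2 C odd_part by (rule linear_map_odd_part [OF C_sub [OF C]])
  have O_bound: "hnorm l2 (odd_part x) \<le> 1 * hnorm l2 x" if "x \<in> C" for x
    using hnorm_odd_part [OF Cin [OF that]] by simp
  show oddN: "odd_part x \<in> N" if x: "x \<in> C" for x
  proof -
    have "\<exists>y\<in>N. hnorm l2 (odd_part x \<ominus>\<^bsub>l2\<^esub> y) < e" if e: "e > 0" for e
    proof -
      obtain y where y: "y \<in> span_of (gen g)" "hnorm l2 (x \<ominus>\<^bsub>l2\<^esub> y) < e"
        by (rule l2.hclosure_approx [OF CS [OF x] l2.submoduleD(1) [OF submodule_span_of [OF gen_l2]] e])
      have yC: "y \<in> C" using y SC by blast
      obtain \<phi> where \<phi>: "\<phi> \<in> coeffs" "y = comb (gen g) \<phi>" using y(1) unfolding span_of_def by blast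
      have "odd_part y \<in> N"
        unfolding \<phi>(2) odd_part_comb_gen by (rule comb_in_invariant [OF \<phi>(1) N gN])
      moreover have "hnorm l2 (odd_part x \<ominus>\<^bsub>l2\<^esub> odd_part y) < e"
        using O.Lipschitz [OF O_bound x yC] y(2) by simp
      ultimately show ?thesis by blast
    qed
    then show ?thesis
      using C_closed [OF N] odd_part_in [OF Cin [OF x]] unfolding l2.closedin_iff by blast
  qed
  have "\<exists>E. \<forall>z\<in>\<Omega>. linear_map_on C l2 l2 (E z) \<and> (\<forall>x\<in>C. hnorm l2 (E z x) \<le> c z * hnorm l2 x) \<and>
    (\<forall>\<phi>\<in>coeffs. E z (comb (gen g) \<phi>) = (\<lambda>l. \<phi> l z))"
    unfolding C_def by (rule bchoice) (intro ballI evaluation_extends [OF g])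
  then obtain E where
    E0: "\<forall>z\<in>\<Omega>. linear_map_on C l2 l2 (E z) \<and> (\<forall>x\<in>C. hnorm l2 (E z x) \<le> c z * hnorm l2 x) \<and>
      (\<forall>\<phi>\<in>coeffs. E z (comb (gen g) \<phi>) = (\<lambda>l. \<phi> l z))" ..
  have E_lin: "linear_map_on C l2 l2 (E z)" if "z \<in> \<Omega>" for z
    using E0 that by blast
  have E_bd: "hnorm l2 (E z x) \<le> c z * hnorm l2 x" if "z \<in> \<Omega>" "x \<in> C" for z x
    using E0 that by blast
  have E_comb: "E z (comb (gen g) \<phi>) = (\<lambda>l. \<phi> l z)" if "z \<in> \<Omega>" "\<phi> \<in> coeffs" for z \<phi>
    using E0 that by blast
  have E_map: "linear_map l2 l2 C (E z)" if "z \<in> \<Omega>" for z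
    by (rule invariant_linear_map [OF C E_lin [OF that]])
  have E_act: "E z (diag_act q \<phi> x) = \<phi> z \<odot>\<^bsub>l2\<^esub> E z x"
    if z: "z \<in> \<Omega>" and \<phi>: "\<phi> \<in> A_set \<Omega>" and x: "x \<in> C" for z \<phi> x
  proof -
    interpret E: linear_map l2 l2 C "E z" by (rule E_map [OF z])
    note actC = C_act [OF C \<phi>]
    have T1: "linear_map l2 l2 C (\<lambda>x. E z (diag_act q \<phi> x))"
      by (rule invariant_linear_map [OF C], rule linear_map_onI)
        (simp_all only: E.T_in actC diag_act_add diag_act_smult E.T_add E.T_smult)
    have T2: "linear_map l2 l2 C (\<lambda>x. \<phi> z \<odot>\<^bsub>l2\<^esub> E z x)"
    proof (rule invariant_linear_map [OF C], rule linear_map_onI)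
      fix x assume x: "x \<in> C"
      note Ex = E.T_in [OF x]
      show "\<phi> z \<odot>\<^bsub>l2\<^esub> E z x \<in> carrier l2" by (rule l2.smult_in [OF Ex])
      show "\<phi> z \<odot>\<^bsub>l2\<^esub> E z (a \<odot>\<^bsub>l2\<^esub> x) = a \<odot>\<^bsub>l2\<^esub> (\<phi> z \<odot>\<^bsub>l2\<^esub> E z x)" for a
        unfolding E.T_smult [OF x] l2.smult_smult [OF Ex] by (simp only: mult.commute)
      show "\<phi> z \<odot>\<^bsub>l2\<^esub> E z (x \<oplus>\<^bsub>l2\<^esub> y) = \<phi> z \<odot>\<^bsub>l2\<^esub> E z x \<oplus>\<^bsub>l2\<^esub> \<phi> z \<odot>\<^bsub>l2\<^esub> E z y" if y: "y \<in> C" for y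
        unfolding E.T_add [OF x y] by (rule l2.smult_add_right [OF Ex E.T_in [OF y]])
    qed
    show ?thesis
    proof (rule linear_maps_eq_on_hclosure [OF T1 T2 _ _ SC _ x CS [OF x]])
      fix y assume y: "y \<in> C"
      have "hnorm l2 (E z (diag_act q \<phi> y)) \<le> c z * hnorm l2 (diag_act q \<phi> y)"
        by (rule E_bd [OF z actC [OF y]])
      also have "\<dots> \<le> c z * (sup_norm \<Omega> \<phi> * hnorm l2 y)"
        by (rule mult_left_mono [OF diag_act_bound [OF \<phi> Cin [OF y]] c_nonneg [OF z]])
      finally show "hnorm l2 (E z (diag_act q \<phi> y)) \<le> (c z * sup_norm \<Omega> \<phi>) * hnorm l2 y"
        by (simp only: mult.assoc)
      have "hnorm l2 (\<phi> z \<odot>\<^bsub>l2\<^esub> E z y) = cmod (\<phi> z) * hnorm l2 (E z y)"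
        by (rule l2.hnorm_smult [OF E.T_in [OF y]])
      also have "\<dots> \<le> cmod (\<phi> z) * (c z * hnorm l2 y)"
        by (rule mult_left_mono [OF E_bd [OF z y] norm_ge_zero])
      finally show "hnorm l2 (\<phi> z \<odot>\<^bsub>l2\<^esub> E z y) \<le> (cmod (\<phi> z) * c z) * hnorm l2 y"
        by (simp only: mult.assoc)
    next
      fix y assume "y \<in> span_of (gen g)"
      then obtain \<psi> where \<psi>: "\<psi> \<in> coeffs" "y = comb (gen g) \<psi>" unfolding span_of_def by blast
      show "E z (diag_act q \<phi> y) = \<phi> z \<odot>\<^bsub>l2\<^esub> E z y"
        unfolding \<psi>(2) coeffs_mult(2) [OF \<psi>(1) \<phi>, symmetric] E_comb [OF z coeffs_mult(1) [OF \<psi>(1) \<phi>]]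
          E_comb [OF z \<psi>(1)] by simp
    qed
  qed
  \<comment> \<open>The even rows of every element of the closure are the weighted values at the sample points.\<close>
  have even: "x (even_row i j) = weights j * E (p j) x i" if x: "x \<in> C" for x i j
  proof -
    let ?P = "point_module (p j)"
    interpret E: linear_map l2 l2 C "E (p j)" by (rule E_map [OF p_in])
    have T1: "linear_map l2 ?P C (\<lambda>x. x (even_row i j))"
      by (intro linear_map.intro linear_map_axioms.intro inner_product_space_l2
          inner_product_space_point_module C_sub [OF C] linear_map_onI) simp_all
    have T2: "linear_map l2 ?P C (\<lambda>x. weights j * E (p j) x i)"
    proof (intro linear_map.intro linear_map_axioms.intro inner_product_space_l2
          inner_product_space_point_module C_sub [OF C] linear_map_onI)
      fix x assume x: "x \<in> C"
      show "weights j * E (p j) x i \<in> carrier ?P" by simp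
      show "weights j * E (p j) (a \<odot>\<^bsub>l2\<^esub> x) i = a \<odot>\<^bsub>?P\<^esub> (weights j * E (p j) x i)" for a
        unfolding E.T_smult [OF x] by simp
      show "weights j * E (p j) (x \<oplus>\<^bsub>l2\<^esub> y) i = weights j * E (p j) x i \<oplus>\<^bsub>?P\<^esub> weights j * E (p j) y i"
        if y: "y \<in> C" for y unfolding E.T_add [OF x y] by (simp add: distrib_left)
    qed
    show ?thesis
    proof (rule linear_maps_eq_on_hclosure [OF T1 T2 _ _ SC _ x CS [OF x]])
      fix y assume y: "y \<in> C"
      show "hnorm ?P (y (even_row i j)) \<le> 1 * hnorm l2 y" using l2_coord_le [OF Cin [OF y]] by simp
      have "hnorm ?P (weights j * E (p j) y i) = cmod (weights j) * cmod (E (p j) y i)"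
        by (simp add: norm_mult)
      also have "\<dots> \<le> cmod (weights j) * (c (p j) * hnorm l2 y)"
        using l2_coord_le [OF E.T_in [OF y], of i] E_bd [OF p_in [of j] y]
        by (intro mult_left_mono) auto
      finally show "hnorm ?P (weights j * E (p j) y i) \<le> (cmod (weights j) * c (p j)) * hnorm l2 y"
        by (simp only: mult.assoc)
    next
      fix y assume "y \<in> span_of (gen g)"
      then obtain \<psi> where \<psi>: "\<psi> \<in> coeffs" "y = comb (gen g) \<psi>" unfolding span_of_def by blast
      show "y (even_row i j) = weights j * E (p j) y i"
        unfolding \<psi>(2) comb_gen_even_row [OF \<psi>(1)] E_comb [OF p_in \<psi>(1)] by (simp only: mult.commute)
    qed
  qed
  have odd_zero: "E' z (odd_part x) = \<zero>\<^bsub>l2\<^esub>"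
    if x: "x \<in> C" and z: "z \<in> \<Omega>" and Ezx: "E z x = \<zero>\<^bsub>l2\<^esub>" for x z
  proof -
    obtain B where B: "B \<ge> 0" "\<forall>y\<in>N. hnorm l2 (E' z y) \<le> B * hnorm l2 y"
      and E'_lin: "linear_map_on N l2 l2 (E' z)"
      and E'_act: "\<forall>\<phi>\<in>A_set \<Omega>. \<forall>y\<in>N. E' z (diag_act q \<phi> y) = \<phi> z \<odot>\<^bsub>l2\<^esub> E' z y"
      using E' z unfolding evaluation_def by blast
    interpret E: linear_map l2 l2 C "E z" by (rule E_map [OF z])
    interpret E': linear_map l2 l2 N "E' z" by (rule invariant_linear_map [OF N E'_lin])
    have EO: "linear_map l2 l2 C (\<lambda>x. E' z (odd_part x))"
      by (rule invariant_linear_map [OF C], rule linear_map_onI)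
        (simp_all only: E'.T_in oddN odd_part_add odd_part_smult E'.T_add E'.T_smult)
    interpret EO: linear_map l2 l2 C "\<lambda>x. E' z (odd_part x)" by (rule EO)
    have EO_bd: "hnorm l2 (E' z (odd_part y)) \<le> B * hnorm l2 y" if y: "y \<in> C" for y
    proof -
      have "hnorm l2 (E' z (odd_part y)) \<le> B * hnorm l2 (odd_part y)" using B(2) oddN [OF y] by blast
      also have "\<dots> \<le> B * hnorm l2 y" by (rule mult_left_mono [OF hnorm_odd_part [OF Cin [OF y]] B(1)])
      finally show ?thesis .
    qed
    have "hnorm l2 (E' z (odd_part x)) - 2 * B * hnorm l2 (E z x) \<le> 0"
    proof (rule l2.Lipschitz_nonpos_hclosure [OF SC _ _ _ x CS [OF x], where L = "B + 2 * B * c z"])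
      show "C \<subseteq> carrier l2" using Cin by blast
      fix y assume "y \<in> span_of (gen g)"
      then obtain \<psi> where \<psi>: "\<psi> \<in> coeffs" "y = comb (gen g) \<psi>" unfolding span_of_def by blast
      have yC: "y \<in> C" using SC \<open>y \<in> span_of (gen g)\<close> by blast
      obtain M where M: "\<forall>l\<ge>M. \<psi> l = (\<lambda>z. 0)" using coeffsD(2) [OF \<psi>(1)] by blast
      have dN: "diag_act q (\<psi> l) (g l) \<in> N" for l by (rule C_act [OF N coeffsD(1) [OF \<psi>(1)] gN])
      have "E' z (odd_part y) = E' z (\<Oplus>\<^bsub>l2\<^esub>l\<in>{..<M}. diag_act q (\<psi> l) (g l))"
        unfolding \<psi>(2) odd_part_comb_gen comb_finsum [where h = g, OF \<psi>(1) M g] ..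
      also have "\<dots> = (\<Oplus>\<^bsub>l2\<^esub>l\<in>{..<M}. E' z (diag_act q (\<psi> l) (g l)))"
        by (rule E'.T_finsum [OF finite_lessThan dN])
      finally have "hnorm l2 (E' z (odd_part y)) \<le> (\<Sum>l<M. hnorm l2 (E' z (diag_act q (\<psi> l) (g l))))"
        using l2.hnorm_finsum_le [of "{..<M}" "\<lambda>l. E' z (diag_act q (\<psi> l) (g l))"] E'.T_in [OF dN] by simp
      also have "\<dots> \<le> (\<Sum>l<M. (B * hnorm l2 (E z y)) * (1 / 2) ^ l)"
      proof (rule sum_mono)
        fix l
        have "cmod (\<psi> l z) = cmod (E z y l)" unfolding \<psi>(2) E_comb [OF z \<psi>(1)] ..
        also have "\<dots> \<le> hnorm l2 (E z y)" by (rule l2_coord_le [OF E.T_in [OF yC]])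
        finally have *: "cmod (\<psi> l z) \<le> hnorm l2 (E z y)" .
        have "hnorm l2 (E' z (g l)) \<le> B * hnorm l2 (g l)" using B(2) gN by blast
        also have "\<dots> \<le> B * (1 / 2) ^ l" by (rule mult_left_mono [OF small B(1)])
        finally have **: "hnorm l2 (E' z (g l)) \<le> B * (1 / 2) ^ l" .
        have "E' z (diag_act q (\<psi> l) (g l)) = \<psi> l z \<odot>\<^bsub>l2\<^esub> E' z (g l)"
          using E'_act coeffsD(1) [OF \<psi>(1)] gN by blast
        then have "hnorm l2 (E' z (diag_act q (\<psi> l) (g l))) = cmod (\<psi> l z) * hnorm l2 (E' z (g l))"
          using l2.hnorm_smult [OF E'.T_in [OF gN], of "\<psi> l z" l] by (simp only:)
        also have "\<dots> \<le> hnorm l2 (E z y) * (B * (1 / 2) ^ l)"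
          by (rule mult_mono [OF * **])
            (rule l2.hnorm_nonneg [OF E.T_in [OF yC]], rule l2.hnorm_nonneg [OF E'.T_in [OF gN]])
        finally show "hnorm l2 (E' z (diag_act q (\<psi> l) (g l))) \<le> (B * hnorm l2 (E z y)) * (1 / 2) ^ l"
          by (simp only: ac_simps)
      qed
      also have "\<dots> = (B * hnorm l2 (E z y)) * (\<Sum>l<M. (1 / 2) ^ l)" by (simp only: sum_distrib_left)
      also have "\<dots> \<le> (B * hnorm l2 (E z y)) * 2"
        by (rule mult_left_mono [OF sum_half_powers_le])
          (rule mult_nonneg_nonneg [OF B(1) l2.hnorm_nonneg [OF E.T_in [OF yC]]])
      finally show "hnorm l2 (E' z (odd_part y)) - 2 * B * hnorm l2 (E z y) \<le> 0" by simp
    next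
      fix y y' assume y: "y \<in> C" and y': "y' \<in> C"
      define d where "d = hnorm l2 (y \<ominus>\<^bsub>l2\<^esub> y')"
      have a: "\<bar>hnorm l2 (E' z (odd_part y)) - hnorm l2 (E' z (odd_part y'))\<bar> \<le> B * d"
        unfolding d_def by (rule EO.Lipschitz_hnorm [OF EO_bd y y'])
      have b: "\<bar>hnorm l2 (E z y) - hnorm l2 (E z y')\<bar> \<le> c z * d"
        unfolding d_def by (rule E.Lipschitz_hnorm [OF E_bd [OF z] y y'])
      have "2 * B * \<bar>hnorm l2 (E z y) - hnorm l2 (E z y')\<bar> \<le> 2 * B * (c z * d)"
        using B(1) b by (intro mult_left_mono) simp_all
      moreover have "\<bar>2 * B * hnorm l2 (E z y) - 2 * B * hnorm l2 (E z y')\<bar> =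
          2 * B * \<bar>hnorm l2 (E z y) - hnorm l2 (E z y')\<bar>"
        using B(1) by (simp only: right_diff_distrib [symmetric] abs_mult)
      moreover have "(B + 2 * B * c z) * d = B * d + 2 * B * (c z * d)" by (simp add: algebra_simps)
      ultimately have "\<bar>(hnorm l2 (E' z (odd_part y)) - 2 * B * hnorm l2 (E z y)) -
          (hnorm l2 (E' z (odd_part y')) - 2 * B * hnorm l2 (E z y'))\<bar> \<le> (B + 2 * B * c z) * d"
        using a by linarith
      then show "\<bar>(hnorm l2 (E' z (odd_part y)) - 2 * B * hnorm l2 (E z y)) -
          (hnorm l2 (E' z (odd_part y')) - 2 * B * hnorm l2 (E z y'))\<bar>
          \<le> (B + 2 * B * c z) * hnorm l2 (y \<ominus>\<^bsub>l2\<^esub> y')" unfolding d_def .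
    qed
    then have "hnorm l2 (E' z (odd_part x)) \<le> 0" unfolding Ezx l2.hnorm_zero by simp
    then have "hnorm l2 (E' z (odd_part x)) = 0"
      using l2.hnorm_nonneg [OF EO.T_in [OF x]] by linarith
    then show ?thesis by (rule l2.hnorm_eq_zero [OF EO.T_in [OF x]])
  qed
  have sep: "x = \<zero>\<^bsub>l2\<^esub>" if x: "x \<in> C" and zero: "\<And>z. z \<in> \<Omega> \<Longrightarrow> E z x = \<zero>\<^bsub>l2\<^esub>" for x
  proof -
    have "E' z (odd_part x) = \<zero>\<^bsub>l2\<^esub>" if "z \<in> \<Omega>" for z by (rule odd_zero [OF x that zero [OF that]])
    then have odd: "odd_part x = \<zero>\<^bsub>l2\<^esub>"
      using E' oddN [OF x] unfolding evaluation_def by blast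
    have "x n = 0" for n
    proof (cases n rule: row_cases)
      case (1 i j)
      then show ?thesis using even [OF x, of i j] zero [OF p_in, of j] by simp
    next
      case (2 m)
      then show ?thesis using fun_cong [OF odd, of m] by (simp add: odd_part_def)
    qed
    then show ?thesis by auto
  qed
  have ev: "evaluation C E"
    unfolding evaluation_def
  proof (intro conjI ballI impI)
    show "linear_map_on C l2 l2 (E z)" if "z \<in> \<Omega>" for z by (rule E_lin [OF that])
    show "\<exists>B\<ge>0. \<forall>x\<in>C. hnorm l2 (E z x) \<le> B * hnorm l2 x" if z: "z \<in> \<Omega>" for z
      by (intro exI [of _ "c z"] conjI ballI c_nonneg [OF z] E_bd [OF z])
    show "E z (diag_act q \<phi> x) = \<phi> z \<odot>\<^bsub>l2\<^esub> E z x" if "z \<in> \<Omega>" "\<phi> \<in> A_set \<Omega>" "x \<in> C" for z \<phi> x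
      by (rule E_act [OF that])
    show "x = \<zero>\<^bsub>l2\<^esub>" if "x \<in> C" "\<forall>z\<in>\<Omega>. E z x = \<zero>\<^bsub>l2\<^esub>" for x
      by (rule sep [OF that(1)]) (use that(2) in blast)
  qed
  show "\<exists>E. evaluation C E"
    by (rule exI [where P = "\<lambda>E. evaluation C E", OF ev])
  let ?D = "diag_module q C"
  interpret D: hilbert_module \<Omega> ?D by (rule hilbert_module_D [OF C])
  have E_gen: "E z (gen g i) = ell2_basis i" if z: "z \<in> \<Omega>" for z i
    using E_comb [OF z unit_coeff_in, of i] unfolding comb_unit_coeff
    by (auto simp: unit_coeff_def ell2_basis_def one_at [OF z])
  have gen_C: "gen g i \<in> C" for i unfolding C_def by (rule generator_in [OF gen_l2])
  have inj: "inj (gen g)"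
  proof (rule injI)
    fix i j assume ij: "gen g i = gen g j"
    obtain z where z: "z \<in> \<Omega>" using nonempty by blast
    have "ell2_basis i = ell2_basis j" by (simp only: E_gen [OF z, symmetric] ij)
    then show "i = j" by (simp only: ell2_basis_inj)
  qed
  have "generating \<Omega> ?D (range (gen g))"
    unfolding generating_def
  proof
    show "range (gen g) \<subseteq> carrier ?D" using gen_C by (auto simp only: diag_module_simps)
    let ?G = "{\<Oplus>\<^bsub>?D\<^esub>f\<in>I. act ?D (\<phi> f) f | I \<phi>. finite I \<and> I \<subseteq> range (gen g) \<and> \<phi> \<in> I \<rightarrow> A_set \<Omega>}"
    have "?G \<subseteq> carrier ?D"
    proof
      fix x assume "x \<in> ?G"
      then obtain I \<phi> where I: "x = (\<Oplus>\<^bsub>?D\<^esub>f\<in>I. act ?D (\<phi> f) f)" "I \<subseteq> range (gen g)" "\<phi> \<in> I \<rightarrow> A_set \<Omega>" by blast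
      show "x \<in> carrier ?D" unfolding I(1)
      proof (rule D.finsum_closed, rule Pi_I)
        fix f assume f: "f \<in> I"
        then have "f \<in> carrier ?D" using I(2) gen_C by (auto simp only: diag_module_simps)
        then show "act ?D (\<phi> f) f \<in> carrier ?D" by (rule D.act_in [OF funcset_mem [OF I(3) f]])
      qed
    qed
    then have GC: "?G \<subseteq> C" by (simp only: diag_module_simps)
    have "span_of (gen g) \<subseteq> ?G"
    proof
      fix x assume "x \<in> span_of (gen g)"
      then obtain \<psi> where \<psi>: "\<psi> \<in> coeffs" "x = comb (gen g) \<psi>" unfolding span_of_def by blast
      obtain M where M: "\<forall>l\<ge>M. \<psi> l = (\<lambda>z. 0)" using coeffsD(2) [OF \<psi>(1)] by blast
      define \<phi> where "\<phi> f = \<psi> (inv_into UNIV (gen g) f)" for f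
      have \<phi>g: "\<phi> (gen g l) = \<psi> l" for l unfolding \<phi>_def inv_into_f_f [OF inj UNIV_I] ..
      have "(\<Oplus>\<^bsub>?D\<^esub>f\<in>gen g ` {..<M}. act ?D (\<phi> f) f) = (\<lambda>n. \<Sum>f\<in>gen g ` {..<M}. act ?D (\<phi> f) f n)"
      proof (rule D_finsum [OF C])
        fix f assume "f \<in> gen g ` {..<M}"
        then obtain l where f: "f = gen g l" by blast
        show "act ?D (\<phi> f) f \<in> C"
          unfolding f \<phi>g diag_module_simps by (rule C_act [OF C coeffsD(1) [OF \<psi>(1)] gen_C])
      qed simp
      also have "\<dots> = (\<lambda>n. \<Sum>l<M. \<psi> l (q n) * gen g l n)"
        by (subst sum.reindex) (auto intro: inj_on_subset [OF inj] simp: \<phi>g diag_module_simps diag_act_def)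
      also have "\<dots> = x" unfolding \<psi>(2) comb_eq [OF M] ..
      finally have x: "x = (\<Oplus>\<^bsub>?D\<^esub>f\<in>gen g ` {..<M}. act ?D (\<phi> f) f)" ..
      have "\<phi> \<in> gen g ` {..<M} \<rightarrow> A_set \<Omega>"
        by (rule Pi_I) (auto simp: \<phi>g intro: coeffsD(1) [OF \<psi>(1)])
      then show "x \<in> ?G" using x by blast
    qed
    then have "hclosure l2 (span_of (gen g)) \<subseteq> hclosure l2 ?G"
      unfolding hclosure_def by (rule closure_of_mono)
    moreover have "C = hclosure l2 (span_of (gen g))" by (simp only: C_def generated_def)
    ultimately have "C \<subseteq> hclosure l2 ?G" by (rule ord_eq_le_trans [rotated])
    then have "C \<subseteq> hclosure ?D ?G" using D_hclosure [OF C GC] by (simp only:)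
    then have "hclosure ?D ?G = carrier ?D"
      using D.hclosure_in_carrier [of ?G] by (auto simp only: diag_module_simps)
    then show "dense_in ?D ?G" unfolding dense_in_def hclosure_def .
  qed
  then have "quasi_free_rel \<Omega> ?D \<infinity> (gen g)"
  proof (rule quasi_free_relI [OF bounded' nonempty hilbert_module_D [OF C], where E = E and \<beta> = c])
    show "linear_map_on (carrier ?D) ?D l2 (E z)" if "z \<in> \<Omega>" for z
      using E_lin [OF that] unfolding linear_map_on_def diag_module_simps .
    show "continuous_on \<Omega> c" by (rule c_cont)
  qed (simp_all only: diag_module_simps diag_hnorm E_bd E_act E_gen sep)
  then show "quasi_free \<Omega> ?D" unfolding quasi_free_def by blast
qed

lemma evaluation_kernel:
  assumes C: "invariant C" and E: "evaluation C E" and X: "linear_map l2 K C X"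
    and bd: "\<And>x. x \<in> C \<Longrightarrow> hnorm K (X x) \<le> B * hnorm l2 x"
    and eq: "\<And>\<phi> x. \<lbrakk>\<phi> \<in> A_set \<Omega>; x \<in> C; X x = \<zero>\<^bsub>K\<^esub>\<rbrakk> \<Longrightarrow> X (diag_act q \<phi> x) = \<zero>\<^bsub>K\<^esub>"
  shows "invariant {x \<in> C. X x = \<zero>\<^bsub>K\<^esub>}" "evaluation {x \<in> C. X x = \<zero>\<^bsub>K\<^esub>} E"
proof -
  interpret X: linear_map l2 K C X by (rule X)
  show "invariant {x \<in> C. X x = \<zero>\<^bsub>K\<^esub>}"
    unfolding invariant_def
  proof (intro conjI ballI)
    show "submodule {x \<in> C. X x = \<zero>\<^bsub>K\<^esub>} complex_ring l2" by (rule X.submodule_kernel)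
    show "closedin (htop l2) {x \<in> C. X x = \<zero>\<^bsub>K\<^esub>}" by (rule X.closedin_kernel [OF bd C_closed [OF C]])
    show "diag_act q \<phi> x \<in> {x \<in> C. X x = \<zero>\<^bsub>K\<^esub>}" if "\<phi> \<in> A_set \<Omega>" "x \<in> {x \<in> C. X x = \<zero>\<^bsub>K\<^esub>}" for \<phi> x
      using that C_act [OF C] eq by blast
  qed
  show "evaluation {x \<in> C. X x = \<zero>\<^bsub>K\<^esub>} E"
    unfolding evaluation_def
  proof (intro conjI ballI impI)
    fix z assume z: "z \<in> \<Omega>"
    have lin: "linear_map_on C l2 l2 (E z)"
      and bd: "\<exists>B\<ge>0. \<forall>x\<in>C. hnorm l2 (E z x) \<le> B * hnorm l2 x"
      and act: "\<forall>\<phi>\<in>A_set \<Omega>. \<forall>x\<in>C. E z (diag_act q \<phi> x) = \<phi> z \<odot>\<^bsub>l2\<^esub> E z x"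
      using bspec [OF conjunct1 [OF E [unfolded evaluation_def]] z] by auto
    show "linear_map_on {x \<in> C. X x = \<zero>\<^bsub>K\<^esub>} l2 l2 (E z)"
      using lin unfolding linear_map_on_def by auto
    show "\<exists>B\<ge>0. \<forall>x\<in>{x \<in> C. X x = \<zero>\<^bsub>K\<^esub>}. hnorm l2 (E z x) \<le> B * hnorm l2 x" using bd by auto
    show "E z (diag_act q \<phi> x) = \<phi> z \<odot>\<^bsub>l2\<^esub> E z x"
      if "\<phi> \<in> A_set \<Omega>" "x \<in> {x \<in> C. X x = \<zero>\<^bsub>K\<^esub>}" for \<phi> x using act that by blast
  next
    fix x assume "x \<in> {x \<in> C. X x = \<zero>\<^bsub>K\<^esub>}" "\<forall>z\<in>\<Omega>. E z x = \<zero>\<^bsub>l2\<^esub>"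
    then show "x = \<zero>\<^bsub>l2\<^esub>" using conjunct2 [OF E [unfolded evaluation_def]] by blast
  qed
qed

text \<open>
  The projections \<open>s l\<close> of the standard basis vectors to \<open>N\<close> span a dense subspace of \<open>N\<close>, since a
  vector of \<open>N\<close> orthogonal to all of them has vanishing coordinates. Their norms are at most 1, so scaling by
  \<open>1 / 2 ^ l\<close> makes them as small as required.
\<close>

lemma small_generators:
  assumes N: "invariant N"
  obtains g where "\<And>l. g l \<in> N" "\<And>l. hnorm l2 (g l) \<le> (1 / 2) ^ l"
    "\<And>V. \<lbrakk>submodule V complex_ring l2; closedin (htop l2) V; \<And>l. g l \<in> V\<rbrakk> \<Longrightarrow> N \<subseteq> V"
proof -
  have "\<exists>s. s \<in> N \<and> (\<forall>t\<in>N. cinner l2 (ell2_basis l \<ominus>\<^bsub>l2\<^esub> s) t = 0)" for l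
    using hilbert_space.orthogonal_projection [OF hilbert_space_l2 C_sub [OF N] C_closed [OF N] ell2_basis_in]
    by metis
  then obtain s where s: "\<And>l. s l \<in> N" "\<And>l t. t \<in> N \<Longrightarrow> cinner l2 (ell2_basis l \<ominus>\<^bsub>l2\<^esub> s l) t = 0" by metis
  note sl = C_in [OF N s(1)]
  have proj: "cinner l2 (ell2_basis l) t = cinner l2 (s l) t" if t: "t \<in> N" for l t
    using s(2) [OF t, of l] l2.cinner_minus_left [OF ell2_basis_in sl C_in [OF N t], of l l] by (simp only: right_minus_eq)
  have s1: "hnorm l2 (s l) \<le> 1" for l
  proof -
    have "hnorm l2 (s l) * hnorm l2 (s l) = Re (cinner l2 (ell2_basis l) (s l))"
      unfolding proj [OF s(1)] power2_eq_square [symmetric] by (rule l2.hnorm_sq [OF sl])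
    also have "\<dots> \<le> 1 * hnorm l2 (s l)"
      using l2.cauchy_schwarz [OF ell2_basis_in sl, of l l] complex_Re_le_cmod [of "cinner l2 (ell2_basis l) (s l)"]
      unfolding l2_hnorm_basis by linarith
    finally have le: "hnorm l2 (s l) * hnorm l2 (s l) \<le> 1 * hnorm l2 (s l)" .
    show ?thesis
    proof (cases "hnorm l2 (s l) = 0")
      case False
      then have "hnorm l2 (s l) > 0" using l2.hnorm_nonneg [OF sl, of l] by linarith
      with le show ?thesis by (simp only: mult_le_cancel_right_pos)
    qed simp
  qed
  define g where "g l = complex_of_real ((1 / 2) ^ l) \<odot>\<^bsub>l2\<^esub> s l" for l
  have gN: "g l \<in> N" for l unfolding g_def by (rule l2.submoduleD(4) [OF C_sub [OF N] s(1)])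
  have gs: "hnorm l2 (g l) \<le> (1 / 2) ^ l" for l
  proof -
    have "hnorm l2 (g l) = (1 / 2) ^ l * hnorm l2 (s l)"
      unfolding g_def l2.hnorm_smult [OF sl] by (simp add: norm_power norm_divide)
    also have "\<dots> \<le> (1 / 2) ^ l * 1" by (rule mult_left_mono [OF s1]) simp
    finally show ?thesis by simp
  qed
  have "N \<subseteq> V" if V: "submodule V complex_ring l2" "closedin (htop l2) V" "\<And>l. g l \<in> V" for V
  proof
    fix x assume x: "x \<in> N"
    note xl = C_in [OF N x]
    have sV: "s l \<in> V" for l
    proof -
      have "complex_of_real (2 ^ l) \<odot>\<^bsub>l2\<^esub> g l \<in> V" by (rule l2.submoduleD(4) [OF V(1) V(3)])
      also have "complex_of_real (2 ^ l) \<odot>\<^bsub>l2\<^esub> g l = s l"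
        unfolding g_def l2.smult_smult [OF sl] by (simp add: power_mult_distrib [symmetric])
      finally show ?thesis .
    qed
    have sub: "submodule (N \<inter> V) complex_ring l2"
      using C_sub [OF N] V(1) unfolding l2.submodule_iff by blast
    have cl: "closedin (htop l2) (N \<inter> V)" by (rule closedin_Int [OF C_closed [OF N] V(2)])
    obtain v where v: "v \<in> N \<inter> V" "\<And>t. t \<in> N \<inter> V \<Longrightarrow> cinner l2 (x \<ominus>\<^bsub>l2\<^esub> v) t = 0"
      using hilbert_space.orthogonal_projection [OF hilbert_space_l2 sub cl xl] by metis
    define y where "y = x \<ominus>\<^bsub>l2\<^esub> v"
    have vN: "v \<in> N" using v(1) by blast
    have yN: "y \<in> N" unfolding y_def by (rule l2.submoduleD(5) [OF C_sub [OF N] x vN])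
    note yl = C_in [OF N yN]
    have "y l = 0" for l
    proof -
      have "cnj (y l) = cinner l2 (ell2_basis l) y"
        unfolding l2.ip_commute [OF yl ell2_basis_in] l2_cinner_basis ..
      also have "\<dots> = cinner l2 (s l) y" by (rule proj [OF yN])
      also have "\<dots> = cnj (cinner l2 y (s l))" by (rule l2.ip_commute [OF yl sl])
      also have "cinner l2 y (s l) = 0" unfolding y_def by (rule v(2)) (use s(1) sV in blast)
      finally show ?thesis by simp
    qed
    then have "x \<ominus>\<^bsub>l2\<^esub> v = \<zero>\<^bsub>l2\<^esub>" unfolding y_def [symmetric] by auto
    then have "x = v" by (rule l2.minus_eq_zero [OF xl C_in [OF N vN]])
    then show "x \<in> V" using v(1) by blast
  qed
  then show thesis using that [OF gN gs] by blast
qed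

definition free_stage :: "(nat \<Rightarrow> complex) set \<Rightarrow> bool" where
  "free_stage C \<longleftrightarrow> invariant C \<and> quasi_free \<Omega> (diag_module q C) \<and> (\<exists>E. evaluation C E)"

text \<open>
  One step of the resolution: every module with evaluations is the closure of the image of a
  quasi-free module that has evaluations itself.
\<close>

theorem free_stage_over:
  assumes N: "invariant N" and E': "evaluation N E'"
  obtains C where "free_stage C" "\<And>x. x \<in> C \<Longrightarrow> odd_part x \<in> N" "hclosure l2 (odd_part ` C) = N"
proof -
  obtain g where g: "\<And>l. g l \<in> N" "\<And>l. hnorm l2 (g l) \<le> (1 / 2) ^ l"
    "\<And>V. \<lbrakk>submodule V complex_ring l2; closedin (htop l2) V; \<And>l. g l \<in> V\<rbrakk> \<Longrightarrow> N \<subseteq> V"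
    using small_generators [OF N] by metis
  define C where "C = generated (gen g)"
  note gl = C_in [OF N g(1)]
  note cover = quasi_free_cover [OF N E' g(1,2), folded C_def]
  have C: "invariant C" unfolding C_def by (rule invariant_generated [OF gen_in [OF gl]])
  have stage: "free_stage C" unfolding free_stage_def using C cover(2,3) by blast
  interpret O: linear_map l2 l2 C odd_part by (rule linear_map_odd_part [OF C_sub [OF C]])
  have im_sub: "odd_part ` C \<subseteq> N" using cover(1) by blast
  have sub: "submodule (odd_part ` C) complex_ring l2"
    unfolding l2.submodule_iff
  proof (intro conjI ballI allI)
    note D = l2.submoduleD [OF C_sub [OF C]]
    show "odd_part ` C \<subseteq> carrier l2" using O.T_in by blast
    show "\<zero>\<^bsub>l2\<^esub> \<in> odd_part ` C" using imageI [OF D(2), of odd_part] unfolding O.T_zero .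
    show "u \<oplus>\<^bsub>l2\<^esub> v \<in> odd_part ` C" if u: "u \<in> odd_part ` C" and v: "v \<in> odd_part ` C" for u v
    proof -
      obtain x y where xy: "x \<in> C" "u = odd_part x" "y \<in> C" "v = odd_part y" using u v by blast
      show ?thesis unfolding xy(2,4) odd_part_add [symmetric] by (rule imageI [OF D(3) [OF xy(1,3)]])
    qed
    show "a \<odot>\<^bsub>l2\<^esub> u \<in> odd_part ` C" if u: "u \<in> odd_part ` C" for a u
    proof -
      obtain x where x: "x \<in> C" "u = odd_part x" using u by blast
      show ?thesis unfolding x(2) odd_part_smult [symmetric] by (rule imageI [OF D(4) [OF x(1)]])
    qed
  qed
  have "g l \<in> odd_part ` C" for l
  proof (rule image_eqI)
    show "g l = odd_part (gen g l)" by (simp add: odd_part_def gen_odd_rows)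
    show "gen g l \<in> C" unfolding C_def by (rule generator_in [OF gen_in [OF gl]])
  qed
  then have "g l \<in> hclosure l2 (odd_part ` C)" for l
    using l2.subset_hclosure [OF l2.submoduleD(1) [OF sub]] by blast
  then have "N \<subseteq> hclosure l2 (odd_part ` C)"
    by (rule g(3) [OF l2.submodule_hclosure [OF sub] l2.closedin_hclosure])
  moreover have "hclosure l2 (odd_part ` C) \<subseteq> N"
    by (rule l2.hclosure_minimal [OF im_sub C_closed [OF N]])
  ultimately have "hclosure l2 (odd_part ` C) = N" by blast
  with stage cover(1) show thesis using that by blast
qed

end

section \<open>The resolution\<close>

context hilbert_module
begin

lemma closed_submodule_hclosure:
  assumes b: "bounded \<Omega>" and V: "submodule V complex_ring M"
    and inv: "\<And>\<phi> x. \<lbrakk>\<phi> \<in> A_set \<Omega>; x \<in> V\<rbrakk> \<Longrightarrow> act M \<phi> x \<in> V"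
  shows "closed_submodule \<Omega> M (hclosure M V)"
  unfolding closed_submodule_def
proof (intro conjI ballI submodule_hclosure [OF V] closedin_hclosure)
  note Vc = submoduleD(1) [OF V]
  fix \<phi> x assume \<phi>: "\<phi> \<in> A_set \<Omega>" and x: "x \<in> hclosure M V"
  have xc: "x \<in> carrier M" using x hclosure_in_carrier by blast
  interpret L: linear_map M M "carrier M" "act M \<phi>" by (rule linear_map_act [OF \<phi>])
  obtain B where B: "0 \<le> B" "\<And>x. x \<in> carrier M \<Longrightarrow> hnorm M (act M \<phi> x) \<le> B * hnorm M x"
    by (rule act_bounded [OF b \<phi>]) blast
  show "act M \<phi> x \<in> hclosure M V"
    unfolding in_closure_iff [OF Vc]
  proof (intro conjI allI impI act_in [OF \<phi> xc])
    fix e :: real assume e: "e > 0"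
    then have e': "e / (B + 1) > 0" using B(1) by simp
    obtain y where y: "y \<in> V" "hnorm M (x \<ominus> y) < e / (B + 1)"
      by (rule hclosure_approx [OF x Vc e'])
    have yc: "y \<in> carrier M" using y Vc by blast
    have "hnorm M (act M \<phi> x \<ominus> act M \<phi> y) \<le> B * hnorm M (x \<ominus> y)"
      by (rule L.Lipschitz [OF B(2) xc yc])
    also have "\<dots> \<le> (B + 1) * hnorm M (x \<ominus> y)"
      using hnorm_nonneg [OF minus_closed [OF xc yc]] by (intro mult_right_mono) simp_all
    also have "\<dots> < e"
      using y(2) B(1) by (simp only: pos_less_divide_eq [of "B + 1"] mult.commute)
    finally show "\<exists>y\<in>V. hnorm M (act M \<phi> x \<ominus> y) < e" using inv [OF \<phi> y(1)] by blast
  qed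
qed

lemma closed_submodule_eq_carrier:
  assumes gen: "generating \<Omega> M F" and N: "closed_submodule \<Omega> M N" and F: "F \<subseteq> N"
  shows "N = carrier M"
proof -
  have sub: "submodule N complex_ring M" and cl: "closedin (htop M) N"
    and act: "\<And>\<phi> x. \<lbrakk>\<phi> \<in> A_set \<Omega>; x \<in> N\<rbrakk> \<Longrightarrow> act M \<phi> x \<in> N"
    using N unfolding closed_submodule_def by blast+
  let ?G = "{\<Oplus>f\<in>I. act M (\<phi> f) f | I \<phi>. finite I \<and> I \<subseteq> F \<and> \<phi> \<in> I \<rightarrow> A_set \<Omega>}"
  have "?G \<subseteq> N"
  proof
    fix x assume "x \<in> ?G"
    then obtain I \<phi> where I: "x = (\<Oplus>f\<in>I. act M (\<phi> f) f)" "finite I" "I \<subseteq> F" "\<phi> \<in> I \<rightarrow> A_set \<Omega>" by blast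
    show "x \<in> N" unfolding I(1)
    proof (rule finsum_in_submodule [OF sub I(2)])
      fix f assume f: "f \<in> I"
      then have "f \<in> N" using I(3) F by blast
      then show "act M (\<phi> f) f \<in> N" by (rule act [OF funcset_mem [OF I(4) f]])
    qed
  qed
  then have "hclosure M ?G \<subseteq> N" by (rule hclosure_minimal [OF _ cl])
  moreover have "hclosure M ?G = carrier M"
    using gen unfolding generating_def dense_in_def hclosure_def by blast
  ultimately show ?thesis using submoduleD(1) [OF sub] by blast
qed

text \<open>
  Each member of a countable generating set is approximated, to every precision \<open>1 / (n + 1)\<close>, by a linear
  combination of compactly supported vectors. The vectors used are countably many, and a closed
  submodule containing them contains the generating set.
\<close>

lemma compactly_supported_sequence:
  assumes cg: "countably_generated \<Omega> M" and acs: "almost_compactly_supported \<Omega> M"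
  shows "\<exists>m. (\<forall>l::nat. compactly_supported \<Omega> M (m l)) \<and>
    (\<forall>N. closed_submodule \<Omega> M N \<longrightarrow> range m \<subseteq> N \<longrightarrow> N = carrier M)"
proof -
  obtain F where F: "countable F" "generating \<Omega> M F" using cg unfolding countably_generated_def by blast
  let ?K = "{f. compactly_supported \<Omega> M f}"
  have K: "?K \<subseteq> carrier M" unfolding compactly_supported_def by blast
  have dense: "\<forall>x\<in>carrier M. \<forall>e>0. \<exists>y\<in>cspan M ?K. hnorm M (x \<ominus> y) < e"
    using acs unfolding almost_compactly_supported_def dense_in_iff [OF cspan_in_carrier [OF K]] .
  have "\<exists>I. finite I \<and> I \<subseteq> ?K \<and> (\<exists>a. hnorm M (x \<ominus> (\<Oplus>f\<in>I. a f \<odot> f)) < 1 / real (Suc n))"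
    if x: "x \<in> F" for x and n :: nat
  proof -
    have "x \<in> carrier M" using x F(2) unfolding generating_def by blast
    moreover have "1 / real (Suc n) > 0" by simp
    ultimately obtain y where "y \<in> cspan M ?K" "hnorm M (x \<ominus> y) < 1 / real (Suc n)"
      using dense by blast
    then show ?thesis unfolding cspan_def by blast
  qed
  then have "\<exists>I. \<forall>x\<in>F. \<forall>n. finite (I x n) \<and> I x n \<subseteq> ?K \<and>
      (\<exists>a. hnorm M (x \<ominus> (\<Oplus>f\<in>I x n. a f \<odot> f)) < 1 / real (Suc n))"
    by (intro bchoice ballI choice allI)
  then obtain I where I: "\<And>x n. x \<in> F \<Longrightarrow> finite (I x n)" "\<And>x n. x \<in> F \<Longrightarrow> I x n \<subseteq> ?K"
    "\<And>x n. x \<in> F \<Longrightarrow> \<exists>a. hnorm M (x \<ominus> (\<Oplus>f\<in>I x n. a f \<odot> f)) < 1 / real (Suc n)" by blast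
  \<comment> \<open>The zero vector is added because a sequence needs a nonempty range; it is compactly supported.\<close>
  define D where "D = insert \<zero> (\<Union>x\<in>F. \<Union>n. I x n)"
  have cD: "countable D"
    unfolding D_def by (intro countable_insert countable_UN F(1) countableI_type countable_finite I(1))
  have "act M \<phi> \<zero> = \<zero>" if "\<phi> \<in> A_set \<Omega>" for \<phi> by (rule act_zero [OF that])
  then have z: "compactly_supported \<Omega> M \<zero>"
    unfolding compactly_supported_def by (intro conjI exI [of _ "{}"] exI [of _ 0]) auto
  then have DK: "D \<subseteq> ?K" unfolding D_def using I(2) by blast
  define m where "m = from_nat_into D"
  have m: "range m = D" unfolding m_def by (rule range_from_nat_into [OF _ cD]) (simp add: D_def)
  have "N = carrier M" if N: "closed_submodule \<Omega> M N" and mN: "range m \<subseteq> N" for N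
  proof (rule closed_submodule_eq_carrier [OF F(2) N], rule subsetI)
    have sub: "submodule N complex_ring M" and cl: "closedin (htop M) N"
      using N unfolding closed_submodule_def by blast+
    fix x assume x: "x \<in> F"
    then have xc: "x \<in> carrier M" using F(2) unfolding generating_def by blast
    have "\<exists>y\<in>N. hnorm M (x \<ominus> y) < e" if e: "e > 0" for e
    proof -
      obtain n where n: "inverse (real (Suc n)) < e" using reals_Archimedean [OF e] by blast
      obtain a where a: "hnorm M (x \<ominus> (\<Oplus>f\<in>I x n. a f \<odot> f)) < 1 / real (Suc n)" using I(3) [OF x] by blast
      have "I x n \<subseteq> D" unfolding D_def using x by blast
      then have "I x n \<subseteq> N" using mN m by blast
      then have "(\<Oplus>f\<in>I x n. a f \<odot> f) \<in> N"
        by (intro finsum_in_submodule [OF sub I(1) [OF x]] submoduleD(4) [OF sub]) blast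
      moreover have "hnorm M (x \<ominus> (\<Oplus>f\<in>I x n. a f \<odot> f)) < e"
        using a n by (simp only: inverse_eq_divide)
      ultimately show ?thesis by blast
    qed
    then show "x \<in> N" using cl xc unfolding closedin_iff by blast
  qed
  moreover have "compactly_supported \<Omega> M (m l)" for l using DK m by blast
  ultimately show ?thesis by blast
qed

end

context sampled
begin

lemma sample_norm_nonneg: "\<phi> \<in> A_set \<Omega> \<Longrightarrow> 0 \<le> sample_norm \<phi>"
  unfolding sample_norm_def by (simp add: suminf_nonneg [OF sample_summable])

text \<open>
  The function \<open>c\<close> of the sampling theorem is bounded on compact subsets of \<open>\<Omega>\<close>, so the supremum over such a
  set is at most a multiple of the sampled norm.
\<close>

lemma compactly_supported_sample_bound:
  assumes "compactly_supported \<Omega> M m" "hilbert_module \<Omega> M"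
  shows "\<exists>\<kappa>\<ge>0. \<forall>\<phi>\<in>A_set \<Omega>. hnorm M (act M \<phi> m) \<le> \<kappa> * sample_norm \<phi>"
proof -
  interpret M: hilbert_module \<Omega> M by fact
  obtain X \<beta> where X: "compact X" "X \<subseteq> \<Omega>" and mM: "m \<in> carrier M"
    and le: "\<forall>\<phi>\<in>A_set \<Omega>. hnorm M (act M \<phi> m) \<le> \<beta> * sup_norm X \<phi> * hnorm M m"
    using assms(1) unfolding compactly_supported_def by blast
  have "compact (c ` X)" by (rule compact_continuous_image [OF continuous_on_subset [OF c_cont X(2)] X(1)])
  then obtain K where K: "\<And>z. z \<in> X \<Longrightarrow> norm (c z) \<le> K" using compact_imp_bounded bounded_iff by (metis imageI)
  define K' where "K' = \<bar>K\<bar>"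
  have K': "K' \<ge> 0" "c z \<le> K'" if "z \<in> X" for z using K [OF that] by (auto simp: K'_def)
  have K'0: "K' \<ge> 0" by (simp add: K'_def)
  have "hnorm M (act M \<phi> m) \<le> (\<bar>\<beta>\<bar> * K' * hnorm M m) * sample_norm \<phi>" if \<phi>: "\<phi> \<in> A_set \<Omega>" for \<phi>
  proof -
    note s0 = sample_norm_nonneg [OF \<phi>]
    have z: "cmod (\<phi> z) \<le> K' * sample_norm \<phi>" if z: "z \<in> X" for z
    proof -
      have "z \<in> \<Omega>" using z X(2) by blast
      then have "cmod (\<phi> z) \<le> c z * sample_norm \<phi>"
        unfolding sample_norm_def by (rule sample_bound [OF \<phi>])
      also have "\<dots> \<le> K' * sample_norm \<phi>" by (rule mult_right_mono [OF K'(2) [OF z] s0])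
      finally show ?thesis .
    qed
    have s: "sup_norm X \<phi> \<le> K' * sample_norm \<phi>"
      by (rule sup_norm_least [OF z mult_nonneg_nonneg [OF K'0 s0]])
    have sp: "0 \<le> sup_norm X \<phi>" by (rule sup_norm_upper(1) [OF z])
    have "\<beta> * sup_norm X \<phi> \<le> \<bar>\<beta>\<bar> * (K' * sample_norm \<phi>)"
      by (rule mult_mono [OF abs_ge_self s abs_ge_zero sp])
    then have "\<beta> * sup_norm X \<phi> * hnorm M m \<le> \<bar>\<beta>\<bar> * (K' * sample_norm \<phi>) * hnorm M m"
      by (rule mult_right_mono [OF _ M.hnorm_nonneg [OF mM]])
    with le \<phi> have "hnorm M (act M \<phi> m) \<le> \<bar>\<beta>\<bar> * (K' * sample_norm \<phi>) * hnorm M m" by force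
    then show ?thesis by (simp only: ac_simps)
  qed
  moreover have "0 \<le> \<bar>\<beta>\<bar> * K' * hnorm M m" by (simp add: K'0 M.hnorm_nonneg [OF mM])
  ultimately show ?thesis by blast
qed

text \<open>
  With nothing in the odd rows, the norm of a combination depends on the samples of the coefficients only.
\<close>

abbreviation (input) "base \<equiv> generated (gen (\<lambda>l n. 0))"

lemma zero_seq_in: "(\<lambda>n. 0) \<in> carrier l2"
  by (simp add: in_l2_iff)

lemma base_invariant: "invariant base"
  by (rule invariant_generated [OF gen_in [OF zero_seq_in]])

text \<open>
  The zero module has evaluations, so the covering theorem applies with \<open>g l = 0\<close>.
\<close>

lemma base_stage: "free_stage base"
proof -
  have z: "{\<lambda>n. 0} = {x \<in> carrier l2. x = \<zero>\<^bsub>l2\<^esub>}" using zero_seq_in by auto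
  have N: "invariant {\<lambda>n. 0}"
    unfolding invariant_def
  proof (intro conjI ballI)
    show "submodule {\<lambda>n. 0} complex_ring l2" unfolding l2.submodule_iff using zero_seq_in by simp
    show "closedin (htop l2) {\<lambda>n. 0}"
      unfolding l2.closedin_iff
    proof (intro conjI ballI impI)
      show "{\<lambda>n. 0} \<subseteq> carrier l2" using zero_seq_in by simp
      fix x assume x: "x \<in> carrier l2" and a: "\<forall>e>0. \<exists>y\<in>{\<lambda>n. 0}. hnorm l2 (x \<ominus>\<^bsub>l2\<^esub> y) < e"
      have "x = \<zero>\<^bsub>l2\<^esub>"
        by (rule l2.eq_if_hnorm_small [OF x l2.zero_closed]) (use a in \<open>auto intro: less_imp_le\<close>)
      then show "x \<in> {\<lambda>n. 0}" by simp
    qed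
    show "diag_act q \<phi> x \<in> {\<lambda>n. 0}" if "x \<in> {\<lambda>n. 0}" for \<phi> x using that by (simp add: diag_act_def)
  qed
  have h0: "hnorm l2 (\<lambda>n. 0) = 0" using l2.hnorm_zero by simp
  have E: "evaluation {\<lambda>n. 0} (\<lambda>z x n. 0)"
    unfolding evaluation_def linear_map_on_def using zero_seq_in h0 by (auto intro!: exI [of _ 0])
  have h: "hnorm l2 (\<lambda>n. 0) \<le> (1 / 2) ^ l" for l using h0 by simp
  show ?thesis
    unfolding free_stage_def
    using base_invariant quasi_free_cover(2,3) [OF N E, of "\<lambda>l n. 0", OF _ h] by blast
qed

text \<open>
  A combination of the generators with coefficients \<open>\<phi> l\<close> has to be sent to the sum of the \<open>\<phi> l (m l)\<close>. Since
  the sampled norm of every \<open>\<phi> l\<close> is at most the norm of the combination, the geometric decay of the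
  bounds makes this well defined and bounded, and it extends to the closure.
\<close>

lemma map_from_base:
  fixes M :: "(complex^'m \<Rightarrow> complex, 'a, 'x) hmodule_scheme"
  assumes M: "hilbert_module \<Omega> M" and m: "\<And>l. m l \<in> carrier M"
    and small: "\<And>l \<phi>. \<phi> \<in> A_set \<Omega> \<Longrightarrow> hnorm M (act M \<phi> (m l)) \<le> (1 / 2) ^ l * sample_norm \<phi>"
  obtains X where "linear_map l2 M base X" "\<And>x. x \<in> base \<Longrightarrow> hnorm M (X x) \<le> 2 * hnorm l2 x"
    "\<And>\<phi> x. \<lbrakk>\<phi> \<in> A_set \<Omega>; x \<in> base\<rbrakk> \<Longrightarrow> X (diag_act q \<phi> x) = act M \<phi> (X x)"
    "range m \<subseteq> X ` base"
proof -
  interpret M: hilbert_module \<Omega> M by fact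
  let ?h = "gen (\<lambda>l n. 0)"
  note h_in = gen_in [OF zero_seq_in]
  define val where "val N \<phi> = (\<Oplus>\<^bsub>M\<^esub>l\<in>{..<N}. act M (\<phi> l) (m l))" for N :: nat and \<phi>
  have a_in: "act M (\<phi> l) (m l) \<in> carrier M" if "\<phi> \<in> coeffs" for \<phi> l
    by (rule M.act_in [OF coeffsD(1) [OF that] m])
  have val_in: "val N \<phi> \<in> carrier M" if "\<phi> \<in> coeffs" for N \<phi>
    unfolding val_def by (rule M.finsum_closed, rule Pi_I) (rule a_in [OF that])
  have val_Suc: "val (Suc N) \<phi> = act M (\<phi> N) (m N) \<oplus>\<^bsub>M\<^esub> val N \<phi>" if "\<phi> \<in> coeffs" for N \<phi>
    unfolding val_def lessThan_Suc
    by (rule M.finsum_insert) (auto intro: a_in [OF that])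
  have act0: "act M (\<lambda>z. 0) x = \<zero>\<^bsub>M\<^esub>" if "x \<in> carrier M" for x
    using M.act_scale [OF A_zero that, of 0] M.act_in [OF A_zero that] by simp
  have val_mono: "val N' \<phi> = val N \<phi>"
    if \<phi>: "\<phi> \<in> coeffs" and z: "\<forall>l\<ge>N. \<phi> l = (\<lambda>z. 0)" and le: "N \<le> N'" for N N' \<phi>
    using le
  proof (induction N' rule: dec_induct)
    case (step k)
    have "\<phi> k = (\<lambda>z. 0)" using z step.hyps by blast
    then have "act M (\<phi> k) (m k) = \<zero>\<^bsub>M\<^esub>" using act0 [OF m] by (simp only:)
    then show ?case using val_Suc [OF \<phi>, of k] step.IH val_in [OF \<phi>] by simp
  qed simp
  define G where "G = {(comb ?h \<phi>, val N \<phi>) | \<phi> N. \<phi> \<in> coeffs \<and> (\<forall>l\<ge>N. \<phi> l = (\<lambda>z. 0))}"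
  have GI: "(comb ?h \<phi>, val N \<phi>) \<in> G" if "\<phi> \<in> coeffs" "\<forall>l\<ge>N. \<phi> l = (\<lambda>z. 0)" for \<phi> N
    unfolding G_def using that by blast
  have fstG: "fst ` G = span_of ?h"
  proof (intro Set.set_eqI iffI)
    fix x assume "x \<in> span_of ?h"
    then obtain \<phi> where \<phi>: "\<phi> \<in> coeffs" "x = comb ?h \<phi>" unfolding span_of_def by blast
    obtain N where N: "\<forall>l\<ge>N. \<phi> l = (\<lambda>z. 0)" using coeffsD(2) [OF \<phi>(1)] by blast
    show "x \<in> fst ` G" using imageI [OF GI [OF \<phi>(1) N], of fst] by (simp add: \<phi>(2))
  qed (auto simp: G_def span_of_def)
  have val_add: "val N (\<lambda>l z. \<phi> l z + \<psi> l z) = val N \<phi> \<oplus>\<^bsub>M\<^esub> val N \<psi>"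
    if \<phi>: "\<phi> \<in> coeffs" and \<psi>: "\<psi> \<in> coeffs" for N \<phi> \<psi>
    unfolding val_def M.act_add_left [OF coeffsD(1) [OF \<phi>] coeffsD(1) [OF \<psi>] m]
    by (rule M.finsum_addf) (auto intro: a_in \<phi> \<psi>)
  have val_smult: "val N (\<lambda>l z. a * \<phi> l z) = a \<odot>\<^bsub>M\<^esub> val N \<phi>" if \<phi>: "\<phi> \<in> coeffs" for N \<phi> a
    unfolding val_def M.act_scale [OF coeffsD(1) [OF \<phi>] m]
    by (rule M.finsum_smult_ldistr [symmetric]) (auto intro: a_in \<phi>)
  have val_mult: "val N (\<lambda>l z. \<psi> z * \<phi> l z) = act M \<psi> (val N \<phi>)"
    if \<phi>: "\<phi> \<in> coeffs" and \<psi>: "\<psi> \<in> A_set \<Omega>" for N \<phi> \<psi>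
  proof -
    interpret L: linear_map M M "carrier M" "act M \<psi>" by (rule M.linear_map_act [OF \<psi>])
    show ?thesis
      unfolding val_def M.act_mult [OF \<psi> coeffsD(1) [OF \<phi>] m]
      by (rule L.T_finsum [symmetric]) (auto intro: a_in \<phi>)
  qed
  have bound: "hnorm M (val N \<phi>) \<le> 2 * hnorm l2 (comb ?h \<phi>)" if \<phi>: "\<phi> \<in> coeffs" for N \<phi>
  proof -
    have x: "comb ?h \<phi> \<in> carrier l2" by (rule comb_in_invariant [OF \<phi> invariant_l2 h_in])
    have "hnorm M (val N \<phi>) \<le> (\<Sum>l<N. hnorm M (act M (\<phi> l) (m l)))"
      unfolding val_def by (rule M.hnorm_finsum_le) (auto intro: a_in \<phi>)
    also have "\<dots> \<le> (\<Sum>l<N. hnorm l2 (comb ?h \<phi>) * (1 / 2) ^ l)"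
    proof (rule sum_mono)
      fix l
      have "(sample_norm (\<phi> l))\<^sup>2 \<le> (\<Sum>k<Suc l. (sample_norm (\<phi> k))\<^sup>2)"
        by (rule member_le_sum) auto
      also have "\<dots> \<le> (hnorm l2 (comb ?h \<phi>))\<^sup>2" by (rule sample_norms_le [OF \<phi> zero_seq_in])
      finally have s: "sample_norm (\<phi> l) \<le> hnorm l2 (comb ?h \<phi>)"
        by (rule power2_le_imp_le [OF _ l2.hnorm_nonneg [OF x]])
      have "hnorm M (act M (\<phi> l) (m l)) \<le> (1 / 2) ^ l * sample_norm (\<phi> l)" by (rule small [OF coeffsD(1) [OF \<phi>]])
      also have "\<dots> \<le> (1 / 2) ^ l * hnorm l2 (comb ?h \<phi>)" by (rule mult_left_mono [OF s]) simp
      finally show "hnorm M (act M (\<phi> l) (m l)) \<le> hnorm l2 (comb ?h \<phi>) * (1 / 2) ^ l"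
        by (simp only: mult.commute)
    qed
    also have "\<dots> = hnorm l2 (comb ?h \<phi>) * (\<Sum>l<N. (1 / 2) ^ l)" by (simp only: sum_distrib_left)
    also have "\<dots> \<le> hnorm l2 (comb ?h \<phi>) * 2"
      by (rule mult_left_mono [OF sum_half_powers_le l2.hnorm_nonneg [OF x]])
    finally show ?thesis by (simp only: mult.commute)
  qed
  have "\<exists>X. linear_map_on base l2 M X \<and> (\<forall>x\<in>base. hnorm M (X x) \<le> 2 * hnorm l2 x) \<and>
    (\<forall>x y. (x, y) \<in> G \<longrightarrow> X x = y)"
  proof (rule extend_by_continuity [of l2 M G 2])
    show "G \<subseteq> carrier l2 \<times> carrier M"
    proof
      fix t assume "t \<in> G"
      then obtain \<phi> N where t: "t = (comb ?h \<phi>, val N \<phi>)" "\<phi> \<in> coeffs" unfolding G_def by blast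
      show "t \<in> carrier l2 \<times> carrier M"
        unfolding t(1) by (rule SigmaI [OF comb_in_invariant [OF t(2) invariant_l2 h_in] val_in [OF t(2)]])
    qed
    have "(comb ?h (unit_coeff 0), val 1 (unit_coeff 0)) \<in> G"
      by (rule GI [OF unit_coeff_in]) (simp add: unit_coeff_def)
    then show "G \<noteq> {}" by blast
    show "hnorm M y \<le> 2 * hnorm l2 x" if xy: "(x, y) \<in> G" for x y
    proof -
      obtain \<phi> N where "x = comb ?h \<phi>" "y = val N \<phi>" "\<phi> \<in> coeffs" using xy unfolding G_def by blast
      then show ?thesis using bound by (simp only:)
    qed
    show "(x \<oplus>\<^bsub>l2\<^esub> x', y \<oplus>\<^bsub>M\<^esub> y') \<in> G" if xy: "(x, y) \<in> G" and xy': "(x', y') \<in> G" for x y x' y'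
    proof -
      obtain \<phi> N where \<phi>: "x = comb ?h \<phi>" "y = val N \<phi>" "\<phi> \<in> coeffs" "\<forall>l\<ge>N. \<phi> l = (\<lambda>z. 0)"
        using xy unfolding G_def by blast
      obtain \<psi> N' where \<psi>: "x' = comb ?h \<psi>" "y' = val N' \<psi>" "\<psi> \<in> coeffs" "\<forall>l\<ge>N'. \<psi> l = (\<lambda>z. 0)"
        using xy' unfolding G_def by blast
      let ?K = "max N N'"
      have y: "y = val ?K \<phi>" "y' = val ?K \<psi>"
        unfolding \<phi>(2) \<psi>(2) by (rule val_mono [OF \<phi>(3,4), symmetric], simp)
          (rule val_mono [OF \<psi>(3,4), symmetric], simp)
      show ?thesis
        unfolding \<phi>(1) \<psi>(1) y coeffs_add(2) [OF \<phi>(3) \<psi>(3), symmetric] val_add [OF \<phi>(3) \<psi>(3), symmetric]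
        by (rule GI [OF coeffs_add(1) [OF \<phi>(3) \<psi>(3)]]) (use \<phi>(4) \<psi>(4) in simp)
    qed
    show "(a \<odot>\<^bsub>l2\<^esub> x, a \<odot>\<^bsub>M\<^esub> y) \<in> G" if xy: "(x, y) \<in> G" for a x y
    proof -
      obtain \<phi> N where \<phi>: "x = comb ?h \<phi>" "y = val N \<phi>" "\<phi> \<in> coeffs" "\<forall>l\<ge>N. \<phi> l = (\<lambda>z. 0)"
        using xy unfolding G_def by blast
      show ?thesis
        unfolding \<phi>(1,2) coeffs_smult(2) [OF \<phi>(3), symmetric] val_smult [OF \<phi>(3), symmetric]
        by (rule GI [OF coeffs_smult(1) [OF \<phi>(3)]]) (use \<phi>(4) in simp)
    qed
    fix T
    assume T: "linear_map_on (hclosure l2 (fst ` G)) l2 M T"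
      "\<And>x. x \<in> hclosure l2 (fst ` G) \<Longrightarrow> hnorm M (T x) \<le> 2 * hnorm l2 x"
      "\<And>x y. (x, y) \<in> G \<Longrightarrow> T x = y"
    then show ?thesis unfolding generated_def fstG by blast
  qed (use inner_product_space_l2 M.hilbert_space_axioms in auto)
  then obtain X where X: "linear_map_on base l2 M X" "\<forall>x\<in>base. hnorm M (X x) \<le> 2 * hnorm l2 x"
    "\<forall>x y. (x, y) \<in> G \<longrightarrow> X x = y" by blast
  have bd: "hnorm M (X x) \<le> 2 * hnorm l2 x" if "x \<in> base" for x using X(2) that by blast
  have Xm: "linear_map l2 M base X"
    by (intro linear_map.intro linear_map_axioms.intro inner_product_space_l2
        M.inner_product_space_axioms C_sub [OF base_invariant] X(1))
  interpret X: linear_map l2 M base X by (rule Xm)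
  note actB = C_act [OF base_invariant]
  have X_act: "X (diag_act q \<phi> x) = act M \<phi> (X x)" if \<phi>: "\<phi> \<in> A_set \<Omega>" and x: "x \<in> base" for \<phi> x
  proof -
    interpret L: linear_map M M "carrier M" "act M \<phi>" by (rule M.linear_map_act [OF \<phi>])
    obtain B where B: "0 \<le> B" "\<And>y. y \<in> carrier M \<Longrightarrow> hnorm M (act M \<phi> y) \<le> B * hnorm M y"
      by (rule M.act_bounded [OF bounded' \<phi>]) blast
    have T1: "linear_map l2 M base (\<lambda>x. X (diag_act q \<phi> x))"
      by (intro linear_map.intro linear_map_axioms.intro inner_product_space_l2
          M.inner_product_space_axioms C_sub [OF base_invariant] linear_map_onI)
        (simp_all only: X.T_in actB [OF \<phi>] diag_act_add diag_act_smult X.T_add X.T_smult)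
    have T2: "linear_map l2 M base (\<lambda>x. act M \<phi> (X x))"
      by (intro linear_map.intro linear_map_axioms.intro inner_product_space_l2
          M.inner_product_space_axioms C_sub [OF base_invariant] linear_map_onI)
        (simp_all only: X.T_in L.T_in X.T_add X.T_smult L.T_add L.T_smult)
    have CS: "x \<in> hclosure l2 (span_of ?h)" using x by (simp only: generated_def)
    show ?thesis
    proof (rule linear_maps_eq_on_hclosure [OF T1 T2 _ _ span_of_subset [OF h_in] _ x CS])
      fix y assume y: "y \<in> base"
      have "hnorm M (X (diag_act q \<phi> y)) \<le> 2 * hnorm l2 (diag_act q \<phi> y)" by (rule bd [OF actB [OF \<phi> y]])
      also have "\<dots> \<le> 2 * (sup_norm \<Omega> \<phi> * hnorm l2 y)"
        by (rule mult_left_mono [OF diag_act_bound [OF \<phi> C_in [OF base_invariant y]]]) simp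
      finally show "hnorm M (X (diag_act q \<phi> y)) \<le> (2 * sup_norm \<Omega> \<phi>) * hnorm l2 y" by (simp only: mult.assoc)
      have "hnorm M (act M \<phi> (X y)) \<le> B * hnorm M (X y)" by (rule B(2) [OF X.T_in [OF y]])
      also have "\<dots> \<le> B * (2 * hnorm l2 y)" by (rule mult_left_mono [OF bd [OF y] B(1)])
      finally show "hnorm M (act M \<phi> (X y)) \<le> (B * 2) * hnorm l2 y" by (simp only: mult.assoc)
    next
      fix y assume "y \<in> span_of ?h"
      then obtain \<psi> where \<psi>: "\<psi> \<in> coeffs" "y = comb ?h \<psi>" unfolding span_of_def by blast
      obtain N where N: "\<forall>l\<ge>N. \<psi> l = (\<lambda>z. 0)" using coeffsD(2) [OF \<psi>(1)] by blast
      then have N2: "\<forall>l\<ge>N. (\<lambda>z. \<phi> z * \<psi> l z) = (\<lambda>z. 0)" by simp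
      have "X (diag_act q \<phi> y) = val N (\<lambda>l z. \<phi> z * \<psi> l z)"
        using X(3) GI [OF coeffs_mult(1) [OF \<psi>(1) \<phi>] N2]
        unfolding \<psi>(2) coeffs_mult(2) [OF \<psi>(1) \<phi>] by blast
      also have "\<dots> = act M \<phi> (val N \<psi>)" by (rule val_mult [OF \<psi>(1) \<phi>])
      also have "val N \<psi> = X y" using X(3) GI [OF \<psi>(1) N] unfolding \<psi>(2) by simp
      finally show "X (diag_act q \<phi> y) = act M \<phi> (X y)" .
    qed
  qed
  have "m i \<in> X ` base" for i
  proof (rule image_eqI)
    show "?h i \<in> base" by (rule generator_in [OF h_in])
    have z: "\<forall>l\<ge>Suc i. unit_coeff i l = (\<lambda>z. 0)" by (simp add: unit_coeff_def)
    have "X (comb ?h (unit_coeff i)) = val (Suc i) (unit_coeff i)"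
      using X(3) GI [OF unit_coeff_in z] by blast
    also have "\<dots> = act M (unit_coeff i i) (m i) \<oplus>\<^bsub>M\<^esub> val i (unit_coeff i)" by (rule val_Suc [OF unit_coeff_in])
    also have "val i (unit_coeff i) = (\<Oplus>\<^bsub>M\<^esub>l\<in>{..<i}. \<zero>\<^bsub>M\<^esub>)"
      unfolding val_def by (rule M.finsum_cong') (auto simp: unit_coeff_def act0 [OF m])
    also have "\<dots> = \<zero>\<^bsub>M\<^esub>" by (rule M.finsum_zero)
    also have "act M (unit_coeff i i) (m i) = m i" using M.act_one [OF m] by (simp add: unit_coeff_def)
    finally show "m i = X (?h i)" unfolding comb_unit_coeff using m by simp
  qed
  then show thesis using that [OF Xm bd X_act] by blast
qed

end

text \<open>
  The kernel of the projection to the odd rows is again a module with evaluations, so the covering step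
  can be iterated.
\<close>

lemma free_stage_chain:
  assumes S: "sampled \<Omega> p w c" and N: "diagonal.invariant \<Omega> (sampled.q p) N" and E: "sampled.evaluation \<Omega> p N E"
  obtains C where "hclosure l2 (odd_part ` C 0) = N" "\<And>x. x \<in> C 0 \<Longrightarrow> odd_part x \<in> N"
    "\<And>n. sampled.free_stage \<Omega> p (C n)"
    "\<And>n. hclosure l2 (odd_part ` C (Suc n)) = {x \<in> C n. odd_part x = \<zero>\<^bsub>l2\<^esub>}"
    "\<And>n x. x \<in> C (Suc n) \<Longrightarrow> odd_part x \<in> C n \<and> odd_part (odd_part x) = \<zero>\<^bsub>l2\<^esub>"
proof -
  interpret sampled \<Omega> p w c by fact
  have next_stage: "\<exists>C'. free_stage C' \<and> hclosure l2 (odd_part ` C') = {x \<in> C. odd_part x = \<zero>\<^bsub>l2\<^esub>} \<and>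
      (\<forall>x\<in>C'. odd_part x \<in> {x \<in> C. odd_part x = \<zero>\<^bsub>l2\<^esub>})" if C: "free_stage C" for C
  proof -
    obtain E where inv: "invariant C" and E: "evaluation C E" using C unfolding free_stage_def by blast
    have bound: "hnorm l2 (odd_part x) \<le> 1 * hnorm l2 x" if "x \<in> C" for x
      using hnorm_odd_part [OF C_in [OF inv that]] by simp
    have zero: "odd_part (diag_act q \<phi> x) = \<zero>\<^bsub>l2\<^esub>" if "odd_part x = \<zero>\<^bsub>l2\<^esub>" for \<phi> x
      unfolding odd_part_diag_act that by (simp add: diag_act_def)
    note k = evaluation_kernel [OF inv E linear_map_odd_part [OF C_sub [OF inv]] bound zero]
    show ?thesis
    proof (rule free_stage_over [OF k])
      fix C'
      assume "free_stage C'" "hclosure l2 (odd_part ` C') = {x \<in> C. odd_part x = \<zero>\<^bsub>l2\<^esub>}"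
        "\<And>x. x \<in> C' \<Longrightarrow> odd_part x \<in> {x \<in> C. odd_part x = \<zero>\<^bsub>l2\<^esub>}"
      then show ?thesis by (intro exI [of _ C'] conjI ballI)
    qed
  qed
  have "\<exists>C. \<forall>n. (free_stage (C n) \<and> (n = 0 \<longrightarrow> hclosure l2 (odd_part ` C n) = N \<and> (\<forall>x\<in>C n. odd_part x \<in> N))) \<and>
     (hclosure l2 (odd_part ` C (Suc n)) = {x \<in> C n. odd_part x = \<zero>\<^bsub>l2\<^esub>} \<and>
      (\<forall>x\<in>C (Suc n). odd_part x \<in> {x \<in> C n. odd_part x = \<zero>\<^bsub>l2\<^esub>}))"
  proof (rule dependent_nat_choice)
    show "\<exists>C. free_stage C \<and> (0 = (0::nat) \<longrightarrow> hclosure l2 (odd_part ` C) = N \<and> (\<forall>x\<in>C. odd_part x \<in> N))"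
      by (rule free_stage_over [OF N E]) blast
    fix C and n :: nat
    assume "free_stage C \<and> (n = 0 \<longrightarrow> hclosure l2 (odd_part ` C) = N \<and> (\<forall>x\<in>C. odd_part x \<in> N))"
    then show "\<exists>C'. (free_stage C' \<and> (Suc n = 0 \<longrightarrow> hclosure l2 (odd_part ` C') = N \<and> (\<forall>x\<in>C'. odd_part x \<in> N))) \<and>
        (hclosure l2 (odd_part ` C') = {x \<in> C. odd_part x = \<zero>\<^bsub>l2\<^esub>} \<and>
         (\<forall>x\<in>C'. odd_part x \<in> {x \<in> C. odd_part x = \<zero>\<^bsub>l2\<^esub>}))"
      using next_stage [of C] by blast
  qed
  then obtain C where C: "\<forall>n. (free_stage (C n) \<and> (n = 0 \<longrightarrow> hclosure l2 (odd_part ` C n) = N \<and> (\<forall>x\<in>C n. odd_part x \<in> N))) \<and>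
     (hclosure l2 (odd_part ` C (Suc n)) = {x \<in> C n. odd_part x = \<zero>\<^bsub>l2\<^esub>} \<and>
      (\<forall>x\<in>C (Suc n). odd_part x \<in> {x \<in> C n. odd_part x = \<zero>\<^bsub>l2\<^esub>}))" ..
  show thesis
  proof (rule that [of C])
    show "hclosure l2 (odd_part ` C 0) = N" using C by blast
    show "odd_part x \<in> N" if "x \<in> C 0" for x using C that by blast
    show "free_stage (C n)" for n using C by blast
    show "hclosure l2 (odd_part ` C (Suc n)) = {x \<in> C n. odd_part x = \<zero>\<^bsub>l2\<^esub>}" for n using C by blast
    show "odd_part x \<in> C n \<and> odd_part (odd_part x) = \<zero>\<^bsub>l2\<^esub>" if "x \<in> C (Suc n)" for n x using C that by blast
  qed
qed

theorem theorem3: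
  fixes \<Omega> :: "(complex^'m) set"
    and M :: "(complex^'m \<Rightarrow> complex, 'a) hmodule"
  assumes "open \<Omega>" and "connected \<Omega>" and "\<Omega> \<noteq> {}" and "bounded \<Omega>"
    and "hilbert_module \<Omega> M"
    and "countably_generated \<Omega> M"
    and "almost_compactly_supported \<Omega> M"
  shows "\<exists>L (R :: nat \<Rightarrow> (complex^'m \<Rightarrow> complex, nat \<Rightarrow> complex) hmodule) X0 X.
           weak_resolution \<Omega> M L R X0 X"
proof -
  interpret M: hilbert_module \<Omega> M by fact
  obtain p :: "nat \<Rightarrow> complex^'m" and w c where
    samp: "\<And>j. p j \<in> \<Omega>" "\<And>j. 0 \<le> w j" "summable (\<lambda>j. (w j)\<^sup>2)"
    "continuous_on \<Omega> c" "\<And>z. z \<in> \<Omega> \<Longrightarrow> 0 \<le> c z"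
    "\<And>\<phi>. \<phi> \<in> A_set \<Omega> \<Longrightarrow> summable (\<lambda>j. (w j * cmod (\<phi> (p j)))\<^sup>2)"
    "\<And>\<phi> z. \<lbrakk>\<phi> \<in> A_set \<Omega>; z \<in> \<Omega>\<rbrakk> \<Longrightarrow> cmod (\<phi> z) \<le> c z * sqrt (\<Sum>j. (w j * cmod (\<phi> (p j)))\<^sup>2)"
    by (rule sampling [OF assms(1,4,3)]) blast
  have S: "sampled \<Omega> p w c"
    by (intro sampled.intro assms(3,4) M.cring_A samp)
  interpret sampled \<Omega> p w c by (rule S)
  obtain m where m: "\<And>l::nat. compactly_supported \<Omega> M (m l)"
    and m_gen: "\<And>N. \<lbrakk>closed_submodule \<Omega> M N; range m \<subseteq> N\<rbrakk> \<Longrightarrow> N = carrier M"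
    using M.compactly_supported_sequence [OF assms(6,7)] by blast
  have m_in: "m l \<in> carrier M" for l using m unfolding compactly_supported_def by blast
  have "\<forall>l. \<exists>\<kappa>\<ge>0. \<forall>\<phi>\<in>A_set \<Omega>. hnorm M (act M \<phi> (m l)) \<le> \<kappa> * sample_norm \<phi>"
    by (rule allI, rule compactly_supported_sample_bound [OF m assms(5)])
  then obtain \<kappa> where \<kappa>: "\<And>l. \<kappa> l \<ge> 0"
    "\<And>l \<phi>. \<phi> \<in> A_set \<Omega> \<Longrightarrow> hnorm M (act M \<phi> (m l)) \<le> \<kappa> l * sample_norm \<phi>" by metis
  \<comment> \<open>Adding 1 allows for \<open>\<kappa> l = 0\<close>.\<close>
  define s where "s l = (1 / 2) ^ l / (\<kappa> l + 1)" for l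
  have s_pos: "s l > 0" for l unfolding s_def using \<kappa>(1) [of l] by (intro divide_pos_pos) simp_all
  define m' where "m' l = complex_of_real (s l) \<odot>\<^bsub>M\<^esub> m l" for l
  have m'_in: "m' l \<in> carrier M" for l unfolding m'_def by (rule M.smult_in [OF m_in])
  have m'_small: "hnorm M (act M \<phi> (m' l)) \<le> (1 / 2) ^ l * sample_norm \<phi>" if \<phi>: "\<phi> \<in> A_set \<Omega>" for l \<phi>
  proof -
    have "hnorm M (act M \<phi> (m' l)) = s l * hnorm M (act M \<phi> (m l))"
      unfolding m'_def M.act_smult [OF \<phi> m_in] M.hnorm_smult [OF M.act_in [OF \<phi> m_in]]
      using s_pos [of l] by simp
    also have "\<dots> \<le> s l * (\<kappa> l * sample_norm \<phi>)"
      by (rule mult_left_mono [OF \<kappa>(2) [OF \<phi>] less_imp_le [OF s_pos]])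
    also have "\<dots> = (s l * \<kappa> l) * sample_norm \<phi>" by (simp only: mult.assoc)
    also have "\<dots> \<le> (1 / 2) ^ l * sample_norm \<phi>"
    proof (rule mult_right_mono [OF _ sample_norm_nonneg [OF \<phi>]])
      have "s l * \<kappa> l \<le> s l * (\<kappa> l + 1)" by (rule mult_left_mono) (use s_pos [of l] in simp_all)
      also have "\<dots> = (1 / 2) ^ l" unfolding s_def using \<kappa>(1) [of l] by simp
      finally show "s l * \<kappa> l \<le> (1 / 2) ^ l" .
    qed
    finally show ?thesis .
  qed
  obtain X0 where X0: "linear_map l2 M base X0" "\<And>x. x \<in> base \<Longrightarrow> hnorm M (X0 x) \<le> 2 * hnorm l2 x"
    "\<And>\<phi> x. \<lbrakk>\<phi> \<in> A_set \<Omega>; x \<in> base\<rbrakk> \<Longrightarrow> X0 (diag_act q \<phi> x) = act M \<phi> (X0 x)"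
    "range m' \<subseteq> X0 ` base"
  proof (rule map_from_base [OF assms(5) m'_in m'_small])
    fix X
    assume "linear_map l2 M base X" "\<And>x. x \<in> base \<Longrightarrow> hnorm M (X x) \<le> 2 * hnorm l2 x"
      "\<And>\<phi> x. \<lbrakk>\<phi> \<in> A_set \<Omega>; x \<in> base\<rbrakk> \<Longrightarrow> X (diag_act q \<phi> x) = act M \<phi> (X x)"
      "range m' \<subseteq> X ` base"
    then show thesis by (rule that)
  qed
  interpret X0: linear_map l2 M base X0 by (rule X0(1))
  have X0_dense: "dense_in M (X0 ` base)"
  proof -
    note D = l2.submoduleD [OF C_sub [OF base_invariant]]
    have sub: "submodule (X0 ` base) complex_ring M"
      unfolding M.submodule_iff
    proof (intro conjI ballI allI)
      show "X0 ` base \<subseteq> carrier M" using X0.T_in by blast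
      show "\<zero>\<^bsub>M\<^esub> \<in> X0 ` base" using imageI [OF D(2), of X0] unfolding X0.T_zero .
      show "u \<oplus>\<^bsub>M\<^esub> v \<in> X0 ` base" if u: "u \<in> X0 ` base" and v: "v \<in> X0 ` base" for u v
      proof -
        obtain x y where xy: "x \<in> base" "u = X0 x" "y \<in> base" "v = X0 y" using u v by blast
        show ?thesis unfolding xy(2,4) X0.T_add [OF xy(1,3), symmetric] by (rule imageI [OF D(3) [OF xy(1,3)]])
      qed
      show "a \<odot>\<^bsub>M\<^esub> u \<in> X0 ` base" if u: "u \<in> X0 ` base" for a u
      proof -
        obtain x where x: "x \<in> base" "u = X0 x" using u by blast
        show ?thesis unfolding x(2) X0.T_smult [OF x(1), symmetric] by (rule imageI [OF D(4) [OF x(1)]])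
      qed
    qed
    have cl: "closed_submodule \<Omega> M (hclosure M (X0 ` base))"
    proof (rule M.closed_submodule_hclosure [OF assms(4) sub])
      fix \<phi> u assume \<phi>: "\<phi> \<in> A_set \<Omega>" and "u \<in> X0 ` base"
      then obtain x where x: "x \<in> base" "u = X0 x" by blast
      show "act M \<phi> u \<in> X0 ` base"
        unfolding x(2) X0(3) [OF \<phi> x(1), symmetric] by (rule imageI [OF C_act [OF base_invariant \<phi> x(1)]])
    qed
    have "range m \<subseteq> hclosure M (X0 ` base)"
    proof
      fix y assume "y \<in> range m"
      then obtain l where y: "y = m l" by blast
      have "m' l \<in> X0 ` base" using X0(4) by blast
      then have "complex_of_real (1 / s l) \<odot>\<^bsub>M\<^esub> m' l \<in> X0 ` base" by (rule M.submoduleD(4) [OF sub])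
      also have "complex_of_real (1 / s l) \<odot>\<^bsub>M\<^esub> m' l = m l"
        unfolding m'_def M.smult_smult [OF m_in] using s_pos [of l] m_in [of l]
        by (simp del: of_real_divide flip: of_real_mult)
      finally show "y \<in> hclosure M (X0 ` base)"
        unfolding y using M.subset_hclosure [OF M.submoduleD(1) [OF sub]] by blast
    qed
    then have "hclosure M (X0 ` base) = carrier M" by (rule m_gen [OF cl])
    then show ?thesis unfolding dense_in_def hclosure_def .
  qed
  obtain E0 where E0: "evaluation base E0" using base_stage unfolding free_stage_def by blast
  define N0 where "N0 = {x \<in> base. X0 x = \<zero>\<^bsub>M\<^esub>}"
  have N0: "invariant N0" "evaluation N0 E0"
    unfolding N0_def
    by (rule evaluation_kernel [OF base_invariant E0 X0(1) X0(2)]; simp add: X0(3) M.act_zero)+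
  obtain C where C: "hclosure l2 (odd_part ` C 0) = N0" "\<And>x. x \<in> C 0 \<Longrightarrow> odd_part x \<in> N0"
    "\<And>n. free_stage (C n)"
    "\<And>n. hclosure l2 (odd_part ` C (Suc n)) = {x \<in> C n. odd_part x = \<zero>\<^bsub>l2\<^esub>}"
    "\<And>n x. x \<in> C (Suc n) \<Longrightarrow> odd_part x \<in> C n \<and> odd_part (odd_part x) = \<zero>\<^bsub>l2\<^esub>"
    by (rule free_stage_chain [OF S N0]) blast
  \<comment> \<open>The modules of a resolution are numbered from 1: \<open>D 1\<close> maps to \<open>M\<close>, and \<open>D 2 = C 0\<close> covers the kernel.\<close>
  define D where "D i = (if i \<le> 1 then base else C (i - 2))" for i :: nat
  have D: "free_stage (D i)" for i unfolding D_def using base_stage C(3) by simp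
  have D_inv: "invariant (D i)" for i using D unfolding free_stage_def by blast
  have odd_D: "odd_part x \<in> D i" if i: "i \<ge> 1" and x: "x \<in> D (i + 1)" for i x
  proof (cases "i = 1")
    case True
    then show ?thesis using C(2) [of x] x by (simp add: D_def N0_def)
  next
    case False
    then obtain n where n: "i = Suc (Suc n)" using i by (metis One_nat_def Suc_le_D le_antisym not_less_eq_eq)
    show ?thesis using C(5) [of x n] x by (simp add: D_def n)
  qed
  define R where "R i = diag_module q (D i)" for i
  have qf: "quasi_free \<Omega> (R i)" for i using D unfolding R_def free_stage_def by blast
  have map: "module_map \<Omega> (R (i + 1)) (R i) odd_part" if i: "i \<ge> 1" for i
    unfolding module_map_def linear_map_on_def R_def diag_module_simps diag_hnorm
  proof (intro conjI allI ballI)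
    show "odd_part \<in> D (i + 1) \<rightarrow> D i" using odd_D [OF i] by blast
    show "\<exists>B. \<forall>x\<in>D (i + 1). hnorm l2 (odd_part x) \<le> B * hnorm l2 x"
      using hnorm_odd_part [OF C_in [OF D_inv]] by (intro exI [of _ 1]) simp
  qed (rule odd_part_add odd_part_smult odd_part_diag_act)+
  have ker: "a_kernel (R i) K X = {x \<in> D i. X x = \<zero>\<^bsub>K\<^esub>}" for i X and K :: "('k, 'l) hspace_scheme"
    by (simp add: a_kernel_def kernel_def R_def diag_module_simps)
  have cl: "htop (R i) closure_of S = hclosure l2 S" if "S \<subseteq> D i" for i S
    using D_hclosure [OF D_inv that] unfolding R_def hclosure_def .
  have zeroR: "\<zero>\<^bsub>R i\<^esub> = \<zero>\<^bsub>l2\<^esub>" for i unfolding R_def diag_module_simps ..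
  have carR: "carrier (R i) = D i" for i unfolding R_def diag_module_simps ..
  have odd_sub: "odd_part ` D (i + 1) \<subseteq> D i" if "i \<ge> 1" for i using odd_D [OF that] by blast
  have "weak_resolution \<Omega> M \<infinity> R X0 (\<lambda>i. odd_part)"
    unfolding weak_resolution_def
  proof (intro conjI allI impI)
    show "quasi_free \<Omega> (R i)" for i by (rule qf)
    show "module_map \<Omega> (R 1) M X0"
      unfolding module_map_def R_def diag_module_simps diag_hnorm
    proof (intro conjI ballI)
      show "linear_map_on (D 1) (diag_module q (D 1)) M X0"
        using X0.lin unfolding linear_map_on_def diag_module_simps by (simp add: D_def)
      show "\<exists>B. \<forall>x\<in>D 1. hnorm M (X0 x) \<le> B * hnorm l2 x"
        using X0(2) by (intro exI [of _ 2]) (simp add: D_def)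
      show "X0 (diag_act q \<phi> x) = act M \<phi> (X0 x)" if "\<phi> \<in> A_set \<Omega>" "x \<in> D 1" for \<phi> x
        using X0(3) that by (simp add: D_def)
    qed
    show "module_map \<Omega> (R (i + 1)) (R i) odd_part" if "1 \<le> i" for i by (rule map [OF that])
    show "dense_in M (X0 ` carrier (R 1))" using X0_dense by (simp add: carR D_def)
    show "a_kernel (R 1) M X0 = htop (R 1) closure_of (odd_part ` carrier (R 2))"
    proof -
      have "htop (R 1) closure_of (odd_part ` carrier (R 2)) = hclosure l2 (odd_part ` D 2)"
        unfolding carR by (rule cl) (use odd_sub [of 1] in \<open>simp add: numeral_2_eq_2\<close>)
      also have "\<dots> = N0" using C(1) by (simp add: D_def)
      finally show ?thesis by (simp add: ker N0_def D_def)
    qed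
    show "a_kernel (R (i + 1)) (R i) odd_part = htop (R (i + 1)) closure_of (odd_part ` carrier (R (i + 2)))"
      if i: "1 \<le> i" for i
    proof -
      have "htop (R (i + 1)) closure_of (odd_part ` carrier (R (i + 2))) = hclosure l2 (odd_part ` D (i + 2))"
        unfolding carR by (rule cl) (use odd_sub [of "i + 1"] in simp)
      also have "\<dots> = {x \<in> D (i + 1). odd_part x = \<zero>\<^bsub>l2\<^esub>}"
      proof -
        obtain n where n: "i = Suc n" using i by (metis One_nat_def Suc_le_D)
        show ?thesis using C(4) [of n] by (simp add: D_def n)
      qed
      finally show ?thesis by (simp add: ker zeroR del: l2_simps)
    qed
  qed simp_all
  then show ?thesis by blast
qed

end
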